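(* For every $\xi\ge 0$, the set $E_\xi$ has Hausdorff dimension $t(\xi)$. Furthermore, the function $t$ has the following properties: 1) $t(\xi_0)=1$ and $t(+\infty):=\lim_{\xi\to+\infty}t(\xi)=1/2$; 2) $t'(\xi)<0$ for all $\xi>\xi_0$, $t'(\xi_0)=0$, and $t'(\xi)>0$ for all $0<\xi<\xi_0$; 3) $t'(0+):=\lim_{\xi\to0+}t'(\xi)=+\infty$ and $t'(+\infty):=\lim_{\xi\to+\infty}t'(\xi)=0$; 4) $t''(\xi_0)<0$, but $t''(\xi_1)>0$ for some $\xi_1>\xi_0$; so $t$ is neither convex nor concave.
   Context: $T:[0,1)\to[0,1)$ is the Gauss map, $T(0)=0$, $T(x)=\frac1x\pmod 1$ for $x\in(0,1)$. For irrational $x\in[0,1)$, $a_1(x)=\lfloor1/x\rfloor$, $a_n(x)=a_1(T^{n-1}(x))$ are its partial quotients. The Khintchine exponent is $\gamma(x)=\lim_{n\to\infty}\frac1n\sum_{j=1}^n\log a_j(x)$ when the limit exists, and $E_\xi=\{x\in[0,1):\gamma(x)=\xi\}$ (rational $x$, a countable set, are ignored). $\mu_G$ is the Gauss measure $d\mu_G=\frac{dx}{(1+x)\log2}$ on $[0,1)$, and $\xi_0=\int\log a_1(x)\,d\mu_G(x)$. Write $[\omega_1,\dots,\omega_n+x]=\cfrac{1}{\omega_1+\cfrac{1}{\ddots+\cfrac{1}{\omega_n+x}}}$. Let $D=\{(t,q)\in\mathbb{R}^2:2t-q>1\}$ and $D_0=\{(t,q)\in\mathbb{R}^2:2t-q>1,\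 0\le t\le1\}$. For $(t,q)\in D$ let $$P(t,q)=\lim_{n\to\infty}\frac1n\log\sum_{\omega_1=1}^\infty\cdots\sum_{\omega_n=1}^\infty\exp\Big(\sup_{x\in[0,1]}\log\prod_{j=1}^n\omega_j^q\,([\omega_j,\dots,\omega_n+x])^{2t}\Big),$$ which is a real-analytic function on $D$. For $\xi>0$, $(t(\xi),q(\xi))\in D_0$ denotes the unique solution in $D_0$ of the system $P(t,q)=q\xi$, $\frac{\partial P}{\partial q}(t,q)=\xi$; and $t(0):=0$. *)

theory Defs
  imports "HOL-Analysis.Analysis"
begin

section \<open>Hausdorff dimension\<close>

text \<open>
  Gauge \<open>(diam U)\<^sup>s\<close> of a covering set, with the usual conventions that the empty set
  contributes \<open>0\<close> and that \<open>0\<^sup>0 = 1\<close> for nonempty sets (note that \<open>0 powr 0 = 0\<close> in HOL).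
\<close>
definition diam_gauge :: "real \<Rightarrow> 'a::metric_space set \<Rightarrow> ennreal" where
  "diam_gauge s U =
     (if U = {} then 0 else if s = 0 then 1 else ennreal (diameter U powr s))"

text \<open>
  Boundedness is required explicitly because \<^const>\<open>diameter\<close> is meaningless on unbounded sets.
  Finite covers are included, as some of the \<open>U i\<close> may be empty.
\<close>
definition delta_covers :: "real \<Rightarrow> 'a::metric_space set \<Rightarrow> (nat \<Rightarrow> 'a set) set" where
  "delta_covers \<delta> A =
     {U. A \<subseteq> (\<Union>i. U i) \<and> (\<forall>i. bounded (U i) \<and> diameter (U i) \<le> \<delta>)}"

definition hausdorff_content :: "real \<Rightarrow> real \<Rightarrow> 'a::metric_space set \<Rightarrow> ennreal" where
  "hausdorff_content s \<delta> A = (INF U\<in>delta_covers \<delta> A. \<Sum>i. diam_gauge s (U i))"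

definition hausdorff_measure :: "real \<Rightarrow> 'a::metric_space set \<Rightarrow> ennreal" where
  "hausdorff_measure s A = (SUP \<delta>\<in>{0<..}. hausdorff_content s \<delta> A)"

definition hausdorff_dim :: "'a::metric_space set \<Rightarrow> ereal" where
  "hausdorff_dim A = (INF s\<in>{s. 0 \<le> s \<and> hausdorff_measure s A = 0}. ereal s)"


section \<open>Continued fractions and the Khintchine exponent\<close>

definition gauss_map :: "real \<Rightarrow> real" where
  "gauss_map x = (if x = 0 then 0 else frac (1 / x))"

text \<open>The index of the partial quotients starts at \<open>1\<close>.\<close>
definition partial_quotient :: "nat \<Rightarrow> real \<Rightarrow> int" where
  "partial_quotient n x = \<lfloor>1 / (gauss_map ^^ (n - 1)) x\<rfloor>"

definition has_khinchin_exponent :: "real \<Rightarrow> real \<Rightarrow> bool" where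
  "has_khinchin_exponent x \<xi> \<longleftrightarrow>
     (\<lambda>n. (1 / real n) * (\<Sum>j=1..n. ln (real_of_int (partial_quotient j x)))) \<longlonglongrightarrow> \<xi>"

definition khinchin_level_set :: "real \<Rightarrow> real set" where
  "khinchin_level_set \<xi> = {x \<in> {0..<1}. x \<notin> \<rat> \<and> has_khinchin_exponent x \<xi>}"

definition gauss_measure :: "real measure" where
  "gauss_measure =
     density (restrict_space lborel {0..<1}) (\<lambda>x. ennreal (1 / ((1 + x) * ln 2)))"

definition xi0 :: real where
  "xi0 = (LINT x|gauss_measure. ln (real_of_int (partial_quotient 1 x)))"


section \<open>The pressure function and the function \<open>t\<close>\<close>

text \<open>\<open>cfrac_tail [\<omega>\<^sub>1, \<dots>, \<omega>\<^sub>n] x\<close> is \<open>[\<omega>\<^sub>1, \<dots>, \<omega>\<^sub>n + x]\<close>.\<close>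
primrec cfrac_tail :: "nat list \<Rightarrow> real \<Rightarrow> real" where
  "cfrac_tail [] x = x"
| "cfrac_tail (w # ws) x = 1 / (real w + cfrac_tail ws x)"

definition pos_words :: "nat \<Rightarrow> nat list set" where
  "pos_words n = {\<omega>. length \<omega> = n \<and> (\<forall>k\<in>set \<omega>. 1 \<le> k)}"

text \<open>Positions in a list start at \<open>0\<close>, so the \<open>j\<close>-th factor here is the one with index \<open>j + 1\<close>.\<close>
definition word_weight :: "real \<Rightarrow> real \<Rightarrow> nat list \<Rightarrow> real \<Rightarrow> real" where
  "word_weight t q \<omega> x =
     (\<Prod>j<length \<omega>. real (\<omega> ! j) powr q * cfrac_tail (drop j \<omega>) x powr (2 * t))"

definition partition_sum :: "real \<Rightarrow> real \<Rightarrow> nat \<Rightarrow> real" where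
  "partition_sum t q n =
     (\<Sum>\<^sub>\<infinity>\<omega>\<in>pos_words n. exp (SUP x\<in>{0..1}. ln (word_weight t q \<omega> x)))"

text \<open>
  Only the values with \<open>2 * t - q > 1\<close> are meaningful: there the series of positive terms in
  \<^const>\<open>partition_sum\<close> converge and the limit exists.
\<close>
definition pressure :: "real \<Rightarrow> real \<Rightarrow> real" where
  "pressure t q = lim (\<lambda>n. (1 / real n) * ln (partition_sum t q n))"

definition D0 :: "(real \<times> real) set" where
  "D0 = {(t, q). 2 * t - q > 1 \<and> 0 \<le> t \<and> t \<le> 1}"

definition pressure_system :: "real \<Rightarrow> real \<Rightarrow> real \<Rightarrow> bool" where
  "pressure_system \<xi> t q \<longleftrightarrow>
     pressure t q = q * \<xi> \<and> ((\<lambda>q'. pressure t q') has_real_derivative \<xi>) (at q)"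

text \<open>Meaningful for \<open>\<xi> \<ge> 0\<close> only.\<close>
definition t_fun :: "real \<Rightarrow> real" where
  "t_fun \<xi> =
     (if \<xi> = 0 then 0 else fst (THE p. p \<in> D0 \<and> pressure_system \<xi> (fst p) (snd p)))"

end

theory Submission
  imports Defs "HOL-Complex_Analysis.Complex_Analysis" "HOL-Probability.Probability" "HOL-Real_Asymp.Real_Asymp"
begin

text \<open>
  Conjugating the transfer operator \<open>f \<mapsto> (\<lambda>x. \<Sum>k. k\<^sup>q (k + x)\<^sup>-\<^sup>2\<^sup>t f (1 / (k + x)))\<close> by its positive
  eigenfunction gives averaging operators whose kernels have bounded distortion. For a bounded
  concave metric these contract Lipschitz seminorms by a universal factor. The contraction yields the
  eigenfunction, identifies \<open>P(t, q)\<close> with the logarithm of the eigenvalue, and survives small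
  complex perturbations; hence \<open>P\<close> is real-analytic. Cauchy--Schwarz with a quantitative defect
  gives \<open>\<partial>\<^sup>2P/\<partial>q\<^sup>2 > 0\<close>.

  For fixed \<open>t\<close> the number \<open>min\<^sub>q (P(t, q) - q \<xi>)\<close> strictly decreases in \<open>t\<close>, and \<open>t(\<xi>)\<close> is its zero.
  The inverse function theorem makes \<open>t\<close> and \<open>q\<close> differentiable, with \<open>t' = q / (\<partial>P/\<partial>t)\<close>; as Jensen's
  inequality for the Gauss measure identifies \<open>(1, 0)\<close> as the solution for \<open>\<xi>\<^sub>0\<close>, the properties of \<open>t\<close>
  follow from elementary bounds on \<open>P\<close> and its gradient.

  If \<open>s > t(\<xi>)\<close>, cylinders weighted by \<open>exp (q (\<Sum> ln \<omega>\<^sub>j - n \<xi>))\<close> cover the level set with small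
  \<open>s\<close>-dimensional sum. If \<open>s < t(\<xi>)\<close>, the minimum above is positive at \<open>s\<close>, and independent blocks of
  digits bounded by some \<open>N\<close>, distributed proportionally to \<open>exp (q (\<Sum> ln \<omega>\<^sub>j - m \<xi>))\<close> times the length
  of the cylinder to the power \<open>s\<close>, with \<open>q\<close> chosen so that the mean of \<open>\<Sum> ln \<omega>\<^sub>j\<close> is \<open>m \<xi>\<close>, form a
  measure on the level set to which the mass distribution principle applies.
\<close>

text \<open>There are infinitely many digits, so uniformity in \<open>q\<close> fails: the series
  converge only for \<open>2 * t - q > 1\<close>, and moving \<open>q\<close> by \<open>d\<close>
  multiplies the weight of the digit \<open>k\<close> by the unbounded factor
  \<open>k powr d\<close>. Perturbations are therefore estimated digit by digit against a summable
  majorant that uses up part of the gap \<open>2 * t - q - 1\<close>. The contraction itself is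
  uniform; its constants depend only on \<open>0 \<le> t \<le> 2\<close>. The bound 2, rather than
  1, keeps the point \<open>(1, 0)\<close> that belongs to \<open>xi0\<close> in the interior, so
  that two-sided derivatives exist there.

  For the lower bound of the dimension, points with large digits are badly separated. Truncating the
  digits at \<open>N\<close> restores separation but lowers the sums; compactness of sublevel sets
  in \<open>q\<close> controls the loss, and the divergence of \<open>P\<close> at the edge
  \<open>q = 2 * t - 1\<close> rules out a limit parameter beyond the region of convergence. The
  positive minimum at \<open>s < t(\<xi>)\<close> makes the block sums grow exponentially with the
  block length \<open>m\<close>, which pays for the distortion at the joints of the blocks.\<close>

section \<open>Inverse branches of the Gauss map\<close>

text \<open>In the coordinate \<open>ln (1 + x)\<close> the Gauss measure is a multiple of Lebesgue
  measure. The Euclidean distance would not do: the branch of the digit 1 has derivative -1 at 0,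
  whereas \<open>ldist\<close> is halved by every branch.\<close>

definition ldist :: "real \<Rightarrow> real \<Rightarrow> real" where
  "ldist x y = \<bar>ln (1 + x) - ln (1 + y)\<bar>"

text \<open>The index \<open>k\<close> stands for the digit \<open>k + 1\<close>, so that series
  over digits are series over \<open>nat\<close>.\<close>

definition branch :: "nat \<Rightarrow> real \<Rightarrow> real" where
  "branch k x = 1 / (real (Suc k) + x)"

lemma ldist_nonneg [simp]: "0 \<le> ldist x y"
  and ldist_self [simp]: "ldist x x = 0"
  and ldist_commute: "ldist x y = ldist y x"
  by (auto simp: ldist_def)

lemma ldist_le_ln2:
  assumes "x \<in> {0..1}" "y \<in> {0..1}"
  shows "ldist x y \<le> ln 2"
proof -
  have "0 \<le> ln (1 + x)" "ln (1 + x) \<le> ln 2" "0 \<le> ln (1 + y)" "ln (1 + y) \<le> ln 2"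
    using assms by auto
  then show ?thesis by (auto simp: ldist_def)
qed

text \<open>The slope of \<open>ln (c + x)\<close> is at most that of \<open>ln (1 + x)\<close>.
  With \<open>c\<close> a digit this controls the variation of the logarithm of a branch.\<close>

lemma ln_diff_le_ldist:
  assumes "0 \<le> x" "0 \<le> y" "1 \<le> c"
  shows "\<bar>ln (c + x) - ln (c + y)\<bar> \<le> ldist x y"
proof -
  have *: "ln (c + y) - ln (c + x) \<le> ln (1 + y) - ln (1 + x)"
    if "0 \<le> x" "x \<le> y" for x y
  proof -
    have "ln (c + y) + ln (1 + x) \<le> ln (1 + y) + ln (c + x)"
    proof -
      have "(c + y) * (1 + x) \<le> (1 + y) * (c + x)"
        using mult_nonneg_nonneg[of "c - 1" "y - x"] that assms(3) by (auto simp: algebra_simps)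
      then show ?thesis
        using that assms(3) by (simp add: ln_mult_pos[symmetric])
    qed
    then show ?thesis by simp
  qed
  have ml: "ln (c + x) \<le> ln (c + y)" "ln (1 + x) \<le> ln (1 + y)" if "0 \<le> x" "x \<le> y" for x y
    using that assms(3) by auto
  show ?thesis
  proof (cases "x \<le> y")
    case True
    then show ?thesis using *[of x y] ml[of x y] assms by (auto simp: ldist_def)
  next
    case False
    then show ?thesis using *[of y x] ml[of y x] assms by (auto simp: ldist_def)
  qed
qed

lemma branch_pos: "0 \<le> x \<Longrightarrow> 0 < branch k x"
  by (simp add: branch_def add_pos_nonneg)

lemma branch_in [simp]: "x \<in> {0..1} \<Longrightarrow> branch k x \<in> {0..1}"
  by (auto simp: branch_def field_simps)

text \<open>In the coordinate \<open>ln (1 + x)\<close> the branch has slope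
  \<open>- (1 + x) / ((c + x) * (c + 1 + x))\<close> with \<open>c = k + 1\<close>. Its modulus is
  at most \<open>1 / 2\<close>, the value that the digit 1 takes at 0.\<close>

lemma ldist_branch:
  assumes "x \<in> {0..1}" "y \<in> {0..1}"
  shows "ldist (branch k x) (branch k y) \<le> ldist x y / 2"
proof -
  define c where "c = real (Suc k)"
  have c: "1 \<le> c" by (simp add: c_def)
  \<comment> \<open>That \<open>f\<close> is nondecreasing says that
    \<open>ln (1 + branch k x)\<close> falls by at most half of what \<open>ln (1 + x)\<close>
    gains.\<close>
  define f where "f x = ln (c + 1 + x) - ln (c + x) + ln (1 + x) / 2" for x
  have E: "ln (1 + branch k x) = ln (c + 1 + x) - ln (c + x)" if "0 \<le> x" for x
  proof -
    have "1 + branch k x = (c + 1 + x) / (c + x)"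
      using that c unfolding branch_def c_def[symmetric] by (simp add: field_simps)
    then show ?thesis using that c by (simp add: ln_div)
  qed
  have mono: "f x \<le> f y" if "0 \<le> x" "x \<le> y" for x y
  proof (rule DERIV_nonneg_imp_nondecreasing[OF that(2)])
    fix u assume u: "x \<le> u" "u \<le> y"
    then have u0: "0 \<le> u" using that by simp
    have D: "(f has_real_derivative (1 / (c + 1 + u) - 1 / (c + u) + 1 / (1 + u) / 2)) (at u)"
    proof -
      have "((\<lambda>x. ln (a + x)) has_real_derivative 1 / (a + u)) (at u)" if "0 < a + u" for a
        using that by (auto intro!: derivative_eq_intros)
      from this[of "c + 1"] this[of c] DERIV_cdivide[OF this[of 1], of 2] show ?thesis
        unfolding f_def using u0 c by (intro DERIV_add DERIV_diff) auto
    qed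
    have "1 / (c + u) - 1 / (c + 1 + u) = 1 / ((c + u) * (c + 1 + u))"
      using u0 c by (simp add: field_simps)
    also have "\<dots> \<le> 1 / ((1 + u) * 2)"
      by (intro divide_left_mono mult_mono) (use u0 c in auto)
    finally have "0 \<le> 1 / (c + 1 + u) - 1 / (c + u) + 1 / (1 + u) / 2" by simp
    then show "\<exists>D. (f has_real_derivative D) (at u) \<and> D \<ge> 0" using D by blast
  qed
  have anti: "ln (c + 1 + y) - ln (c + y) \<le> ln (c + 1 + x) - ln (c + x)" if "0 \<le> x" "x \<le> y" for x y
  proof -
    have "(c + 1 + y) * (c + x) \<le> (c + 1 + x) * (c + y)"
      using that by (simp add: algebra_simps)
    then have "ln ((c + 1 + y) * (c + x)) \<le> ln ((c + 1 + x) * (c + y))"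
      using that c by simp
    then show ?thesis using that c by (simp add: ln_mult_pos)
  qed
  have *: "ldist (branch k x) (branch k y) \<le> ldist x y / 2" if "0 \<le> x" "x \<le> y" for x y
  proof -
    have "ln (1 + x) \<le> ln (1 + y)" using that by simp
    then show ?thesis using mono[OF that] anti[OF that] that
      by (simp add: ldist_def E f_def field_simps)
  qed
  show ?thesis
  proof (cases "x \<le> y")
    case True then show ?thesis using * assms by auto
  next
    case False then show ?thesis using *[of y x] assms by (auto simp: ldist_commute)
  qed
qed

section \<open>Contraction of averaging operators\<close>

text \<open>The factor 64 is four times the distortion constant 16 in \<open>markov_kernel\<close>; with this
  concave change of metric one application of the operator is already a contraction.\<close>
definition rho :: "real \<Rightarrow> real \<Rightarrow> real" where
  "rho x y = 1 - exp (- 64 * ldist x y)"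

definition lip :: "real \<Rightarrow> (real \<Rightarrow> 'a::real_normed_vector) \<Rightarrow> bool" where
  "lip A \<phi> \<longleftrightarrow> (\<forall>x\<in>{0..1}. \<forall>y\<in>{0..1}. norm (\<phi> x - \<phi> y) \<le> A * rho x y)"

text \<open>The last clause is two-sided, as \<open>x\<close> and \<open>y\<close> may be exchanged:
  the distributions at two points share a fraction \<open>exp (- 16 * ldist x y)\<close> of their
  mass.\<close>

definition markov_kernel :: "(nat \<Rightarrow> real \<Rightarrow> real) \<Rightarrow> bool" where
  "markov_kernel p \<longleftrightarrow> (\<forall>x\<in>{0..1}. (\<forall>k. 0 \<le> p k x) \<and> (\<lambda>k. p k x) sums 1 \<and>
     (\<forall>y\<in>{0..1}. \<forall>k. exp (- 16 * ldist x y) * p k y \<le> p k x))"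

definition avg :: "(nat \<Rightarrow> real \<Rightarrow> real) \<Rightarrow> (real \<Rightarrow> 'a::banach) \<Rightarrow> real \<Rightarrow> 'a" where
  "avg p \<phi> x = (\<Sum>k. p k x *\<^sub>R \<phi> (branch k x))"

definition theta :: real where
  "theta = 1 - (1 / 2) ^ 48 / 4"

lemma theta: "0 < theta" "theta < 1"
  by (simp_all add: theta_def power_one_over field_simps)

lemma rho_nonneg [simp]: "0 \<le> rho x y" and rho_le_1: "rho x y \<le> 1"
  and rho_commute: "rho x y = rho y x"
  by (auto simp: rho_def ldist_commute)

lemma rho_mono: "ldist x y \<le> ldist u v \<Longrightarrow> rho x y \<le> rho u v"
  by (simp add: rho_def)

lemma rho_branch_le:
  assumes "x \<in> {0..1}" "y \<in> {0..1}"
  shows "rho (branch k x) (branch k y) \<le> rho x y"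
  using ldist_branch[OF assms, of k] ldist_nonneg[of x y] by (intro rho_mono) linarith

text \<open>By \<open>1 + 64 * s \<le> exp (64 * s)\<close> it suffices that
  \<open>s \<le> 63 / 64\<close>, and \<open>ln 2\<close> is smaller. Estimates in
  \<open>ldist\<close> thus become estimates of the \<open>lip\<close> seminorm without a further
  constant.\<close>

lemma ldist_le_rho:
  assumes "x \<in> {0..1}" "y \<in> {0..1}"
  shows "ldist x y \<le> rho x y"
proof -
  define s where "s = ldist x y"
  have s: "0 \<le> s" "s \<le> 1"
    using ldist_le_ln2[OF assms] ln_le_minus_one[of 2] by (auto simp: s_def)
  have "1 + 64 * s \<le> exp (64 * s)" by simp
  then have "exp (- 64 * s) \<le> 1 / (1 + 64 * s)"
    using s by (simp add: exp_minus field_simps)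
  also have "\<dots> \<le> 1 - s"
  proof -
    have "0 \<le> s * (63 - 64 * s) \<or> 63 < 64 * s" using s by auto
    then show ?thesis
    proof
      assume "0 \<le> s * (63 - 64 * s)"
      then show ?thesis using s by (simp add: field_simps)
    next
      assume h: "63 < 64 * s"
      have "s \<le> ln 2" using ldist_le_ln2[OF assms] by (simp add: s_def)
      moreover have "ln (2::real) < 63/64"
      proof -
        have "2 < exp (63/64 :: real)"
          using exp_lower_Taylor_quadratic[of "63/64::real"] by (simp add: power2_eq_square)
        then show ?thesis by (metis exp_less_mono exp_ln less_numeral_extra(3) linorder_neqE_linordered_idom not_less_iff_gr_or_eq zero_less_numeral)
      qed
      ultimately show ?thesis using h by simp
    qed
  qed
  finally show ?thesis by (simp add: rho_def s_def)
qed

lemma lipD: "lip A \<phi> \<Longrightarrow> x \<in> {0..1} \<Longrightarrow> y \<in> {0..1} \<Longrightarrow> norm (\<phi> x - \<phi> y) \<le> A * rho x y"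
  by (auto simp: lip_def)

lemma lip_nonneg:
  assumes "lip A \<phi>" shows "0 \<le> A"
proof -
  have "0 \<le> norm (\<phi> 0 - \<phi> 1)" by simp
  also have "\<dots> \<le> A * rho 0 1" using assms by (intro lipD) auto
  finally have "0 \<le> A * rho 0 1" .
  moreover have "rho 0 1 > 0" by (simp add: rho_def ldist_def)
  ultimately show ?thesis by (simp add: zero_le_mult_iff)
qed

text \<open>Because \<open>rho\<close> is bounded by 1, one seminorm controls both regularity and
  oscillation.\<close>

lemma lip_osc:
  assumes "lip A \<phi>" "x \<in> {0..1}" "y \<in> {0..1}" shows "norm (\<phi> x - \<phi> y) \<le> A"
proof -
  have "norm (\<phi> x - \<phi> y) \<le> A * rho x y" using assms by (intro lipD) auto
  also have "\<dots> \<le> A * 1" by (intro mult_left_mono rho_le_1 lip_nonneg[OF assms(1)])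
  finally show ?thesis by simp
qed

lemma lip_bounded:
  assumes "lip A \<phi>" "x \<in> {0..1}" shows "norm (\<phi> x) \<le> norm (\<phi> 0) + A"
proof -
  have "norm (\<phi> x) \<le> norm (\<phi> 0) + norm (\<phi> x - \<phi> 0)"
    by (metis add.commute diff_add_cancel norm_triangle_ineq)
  then show ?thesis using lip_osc[OF assms, of 0] by simp
qed

lemma markov_kernelD:
  assumes "markov_kernel p" "x \<in> {0..1}"
  shows "0 \<le> p k x" "(\<lambda>k. p k x) sums 1" "summable (\<lambda>k. p k x)" "(\<Sum>k. p k x) = 1"
    and "y \<in> {0..1} \<Longrightarrow> exp (- 16 * ldist x y) * p k y \<le> p k x"
  using assms by (auto simp: markov_kernel_def sums_iff)

lemma summable_weighted:
  fixes g :: "nat \<Rightarrow> 'a::banach"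
  assumes "summable p" "\<And>k. norm (g k) \<le> b" "\<And>k. 0 \<le> p k"
  shows "summable (\<lambda>k. p k *\<^sub>R g k)" "norm (\<Sum>k. p k *\<^sub>R g k) \<le> (\<Sum>k. p k) * b"
proof -
  have b: "norm (p k *\<^sub>R g k) \<le> p k * b" for k
    using assms by (auto intro: mult_left_mono)
  have s: "summable (\<lambda>k. p k * b)" using assms(1) by (rule summable_mult2)
  show "summable (\<lambda>k. p k *\<^sub>R g k)"
    by (rule summable_comparison_test'[OF s]) (use b in auto)
  show "norm (\<Sum>k. p k *\<^sub>R g k) \<le> (\<Sum>k. p k) * b"
    using norm_suminf_le[OF b s] suminf_mult2[OF assms(1), of b] by simp
qed

lemma avg_summable:
  fixes \<phi> :: "real \<Rightarrow> 'a::banach"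
  assumes "markov_kernel p" "x \<in> {0..1}" "\<And>u. u \<in> {0..1} \<Longrightarrow> norm (\<phi> u) \<le> b"
  shows "summable (\<lambda>k. p k x *\<^sub>R \<phi> (branch k x))" "norm (avg p \<phi> x) \<le> b"
  using summable_weighted[of "\<lambda>k. p k x" "\<lambda>k. \<phi> (branch k x)" b] markov_kernelD[OF assms(1,2)]
    assms(3) branch_in[OF assms(2)] by (simp_all add: avg_def)

text \<open>A probability kernel fixes constants, so \<open>c\<close> may be subtracted under the
  average.\<close>

lemma avg_diff_const:
  fixes \<phi> :: "real \<Rightarrow> 'a::banach"
  assumes "markov_kernel p" "x \<in> {0..1}" "\<And>u. u \<in> {0..1} \<Longrightarrow> norm (\<phi> u) \<le> b"
    and "\<And>u. u \<in> {0..1} \<Longrightarrow> norm (\<phi> u - c) \<le> a"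
  shows "norm (avg p \<phi> x - c) \<le> a"
proof -
  have b: "norm (\<phi> u - c) \<le> b + norm c" if "u \<in> {0..1}" for u
    using norm_triangle_ineq4[of "\<phi> u" c] assms(3)[OF that] by linarith
  have "(\<lambda>k. p k x *\<^sub>R \<phi> (branch k x) - p k x *\<^sub>R c) sums (avg p \<phi> x - 1 *\<^sub>R c)"
    unfolding avg_def using avg_summable(1)[OF assms(1-3)] markov_kernelD(2)[OF assms(1,2)]
    by (intro sums_diff summable_sums sums_scaleR_left)
  then have "avg p \<phi> x - c = avg p (\<lambda>u. \<phi> u - c) x"
    by (simp add: avg_def sums_iff scaleR_diff_right)
  also have "norm \<dots> \<le> a"
    by (rule avg_summable(2)[OF assms(1,2)]) (use assms(4) in auto)
  finally show ?thesis .
qed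

text \<open>With \<open>u = exp (- 16 * s)\<close> the left side is
  \<open>(1 - u ^ 4) - u ^ 3 * (1 - u)\<close>. Here \<open>u ^ 3 \<ge> (1 / 2) ^ 48\<close> as
  \<open>s \<le> ln 2\<close>, and \<open>1 - u \<ge> (1 - u ^ 4) / 4\<close>; this is where
  \<open>theta\<close> comes from.\<close>

lemma contraction_scalar:
  assumes "0 \<le> s" "s \<le> ln (2::real)"
  shows "1 - exp (- 48 * s) \<le> theta * (1 - exp (- 64 * s))"
proof -
  define u where "u = exp (- 16 * s)"
  have u: "0 < u" "u \<le> 1" using assms by (auto simp: u_def)
  have u3: "exp (- 48 * s) = u ^ 3" and u4: "exp (- 64 * s) = u ^ 4"
    unfolding u_def exp_of_nat_mult[symmetric] by simp_all
  have "exp (- (48 * ln 2)) \<le> exp (- 48 * s)" using assms by simp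
  also have "exp (- (48 * ln (2::real))) = (1 / 2) ^ 48"
  proof -
    have "exp (- (48 * ln (2::real))) = inverse (exp (real 48 * ln 2))" by (simp add: exp_minus)
    also have "\<dots> = inverse (2 ^ 48)" by (subst exp_of_nat_mult) simp
    finally show ?thesis by (simp add: power_one_over inverse_eq_divide)
  qed
  finally have l: "(1 / 2) ^ 48 \<le> u ^ 3" using u3 by simp
  have p: "u ^ 2 \<le> 1" "u ^ 3 \<le> 1" using u by (auto intro: power_le_one)
  have "1 - u ^ 4 = (1 - u) * (1 + u + u ^ 2 + u ^ 3)" by (simp add: algebra_simps eval_nat_numeral)
  also have "\<dots> \<le> (1 - u) * 4" using u p by (intro mult_left_mono) auto
  finally have f: "(1 - u ^ 4) / 4 \<le> 1 - u" by simp
  have "(1/2)^48 * ((1 - u ^ 4) / 4) \<le> u ^ 3 * (1 - u)"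
    using l f u by (intro mult_mono) (auto intro: power_le_one)
  moreover define a where "a = ((1::real) / 2) ^ 48"
  moreover have "1 - u ^ 3 = (1 - u ^ 4) - u ^ 3 * (1 - u)" by (simp add: algebra_simps eval_nat_numeral)
  ultimately show ?thesis unfolding u3 u4 theta_def a_def[symmetric] by (simp add: field_simps)
qed

text \<open>A fraction \<open>r = exp (- 16 d)\<close> of the two distributions is coupled along equal branches, where
  distances are halved; the rest is at distance at most \<open>1\<close>.\<close>
lemma lip_avg:
  fixes \<phi> :: "real \<Rightarrow> 'a::banach"
  assumes K: "markov_kernel p" and L: "lip A \<phi>"
  shows "lip (theta * A) (avg p \<phi>)"
  unfolding lip_def
proof (intro ballI)
  fix x y :: real assume x: "x \<in> {0..1}" and y: "y \<in> {0..1}"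
  define s where "s = ldist x y"
  define r where "r = exp (- 16 * s)"
  have s: "0 \<le> s" "s \<le> ln 2" using ldist_le_ln2[OF x y] by (auto simp: s_def)
  have r: "0 < r" "r \<le> 1" using s by (auto simp: r_def)
  define b where "b = norm (\<phi> 0) + A"
  have b: "norm (\<phi> u) \<le> b" if "u \<in> {0..1}" for u
    unfolding b_def using lip_bounded[OF L that] .
  have A: "0 \<le> A" using lip_nonneg[OF L] .
  note kx = markov_kernelD[OF K x] and ky = markov_kernelD[OF K y]
  \<comment> \<open>What remains of the distribution at \<open>x\<close> once the common part is
    removed; its total mass is \<open>1 - r\<close>.\<close>
  define \<pi> where "\<pi> k = p k x - r * p k y" for k
  have pi0: "0 \<le> \<pi> k" for k
    using kx(5)[OF y, of k] by (simp add: \<pi>_def r_def s_def)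
  have pi1: "\<pi> sums (1 - r)"
    unfolding \<pi>_def using sums_diff[OF kx(2) sums_mult[OF ky(2), of r]] by simp
  \<comment> \<open>The reference value is an average of \<open>\<phi>\<close>, so
    \<open>\<phi> - c\<close> is bounded by the oscillation of \<open>\<phi>\<close>, and it cancels
    in the difference of the two averages.\<close>
  define c where "c = avg p \<phi> y"
  have cb: "norm (\<phi> u - c) \<le> A" if "u \<in> {0..1}" for u
    unfolding c_def using avg_diff_const[of p y \<phi> b "\<phi> u" A, OF K y b] lip_osc[OF L _ that]
    by (simp add: norm_minus_commute)
  define P where "P = (\<Sum>k. p k y *\<^sub>R (\<phi> (branch k x) - \<phi> (branch k y)))"
  define Q where "Q = (\<Sum>k. \<pi> k *\<^sub>R (\<phi> (branch k x) - c))"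
  have nP: "norm (\<phi> (branch k x) - \<phi> (branch k y)) \<le> A * (1 - exp (- 32 * s))" for k
  proof -
    have "norm (\<phi> (branch k x) - \<phi> (branch k y)) \<le> A * rho (branch k x) (branch k y)"
      by (rule lipD[OF L branch_in[OF x] branch_in[OF y]])
    also have "\<dots> \<le> A * (1 - exp (- 32 * s))"
      using ldist_branch[OF x y, of k] A by (intro mult_left_mono) (auto simp: rho_def s_def)
    finally show ?thesis .
  qed
  have P: "summable (\<lambda>k. p k y *\<^sub>R (\<phi> (branch k x) - \<phi> (branch k y)))"
    "norm P \<le> A * (1 - exp (- 32 * s))"
    using summable_weighted[OF ky(3) nP ky(1)] ky(4) by (auto simp: P_def)
  have Q: "summable (\<lambda>k. \<pi> k *\<^sub>R (\<phi> (branch k x) - c))" "norm Q \<le> (1 - r) * A"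
    using summable_weighted[of \<pi> "\<lambda>k. \<phi> (branch k x) - c" A, OF _ cb[OF branch_in[OF x]] pi0] pi1
    by (simp_all add: Q_def sums_iff)
  have sumy: "(\<lambda>k. p k y *\<^sub>R \<phi> (branch k y)) sums c"
    unfolding c_def avg_def using avg_summable(1)[of p y \<phi> b, OF K y b] by (simp add: summable_sums)
  have "(\<lambda>k. r *\<^sub>R (p k y *\<^sub>R (\<phi> (branch k x) - \<phi> (branch k y))) + r *\<^sub>R (p k y *\<^sub>R \<phi> (branch k y))
      + \<pi> k *\<^sub>R (\<phi> (branch k x) - c) + \<pi> k *\<^sub>R c) sums (r *\<^sub>R P + r *\<^sub>R c + Q + (1 - r) *\<^sub>R c)"
    using P(1) Q(1) pi1 sumy unfolding P_def Q_def
    by (intro sums_add sums_scaleR_right sums_scaleR_left) (auto simp: summable_sums)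
  moreover have "r *\<^sub>R (p k y *\<^sub>R (\<phi> (branch k x) - \<phi> (branch k y))) + r *\<^sub>R (p k y *\<^sub>R \<phi> (branch k y))
      + \<pi> k *\<^sub>R (\<phi> (branch k x) - c) + \<pi> k *\<^sub>R c = p k x *\<^sub>R \<phi> (branch k x)" for k
    by (simp add: \<pi>_def algebra_simps)
  ultimately have "avg p \<phi> x = r *\<^sub>R P + r *\<^sub>R c + Q + (1 - r) *\<^sub>R c"
    unfolding avg_def by (simp add: sums_iff)
  then have "avg p \<phi> x - avg p \<phi> y = r *\<^sub>R P + Q"
    by (simp add: c_def[symmetric] algebra_simps)
  then have "norm (avg p \<phi> x - avg p \<phi> y) \<le> r * norm P + norm Q"
    using norm_triangle_ineq[of "r *\<^sub>R P" Q] r by simp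
  also have "\<dots> \<le> r * (A * (1 - exp (- 32 * s))) + (1 - r) * A"
    using P(2) Q(2) r by (intro add_mono mult_left_mono) auto
  \<comment> \<open>The common part has mass \<open>exp (- 16 * s)\<close>, and its halved distances
    contribute the factor \<open>1 - exp (- 32 * s)\<close>; adding the rest, of mass
    \<open>1 - exp (- 16 * s)\<close>, gives \<open>1 - exp (- 48 * s)\<close>.\<close>
  also have "\<dots> = A * (1 - exp (- 48 * s))"
    by (simp add: r_def algebra_simps exp_add[symmetric])
  also have "\<dots> \<le> A * (theta * (1 - exp (- 64 * s)))"
    using contraction_scalar[OF s] A by (intro mult_left_mono) auto
  finally show "norm (avg p \<phi> x - avg p \<phi> y) \<le> theta * A * rho x y"
    by (simp add: rho_def s_def mult_ac)
qed

section \<open>Words and their weights\<close>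

lemma word_weight_Nil [simp]: "word_weight t q [] x = 1"
  by (simp add: word_weight_def)

lemma word_weight_Cons:
  "word_weight t q (w # ws) x =
     real w powr q * cfrac_tail (w # ws) x powr (2 * t) * word_weight t q ws x"
  unfolding word_weight_def by (simp only: length_Cons prod.lessThan_Suc_shift) simp

lemma cfrac_tail_append: "cfrac_tail (u @ v) x = cfrac_tail u (cfrac_tail v x)"
  by (induction u) auto

lemma word_weight_append:
  "word_weight t q (u @ v) x = word_weight t q u (cfrac_tail v x) * word_weight t q v x"
  by (induction u) (simp_all add: word_weight_Cons cfrac_tail_append mult.assoc)

lemma cfrac_tail_in:
  assumes "\<forall>k\<in>set u. 1 \<le> k" "x \<in> {0..1}"
  shows "cfrac_tail u x \<in> {0..1}"
  using assms(1)
proof (induction u)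
  case Nil then show ?case using assms by simp
next
  case (Cons w u)
  then have "cfrac_tail u x \<in> {0..1}" "1 \<le> real w" by auto
  then show ?case by (auto simp: field_simps)
qed

lemma cfrac_tail_pos:
  assumes "\<forall>k\<in>set u. 1 \<le> k" "x \<in> {0..1}" "u \<noteq> []"
  shows "0 < cfrac_tail u x"
  using assms cfrac_tail_in[of "tl u" x] by (cases u) (auto simp: add_pos_nonneg)

lemma word_weight_pos:
  assumes "\<forall>k\<in>set u. 1 \<le> k" "x \<in> {0..1}"
  shows "0 < word_weight t q u x"
  using assms(1)
proof (induction u)
  case Nil then show ?case by simp
next
  case (Cons w u)
  then have "0 < cfrac_tail (w # u) x" using assms(2) by (intro cfrac_tail_pos) auto
  with Cons show ?case unfolding word_weight_Cons by (auto intro!: mult_pos_pos)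
qed

lemma word_weight_add:
  "word_weight (t + t') (q + q') u x = word_weight t q u x * word_weight t' q' u x"
  by (induction u) (simp_all add: word_weight_Cons powr_add distrib_left mult_ac)

lemma pos_wordsD: "u \<in> pos_words n \<Longrightarrow> \<forall>k\<in>set u. 1 \<le> k"
  "u \<in> pos_words n \<Longrightarrow> length u = n"
  by (auto simp: pos_words_def)

definition wt :: "real \<Rightarrow> real \<Rightarrow> nat \<Rightarrow> real \<Rightarrow> real" where
  "wt t q k x = real (Suc k) powr q * branch k x powr (2 * t)"

lemma cfrac_tail_single: "cfrac_tail [Suc k] x = branch k x"
  by (simp add: branch_def)

text \<open>The last digit acts on \<open>x\<close> first. Words are therefore extended on the
  right, so that appending a digit matches one more application of the transfer operator.\<close>

lemma word_weight_snoc: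
  "word_weight t q (u @ [Suc k]) x = word_weight t q u (branch k x) * wt t q k x"
  by (simp only: word_weight_append cfrac_tail_single)
     (simp add: word_weight_Cons wt_def branch_def)

lemma pos_words_Suc: "pos_words (Suc n) = (\<lambda>(k, u). u @ [Suc k]) ` (UNIV \<times> pos_words n)"
proof (intro subset_antisym subsetI)
  fix v assume v: "v \<in> pos_words (Suc n)"
  then have ne: "v \<noteq> []" by (auto simp: pos_words_def)
  have "last v \<in> set v" using ne by simp
  then have "1 \<le> last v" using v by (auto simp: pos_words_def)
  then obtain k where k: "last v = Suc k" by (cases "last v") auto
  have "butlast v \<in> pos_words n"
    using v by (auto simp: pos_words_def dest: in_set_butlastD)
  moreover have "v = butlast v @ [Suc k]" using ne k by (metis append_butlast_last_id)
  ultimately show "v \<in> (\<lambda>(k, u). u @ [Suc k]) ` (UNIV \<times> pos_words n)" by force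
qed (auto simp: pos_words_def)

section \<open>The transfer operator\<close>

text \<open>The constant 8 solves \<open>a = a / 2 + 4\<close>: a branch halves distances, and for
  \<open>t \<le> 2\<close> multiplication by the weight of a branch adds 4 to the exponent. So the
  cone is invariant under the transfer operator, whatever \<open>q\<close> is.\<close>

definition dcone :: "(real \<Rightarrow> real) \<Rightarrow> bool" where
  "dcone f \<longleftrightarrow> (\<forall>x\<in>{0..1}. \<forall>y\<in>{0..1}. 0 < f x \<and> f x \<le> exp (8 * ldist x y) * f y)"

definition transfer :: "real \<Rightarrow> real \<Rightarrow> (real \<Rightarrow> real) \<Rightarrow> real \<Rightarrow> real" where
  "transfer t q f x = (\<Sum>k. wt t q k x * f (branch k x))"

text \<open>The unit interval has diameter \<open>ln 2\<close> for \<open>ldist\<close>, and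
  \<open>2 ^ 8 = 256\<close>. This bounds the quotient of two values of a function in the cone and
  is the source of the constants 256 and 65536 below.\<close>

lemma exp_ldist_le:
  assumes "x \<in> {0..1}" "y \<in> {0..1}"
  shows "exp (8 * ldist x y) \<le> 256"
proof -
  have "exp (8 * ldist x y) \<le> exp (real 8 * ln 2)" using ldist_le_ln2[OF assms] by simp
  also have "\<dots> = 256" by (subst exp_of_nat_mult) simp
  finally show ?thesis .
qed

lemma coneD:
  assumes "dcone f" "x \<in> {0..1}" "y \<in> {0..1}"
  shows "0 < f x" "f x \<le> exp (8 * ldist x y) * f y" "f x \<le> 256 * f y"
proof -
  show *: "0 < f x" "f x \<le> exp (8 * ldist x y) * f y" using assms by (auto simp: dcone_def)
  have "0 < f y" using assms by (auto simp: dcone_def)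
  then show "f x \<le> 256 * f y"
    using *(2) mult_right_mono[OF exp_ldist_le[OF assms(2,3)], of "f y"] by linarith
qed

lemma cone_const: "0 < c \<Longrightarrow> dcone (\<lambda>_. c)"
  by (simp add: dcone_def)

text \<open>One factor 256 compares \<open>f y\<close> with \<open>f 0\<close>, the other bounds
  \<open>exp (8 * ldist x y)\<close>.\<close>

lemma cone_lip:
  assumes "dcone f" shows "lip (65536 * f 0) f"
  unfolding lip_def
proof (intro ballI)
  have *: "f x - f y \<le> 65536 * f 0 * rho x y" if x: "x \<in> {0..1}" and y: "y \<in> {0..1}" for x y
  proof -
    define s where "s = ldist x y"
    have s: "0 \<le> s" by (simp add: s_def)
    have "f x - f y \<le> f y * (exp (8 * s) - 1)"
      using coneD(2)[OF assms x y] by (simp add: s_def algebra_simps)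
    also have "exp (8 * s) - 1 = exp (8 * s) * (1 - exp (- 8 * s))"
      by (simp add: algebra_simps flip: exp_add)
    also have "f y * \<dots> \<le> (256 * f 0) * (256 * rho x y)"
    proof (intro mult_mono)
      show "f y \<le> 256 * f 0" using coneD(3)[OF assms y, of 0] by simp
      show "exp (8 * s) \<le> 256" using exp_ldist_le[OF x y] by (simp add: s_def)
      show "1 - exp (- 8 * s) \<le> rho x y" using s by (simp add: rho_def s_def)
    qed (use coneD(1)[OF assms, of 0 0] s in auto)
    finally show ?thesis by simp
  qed
  fix x y :: real assume "x \<in> {0..1}" "y \<in> {0..1}"
  then show "norm (f x - f y) \<le> 65536 * f 0 * rho x y"
    using *[of x y] *[of y x] by (auto simp: rho_commute abs_le_iff)
qed

lemma geometric_limit: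
  fixes f :: "nat \<Rightarrow> 'a::banach"
  assumes "\<And>n. norm (f (Suc n) - f n) \<le> C * r ^ n" "0 \<le> r" "r < 1"
  obtains l where "f \<longlonglongrightarrow> l" "\<And>n. norm (f n - l) \<le> C * r ^ n / (1 - r)"
proof -
  have sg: "summable (\<lambda>i. C * r ^ i)" using assms by (intro summable_mult summable_geometric) auto
  have s: "summable (\<lambda>i. f (Suc i) - f i)"
    by (rule summable_comparison_test'[OF sg]) (use assms in auto)
  define l where "l = f 0 + (\<Sum>i. f (Suc i) - f i)"
  have e: "f n = f 0 + (\<Sum>i<n. f (Suc i) - f i)" for n by (simp add: sum_lessThan_telescope)
  have "(\<lambda>n. f 0 + (\<Sum>i<n. f (Suc i) - f i)) \<longlonglongrightarrow> l"
    unfolding l_def by (intro tendsto_intros summable_LIMSEQ s)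
  then have lim: "f \<longlonglongrightarrow> l" using e by (metis (no_types, lifting) ext)
  have "norm (f n - l) \<le> C * r ^ n / (1 - r)" for n
  proof -
    have g: "(\<lambda>i. C * r ^ (i + n)) sums (C * r ^ n / (1 - r))"
      using sums_mult[OF geometric_sums[of r], of "C * r ^ n"] assms
      by (simp add: power_add mult_ac)
    have "l - f n = (\<Sum>i. f (Suc (i + n)) - f (i + n))"
      using suminf_split_initial_segment[OF s, of n] e[of n] by (simp add: l_def)
    also have "norm \<dots> \<le> (\<Sum>i. C * r ^ (i + n))"
      by (rule norm_suminf_le) (use assms g in \<open>auto simp: sums_iff\<close>)
    also have "\<dots> = C * r ^ n / (1 - r)" using g by (simp add: sums_iff)
    finally show ?thesis by (simp add: norm_minus_commute)
  qed
  with lim show ?thesis using that by blast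
qed

locale gibbs =
  fixes t q :: real
  assumes t0: "0 \<le> t" and t2: "t \<le> 2" and conv: "1 < 2 * t - q"
begin

lemma branch_powr:
  assumes "0 \<le> x"
  shows "branch k x powr a = exp (- a * ln (real (Suc k) + x))"
  using assms branch_pos[OF assms, of k] by (simp add: powr_def branch_def ln_div del: of_nat_Suc)

lemma wt_pos: "x \<in> {0..1} \<Longrightarrow> 0 < wt t q k x"
  using branch_pos[of x k] by (simp add: wt_def)

lemma wt_distortion:
  assumes "x \<in> {0..1}" "y \<in> {0..1}"
  shows "wt t q k x \<le> exp (4 * ldist x y) * wt t q k y"
proof -
  have 0: "0 \<le> x" "0 \<le> y" using assms by auto
  have "2 * t * (ln (real (Suc k) + y) - ln (real (Suc k) + x)) \<le> (2 * t) * ldist x y"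
    using ln_diff_le_ldist[of x y "real (Suc k)"] assms t0 by (intro mult_left_mono) auto
  also have "\<dots> \<le> 4 * ldist x y" using t2 by (intro mult_right_mono) auto
  finally have "exp (- (2 * t) * ln (real (Suc k) + x)) \<le> exp (4 * ldist x y + - (2 * t) * ln (real (Suc k) + y))"
    by (simp add: algebra_simps)
  then have "branch k x powr (2 * t) \<le> exp (4 * ldist x y) * branch k y powr (2 * t)"
    unfolding branch_powr[OF 0(1)] branch_powr[OF 0(2)] exp_add .
  then have "real (Suc k) powr q * branch k x powr (2 * t) \<le>
      real (Suc k) powr q * (exp (4 * ldist x y) * branch k y powr (2 * t))"
    by (intro mult_left_mono) auto
  then show ?thesis by (simp add: wt_def mult_ac)
qed

lemma wt_le:
  assumes "x \<in> {0..1}"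
  shows "wt t q k x \<le> real (Suc k) powr (q - 2 * t)"
proof -
  have "branch k x powr (2 * t) \<le> (1 / real (Suc k)) powr (2 * t)"
    unfolding branch_def using assms t0 by (intro powr_mono2 divide_left_mono) auto
  also have "\<dots> = real (Suc k) powr (- (2 * t))"
    by (simp add: powr_minus powr_divide divide_simps)
  finally have "real (Suc k) powr q * branch k x powr (2 * t) \<le>
    real (Suc k) powr q * real (Suc k) powr (- (2 * t))" by (intro mult_left_mono) auto
  then show ?thesis by (simp add: wt_def powr_add[symmetric])
qed

lemma summable_wt_bound: "summable (\<lambda>k. real (Suc k) powr (q - 2 * t))"
  using conv by (subst summable_Suc_iff) (simp add: summable_real_powr_iff)

lemma wt_summable: "x \<in> {0..1} \<Longrightarrow> summable (\<lambda>k. wt t q k x)"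
  by (rule summable_comparison_test'[OF summable_wt_bound])
     (use wt_le wt_pos in \<open>auto simp: less_imp_le abs_of_pos\<close>)

lemma transfer_summable:
  assumes "x \<in> {0..1}" "\<And>u. u \<in> {0..1} \<Longrightarrow> \<bar>f u\<bar> \<le> b"
  shows "summable (\<lambda>k. wt t q k x * f (branch k x))"
  using summable_weighted(1)[of "\<lambda>k. wt t q k x" "\<lambda>k. f (branch k x)" b]
    wt_summable[OF assms(1)] assms(2)[OF branch_in[OF assms(1)]] less_imp_le[OF wt_pos[OF assms(1)]]
  by simp

lemma cone_transfer_summable:
  assumes "dcone f" "x \<in> {0..1}"
  shows "summable (\<lambda>k. wt t q k x * f (branch k x))"
proof (rule transfer_summable[OF assms(2)])
  fix u :: real assume u: "u \<in> {0..1}"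
  show "\<bar>f u\<bar> \<le> 256 * f 0" using coneD[OF assms(1) u, of 0] by simp
qed

text \<open>The digit 1 suffices: its branch is at least \<open>1 / 2\<close>, so its weight is at
  least \<open>(1 / 2) ^ 4\<close> for every \<open>q\<close>, and moving the argument of
  \<open>f\<close> costs at most 256.\<close>

lemma transfer_ge_first:
  assumes "dcone f" "x \<in> {0..1}"
  shows "f x / 4096 \<le> transfer t q f x"
proof -
  have 1: "1 / 16 \<le> wt t q 0 x"
  proof -
    have "(1 / 16 :: real) = (1 / 2) powr 4" by (simp add: powr_numeral power_one_over)
    also have "\<dots> \<le> (1 / 2) powr (2 * t)" using t2 by (intro powr_mono') auto
    also have "\<dots> \<le> branch 0 x powr (2 * t)"
      using assms(2) t0 by (intro powr_mono2) (auto simp: branch_def field_simps)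
    finally show ?thesis by (simp add: wt_def)
  qed
  have 2: "f x / 256 \<le> f (branch 0 x)"
    using coneD(3)[OF assms(1,2) branch_in[OF assms(2), of 0]] by simp
  have "f x / 4096 = 1 / 16 * (f x / 256)" by simp
  also have "\<dots> \<le> wt t q 0 x * f (branch 0 x)"
    using 1 2 coneD(1)[OF assms(1,2,2)] by (intro mult_mono) auto
  also have "\<dots> = (\<Sum>k\<in>{0}. wt t q k x * f (branch k x))" by simp
  also have "\<dots> \<le> transfer t q f x"
    unfolding transfer_def using assms
    by (intro sum_le_suminf cone_transfer_summable) 
       (auto intro!: mult_nonneg_nonneg less_imp_le[OF wt_pos] less_imp_le[OF coneD(1)[OF assms(1) branch_in branch_in]])
  finally show ?thesis .
qed

lemma cone_transfer:
  assumes "dcone f" shows "dcone (transfer t q f)"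
  unfolding dcone_def
proof (intro ballI conjI)
  fix x y :: real assume x: "x \<in> {0..1}" and y: "y \<in> {0..1}"
  show "0 < transfer t q f x"
    using transfer_ge_first[OF assms x] coneD(1)[OF assms x x] by simp
  have "transfer t q f x \<le> (\<Sum>k. exp (8 * ldist x y) * (wt t q k y * f (branch k y)))"
    unfolding transfer_def
  proof (rule suminf_le)
    fix k
    have "f (branch k x) \<le> exp (8 * ldist (branch k x) (branch k y)) * f (branch k y)"
      by (rule coneD(2)[OF assms branch_in[OF x] branch_in[OF y]])
    also have "\<dots> \<le> exp (4 * ldist x y) * f (branch k y)"
      using ldist_branch[OF x y, of k] less_imp_le[OF coneD(1)[OF assms branch_in[OF y] branch_in[OF y]]]
      by (intro mult_right_mono) auto
    finally have "wt t q k x * f (branch k x) \<le> (exp (4 * ldist x y) * wt t q k y) * (exp (4 * ldist x y) * f (branch k y))"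
      using wt_distortion[OF x y, of k] wt_pos[OF y, of k] coneD(1)[OF assms branch_in[OF x] branch_in[OF x]]
      by (intro mult_mono) (auto intro: less_imp_le)
    also have "\<dots> = (exp (4 * ldist x y) * exp (4 * ldist x y)) * (wt t q k y * f (branch k y))"
      by (simp add: mult_ac)
    finally show "wt t q k x * f (branch k x) \<le> exp (8 * ldist x y) * (wt t q k y * f (branch k y))"
      by (simp flip: exp_add)
  qed (use cone_transfer_summable[OF assms] x y in \<open>auto intro: summable_mult\<close>)
  then show "transfer t q f x \<le> exp (8 * ldist x y) * transfer t q f y"
    unfolding transfer_def by (simp add: suminf_mult cone_transfer_summable[OF assms y])
qed

text \<open>The transition probabilities obtained by conjugating with \<open>g\<close>. Here
  \<open>g\<close> is any function in the cone, so the construction is available before an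
  eigenfunction is known.\<close>

definition kernel :: "(real \<Rightarrow> real) \<Rightarrow> nat \<Rightarrow> real \<Rightarrow> real" where
  "kernel g k x = wt t q k x * g (branch k x) / transfer t q g x"

text \<open>The exponent 16 is \<open>4 + 4 + 8\<close>: the weight, the function \<open>g\<close>
  at points whose distance a branch has halved, and the normalising factor
  \<open>transfer t q g\<close>.\<close>

lemma markov_kernel:
  assumes "dcone g" shows "markov_kernel (kernel g)"
  unfolding markov_kernel_def
proof (intro ballI conjI allI)
  note ct = cone_transfer[OF assms]
  fix x :: real assume x: "x \<in> {0..1}"
  note gx = coneD(1)[OF assms branch_in[OF x] branch_in[OF x]] and Tx = coneD(1)[OF ct x x]
  show "0 \<le> kernel g k x" for k
    using wt_pos[OF x, of k] gx[of k] Tx by (simp add: kernel_def)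
  show "(\<lambda>k. kernel g k x) sums 1"
    using sums_divide[OF summable_sums[OF cone_transfer_summable[OF assms x]], of "transfer t q g x"] Tx
    by (simp add: kernel_def transfer_def)
  fix y :: real and k assume y: "y \<in> {0..1}"
  note gy = coneD(1)[OF assms branch_in[OF y] branch_in[OF y]] and Ty = coneD(1)[OF ct y y]
  define e where "e = exp (4 * ldist x y)"
  have e: "1 \<le> e" "e * e * (e * e) * exp (- 16 * ldist x y) = 1" "exp (8 * ldist x y) = e * e"
    by (auto simp: e_def simp flip: exp_add)
  have 1: "wt t q k y \<le> e * wt t q k x" using wt_distortion[OF y x, of k] by (simp add: e_def ldist_commute)
  have 2: "g (branch k y) \<le> e * g (branch k x)"
  proof -
    have "g (branch k y) \<le> exp (8 * ldist (branch k y) (branch k x)) * g (branch k x)"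
      by (rule coneD(2)[OF assms branch_in[OF y] branch_in[OF x]])
    also have "\<dots> \<le> e * g (branch k x)"
      using ldist_branch[OF y x, of k] gx[of k]
      by (intro mult_right_mono) (auto simp: e_def ldist_commute)
    finally show ?thesis .
  qed
  have 3: "transfer t q g x \<le> e * e * transfer t q g y"
    using coneD(2)[OF ct x y] e(3) by simp
  have "wt t q k y * g (branch k y) * transfer t q g x \<le>
     (e * wt t q k x) * (e * g (branch k x)) * (e * e * transfer t q g y)"
    using 1 2 3 wt_pos[OF y, of k] wt_pos[OF x, of k] gx[of k] gy[of k] Tx Ty e(1)
    by (intro mult_mono) (auto intro!: mult_nonneg_nonneg simp: less_imp_le)
  then have "exp (- 16 * ldist x y) * (wt t q k y * g (branch k y) * transfer t q g x) \<le>
    exp (- 16 * ldist x y) * ((e * wt t q k x) * (e * g (branch k x)) * (e * e * transfer t q g y))"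
    by (intro mult_left_mono) auto
  also have "\<dots> = (e * e * (e * e) * exp (- 16 * ldist x y)) * (wt t q k x * g (branch k x) * transfer t q g y)"
    by (simp only: mult_ac)
  also have "\<dots> = wt t q k x * g (branch k x) * transfer t q g y" by (simp only: e(2) mult_1)
  finally show "exp (- 16 * ldist x y) * kernel g k y \<le> kernel g k x"
    using Tx Ty by (simp add: kernel_def field_simps)
qed

lemma avg_kernel:
  assumes "dcone g" "x \<in> {0..1}" "\<And>y. y \<in> {0..1} \<Longrightarrow> \<bar>g y * u y\<bar> \<le> b"
  shows "avg (kernel g) u x = transfer t q (\<lambda>y. g y * u y) x / transfer t q g x"
proof -
  have "avg (kernel g) u x = (\<Sum>k. (wt t q k x * (g (branch k x) * u (branch k x))) / transfer t q g x)"
    by (simp add: avg_def kernel_def mult_ac)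
  also have "\<dots> = (\<Sum>k. wt t q k x * (g (branch k x) * u (branch k x))) / transfer t q g x"
    by (rule suminf_divide[OF transfer_summable[OF assms(2), of "\<lambda>y. g y * u y", OF assms(3)]])
  finally show ?thesis by (simp add: transfer_def)
qed

lemma transfer_mono:
  assumes "x \<in> {0..1}" "\<And>y. y \<in> {0..1} \<Longrightarrow> \<bar>f y\<bar> \<le> a" "\<And>y. y \<in> {0..1} \<Longrightarrow> \<bar>g y\<bar> \<le> b"
    and "\<And>y. y \<in> {0..1} \<Longrightarrow> f y \<le> g y"
  shows "transfer t q f x \<le> transfer t q g x"
  unfolding transfer_def
  by (intro suminf_le mult_left_mono transfer_summable[OF assms(1), of f, OF assms(2)]
      transfer_summable[OF assms(1), of g, OF assms(3)] assms(4) branch_in assms(1)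
      less_imp_le[OF wt_pos[OF assms(1)]])

lemma transfer_cmult:
  assumes "x \<in> {0..1}" "\<And>y. y \<in> {0..1} \<Longrightarrow> \<bar>f y\<bar> \<le> a"
  shows "transfer t q (\<lambda>y. c * f y) x = c * transfer t q f x"
  unfolding transfer_def
  using suminf_mult[OF transfer_summable[OF assms(1), of f, OF assms(2)], of c] by (simp add: mult_ac)

lemma transfer_diff:
  assumes "x \<in> {0..1}" "\<And>y. y \<in> {0..1} \<Longrightarrow> \<bar>f y\<bar> \<le> a" "\<And>y. y \<in> {0..1} \<Longrightarrow> \<bar>g y\<bar> \<le> b"
  shows "transfer t q (\<lambda>y. f y - g y) x = transfer t q f x - transfer t q g x"
  unfolding transfer_def
  using suminf_diff[OF transfer_summable[OF assms(1), of f, OF assms(2)]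
     transfer_summable[OF assms(1), of g, OF assms(3)]] by (simp add: right_diff_distrib)

lemma cone_bound: "dcone f \<Longrightarrow> y \<in> {0..1} \<Longrightarrow> \<bar>f y\<bar> \<le> 256 * f 0"
  using coneD(1)[of f y y] coneD(3)[of f y 0] by simp

lemma transfer_abs_le:
  assumes "x \<in> {0..1}" "\<And>y. y \<in> {0..1} \<Longrightarrow> \<bar>f y\<bar> \<le> a"
  shows "\<bar>transfer t q f x\<bar> \<le> a * transfer t q (\<lambda>_. 1) x"
proof -
  have a: "0 \<le> a" using assms(2)[of 0] by simp
  have c: "transfer t q (\<lambda>_. c) x = c * transfer t q (\<lambda>_. 1) x" for c
    using transfer_cmult[OF assms(1), of "\<lambda>_. 1" 1 c] by simp
  have "transfer t q f x \<le> transfer t q (\<lambda>_. a) x"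
    by (rule transfer_mono[of x f a _ a]) (use assms a in \<open>auto simp: abs_le_iff\<close>)
  moreover have "transfer t q (\<lambda>_. - a) x \<le> transfer t q f x"
    by (rule transfer_mono[of x _ a f a]) (use assms a in \<open>auto simp: abs_le_iff minus_le_iff\<close>)
  ultimately show ?thesis by (simp add: c[of a] c[of "- a"] abs_le_iff)
qed

section \<open>Convergence of the normalised iterates\<close>

definition iter :: "nat \<Rightarrow> real \<Rightarrow> real" where
  "iter n = (transfer t q ^^ n) (\<lambda>_. 1)"

lemma iter_Suc: "iter (Suc n) = transfer t q (iter n)"
  by (simp add: iter_def)

lemma cone_iter: "dcone (iter n)"
  by (induction n) (auto simp: iter_def intro: cone_transfer cone_const)

definition ratio :: "nat \<Rightarrow> real \<Rightarrow> real" where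
  "ratio n x = iter (Suc n) x / iter n x"

lemma iter_mult_ratio: "x \<in> {0..1} \<Longrightarrow> iter n x * ratio n x = iter (Suc n) x"
  using coneD(1)[OF cone_iter, of x x n] by (simp add: ratio_def)

text \<open>Since \<open>iter (Suc n) = iter n * ratio n\<close>, applying the operator and dividing
  by its value on \<open>iter n\<close> averages \<open>ratio n\<close>. The kernel changes with
  \<open>n\<close>, but its distortion bound does not.\<close>

lemma ratio_Suc:
  assumes x: "x \<in> {0..1}"
  shows "ratio (Suc n) x = avg (kernel (iter n)) (ratio n) x"
proof -
  have "avg (kernel (iter n)) (ratio n) x =
      transfer t q (\<lambda>y. iter n y * ratio n y) x / transfer t q (iter n) x"
    by (rule avg_kernel[OF cone_iter x, of _ _ "256 * iter (Suc n) 0"])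
       (use cone_bound[OF cone_iter[of "Suc n"]] in \<open>simp add: iter_mult_ratio\<close>)
  also have "transfer t q (\<lambda>y. iter n y * ratio n y) x = iter (Suc (Suc n)) x"
    unfolding iter_Suc[of "Suc n"] transfer_def
    using iter_mult_ratio[OF branch_in[OF x]] by simp
  finally show ?thesis by (simp add: ratio_def[of "Suc n"] iter_Suc)
qed

text \<open>Each step contracts by the universal \<open>theta\<close>, so the quotient of successive
  iterates becomes constant at a geometric rate.\<close>

lemma lip_ratio: "lip (theta ^ n * (65536 * iter 1 0)) (ratio n)"
proof (induction n)
  case 0
  have "ratio 0 = iter 1" by (simp add: ratio_def iter_def fun_eq_iff)
  then show ?case using cone_lip[OF cone_iter[of 1]] by simp
next
  case (Suc n)
  show ?case
    using lip_avg[OF markov_kernel[OF cone_iter] Suc, of n]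
    by (auto simp: lip_def ratio_Suc mult.assoc)
qed

lemma ratio_ge: "x \<in> {0..1} \<Longrightarrow> 1 / 4096 \<le> ratio n x"
  using transfer_ge_first[OF cone_iter, of x n] coneD(1)[OF cone_iter, of x x n]
  by (simp add: ratio_def iter_Suc field_simps)

text \<open>Normalised at 0, consecutive iterates differ by the factor
  \<open>ratio n x / ratio n 0\<close>, which tends to 1 geometrically and uniformly in
  \<open>x\<close>. Hence they converge uniformly, and the limit inherits the cone
  condition.\<close>

theorem eigenfunction:
  obtains h l where "dcone h" "h 0 = 1" "0 < l"
    "\<And>x. x \<in> {0..1} \<Longrightarrow> transfer t q h x = l * h x"
proof -
  define f where "f n x = iter n x / iter n 0" for n x
  have g0: "0 < iter n 0" for n using coneD(1)[OF cone_iter, of 0 0] by simp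
  have cf: "dcone (f n)" for n
    using cone_iter[of n] g0[of n] by (auto simp: dcone_def f_def divide_right_mono)
  have f0: "f n 0 = 1" for n using g0[of n] by (simp add: f_def)
  define A where "A = 65536 * iter 1 0"
  define C where "C = 256 * (4096 * A)"
  have A: "0 \<le> A" using g0[of 1] by (simp add: A_def)
  have step: "norm (f (Suc n) x - f n x) \<le> C * theta ^ n" if x: "x \<in> {0..1}" for n x
  proof -
    have r0: "1 / 4096 \<le> ratio n 0" using ratio_ge[of 0] by simp
    have "f (Suc n) x = f n x * (ratio n x / ratio n 0)"
      using coneD(1)[OF cone_iter x x, of n] g0[of n] g0[of "Suc n"] by (simp add: f_def ratio_def)
    then have "f (Suc n) x - f n x = f n x * ((ratio n x - ratio n 0) / ratio n 0)"
      using r0 by (simp add: field_simps)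
    then have "norm (f (Suc n) x - f n x) = \<bar>f n x\<bar> * (\<bar>ratio n x - ratio n 0\<bar> * (1 / ratio n 0))"
      using r0 by (simp add: abs_mult)
    also have "\<dots> \<le> 256 * ((theta ^ n * A) * 4096)"
    proof (intro mult_mono)
      show "\<bar>f n x\<bar> \<le> 256" using cone_bound[OF cf x, of n] f0 by simp
      show "\<bar>ratio n x - ratio n 0\<bar> \<le> theta ^ n * A"
        using lip_osc[OF lip_ratio x, of 0 n] by (simp add: A_def)
      show "1 / ratio n 0 \<le> 4096" using r0 by (simp add: field_simps)
    qed (use r0 A theta in auto)
    finally show ?thesis by (simp add: C_def mult_ac)
  qed
  have "\<exists>l. (\<lambda>n. f n x) \<longlonglongrightarrow> l \<and> (\<forall>n. norm (f n x - l) \<le> C * theta ^ n / (1 - theta))"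
    if "x \<in> {0..1}" for x
    using geometric_limit[of "\<lambda>n. f n x", OF step[OF that]] theta by (metis less_imp_le)
  then obtain h where h: "\<And>x. x \<in> {0..1} \<Longrightarrow> (\<lambda>n. f n x) \<longlonglongrightarrow> h x"
    "\<And>x n. x \<in> {0..1} \<Longrightarrow> norm (f n x - h x) \<le> C * theta ^ n / (1 - theta)"
    by metis
  have h0: "h 0 = 1" using h(1)[of 0] f0 by (simp add: LIMSEQ_const_iff)
  have ch0: "h x \<le> exp (8 * ldist x y) * h y" if "x \<in> {0..1}" "y \<in> {0..1}" for x y
    by (rule LIMSEQ_le[OF h(1)[OF that(1)] tendsto_mult_left[OF h(1)[OF that(2)]]])
       (use coneD(2)[OF cf that] in auto)
  have hpos: "0 < h x" if "x \<in> {0..1}" for x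
  proof -
    have "1 \<le> exp (8 * ldist 0 x) * h x" using ch0[of 0 x] that h0 by simp
    then have "0 < exp (8 * ldist 0 x) * h x" by linarith
    then show ?thesis by (simp add: zero_less_mult_iff)
  qed
  have ch: "dcone h" using ch0 hpos by (auto simp: dcone_def)
  \<comment> \<open>The uniform rate in \<open>h(2)\<close> allows the limit to be taken under the
    series.\<close>
  have lim: "(\<lambda>n. transfer t q (f n) x) \<longlonglongrightarrow> transfer t q h x" if x: "x \<in> {0..1}" for x
  proof (rule metric_LIMSEQ_I)
    fix e :: real assume e: "0 < e"
    define T where "T = transfer t q (\<lambda>_. 1) x"
    have "(\<lambda>n. C * theta ^ n / (1 - theta) * T) \<longlonglongrightarrow> C * 0 / (1 - theta) * T"
      using theta by (intro tendsto_intros LIMSEQ_realpow_zero) auto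
    then have "(\<lambda>n. C * theta ^ n / (1 - theta) * T) \<longlonglongrightarrow> 0" by simp
    from order_tendstoD(2)[OF this e] obtain N where N: "\<And>n. n \<ge> N \<Longrightarrow> C * theta ^ n / (1 - theta) * T < e"
      by (auto simp: eventually_sequentially)
    have "dist (transfer t q (f n) x) (transfer t q h x) \<le> C * theta ^ n / (1 - theta) * T" for n
      using transfer_abs_le[OF x, of "\<lambda>y. f n y - h y" "C * theta ^ n / (1 - theta)"] h(2)
        transfer_diff[OF x cone_bound[OF cf, of _ n] cone_bound[OF ch]]
      by (simp add: dist_norm T_def)
    then show "\<exists>N. \<forall>n\<ge>N. dist (transfer t q (f n) x) (transfer t q h x) < e"
      using N by (meson le_less_trans)
  qed
  have tf: "transfer t q (f n) x = f (Suc n) x * ratio n 0" if x: "x \<in> {0..1}" for n x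
  proof -
    have "transfer t q (f n) x = transfer t q (\<lambda>y. (1 / iter n 0) * iter n y) x"
      by (simp add: f_def[abs_def])
    also have "\<dots> = (1 / iter n 0) * iter (Suc n) x"
      unfolding iter_Suc by (rule transfer_cmult[OF x cone_bound[OF cone_iter]])
    finally show ?thesis using g0[of n] g0[of "Suc n"] by (simp add: f_def ratio_def)
  qed
  define l where "l = transfer t q h 0"
  have rl: "(\<lambda>n. ratio n 0) \<longlonglongrightarrow> l"
    using lim[of 0] tf[of 0] f0 by (simp add: l_def)
  have "transfer t q h x = l * h x" if x: "x \<in> {0..1}" for x
  proof -
    have "(\<lambda>n. f (Suc n) x * ratio n 0) \<longlonglongrightarrow> h x * l"
      by (intro tendsto_mult LIMSEQ_Suc h(1) x rl)
    moreover have "(\<lambda>n. f (Suc n) x * ratio n 0) \<longlonglongrightarrow> transfer t q h x"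
      using lim[OF x] by (simp add: tf[OF x])
    ultimately show ?thesis using LIMSEQ_unique by (metis mult.commute)
  qed
  moreover have "0 < l" unfolding l_def using coneD(1)[OF cone_transfer[OF ch], of 0 0] by simp
  ultimately show ?thesis using that ch h0 by blast
qed

section \<open>The pressure as logarithm of the leading eigenvalue\<close>

lemma word_weight_distortion:
  assumes "\<forall>k\<in>set u. 1 \<le> k" "x \<in> {0..1}" "y \<in> {0..1}"
  shows "word_weight t q u x \<le> exp (8 * ldist x y) * word_weight t q u y"
  using assms
proof (induction u arbitrary: x y rule: rev_induct)
  case Nil then show ?case by simp
next
  case (snoc w u)
  then obtain k where k: "w = Suc k" by (cases w) auto
  note x = snoc.prems(2) and y = snoc.prems(3)
  have u: "\<forall>k\<in>set u. 1 \<le> k" using snoc.prems by auto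
  have "word_weight t q u (branch k x) \<le> exp (8 * ldist (branch k x) (branch k y)) * word_weight t q u (branch k y)"
    by (rule snoc.IH[OF u branch_in[OF x] branch_in[OF y]])
  also have "\<dots> \<le> exp (4 * ldist x y) * word_weight t q u (branch k y)"
    using ldist_branch[OF x y, of k] less_imp_le[OF word_weight_pos[OF u branch_in[OF y]]]
    by (intro mult_right_mono) auto
  finally have "word_weight t q u (branch k x) * wt t q k x \<le>
     (exp (4 * ldist x y) * word_weight t q u (branch k y)) * (exp (4 * ldist x y) * wt t q k y)"
    using wt_distortion[OF x y, of k] wt_pos[OF x, of k] less_imp_le[OF word_weight_pos[OF u branch_in[OF y]]]
    by (intro mult_mono) auto
  also have "\<dots> = (exp (4 * ldist x y) * exp (4 * ldist x y)) * (word_weight t q u (branch k y) * wt t q k y)"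
    by simp
  finally show ?case by (simp add: k word_weight_snoc flip: exp_add)
qed

lemma transfer_sums:
  "dcone h \<Longrightarrow> x \<in> {0..1} \<Longrightarrow> (\<lambda>k. wt t q k x * h (branch k x)) sums transfer t q h x"
  unfolding transfer_def by (rule summable_sums[OF cone_transfer_summable])

text \<open>The \<open>n\<close>-th iterate of the operator on \<open>h\<close>, unfolded into a sum
  over words. Nonnegativity of the terms lets the nested sums merge into one unordered sum.\<close>

lemma has_sum_words:
  assumes h: "dcone h" and l: "\<And>x. x \<in> {0..1} \<Longrightarrow> transfer t q h x = l * h x" and x: "x \<in> {0..1}"
  shows "((\<lambda>u. word_weight t q u x * h (cfrac_tail u x)) has_sum l ^ n * h x) (pos_words n)"
  using x
proof (induction n arbitrary: x)
  case 0
  have "pos_words 0 = {[]}" by (auto simp: pos_words_def)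
  then show ?case by (simp add: has_sum_finiteI)
next
  case (Suc n)
  note x = Suc.prems
  define F where "F = (\<lambda>u. word_weight t q u x * h (cfrac_tail u x))"
  define g where "g = (\<lambda>(k, u::nat list). u @ [Suc k])"
  have inj: "inj_on g (UNIV \<times> pos_words n)" by (auto simp: inj_on_def g_def)
  have Fg: "F (g (k, u)) = wt t q k x * (word_weight t q u (branch k x) * h (cfrac_tail u (branch k x)))" for k u
    by (simp add: F_def g_def word_weight_snoc cfrac_tail_append branch_def mult_ac)
  have inner: "((\<lambda>u. (F \<circ> g) (k, u)) has_sum wt t q k x * (l ^ n * h (branch k x))) (pos_words n)" for k
    unfolding o_def Fg by (intro has_sum_cmult_right Suc.IH branch_in[OF x])
  have nn: "0 \<le> wt t q k x * h (branch k x)" for k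
    using wt_pos[OF x, of k] coneD(1)[OF h branch_in[OF x] branch_in[OF x], of k] by simp
  have "(\<lambda>k. wt t q k x * h (branch k x)) sums (l * h x)"
    using transfer_sums[OF h x] l[OF x] by simp
  then have "((\<lambda>k. wt t q k x * h (branch k x)) has_sum (l * h x)) UNIV"
    by (rule sums_nonneg_imp_has_sum) (rule nn)
  from has_sum_cmult_right[OF this, of "l ^ n"]
  have outer: "((\<lambda>k. wt t q k x * (l ^ n * h (branch k x))) has_sum l ^ Suc n * h x) UNIV"
    by (simp add: mult_ac)
  have "0 \<le> (F \<circ> g) (k, u)" if "u \<in> pos_words n" for k u
    unfolding o_def Fg using wt_pos[OF x, of k] pos_wordsD(1)[OF that]
      coneD(1)[OF h cfrac_tail_in cfrac_tail_in, of u "branch k x" u "branch k x"]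
      word_weight_pos[of u "branch k x" t q] branch_in[OF x, of k]
    by (intro mult_nonneg_nonneg less_imp_le) auto
  then have "(F \<circ> g) summable_on (UNIV \<times> pos_words n)"
    by (intro summable_on_SigmaI[OF inner has_sum_imp_summable[OF outer]])
  from has_sum_SigmaI[OF inner outer this]
  have "(F has_sum l ^ Suc n * h x) (g ` (UNIV \<times> pos_words n))"
    by (simp add: has_sum_reindex[OF inj])
  then show ?case by (simp add: pos_words_Suc g_def F_def)
qed

text \<open>The supremum in \<open>partition_sum\<close> is replaced by the value at 0; by bounded
  distortion this changes the sums by at most the factor 256.\<close>

definition Zn :: "nat \<Rightarrow> real" where
  "Zn n = infsum (\<lambda>u. word_weight t q u 0) (pos_words n)"

lemma summable_words:
  assumes "x \<in> {0..1}" shows "(\<lambda>u. word_weight t q u x) summable_on pos_words n"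
proof -
  obtain h l where h: "dcone h" "h 0 = 1" "\<And>x. x \<in> {0..1} \<Longrightarrow> transfer t q h x = l * h x"
    by (rule eigenfunction) blast
  show ?thesis
  proof (rule summable_on_comparison_test)
    show "(\<lambda>u. 256 * (word_weight t q u x * h (cfrac_tail u x))) summable_on pos_words n"
      using has_sum_words[OF h(1,3) assms, of n]
      by (intro summable_on_cmult_right) (auto simp: has_sum_imp_summable)
    fix u assume "u \<in> pos_words n"
    then have u: "\<forall>k\<in>set u. 1 \<le> k" by (rule pos_wordsD)
    show "0 \<le> word_weight t q u x" using word_weight_pos[OF u assms] by (rule less_imp_le)
    show "word_weight t q u x \<le> 256 * (word_weight t q u x * h (cfrac_tail u x))"
      using coneD(3)[OF h(1) _ cfrac_tail_in[OF u assms], of 0] h(2) word_weight_pos[OF u assms, of t q]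
      by simp
  qed
qed

lemma Zn_bounds:
  assumes h: "dcone h" "0 < l" "\<And>x. x \<in> {0..1} \<Longrightarrow> transfer t q h x = l * h x"
  shows "l ^ n / 256 \<le> Zn n" "Zn n \<le> 256 * l ^ n"
proof -
  have 0: "(0::real) \<in> {0..1}" by simp
  note hs = has_sum_words[OF h(1,3) 0, of n]
  have h0: "0 < h 0" using coneD(1)[OF h(1) 0 0] .
  have s: "((\<lambda>u. word_weight t q u 0) has_sum Zn n) (pos_words n)"
    unfolding Zn_def by (rule has_sum_infsum[OF summable_words]) simp
  have b: "h 0 / 256 \<le> h (cfrac_tail u 0)" "h (cfrac_tail u 0) \<le> 256 * h 0" "0 < word_weight t q u 0"
    if "u \<in> pos_words n" for u
    using coneD(3)[OF h(1) 0 cfrac_tail_in[OF pos_wordsD(1)[OF that] 0]]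
      coneD(3)[OF h(1) cfrac_tail_in[OF pos_wordsD(1)[OF that] 0] 0]
      word_weight_pos[OF pos_wordsD(1)[OF that] 0] by auto
  have "l ^ n * h 0 \<le> Zn n * (256 * h 0)"
    by (rule has_sum_mono[OF hs has_sum_cmult_left[OF s]]) (use b in \<open>auto intro!: mult_left_mono less_imp_le\<close>)
  then show "l ^ n / 256 \<le> Zn n" using h0 by simp
  have "Zn n * (h 0 / 256) \<le> l ^ n * h 0"
    by (rule has_sum_mono[OF has_sum_cmult_left[OF s] hs])
       (use b in \<open>auto intro!: mult_left_mono less_imp_le simp del: times_divide_eq_right\<close>)
  then show "Zn n \<le> 256 * l ^ n" using h0 by simp
qed

lemma sup_weight_bounds:
  assumes "\<forall>k\<in>set u. 1 \<le> k"
  shows "word_weight t q u 0 \<le> exp (SUP x\<in>{0..1}. ln (word_weight t q u x))"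
    "exp (SUP x\<in>{0..1}. ln (word_weight t q u x)) \<le> 256 * word_weight t q u 0"
proof -
  have p: "0 < word_weight t q u x" if "x \<in> {0..1}" for x using word_weight_pos[OF assms that] .
  have b: "ln (word_weight t q u x) \<le> ln (256 * word_weight t q u 0)" if x: "x \<in> {0..1}" for x
  proof -
    have "word_weight t q u x \<le> exp (8 * ldist x 0) * word_weight t q u 0"
      by (rule word_weight_distortion[OF assms x]) simp
    also have "\<dots> \<le> 256 * word_weight t q u 0"
      using exp_ldist_le[OF x, of 0] p[of 0] by (intro mult_right_mono) auto
    finally show ?thesis using p[OF x] p[of 0] by simp
  qed
  have bdd: "bdd_above ((\<lambda>x. ln (word_weight t q u x)) ` {0..1})" by (rule bdd_aboveI2) (rule b)
  have "ln (word_weight t q u 0) \<le> (SUP x\<in>{0..1}. ln (word_weight t q u x))"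
    by (rule cSUP_upper[OF _ bdd]) simp
  then have "exp (ln (word_weight t q u 0)) \<le> exp (SUP x\<in>{0..1}. ln (word_weight t q u x))"
    by (simp only: exp_le_cancel_iff)
  then show "word_weight t q u 0 \<le> exp (SUP x\<in>{0..1}. ln (word_weight t q u x))"
    using p[of 0] by simp
  have "(SUP x\<in>{0..1}. ln (word_weight t q u x)) \<le> ln (256 * word_weight t q u 0)"
    by (rule cSUP_least) (use b in auto)
  then have "exp (SUP x\<in>{0..1}. ln (word_weight t q u x)) \<le> exp (ln (256 * word_weight t q u 0))"
    by simp
  then show "exp (SUP x\<in>{0..1}. ln (word_weight t q u x)) \<le> 256 * word_weight t q u 0"
    using p[of 0] by simp
qed

lemma partition_sum_bounds: "Zn n \<le> partition_sum t q n" "partition_sum t q n \<le> 256 * Zn n"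
proof -
  have s: "(\<lambda>u. word_weight t q u 0) summable_on pos_words n" by (rule summable_words) simp
  have s2: "(\<lambda>u. exp (SUP x\<in>{0..1}. ln (word_weight t q u x))) summable_on pos_words n"
    by (rule summable_on_comparison_test[OF summable_on_cmult_right[OF s, of 256]])
       (use sup_weight_bounds(2) in \<open>auto dest: pos_wordsD(1)\<close>)
  show "Zn n \<le> partition_sum t q n"
    unfolding Zn_def partition_sum_def
    by (rule infsum_mono[OF s s2]) (use sup_weight_bounds(1) in \<open>auto dest: pos_wordsD(1)\<close>)
  have "partition_sum t q n \<le> infsum (\<lambda>u. 256 * word_weight t q u 0) (pos_words n)"
    unfolding partition_sum_def
    by (rule infsum_mono[OF s2 summable_on_cmult_right[OF s, of 256]])
       (use sup_weight_bounds(2) in \<open>auto dest: pos_wordsD(1)\<close>)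
  then show "partition_sum t q n \<le> 256 * Zn n" by (simp add: Zn_def infsum_cmult_right')
qed

text \<open>All comparisons cost bounded factors, so \<open>ln (partition_sum t q n)\<close> differs
  from \<open>n * ln l\<close> by at most \<open>ln 65536\<close>, and division by \<open>n\<close>
  removes this. In particular the limit in \<open>pressure\<close> exists.\<close>

theorem pressure_eq_ln:
  assumes h: "dcone h" "0 < l" "\<And>x. x \<in> {0..1} \<Longrightarrow> transfer t q h x = l * h x"
  shows "pressure t q = ln l"
proof -
  have "\<bar>(1 / real n) * ln (partition_sum t q n) - ln l\<bar> \<le> ln 65536 * (1 / real n)" if n: "n > 0" for n
  proof -
    have lo: "l ^ n / 65536 \<le> partition_sum t q n" and hi: "partition_sum t q n \<le> 65536 * l ^ n"
      using Zn_bounds[OF h, of n] partition_sum_bounds[of n] h(2) by auto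
    have ln: "ln (l ^ n) = real n * ln l" using h(2) by (simp add: ln_realpow)
    have pos: "0 < partition_sum t q n" using lo h(2) by (smt (verit) divide_pos_pos zero_less_power)
    have "ln (l ^ n / 65536) \<le> ln (partition_sum t q n)" "ln (partition_sum t q n) \<le> ln (65536 * l ^ n)"
      using lo hi pos h(2) by (auto intro!: ln_mono)
    then have "\<bar>ln (partition_sum t q n) - real n * ln l\<bar> \<le> ln 65536"
      using h(2) ln by (simp add: ln_div ln_mult_pos abs_le_iff)
    moreover have "(1 / real n) * ln (partition_sum t q n) - ln l =
       (ln (partition_sum t q n) - real n * ln l) * (1 / real n)" using n by (simp add: field_simps)
    ultimately show ?thesis by (simp add: abs_mult divide_right_mono)
  qed
  then have ev: "eventually (\<lambda>n. norm ((1 / real n) * ln (partition_sum t q n) - ln l) \<le> ln 65536 * (1 / real n)) sequentially"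
    by (intro eventually_sequentiallyI[of 1]) auto
  have "(\<lambda>n. ln 65536 * (1 / real n)) \<longlonglongrightarrow> 0"
    using tendsto_mult_right[OF lim_1_over_n, of "ln 65536"] by simp
  then have "(\<lambda>n. (1 / real n) * ln (partition_sum t q n) - ln l) \<longlonglongrightarrow> 0"
    by (rule Lim_null_comparison[OF ev])
  then have "(\<lambda>n. (1 / real n) * ln (partition_sum t q n)) \<longlonglongrightarrow> ln l"
    using LIM_zero_iff by blast
  then show ?thesis unfolding pressure_def by (rule limI)
qed

theorem eigenfunction_pressure:
  obtains h where "dcone h" "h 0 = 1"
    "\<And>x. x \<in> {0..1} \<Longrightarrow> transfer t q h x = exp (pressure t q) * h x"
proof -
  obtain h l where h: "dcone h" "h 0 = 1" "0 < l" "\<And>x. x \<in> {0..1} \<Longrightarrow> transfer t q h x = l * h x"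
    by (rule eigenfunction) blast
  have "l = exp (pressure t q)" using pressure_eq_ln[OF h(1,3,4)] h(3) by simp
  with h that show ?thesis by blast
qed

lemma Zn_pressure: "exp (real n * pressure t q) / 256 \<le> Zn n" "Zn n \<le> 256 * exp (real n * pressure t q)"
proof -
  obtain h where h: "dcone h" "\<And>x. x \<in> {0..1} \<Longrightarrow> transfer t q h x = exp (pressure t q) * h x"
    by (rule eigenfunction_pressure) blast
  show "exp (real n * pressure t q) / 256 \<le> Zn n" "Zn n \<le> 256 * exp (real n * pressure t q)"
    using Zn_bounds[OF h(1) _ h(2), of n] by (simp_all add: exp_of_nat_mult)
qed

text \<open>Let \<open>r\<close> be the largest number with \<open>r * \<phi> \<le> h\<close>.
  Applying the operator to this inequality improves \<open>r\<close> to \<open>r * b / l\<close>,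
  where \<open>l\<close> is the eigenvalue, so maximality forces \<open>b \<le> l\<close>. This
  admits test functions that are merely bounded above and away from 0.\<close>

lemma pressure_ge_subeigen:
  assumes \<phi>: "\<And>x. x \<in> {0..1} \<Longrightarrow> c \<le> \<phi> x" "\<And>x. x \<in> {0..1} \<Longrightarrow> \<phi> x \<le> C" "0 < c"
    and b: "0 < b" "\<And>x. x \<in> {0..1} \<Longrightarrow> b * \<phi> x \<le> transfer t q \<phi> x"
  shows "ln b \<le> pressure t q"
proof -
  obtain h where h: "dcone h" "h 0 = 1" "\<And>x. x \<in> {0..1} \<Longrightarrow> transfer t q h x = exp (pressure t q) * h x"
    by (rule eigenfunction_pressure) blast
  define l where "l = exp (pressure t q)"
  have hp: "1 / 256 \<le> h x" "h x \<le> 256" if "x \<in> {0..1}" for x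
    using coneD(3)[OF h(1) _ that, of 0] coneD(3)[OF h(1) that, of 0] h(2) by auto
  have C: "0 < C" using \<phi>(1)[of 0] \<phi>(2)[of 0] \<phi>(3) by simp
  define r where "r = (INF x\<in>{0..1}. h x / \<phi> x)"
  have low: "1 / 256 / C \<le> h x / \<phi> x" if "x \<in> {0..1}" for x
    using hp(1)[OF that] \<phi>(1)[OF that] \<phi>(2)[OF that] \<phi>(3) by (intro frac_le) auto
  have r0: "0 < r"
  proof -
    have "1 / 256 / C \<le> r" unfolding r_def by (rule cINF_greatest) (use low in auto)
    moreover have "0 < 1 / 256 / C" using C by simp
    ultimately show ?thesis by linarith
  qed
  have bdd: "bdd_below ((\<lambda>x. h x / \<phi> x) ` {0..1})" by (rule bdd_belowI2) (rule low)
  have rle: "r * \<phi> x \<le> h x" if x: "x \<in> {0..1}" for x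
  proof -
    have "r \<le> h x / \<phi> x" unfolding r_def by (rule cINF_lower[OF bdd x])
    then show ?thesis using \<phi>(1)[OF x] \<phi>(3) by (simp add: field_simps)
  qed
  have phiC: "\<bar>\<phi> x\<bar> \<le> C" if "x \<in> {0..1}" for x using \<phi>(1,2)[OF that] \<phi>(3) by auto
  have "r * b / l \<le> h x / \<phi> x" if x: "x \<in> {0..1}" for x
  proof -
    have "r * (b * \<phi> x) \<le> r * transfer t q \<phi> x" using b(2)[OF x] r0 by simp
    also have "\<dots> = transfer t q (\<lambda>y. r * \<phi> y) x" using transfer_cmult[OF x phiC] by simp
    also have "\<dots> \<le> transfer t q h x"
      by (rule transfer_mono[of x _ "r * C" h "256 * h 0"])
         (use x phiC r0 rle cone_bound[OF h(1)] in \<open>auto simp: abs_mult\<close>)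
    also have "\<dots> = l * h x" using h(3)[OF x] by (simp add: l_def)
    finally show ?thesis using \<phi>(1)[OF x] \<phi>(3) by (simp add: l_def field_simps)
  qed
  then have "r * b / l \<le> r" unfolding r_def[symmetric] by (subst (2) r_def, intro cINF_greatest) auto
  then have "b \<le> l" using r0 by (simp add: l_def field_simps)
  then show ?thesis using b(1) by (metis l_def ln_exp ln_mono)
qed

end

section \<open>Inequalities for the pressure\<close>

text \<open>Growth rates are compared through the partition sums: a strict gap \<open>d\<close>
  would make \<open>exp (real n * d)\<close> bounded in \<open>n\<close>.\<close>

lemma pressure_compare:
  assumes g: "gibbs t q" and g': "gibbs t' q'" and C: "0 < C" and b: "0 < b"
    and le: "\<And>n u. u \<in> pos_words n \<Longrightarrow> word_weight t' q' u 0 \<le> C * b ^ n * word_weight t q u 0"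
  shows "pressure t' q' \<le> pressure t q + ln b"
proof (rule ccontr)
  assume neg: "\<not> ?thesis"
  define d where "d = pressure t' q' - pressure t q - ln b"
  have d: "0 < d" using neg by (simp add: d_def)
  have bound: "exp (real n * d) \<le> 65536 * C" for n
  proof -
    have s: "(\<lambda>u. word_weight t q u 0) summable_on pos_words n" using gibbs.summable_words[OF g] by simp
    have s': "(\<lambda>u. word_weight t' q' u 0) summable_on pos_words n" using gibbs.summable_words[OF g'] by simp
    have "gibbs.Zn t' q' n \<le> infsum (\<lambda>u. C * b ^ n * word_weight t q u 0) (pos_words n)"
      unfolding gibbs.Zn_def[OF g'] by (rule infsum_mono[OF s' summable_on_cmult_right[OF s] le])
    also have "\<dots> = C * b ^ n * gibbs.Zn t q n"
      unfolding gibbs.Zn_def[OF g] by (rule infsum_cmult_right')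
    also have "\<dots> \<le> C * b ^ n * (256 * exp (real n * pressure t q))"
      using gibbs.Zn_pressure(2)[OF g, of n] C b by (intro mult_left_mono) auto
    finally have "exp (real n * pressure t' q') \<le> 65536 * C * (b ^ n * exp (real n * pressure t q))"
      using gibbs.Zn_pressure(1)[OF g', of n] by simp
    also have "b ^ n = exp (real n * ln b)" using b by (simp add: exp_of_nat_mult)
    finally have "exp (real n * pressure t' q') \<le> 65536 * C * exp (real n * ln b + real n * pressure t q)"
      by (simp add: exp_add)
    then have "exp (real n * pressure t' q') / exp (real n * ln b + real n * pressure t q) \<le> 65536 * C"
      by (simp add: field_simps)
    then show ?thesis by (simp add: d_def algebra_simps flip: exp_diff)
  qed
  obtain n :: nat where "65536 * C / d < real n" using reals_Archimedean2 by blast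
  then have "65536 * C < real n * d" using d by (simp add: field_simps)
  also have "\<dots> < exp (real n * d)" using exp_ge_add_one_self[of "real n * d"] by linarith
  finally show False using bound[of n] by simp
qed

text \<open>Two consecutive tails \<open>c\<close> and \<open>1 / (w + c)\<close> have product
  \<open>c / (w + c) \<le> 1 / 2\<close>. Digits are therefore processed in pairs, and
  \<open>2 powr \<tau>\<close> pays for a possible unpaired digit.\<close>

lemma word_weight_half:
  assumes "\<forall>k\<in>set u. 1 \<le> k" "x \<in> {0..1}" "0 \<le> \<tau>"
  shows "word_weight \<tau> 0 u x \<le> 2 powr \<tau> * (2 powr - \<tau>) ^ length u"
  using assms(1)
proof (induction u rule: induct_list012)
  case 1 then show ?case using assms(3) by (simp add: ge_one_powr_ge_zero)
next
  case (2 w)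
  have "cfrac_tail [w] x \<le> 1" "0 \<le> cfrac_tail [w] x" using cfrac_tail_in[OF 2 assms(2)] by auto
  then have "cfrac_tail [w] x powr (2 * \<tau>) \<le> 1" using assms(3) by (intro powr_le1) auto
  moreover have "real w powr 0 = 1" using 2 by simp
  ultimately show ?case
    by (simp add: word_weight_Cons flip: powr_add)
next
  case (3 w w' u)
  define c where "c = cfrac_tail (w' # u) x"
  have c: "0 < c" "c \<le> 1" using cfrac_tail_in[of "w' # u" x] cfrac_tail_pos[of "w' # u" x] 3(3) assms(2)
    by (auto simp: c_def simp del: cfrac_tail.simps)
  have w: "1 \<le> real w" "1 \<le> real w'" using 3(3) by auto
  have e: "word_weight \<tau> 0 (w # w' # u) x = (1 / (real w + c) * c) powr (2 * \<tau>) * word_weight \<tau> 0 u x"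
    unfolding word_weight_Cons cfrac_tail.simps(2)[of w "w' # u"] c_def[symmetric]
    using w c by (subst powr_mult) auto
  have "1 / (real w + c) * c \<le> 1 / 2" using w c by (simp add: field_simps)
  then have "(1 / (real w + c) * c) powr (2 * \<tau>) \<le> (1 / 2) powr (2 * \<tau>)"
    using assms(3) w c by (intro powr_mono2) auto
  also have "\<dots> = (2 powr - \<tau>) * (2 powr - \<tau>)"
    by (simp add: powr_divide powr_minus powr_add[symmetric] divide_simps)
  finally have "word_weight \<tau> 0 (w # w' # u) x \<le>
      ((2 powr - \<tau>) * (2 powr - \<tau>)) * (2 powr \<tau> * (2 powr - \<tau>) ^ length u)"
    unfolding e using 3(1,3) word_weight_pos[of u x \<tau> 0] assms(2) by (intro mult_mono) auto
  then show ?case by (simp add: mult_ac)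
qed

text \<open>A tail starting with the digit \<open>w\<close> lies between \<open>1 / (2 * w)\<close>
  and \<open>1 / w\<close>. This upper bound, and the lower one in
  \<open>word_weight_shift_down\<close>, trade a change of \<open>t\<close> by \<open>\<tau>\<close>
  for a change of \<open>q\<close> by \<open>2 * \<tau>\<close>.\<close>

lemma word_weight_shift_up:
  assumes "\<forall>k\<in>set u. 1 \<le> k" "x \<in> {0..1}" "0 \<le> \<tau>"
  shows "word_weight \<tau> 0 u x \<le> word_weight 0 (- 2 * \<tau>) u x"
  using assms(1)
proof (induction u)
  case Nil then show ?case by simp
next
  case (Cons w u)
  have u: "\<forall>k\<in>set u. 1 \<le> k" using Cons.prems by simp
  define c where "c = cfrac_tail u x"
  have c: "0 \<le> c" using cfrac_tail_in[OF u assms(2)] by (simp add: c_def)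
  have w: "1 \<le> real w" using Cons.prems by auto
  have "(1 / (real w + c)) powr (2 * \<tau>) \<le> (1 / real w) powr (2 * \<tau>)"
    using w c assms(3) by (intro powr_mono2 divide_left_mono) auto
  also have "\<dots> = real w powr (- 2 * \<tau>)" using w by (simp add: powr_divide powr_minus divide_simps)
  finally have "(1 / (real w + c)) powr (2 * \<tau>) * word_weight \<tau> 0 u x \<le>
    real w powr (- 2 * \<tau>) * word_weight 0 (- 2 * \<tau>) u x"
    using Cons.IH[OF u] word_weight_pos[OF u assms(2), of \<tau> 0] by (intro mult_mono) auto
  then show ?case using w c by (simp add: word_weight_Cons c_def[symmetric])
qed

lemma word_weight_shift_down:
  assumes "\<forall>k\<in>set u. 1 \<le> k" "x \<in> {0..1}" "0 \<le> \<tau>"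
  shows "word_weight (- \<tau>) 0 u x \<le> (2 powr (2 * \<tau>)) ^ length u * word_weight 0 (2 * \<tau>) u x"
  using assms(1)
proof (induction u)
  case Nil then show ?case by simp
next
  case (Cons w u)
  have u: "\<forall>k\<in>set u. 1 \<le> k" using Cons.prems by simp
  define c where "c = cfrac_tail u x"
  have c: "0 \<le> c" "c \<le> 1" using cfrac_tail_in[OF u assms(2)] by (auto simp: c_def)
  have w: "1 \<le> real w" using Cons.prems by auto
  have "(1 / (real w + c)) powr (2 * - \<tau>) = (real w + c) powr (2 * \<tau>)"
    using w c by (simp add: powr_divide powr_minus divide_simps)
  also have "\<dots> \<le> (2 * real w) powr (2 * \<tau>)"
    using w c assms(3) by (intro powr_mono2) auto
  also have "\<dots> = 2 powr (2 * \<tau>) * real w powr (2 * \<tau>)" using w by (simp add: powr_mult)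
  finally have "(1 / (real w + c)) powr (2 * - \<tau>) * word_weight (- \<tau>) 0 u x \<le>
    (2 powr (2 * \<tau>) * real w powr (2 * \<tau>)) * ((2 powr (2 * \<tau>)) ^ length u * word_weight 0 (2 * \<tau>) u x)"
    using Cons.IH[OF u] word_weight_pos[OF u assms(2), of "- \<tau>" 0] by (intro mult_mono) auto
  then show ?case using w c by (simp add: word_weight_Cons c_def[symmetric] mult_ac)
qed

text \<open>The rate \<open>ln 2\<close> is universal. It keeps the derivative of \<open>P\<close>
  in \<open>t\<close> away from 0 and supplies the exponential margins in both dimension
  estimates.\<close>

lemma pressure_decreasing:
  assumes "gibbs t q" "0 \<le> \<tau>" "t + \<tau> \<le> 2"
  shows "pressure (t + \<tau>) q \<le> pressure t q - \<tau> * ln 2"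
proof -
  have g': "gibbs (t + \<tau>) q" using assms by (simp add: gibbs_def)
  have "pressure (t + \<tau>) q \<le> pressure t q + ln (2 powr - \<tau>)"
  proof (rule pressure_compare[OF assms(1) g', of "2 powr \<tau>"])
    fix n u assume u: "u \<in> pos_words n"
    have "word_weight t q u 0 * word_weight \<tau> 0 u 0 \<le> word_weight t q u 0 * (2 powr \<tau> * (2 powr - \<tau>) ^ n)"
      using word_weight_half[of u 0 \<tau>] pos_wordsD[OF u] assms(2) word_weight_pos[of u 0 t q]
      by (intro mult_left_mono) auto
    then show "word_weight (t + \<tau>) q u 0 \<le> 2 powr \<tau> * (2 powr - \<tau>) ^ n * word_weight t q u 0"
      using word_weight_add[of t \<tau> q 0 u 0] by (simp add: mult_ac)
  qed auto
  then show ?thesis by (simp add: ln_powr)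
qed

text \<open>Differentiated at \<open>\<tau> = 0\<close>, this and \<open>pressure_shift_down\<close>
  confine \<open>- Pt\<close> between \<open>2 * Pq\<close> and \<open>2 * Pq + 2 * ln 2\<close>.
  The comparison stays in the region of convergence since \<open>2 * t - q\<close> has the same
  value on both sides.\<close>

lemma pressure_shift_up:
  assumes "gibbs (t + \<tau>) q" "0 \<le> t" "0 \<le> \<tau>"
  shows "pressure (t + \<tau>) q \<le> pressure t (q - 2 * \<tau>)"
proof -
  have g: "gibbs t (q - 2 * \<tau>)" using assms by (simp add: gibbs_def)
  have "pressure (t + \<tau>) q \<le> pressure t (q - 2 * \<tau>) + ln 1"
  proof (rule pressure_compare[OF g assms(1), of 1])
    fix n u assume u: "u \<in> pos_words n"
    have "word_weight t q u 0 * word_weight \<tau> 0 u 0 \<le> word_weight t q u 0 * word_weight 0 (- 2 * \<tau>) u 0"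
      using word_weight_shift_up[of u 0 \<tau>] pos_wordsD[OF u] assms(3) word_weight_pos[of u 0 t q]
      by (intro mult_left_mono) auto
    then show "word_weight (t + \<tau>) q u 0 \<le> 1 * 1 ^ n * word_weight t (q - 2 * \<tau>) u 0"
      using word_weight_add[of t \<tau> q 0 u 0] word_weight_add[of t 0 q "- 2 * \<tau>" u 0] by simp
  qed auto
  then show ?thesis by simp
qed

lemma pressure_shift_down:
  assumes "gibbs t (q + 2 * \<tau>)" "0 \<le> t - \<tau>" "0 \<le> \<tau>"
  shows "pressure (t - \<tau>) q \<le> pressure t (q + 2 * \<tau>) + 2 * \<tau> * ln 2"
proof -
  have g: "gibbs (t - \<tau>) q" using assms by (simp add: gibbs_def)
  have "pressure (t - \<tau>) q \<le> pressure t (q + 2 * \<tau>) + ln (2 powr (2 * \<tau>))"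
  proof (rule pressure_compare[OF assms(1) g, of 1])
    fix n u assume u: "u \<in> pos_words n"
    have "word_weight t q u 0 * word_weight (- \<tau>) 0 u 0 \<le>
        word_weight t q u 0 * ((2 powr (2 * \<tau>)) ^ n * word_weight 0 (2 * \<tau>) u 0)"
      using word_weight_shift_down[of u 0 \<tau>] pos_wordsD[OF u] assms(3) word_weight_pos[of u 0 t q]
      by (intro mult_left_mono) auto
    then show "word_weight (t - \<tau>) q u 0 \<le> 1 * (2 powr (2 * \<tau>)) ^ n * word_weight t (q + 2 * \<tau>) u 0"
      using word_weight_add[of t "- \<tau>" q 0 u 0] word_weight_add[of t 0 q "2 * \<tau>" u 0]
      by (simp add: mult_ac)
  qed auto
  then show ?thesis by (simp add: ln_powr)
qed

section \<open>Lower bounds for the pressure and its behaviour at the two ends of the range of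
  q\<close>

context gibbs
begin

lemma wt_ge:
  assumes "x \<in> {0..1}"
  shows "real (Suc k) powr q * real (k + 2) powr (- (2 * t)) \<le> wt t q k x"
proof -
  have "real (k + 2) powr (- (2 * t)) = (1 / real (k + 2)) powr (2 * t)"
    by (simp add: powr_divide powr_minus divide_simps)
  also have "\<dots> \<le> branch k x powr (2 * t)"
    unfolding branch_def using assms t0 by (intro powr_mono2 divide_left_mono) auto
  finally show ?thesis unfolding wt_def by (intro mult_left_mono) auto
qed

text \<open>The mirror image of \<open>pressure_ge_subeigen\<close>, with the least \<open>r\<close>
  such that \<open>h \<le> r * \<phi>\<close>.\<close>

lemma pressure_le_supereigen:
  assumes \<phi>: "\<And>x. x \<in> {0..1} \<Longrightarrow> c \<le> \<phi> x" "\<And>x. x \<in> {0..1} \<Longrightarrow> \<phi> x \<le> C" "0 < c"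
    and b: "0 < b" "\<And>x. x \<in> {0..1} \<Longrightarrow> transfer t q \<phi> x \<le> b * \<phi> x"
  shows "pressure t q \<le> ln b"
proof -
  obtain h where h: "dcone h" "h 0 = 1" "\<And>x. x \<in> {0..1} \<Longrightarrow> transfer t q h x = exp (pressure t q) * h x"
    by (rule eigenfunction_pressure) blast
  define l where "l = exp (pressure t q)"
  have hp: "1 / 256 \<le> h x" "h x \<le> 256" if "x \<in> {0..1}" for x
    using coneD(3)[OF h(1) _ that, of 0] coneD(3)[OF h(1) that, of 0] h(2) by auto
  have C: "0 < C" using \<phi>(1)[of 0] \<phi>(2)[of 0] \<phi>(3) by simp
  define r where "r = (SUP x\<in>{0..1}. h x / \<phi> x)"
  have up: "h x / \<phi> x \<le> 256 / c" if "x \<in> {0..1}" for x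
    using hp[OF that] \<phi>(1)[OF that] \<phi>(3) by (intro frac_le) auto
  have bdd: "bdd_above ((\<lambda>x. h x / \<phi> x) ` {0..1})" by (rule bdd_aboveI2) (rule up)
  have rge: "h x \<le> r * \<phi> x" if x: "x \<in> {0..1}" for x
  proof -
    have "h x / \<phi> x \<le> r" unfolding r_def by (rule cSUP_upper[OF x bdd])
    then show ?thesis using \<phi>(1)[OF x] \<phi>(3) by (simp add: field_simps)
  qed
  have r0: "0 < r"
  proof -
    have "0 < r * \<phi> 0" using rge[of 0] h(2) by simp
    then show ?thesis using \<phi>(1)[of 0] \<phi>(3) by (simp add: zero_less_mult_iff)
  qed
  have phiC: "\<bar>\<phi> x\<bar> \<le> C" if "x \<in> {0..1}" for x using \<phi>(1,2)[OF that] \<phi>(3) by auto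
  have "h x / \<phi> x \<le> r * b / l" if x: "x \<in> {0..1}" for x
  proof -
    have "l * h x = transfer t q h x" using h(3)[OF x] by (simp add: l_def)
    also have "\<dots> \<le> transfer t q (\<lambda>y. r * \<phi> y) x"
      by (rule transfer_mono[of x _ "256 * h 0" _ "r * C"])
         (use x phiC r0 rge cone_bound[OF h(1)] in \<open>auto simp: abs_mult\<close>)
    also have "\<dots> = r * transfer t q \<phi> x" using transfer_cmult[OF x phiC] by simp
    also have "\<dots> \<le> r * (b * \<phi> x)" using b(2)[OF x] r0 by simp
    finally show ?thesis using \<phi>(1)[OF x] \<phi>(3) by (simp add: l_def field_simps)
  qed
  then have "r \<le> r * b / l" by (subst r_def, intro cSUP_least) auto
  then have "l \<le> b" using r0 by (simp add: l_def field_simps)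
  then show ?thesis using b(1) by (metis exp_gt_zero l_def ln_exp ln_mono)
qed

text \<open>The constant 1 is the test function: every finite part of the operator applied to it
  bounds the eigenvalue from below.\<close>

lemma pressure_ge_sum:
  assumes "0 < N"
  shows "ln (\<Sum>k<N. real (Suc k) powr q * real (k + 2) powr (- (2 * t))) \<le> pressure t q"
proof (rule pressure_ge_subeigen[of 1 "\<lambda>_. 1" 1])
  show "0 < (\<Sum>k<N. real (Suc k) powr q * real (k + 2) powr (- (2 * t)))"
    using assms by (intro sum_pos) auto
  fix x :: real assume x: "x \<in> {0..1}"
  have "(\<Sum>k<N. real (Suc k) powr q * real (k + 2) powr (- (2 * t))) \<le> (\<Sum>k<N. wt t q k x)"
    by (intro sum_mono wt_ge x)
  also have "\<dots> \<le> (\<Sum>k. wt t q k x)"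
    by (intro sum_le_suminf wt_summable x) (auto intro: less_imp_le wt_pos x)
  finally show "(\<Sum>k<N. real (Suc k) powr q * real (k + 2) powr (- (2 * t))) * 1 \<le> transfer t q (\<lambda>_. 1) x"
    by (simp add: transfer_def)
qed auto

text \<open>The digits 1 and 2 give a bound that is valid for all \<open>q\<close> in the region, is
  positive at \<open>t = 0\<close>, and never falls below \<open>- 2 * t * ln 3\<close>.\<close>

lemma pressure_ge_two: "ln (1 + 2 powr q) - 2 * t * ln 3 \<le> pressure t q"
proof -
  have p: "(0::real) < 1 + 2 powr q" by (simp add: add_pos_nonneg)
  have "(3::real) powr (- (2 * t)) \<le> 2 powr (- (2 * t))"
    using t0 by (intro powr_mono2') auto
  then have "3 powr (- (2 * t)) * (1 + 2 powr q) \<le> (\<Sum>k<2. real (Suc k) powr q * real (k + 2) powr (- (2 * t)))"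
    by (simp add: eval_nat_numeral ring_distribs mult_ac)
  then have "ln (3 powr (- (2 * t)) * (1 + 2 powr q)) \<le> ln (\<Sum>k<2. real (Suc k) powr q * real (k + 2) powr (- (2 * t)))"
    using p by (intro ln_mono) auto
  also have "\<dots> \<le> pressure t q" by (rule pressure_ge_sum) simp
  finally show ?thesis using p by (simp add: ln_mult_pos ln_powr)
qed

end

text \<open>On the line \<open>q = 2 * t - 1\<close> the terms of \<open>pressure_ge_sum\<close>
  dominate \<open>1 / 16\<close> of the harmonic series. Finitely many of them already have a large
  sum, and a finite sum is continuous in \<open>q\<close>.\<close>

lemma pressure_at_edge:
  assumes "0 \<le> t" "t \<le> 2"
  shows "eventually (\<lambda>q. M < pressure t q) (at_left (2 * t - 1))"
proof -
  have "\<exists>N. 16 * exp M < (\<Sum>k<N. 1 / real (Suc k))"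
  proof (rule ccontr)
    assume "\<not> ?thesis"
    then have "\<And>N. (\<Sum>k<N. 1 / real (Suc k)) \<le> 16 * exp M" by (auto simp: not_less)
    then have "summable (\<lambda>k. 1 / real (Suc k))"
      by (intro summableI_nonneg_bounded[of _ "16 * exp M"]) auto
    then have "summable (\<lambda>k. 1 / real k)" by (subst (asm) summable_Suc_iff)
    then show False using not_summable_harmonic[where 'a = real] by (simp add: inverse_eq_divide)
  qed
  then obtain N where N: "16 * exp M < (\<Sum>k<N. 1 / real (Suc k))" by blast
  have N0: "0 < N" using N by (cases N) (auto simp: not_less)
  define F where "F q = (\<Sum>k<N. real (Suc k) powr q * real (k + 2) powr (- (2 * t)))" for q
  have Fc: "isCont F (2 * t - 1)"
    unfolding F_def by (intro continuous_intros) auto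
  have "(\<Sum>k<N. 1 / real (Suc k)) / 16 \<le> F (2 * t - 1)"
  proof -
    have "1 / real (Suc k) / 16 \<le> real (Suc k) powr (2 * t - 1) * real (k + 2) powr (- (2 * t))" for k
    proof -
      have "(1 / 16 :: real) = 2 powr (- 4)" by (simp add: powr_minus powr_numeral)
      also have "\<dots> \<le> 2 powr (- (2 * t))" using assms by (intro powr_mono) auto
      finally have "1 / real (Suc k) * (1 / 16) \<le> 1 / real (Suc k) * 2 powr (- (2 * t))"
        by (intro mult_left_mono) auto
      also have "1 / real (Suc k) = real (Suc k) powr (- 1)" by (simp add: powr_minus divide_simps)
      also have "\<dots> * 2 powr (- (2 * t)) = real (Suc k) powr (2 * t - 1) * (2 * real (Suc k)) powr (- (2 * t))"
      proof -
        have "(2 * real (Suc k)) powr (- (2 * t)) = 2 powr (- (2 * t)) * real (Suc k) powr (- (2 * t))"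
          by (rule powr_mult)
        moreover have "real (Suc k) powr (- 1) = real (Suc k) powr (2 * t - 1) * real (Suc k) powr (- (2 * t))"
          by (simp only: powr_add[symmetric]) simp
        ultimately show ?thesis by (simp only: mult_ac)
      qed
      also have "\<dots> \<le> real (Suc k) powr (2 * t - 1) * real (k + 2) powr (- (2 * t))"
        using assms by (intro mult_left_mono powr_mono2') auto
      finally show ?thesis by simp
    qed
    then show ?thesis unfolding F_def sum_divide_distrib by (intro sum_mono)
  qed
  then have "exp M < F (2 * t - 1)" using N by simp
  then have "eventually (\<lambda>q. exp M < F q) (at (2 * t - 1))"
    using Fc by (intro order_tendstoD(1)) (auto simp: isCont_def)
  then have "eventually (\<lambda>q. exp M < F q) (at_left (2 * t - 1))"
    by (rule eventually_at_leftI[OF _ ] | simp add: eventually_at_split)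
  moreover have "eventually (\<lambda>q. q < 2 * t - 1) (at_left (2 * t - 1))"
    by (simp add: eventually_at_filter)
  ultimately show ?thesis
  proof eventually_elim
    case (elim q)
    then have g: "gibbs t q" using assms by (simp add: gibbs_def)
    have "M = ln (exp M)" by simp
    also have "\<dots> < ln (F q)" using elim by (simp only: ln_less_cancel_iff exp_gt_zero less_trans[OF exp_gt_zero])
    also have "\<dots> \<le> pressure t q" unfolding F_def by (rule gibbs.pressure_ge_sum[OF g N0])
    finally show ?case .
  qed
qed

text \<open>At \<open>t = 0\<close> constants are eigenfunctions and the pressure is the logarithm
  of the zeta series at \<open>- q\<close>, which tends to 0 as \<open>q\<close> tends to minus
  infinity. Moving to \<open>t\<close> lowers it by at least \<open>t * ln 2\<close>.\<close>

lemma pressure_negative: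
  assumes "0 < t" "t \<le> 2"
  obtains q where "q < - 2" "pressure t q < 0"
proof -
  define S where "S = (\<Sum>k. real (Suc k) powr (- 2))"
  have sS: "summable (\<lambda>k. real (Suc k) powr (- 2))"
    by (subst summable_Suc_iff) (simp add: summable_real_powr_iff)
  have S: "0 \<le> S" unfolding S_def by (rule suminf_nonneg[OF sS]) simp
  have bound: "pressure t q \<le> 2 powr (q + 2) * S - t * ln 2" if q: "q < - 2" for q
  proof -
    have g: "gibbs 0 q" using q by (simp add: gibbs_def)
    define Z where "Z = (\<Sum>k. real (Suc k) powr q)"
    have sq: "summable (\<lambda>k. real (Suc k) powr q)"
      using q by (subst summable_Suc_iff) (simp add: summable_real_powr_iff)
    have tr: "transfer 0 q (\<lambda>_. 1) x = Z * 1" if "x \<in> {0..1}" for x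
    proof -
      have "branch k x \<noteq> 0" for k using branch_pos[of x k] that by auto
      then show ?thesis by (simp add: transfer_def wt_def Z_def)
    qed
    have "(\<Sum>k\<in>{0}. real (Suc k) powr q) \<le> Z"
      unfolding Z_def by (rule sum_le_suminf[OF sq]) auto
    then have Z1: "1 \<le> Z" by simp
    have P0: "pressure 0 q = ln Z"
      by (rule gibbs.pressure_eq_ln[OF g cone_const _ tr]) (use Z1 in auto)
    have "Z = 1 + (\<Sum>k. real (Suc (Suc k)) powr q)"
      using suminf_split_head[OF sq] by (simp add: Z_def)
    also have "(\<Sum>k. real (Suc (Suc k)) powr q) \<le> (\<Sum>k. 2 powr (q + 2) * real (Suc (Suc k)) powr (- 2))"
    proof (rule suminf_le)
      fix k
      have "real (Suc (Suc k)) powr q = real (Suc (Suc k)) powr (q + 2) * real (Suc (Suc k)) powr (- 2)"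
        by (simp add: powr_add[symmetric])
      also have "\<dots> \<le> 2 powr (q + 2) * real (Suc (Suc k)) powr (- 2)"
        using q by (intro mult_right_mono powr_mono2') auto
      finally show "real (Suc (Suc k)) powr q \<le> 2 powr (q + 2) * real (Suc (Suc k)) powr (- 2)" .
    qed (use sq sS in \<open>auto intro!: summable_mult simp: summable_Suc_iff[of "\<lambda>k. real (Suc k) powr a" for a] simp del: of_nat_Suc\<close>)
    also have "\<dots> = 2 powr (q + 2) * (\<Sum>k. real (Suc (Suc k)) powr (- 2))"
      using sS by (intro suminf_mult) (simp add: summable_Suc_iff[of "\<lambda>k. real (Suc k) powr a" for a] del: of_nat_Suc)
    also have "\<dots> \<le> 2 powr (q + 2) * S"
      using suminf_split_head[OF sS] by (intro mult_left_mono) (auto simp: S_def)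
    finally have "Z \<le> 1 + 2 powr (q + 2) * S" by simp
    moreover have "ln Z \<le> Z - 1" using Z1 by (intro ln_le_minus_one) auto
    ultimately show ?thesis
      using pressure_decreasing[OF g, of t] assms P0 by simp
  qed
  have "((\<lambda>q::real. 2 powr (q + 2) * S) \<longlongrightarrow> 0) at_bot"
    by real_asymp
  then have "eventually (\<lambda>q. 2 powr (q + 2) * S < t * ln 2) at_bot"
    by (rule order_tendstoD(2)) (use assms in auto)
  moreover have "eventually (\<lambda>q::real. q < - 2) at_bot" by (rule eventually_gt_at_bot)
  ultimately have "eventually (\<lambda>q. q < - 2 \<and> 2 powr (q + 2) * S < t * ln 2) at_bot"
    by eventually_elim auto
  then obtain q where q: "q < - 2" "2 powr (q + 2) * S < t * ln 2"
    using eventually_happens[of _ "at_bot :: real filter"] by auto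
  then show ?thesis using that bound[OF q(1)] by force
qed

section \<open>Complex perturbations of an averaging operator\<close>

definition kappa :: real where "kappa = (1 / 2) ^ 48 / 16"

lemma kappa: "0 < kappa" "kappa \<le> 1 / 16" "theta = 1 - 4 * kappa"
  by (simp_all add: kappa_def theta_def power_one_over)

lemma kappa_le: "kappa * kappa \<le> kappa / 16"
  using mult_left_mono[OF kappa(2), of kappa] kappa(1) by simp

lemma lip_mono: "lip A \<phi> \<Longrightarrow> A \<le> B \<Longrightarrow> lip B \<phi>"
  unfolding lip_def by (meson mult_right_mono order_trans rho_nonneg)

lemma lip_add:
  assumes "lip A \<phi>" "lip B \<psi>" shows "lip (A + B) (\<lambda>x. \<phi> x + \<psi> x)"
  unfolding lip_def
proof (intro ballI)
  fix x y :: real assume xy: "x \<in> {0..1}" "y \<in> {0..1}"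
  have "\<phi> x + \<psi> x - (\<phi> y + \<psi> y) = (\<phi> x - \<phi> y) + (\<psi> x - \<psi> y)" by simp
  then have "norm (\<phi> x + \<psi> x - (\<phi> y + \<psi> y)) \<le> norm (\<phi> x - \<phi> y) + norm (\<psi> x - \<psi> y)"
    by (metis norm_triangle_ineq)
  then show "norm (\<phi> x + \<psi> x - (\<phi> y + \<psi> y)) \<le> (A + B) * rho x y"
    using lipD[OF assms(1) xy] lipD[OF assms(2) xy] by (simp add: distrib_right)
qed

lemma lip_cmult:
  fixes \<phi> :: "real \<Rightarrow> complex"
  assumes "lip A \<phi>" shows "lip (cmod c * A) (\<lambda>x. c * \<phi> x)"
  unfolding lip_def
proof (intro ballI)
  fix x y :: real assume xy: "x \<in> {0..1}" "y \<in> {0..1}"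
  show "norm (c * \<phi> x - c * \<phi> y) \<le> cmod c * A * rho x y"
    using mult_left_mono[OF lipD[OF assms xy], of "cmod c"]
    by (simp add: norm_mult mult.assoc flip: right_diff_distrib)
qed

text \<open>The kernel \<open>p + r\<close> need not be a probability kernel. Its operator is renormalised by the value at
  \<open>0\<close>, and \<open>eigval\<close> is the resulting normalising factor.\<close>
locale perturbed =
  fixes p :: "nat \<Rightarrow> real \<Rightarrow> real" and r :: "nat \<Rightarrow> real \<Rightarrow> complex" and V :: "nat \<Rightarrow> real" and \<epsilon> :: real
  assumes K: "markov_kernel p" and V: "V sums \<epsilon>" and eps: "\<epsilon> \<le> kappa * kappa / 2"
    and r_bound: "x \<in> {0..1} \<Longrightarrow> cmod (r k x) \<le> V k"
    and r_lip: "x \<in> {0..1} \<Longrightarrow> y \<in> {0..1} \<Longrightarrow> cmod (r k x - r k y) \<le> V k * rho x y"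
begin

definition pavg :: "(real \<Rightarrow> complex) \<Rightarrow> real \<Rightarrow> complex" where
  "pavg \<phi> x = (\<Sum>k. (of_real (p k x) + r k x) * \<phi> (branch k x))"

definition ravg :: "(real \<Rightarrow> complex) \<Rightarrow> real \<Rightarrow> complex" where
  "ravg \<phi> x = (\<Sum>k. r k x * \<phi> (branch k x))"

lemma V_nonneg: "0 \<le> V k"
  using r_bound[of 0 k] norm_ge_zero[of "r k 0"] by (simp del: norm_ge_zero)

lemma eps_nonneg: "0 \<le> \<epsilon>"
  using V_nonneg sums_le[OF _ sums_zero V] by simp

lemma eps_le: "\<epsilon> \<le> 1 / 16" "\<epsilon> \<le> kappa / 16"
  using eps kappa_le kappa by linarith+

lemma ravg_summable:
  assumes "x \<in> {0..1}" "\<And>u. u \<in> {0..1} \<Longrightarrow> cmod (\<phi> u) \<le> b"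
  shows "summable (\<lambda>k. r k x * \<phi> (branch k x))" "cmod (ravg \<phi> x) \<le> \<epsilon> * b"
proof -
  have t: "cmod (r k x * \<phi> (branch k x)) \<le> V k * b" for k
    unfolding norm_mult using r_bound[OF assms(1)] assms(2)[OF branch_in[OF assms(1)]] V_nonneg
    by (intro mult_mono) auto
  have s: "(\<lambda>k. V k * b) sums (\<epsilon> * b)" using V by (rule sums_mult2)
  show "summable (\<lambda>k. r k x * \<phi> (branch k x))"
    by (rule summable_comparison_test'[OF sums_summable[OF s]]) (use t in auto)
  show "cmod (ravg \<phi> x) \<le> \<epsilon> * b"
    unfolding ravg_def using norm_suminf_le[OF t sums_summable[OF s]] s by (simp add: sums_iff)
qed

lemma ravg_lip:
  assumes "\<And>u. u \<in> {0..1} \<Longrightarrow> cmod (\<phi> u) \<le> b" "lip A \<phi>"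
  shows "lip (\<epsilon> * (b + A)) (ravg \<phi>)"
  unfolding lip_def
proof (intro ballI)
  fix x y :: real assume x: "x \<in> {0..1}" and y: "y \<in> {0..1}"
  have A: "0 \<le> A" using lip_nonneg[OF assms(2)] .
  have t: "cmod (r k x * \<phi> (branch k x) - r k y * \<phi> (branch k y)) \<le> V k * ((b + A) * rho x y)" for k
  proof -
    have "cmod (\<phi> (branch k x) - \<phi> (branch k y)) \<le> A * rho (branch k x) (branch k y)"
      by (rule lipD[OF assms(2) branch_in[OF x] branch_in[OF y]])
    also have "\<dots> \<le> A * rho x y" using rho_branch_le[OF x y] A by (intro mult_left_mono) auto
    finally have 1: "cmod (\<phi> (branch k x) - \<phi> (branch k y)) \<le> A * rho x y" .
    have "r k x * \<phi> (branch k x) - r k y * \<phi> (branch k y) =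
      (r k x - r k y) * \<phi> (branch k x) + r k y * (\<phi> (branch k x) - \<phi> (branch k y))"
      by (simp add: algebra_simps)
    also have "cmod \<dots> \<le> cmod (r k x - r k y) * cmod (\<phi> (branch k x)) + cmod (r k y) * cmod (\<phi> (branch k x) - \<phi> (branch k y))"
      by (metis norm_mult norm_triangle_ineq)
    also have "\<dots> \<le> (V k * rho x y) * b + V k * (A * rho x y)"
      using r_lip[OF x y] r_bound[OF y] assms(1)[OF branch_in[OF x]] 1 V_nonneg
      by (intro add_mono mult_mono) auto
    finally show ?thesis by (simp add: algebra_simps)
  qed
  have s: "(\<lambda>k. V k * ((b + A) * rho x y)) sums (\<epsilon> * ((b + A) * rho x y))" using V by (rule sums_mult2)
  have "ravg \<phi> x - ravg \<phi> y = (\<Sum>k. r k x * \<phi> (branch k x) - r k y * \<phi> (branch k y))"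
    unfolding ravg_def by (rule suminf_diff[OF ravg_summable(1)[OF x] ravg_summable(1)[OF y]]) (use assms in auto)
  also have "cmod \<dots> \<le> \<epsilon> * ((b + A) * rho x y)"
    using norm_suminf_le[OF t sums_summable[OF s]] s by (simp add: sums_iff)
  finally show "cmod (ravg \<phi> x - ravg \<phi> y) \<le> \<epsilon> * (b + A) * rho x y" by (simp add: mult_ac)
qed

lemma pavg_sums:
  assumes x: "x \<in> {0..1}" and b: "\<And>u. u \<in> {0..1} \<Longrightarrow> cmod (\<phi> u) \<le> b"
  shows "(\<lambda>k. (of_real (p k x) + r k x) * \<phi> (branch k x)) sums pavg \<phi> x"
    "pavg \<phi> x = avg p \<phi> x + ravg \<phi> x"
proof -
  have "(\<lambda>k. p k x *\<^sub>R \<phi> (branch k x) + r k x * \<phi> (branch k x)) sums (avg p \<phi> x + ravg \<phi> x)"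
    unfolding avg_def ravg_def
    by (intro sums_add summable_sums avg_summable(1)[of p x \<phi> b, OF K x b] ravg_summable(1)[OF x, of \<phi> b, OF b])
  then have *: "(\<lambda>k. (of_real (p k x) + r k x) * \<phi> (branch k x)) sums (avg p \<phi> x + ravg \<phi> x)"
    by (simp add: scaleR_conv_of_real distrib_right)
  then show "pavg \<phi> x = avg p \<phi> x + ravg \<phi> x" by (simp add: pavg_def sums_iff)
  with * show "(\<lambda>k. (of_real (p k x) + r k x) * \<phi> (branch k x)) sums pavg \<phi> x" by simp
qed

lemma pavg_bound:
  assumes x: "x \<in> {0..1}" and b: "\<And>u. u \<in> {0..1} \<Longrightarrow> cmod (\<phi> u) \<le> b"
  shows "cmod (pavg \<phi> x) \<le> 2 * b"
proof -
  have b0: "0 \<le> b" using b[of 0] norm_ge_zero[of "\<phi> 0"] by (simp del: norm_ge_zero)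
  have "cmod (pavg \<phi> x) \<le> cmod (avg p \<phi> x) + cmod (ravg \<phi> x)"
    using norm_triangle_ineq[of "avg p \<phi> x" "ravg \<phi> x"] pavg_sums(2)[OF x b] by simp
  also have "\<dots> \<le> b + \<epsilon> * b"
    using avg_summable(2)[of p x \<phi> b, OF K x b] ravg_summable(2)[OF x, of \<phi> b, OF b] by (rule add_mono)
  also have "\<dots> \<le> b + 1 * b" using eps_le b0 by (intro add_left_mono mult_right_mono) auto
  finally show ?thesis by simp
qed

lemma pavg_lip:
  assumes b: "\<And>u. u \<in> {0..1} \<Longrightarrow> cmod (\<phi> u) \<le> b" and L: "lip A \<phi>"
  shows "lip (theta * A + \<epsilon> * (b + A)) (pavg \<phi>)"
proof -
  have "pavg \<phi> x = avg p \<phi> x + ravg \<phi> x" if "x \<in> {0..1}" for x by (rule pavg_sums(2)[OF that b])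
  then show ?thesis
    using lip_add[OF lip_avg[OF K L] ravg_lip[of \<phi> b, OF b L]] by (simp add: lip_def)
qed

lemma pavg_diff:
  assumes x: "x \<in> {0..1}" and "\<And>u. u \<in> {0..1} \<Longrightarrow> cmod (\<phi> u) \<le> a" "\<And>u. u \<in> {0..1} \<Longrightarrow> cmod (\<psi> u) \<le> b"
  shows "pavg (\<lambda>u. \<phi> u - \<psi> u) x = pavg \<phi> x - pavg \<psi> x"
  using sums_diff[OF pavg_sums(1)[OF x, of \<phi> a] pavg_sums(1)[OF x, of \<psi> b]] assms
  by (simp add: pavg_def[of "\<lambda>u. \<phi> u - \<psi> u"] sums_iff right_diff_distrib)

text \<open>A ball of radius \<open>kappa\<close> around the constant 1, the exact eigenfunction of
  the unperturbed probability kernel.\<close>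

definition admissible :: "(real \<Rightarrow> complex) \<Rightarrow> bool" where
  "admissible \<phi> \<longleftrightarrow> \<phi> 0 = 1 \<and> lip kappa \<phi>"

lemma admissibleD:
  assumes "admissible \<phi>"
  shows "\<phi> 0 = 1" "lip kappa \<phi>" "u \<in> {0..1} \<Longrightarrow> cmod (\<phi> u - 1) \<le> kappa"
    "u \<in> {0..1} \<Longrightarrow> cmod (\<phi> u) \<le> 1 + kappa" "u \<in> {0..1} \<Longrightarrow> cmod (\<phi> u) \<le> 2"
proof -
  show *: "\<phi> 0 = 1" "lip kappa \<phi>" using assms by (auto simp: admissible_def)
  show "cmod (\<phi> u - 1) \<le> kappa" if "u \<in> {0..1}" using lip_osc[OF *(2) that, of 0] *(1) by simp
  show "cmod (\<phi> u) \<le> 1 + kappa" if "u \<in> {0..1}" using lip_bounded[OF *(2) that] *(1) by simp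
  then show "cmod (\<phi> u) \<le> 2" if "u \<in> {0..1}" using that kappa(2) by simp
qed

lemma pavg_0:
  assumes "admissible \<phi>"
  shows "cmod (pavg \<phi> 0 - 1) \<le> kappa + kappa * kappa" "1 - kappa - kappa * kappa \<le> cmod (pavg \<phi> 0)"
    "pavg \<phi> 0 \<noteq> 0"
proof -
  note a = admissibleD[OF assms]
  have "cmod (pavg \<phi> 0 - 1) = cmod ((avg p \<phi> 0 - 1) + ravg \<phi> 0)"
    using pavg_sums(2)[of 0 \<phi> 2, OF _ a(5)] by (simp add: algebra_simps)
  also have "\<dots> \<le> cmod (avg p \<phi> 0 - 1) + cmod (ravg \<phi> 0)" by (rule norm_triangle_ineq)
  also have "\<dots> \<le> kappa + \<epsilon> * 2"
    using avg_diff_const[of p 0 \<phi> 2 1 kappa, OF K _ a(5) a(3)] ravg_summable(2)[of 0 \<phi> 2, OF _ a(5)]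
    by (intro add_mono) auto
  finally show 1: "cmod (pavg \<phi> 0 - 1) \<le> kappa + kappa * kappa" using eps by simp
  have "cmod 1 \<le> cmod (pavg \<phi> 0) + cmod (pavg \<phi> 0 - 1)"
    by (metis add.commute norm_minus_commute norm_triangle_sub)
  then show 2: "1 - kappa - kappa * kappa \<le> cmod (pavg \<phi> 0)" using 1 by simp
  show "pavg \<phi> 0 \<noteq> 0" 
  proof
    assume "pavg \<phi> 0 = 0"
    then have "1 - kappa - kappa * kappa \<le> 0" using 2 by simp
    then show False using kappa kappa_le by linarith
  qed
qed

definition normalized :: "(real \<Rightarrow> complex) \<Rightarrow> real \<Rightarrow> complex" where
  "normalized \<phi> x = pavg \<phi> x / pavg \<phi> 0"

lemma lip_over_pavg:
  assumes "admissible \<phi>" "lip A \<psi>" "A \<le> B * (1 - kappa - kappa * kappa)" "0 \<le> B"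
  shows "lip B (\<lambda>x. \<psi> x / pavg \<phi> 0)"
proof -
  have "lip (cmod (1 / pavg \<phi> 0) * A) (\<lambda>x. (1 / pavg \<phi> 0) * \<psi> x)" by (rule lip_cmult[OF assms(2)])
  moreover have "cmod (1 / pavg \<phi> 0) * A \<le> B"
  proof -
    have "A \<le> B * cmod (pavg \<phi> 0)"
      using assms(3) mult_left_mono[OF pavg_0(2)[OF assms(1)] assms(4)] by simp
    then show ?thesis using pavg_0(3)[OF assms(1)] by (simp add: norm_divide field_simps)
  qed
  ultimately have "lip B (\<lambda>x. (1 / pavg \<phi> 0) * \<psi> x)" by (rule lip_mono)
  then show ?thesis by simp
qed

text \<open>The seminorm of \<open>pavg \<phi>\<close> is at most
  \<open>kappa - 4 * kappa\<^sup>2 + 3/2 * kappa\<^sup>2\<close>, the gap being in the second term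
  and the perturbation in the third. Division by \<open>pavg \<phi> 0\<close>, of modulus at least
  \<open>1 - kappa - kappa\<^sup>2\<close>, leaves at most \<open>kappa\<close>.\<close>

lemma admissible_normalized:
  assumes "admissible \<phi>" shows "admissible (normalized \<phi>)"
proof -
  note a = admissibleD[OF assms]
  have L: "lip (theta * kappa + \<epsilon> * (2 + kappa)) (pavg \<phi>)" by (rule pavg_lip[OF a(5) a(2)])
  have "\<epsilon> * (2 + kappa) \<le> kappa * kappa / 2 * 3"
    using eps eps_nonneg kappa by (intro mult_mono) auto
  then have "theta * kappa + \<epsilon> * (2 + kappa) \<le> kappa - 2.5 * (kappa * kappa)"
    unfolding kappa(3) by (simp add: algebra_simps)
  also have "\<dots> \<le> kappa * (1 - kappa - kappa * kappa)"
  proof -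
    have "kappa * (kappa * kappa) \<le> kappa * (kappa * 1)" using kappa by (intro mult_left_mono) auto
    moreover have "0 \<le> kappa * kappa" using kappa by simp
    ultimately show ?thesis unfolding right_diff_distrib mult_1_right by linarith
  qed
  finally have "lip kappa (normalized \<phi>)"
    unfolding normalized_def[abs_def] using kappa(1) by (intro lip_over_pavg[OF assms L]) auto
  then show ?thesis using pavg_0(3)[OF assms] by (simp add: admissible_def normalized_def)
qed

text \<open>As the difference \<open>\<Delta>\<close> vanishes at 0, it is bounded by its seminorm,
  and its image contracts by \<open>1 - 4 * kappa\<close> up to second order. Changing the
  normalising factor costs \<open>2 * kappa\<close>, because \<open>normalized \<psi>\<close> has
  seminorm \<open>kappa\<close>, and the division costs another \<open>kappa\<close>. A gain of
  \<open>kappa / 2\<close> survives.\<close>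

lemma normalized_contraction:
  assumes \<phi>: "admissible \<phi>" and \<psi>: "admissible \<psi>" and D: "lip A (\<lambda>x. \<phi> x - \<psi> x)"
  shows "lip ((1 - kappa / 2) * A) (\<lambda>x. normalized \<phi> x - normalized \<psi> x)"
proof -
  note a = admissibleD[OF \<phi>] and b = admissibleD[OF \<psi>]
  define \<Delta> where "\<Delta> x = \<phi> x - \<psi> x" for x
  have A: "0 \<le> A" using lip_nonneg[OF D] .
  have D': "lip A \<Delta>" using D by (simp add: \<Delta>_def[abs_def])
  have DA: "cmod (\<Delta> u) \<le> A" if "u \<in> {0..1}" for u
    using lip_bounded[OF D' that] a(1) b(1) by (simp add: \<Delta>_def)
  have pd: "pavg \<Delta> x = pavg \<phi> x - pavg \<psi> x" if "x \<in> {0..1}" for x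
    unfolding \<Delta>_def[abs_def] by (rule pavg_diff[OF that a(5) b(5)])
  define c where "c = - pavg \<Delta> 0"
  have c: "cmod c \<le> 2 * A" unfolding c_def norm_minus_cancel by (rule pavg_bound[OF _ DA]) auto
  have e: "normalized \<phi> x - normalized \<psi> x = (pavg \<Delta> x + c * normalized \<psi> x) / pavg \<phi> 0" if "x \<in> {0..1}" for x
  proof -
    have "pavg \<Delta> 0 = pavg \<phi> 0 - pavg \<psi> 0" by (rule pd) simp
    then show ?thesis using pavg_0(3)[OF \<phi>] pavg_0(3)[OF \<psi>]
      by (simp add: normalized_def c_def pd[OF that] divide_simps) (simp add: algebra_simps)
  qed
  have kl: "0 \<le> kappa * kappa" using kappa by simp
  have 1: "lip (theta * A + \<epsilon> * (A + A)) (pavg \<Delta>)" by (rule pavg_lip[OF DA D'])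
  have 2: "lip (cmod c * kappa) (\<lambda>x. c * normalized \<psi> x)"
    by (rule lip_cmult[OF admissibleD(2)[OF admissible_normalized[OF \<psi>]]])
  have "theta * A + \<epsilon> * (A + A) + cmod c * kappa \<le> A * (1 - 4 * kappa + kappa * kappa + 2 * kappa)"
  proof -
    have "\<epsilon> * (A + A) \<le> kappa * kappa / 2 * (A + A)" using eps A by (intro mult_right_mono) auto
    moreover have "cmod c * kappa \<le> 2 * A * kappa" using c kappa by (intro mult_right_mono) auto
    ultimately show ?thesis unfolding kappa(3) by (simp add: algebra_simps)
  qed
  also have "\<dots> \<le> A * ((1 - kappa / 2) * (1 - kappa - kappa * kappa))"
  proof (intro mult_left_mono A)
    have "0 \<le> kappa * (kappa * kappa)" using kappa by simp
    then show "1 - 4 * kappa + kappa * kappa + 2 * kappa \<le> (1 - kappa / 2) * (1 - kappa - kappa * kappa)"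
    proof -
      have "(1 - kappa / 2) * (1 - kappa - kappa * kappa) =
          1 - 3 / 2 * kappa - kappa * kappa / 2 + kappa * (kappa * kappa) / 2"
        by (simp add: field_simps)
      then show ?thesis using kappa_le kappa(1) kl \<open>0 \<le> kappa * (kappa * kappa)\<close> by linarith
    qed
  qed
  finally have "lip ((1 - kappa / 2) * A) (\<lambda>x. (pavg \<Delta> x + c * normalized \<psi> x) / pavg \<phi> 0)"
    using kappa A by (intro lip_over_pavg[OF \<phi> lip_add[OF 1 2]]) (auto simp: mult_ac)
  then show ?thesis unfolding lip_def using e by simp
qed

definition approx :: "nat \<Rightarrow> real \<Rightarrow> complex" where
  "approx n = (normalized ^^ n) (\<lambda>_. 1)"

lemma approx_Suc: "approx (Suc n) = normalized (approx n)"
  by (simp add: approx_def)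

lemma admissible_approx: "admissible (approx n)"
proof (induction n)
  case 0
  show ?case using kappa by (simp add: approx_def admissible_def lip_def)
next
  case (Suc n) then show ?case unfolding approx_Suc by (rule admissible_normalized)
qed

lemma approx_step: "lip (2 * kappa * (1 - kappa / 2) ^ n) (\<lambda>x. approx (Suc n) x - approx n x)"
proof (induction n)
  case 0
  have "lip (kappa + cmod (-1) * kappa) (\<lambda>x. approx 1 x + (-1) * approx 0 x)"
    by (intro lip_add lip_cmult admissibleD(2)[OF admissible_approx])
  then show ?case by simp
next
  case (Suc n)
  then show ?case
    using normalized_contraction[OF admissible_approx admissible_approx Suc]
    by (simp add: approx_Suc mult_ac)
qed

definition eigfun :: "real \<Rightarrow> complex" where
  "eigfun x = lim (\<lambda>n. approx n x)"

definition eigval :: complex where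
  "eigval = pavg eigfun 0"

text \<open>The rate depends on \<open>kappa\<close> alone, hence is the same for all perturbations;
  this makes the limits uniform in the complex parameters.\<close>

definition rate :: "nat \<Rightarrow> real" where
  "rate n = 2 * kappa * (1 - kappa / 2) ^ n / (1 - (1 - kappa / 2))"

lemma rate_tendsto_0: "rate \<longlonglongrightarrow> 0"
proof -
  have "(\<lambda>n. 2 * kappa * (1 - kappa / 2) ^ n / (1 - (1 - kappa / 2))) \<longlonglongrightarrow> 2 * kappa * 0 / (1 - (1 - kappa / 2))"
    using kappa by (intro tendsto_intros LIMSEQ_realpow_zero) auto
  then show ?thesis by (simp add: rate_def[abs_def])
qed

lemma approx_tendsto:
  assumes x: "x \<in> {0..1}"
  shows "(\<lambda>n. approx n x) \<longlonglongrightarrow> eigfun x" "cmod (approx n x - eigfun x) \<le> rate n"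
proof -
  have st: "cmod (approx (Suc n) x - approx n x) \<le> 2 * kappa * (1 - kappa / 2) ^ n" for n
    using lip_osc[OF approx_step x, of 0 n] admissibleD(1)[OF admissible_approx] by simp
  have c: "0 \<le> 1 - kappa / 2" "1 - kappa / 2 < 1" using kappa by auto
  obtain l where l: "(\<lambda>n. approx n x) \<longlonglongrightarrow> l" "\<And>n. cmod (approx n x - l) \<le> rate n"
    unfolding rate_def by (rule geometric_limit[of "\<lambda>n. approx n x", OF st c]) blast
  then have "eigfun x = l" unfolding eigfun_def by (intro limI)
  with l show "(\<lambda>n. approx n x) \<longlonglongrightarrow> eigfun x" "cmod (approx n x - eigfun x) \<le> rate n" by auto
qed

lemma admissible_eigfun: "admissible eigfun"
proof -
  have "eigfun 0 = 1"
    using approx_tendsto(1)[of 0] admissibleD(1)[OF admissible_approx] by (simp add: LIMSEQ_const_iff)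
  moreover have "lip kappa eigfun" unfolding lip_def
  proof (intro ballI)
    fix x y :: real assume x: "x \<in> {0..1}" and y: "y \<in> {0..1}"
    have "(\<lambda>n. cmod (approx n x - approx n y)) \<longlonglongrightarrow> cmod (eigfun x - eigfun y)"
      by (intro tendsto_intros approx_tendsto x y)
    then show "cmod (eigfun x - eigfun y) \<le> kappa * rho x y"
      by (rule LIMSEQ_le_const2) (use lipD[OF admissibleD(2)[OF admissible_approx] x y] in auto)
  qed
  ultimately show ?thesis by (simp add: admissible_def)
qed

lemma pavg_approx_tendsto:
  assumes x: "x \<in> {0..1}"
  shows "(\<lambda>n. pavg (approx n) x) \<longlonglongrightarrow> pavg eigfun x" 
    and "cmod (pavg (approx n) x - pavg eigfun x) \<le> 2 * rate n"
proof -
  show b: "cmod (pavg (approx n) x - pavg eigfun x) \<le> 2 * rate n" for n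
    using pavg_bound[OF x, of "\<lambda>u. approx n u - eigfun u" "rate n"] approx_tendsto(2)
      pavg_diff[OF x admissibleD(5)[OF admissible_approx] admissibleD(5)[OF admissible_eigfun]] by simp
  have "(\<lambda>n. 2 * rate n) \<longlonglongrightarrow> 2 * 0" by (intro tendsto_intros rate_tendsto_0)
  then have "(\<lambda>n. pavg (approx n) x - pavg eigfun x) \<longlonglongrightarrow> 0"
    by (intro Lim_null_comparison[OF always_eventually[OF allI[OF b]]]) simp
  then show "(\<lambda>n. pavg (approx n) x) \<longlonglongrightarrow> pavg eigfun x" by (rule LIM_zero_cancel)
qed

lemma eigen_equation:
  assumes x: "x \<in> {0..1}" shows "pavg eigfun x = eigval * eigfun x"
proof -
  have "(\<lambda>n. approx (Suc n) x * pavg (approx n) 0) \<longlonglongrightarrow> eigfun x * eigval"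
    unfolding eigval_def by (intro tendsto_mult LIMSEQ_Suc approx_tendsto x pavg_approx_tendsto) auto
  moreover have "approx (Suc n) x * pavg (approx n) 0 = pavg (approx n) x" for n
    using pavg_0(3)[OF admissible_approx] by (simp add: approx_Suc normalized_def)
  ultimately show ?thesis using pavg_approx_tendsto(1)[OF x] LIMSEQ_unique
    by (metis (no_types, lifting) ext mult.commute)
qed

lemma eigval_near_1: "cmod (eigval - 1) \<le> 1 / 8"
  using pavg_0(1)[OF admissible_eigfun] kappa kappa_le unfolding eigval_def by linarith

lemma pavg_real:
  assumes "\<And>k x. x \<in> {0..1} \<Longrightarrow> Im (r k x) = 0" "\<And>u. u \<in> {0..1} \<Longrightarrow> Im (\<phi> u) = 0"
    "\<And>u. u \<in> {0..1} \<Longrightarrow> cmod (\<phi> u) \<le> b" "x \<in> {0..1}"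
  shows "Im (pavg \<phi> x) = 0"
proof -
  have "(\<lambda>k. Im ((of_real (p k x) + r k x) * \<phi> (branch k x))) sums Im (pavg \<phi> x)"
    by (rule sums_Im[OF pavg_sums(1)[of x \<phi> b, OF assms(4,3)]])
  moreover have "Im ((of_real (p k x) + r k x) * \<phi> (branch k x)) = 0" for k
    using assms(1)[OF assms(4), of k] assms(2)[OF branch_in[OF assms(4)], of k] by simp
  ultimately have "(\<lambda>k. 0) sums Im (pavg \<phi> x)" by simp
  then show ?thesis using sums_unique2[OF sums_zero] by metis
qed

text \<open>All iterates of a real kernel starting from the constant 1 are real.\<close>

lemma real_eigen:
  assumes "\<And>k x. x \<in> {0..1} \<Longrightarrow> Im (r k x) = 0"
  shows "x \<in> {0..1} \<Longrightarrow> Im (eigfun x) = 0" "Im eigval = 0"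
proof -
  have a: "Im (approx n x) = 0" if "x \<in> {0..1}" for n x
    using that
  proof (induction n arbitrary: x)
    case 0 then show ?case by (simp add: approx_def)
  next
    case (Suc n)
    have "Im (pavg (approx n) u) = 0" if "u \<in> {0..1}" for u
      by (rule pavg_real[OF assms Suc.IH admissibleD(5)[OF admissible_approx] that])
    from this[OF Suc.prems] this[of 0] show ?case
      by (simp add: approx_Suc normalized_def Im_divide)
  qed
  show e: "Im (eigfun x) = 0" if "x \<in> {0..1}" for x
    using tendsto_Im[OF approx_tendsto(1)[OF that]] a[OF that] by (simp add: LIMSEQ_const_iff)
  show "Im eigval = 0" unfolding eigval_def
    by (rule pavg_real[OF assms e admissibleD(5)[OF admissible_eigfun]]) auto
qed

end

lemma holomorphic_series:
  fixes f :: "nat \<Rightarrow> complex \<Rightarrow> complex"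
  assumes "open S" "\<And>k. f k holomorphic_on S" "\<And>k s. s \<in> S \<Longrightarrow> cmod (f k s) \<le> M k" "summable M"
  shows "(\<lambda>s. \<Sum>k. f k s) holomorphic_on S"
proof -
  have u: "uniform_limit S (\<lambda>n s. \<Sum>k<n. f k s) (\<lambda>s. \<Sum>k. f k s) sequentially"
    by (rule Weierstrass_m_test[OF assms(3,4)])
  show ?thesis
  proof (rule holomorphic_uniform_sequence[OF assms(1)])
    show "(\<lambda>s. \<Sum>k<n. f k s) holomorphic_on S" for n by (intro holomorphic_intros assms)
    fix s assume "s \<in> S"
    then obtain d where "0 < d" "cball s d \<subseteq> S" using assms(1) open_contains_cball by blast
    then show "\<exists>d>0. cball s d \<subseteq> S \<and> uniform_limit (cball s d) (\<lambda>n s. \<Sum>k<n. f k s) (\<lambda>s. \<Sum>k. f k s) sequentially"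
      using uniform_limit_on_subset[OF u] by blast
  qed
qed

text \<open>The iterates are holomorphic in \<open>s\<close> by induction, as uniformly convergent
  series and quotients of such; the common rate carries this over to the limits.\<close>

lemma perturbed_holomorphic:
  fixes r :: "complex \<Rightarrow> nat \<Rightarrow> real \<Rightarrow> complex"
  assumes S: "open S" and P: "\<And>s. s \<in> S \<Longrightarrow> perturbed p (r s) V \<epsilon>"
    and hol: "\<And>k x. x \<in> {0..1} \<Longrightarrow> (\<lambda>s. r s k x) holomorphic_on S"
  shows "x \<in> {0..1} \<Longrightarrow> (\<lambda>s. perturbed.eigfun p (r s) x) holomorphic_on S"
    "(\<lambda>s. perturbed.eigval p (r s)) holomorphic_on S"
proof -
  have step: "(\<lambda>s. perturbed.pavg p (r s) (\<phi> s) x) holomorphic_on S"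
    if x: "x \<in> {0..1}" and \<phi>: "\<And>s u. s \<in> S \<Longrightarrow> u \<in> {0..1} \<Longrightarrow> cmod (\<phi> s u) \<le> 2"
      "\<And>u. u \<in> {0..1} \<Longrightarrow> (\<lambda>s. \<phi> s u) holomorphic_on S" for x \<phi>
  proof (cases "S = {}")
    case False
    then obtain s0 where s0: "s0 \<in> S" by blast
    have K: "markov_kernel p" and V: "summable V"
      using perturbed.K[OF P[OF s0]] perturbed.V[OF P[OF s0]] by (auto simp: sums_iff)
    have "(\<lambda>s. \<Sum>k. (of_real (p k x) + r s k x) * \<phi> s (branch k x)) holomorphic_on S"
    proof (rule holomorphic_series[OF S])
      show "(\<lambda>s. (of_real (p k x) + r s k x) * \<phi> s (branch k x)) holomorphic_on S" for k
        by (intro holomorphic_intros hol x \<phi>(2) branch_in)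
      show "summable (\<lambda>k. (p k x + V k) * 2)"
        by (intro summable_mult2 summable_add V markov_kernelD(3)[OF K x])
      fix k s assume s: "s \<in> S"
      have "cmod (of_real (p k x) + r s k x) \<le> p k x + V k"
        using perturbed.r_bound[OF P[OF s] x, of k] markov_kernelD(1)[OF K x, of k]
          norm_triangle_ineq[of "complex_of_real (p k x)" "r s k x"] by simp
      then show "cmod ((of_real (p k x) + r s k x) * \<phi> s (branch k x)) \<le> (p k x + V k) * 2"
        unfolding norm_mult using \<phi>(1)[OF s branch_in[OF x], of k]
        by (intro mult_mono) (auto intro: order_trans[OF norm_ge_zero])
    qed
    then show ?thesis
      by (rule holomorphic_transform) (simp add: perturbed.pavg_def[OF P])
  qed (simp add: holomorphic_on_def)
  have ap: "(\<lambda>s. perturbed.approx p (r s) n x) holomorphic_on S" if "x \<in> {0..1}" for n x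
    using that
  proof (induction n arbitrary: x)
    case 0
    have "(\<lambda>s. 1) holomorphic_on S" by simp
    then show ?case by (rule holomorphic_transform) (simp add: perturbed.approx_def[OF P])
  next
    case (Suc n)
    have h: "(\<lambda>s. perturbed.pavg p (r s) (perturbed.approx p (r s) n) u) holomorphic_on S" if "u \<in> {0..1}" for u
      by (rule step[OF that _ Suc.IH])
         (use perturbed.admissibleD(5)[OF P perturbed.admissible_approx[OF P]] in auto)
    have "(\<lambda>s. perturbed.pavg p (r s) (perturbed.approx p (r s) n) x / perturbed.pavg p (r s) (perturbed.approx p (r s) n) 0) holomorphic_on S"
      by (intro holomorphic_intros h Suc.prems) (use perturbed.pavg_0(3)[OF P perturbed.admissible_approx[OF P]] in auto)
    then show ?case
      by (rule holomorphic_transform) (simp add: perturbed.approx_Suc[OF P] perturbed.normalized_def[OF P])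
  qed
  show ef: "(\<lambda>s. perturbed.eigfun p (r s) x) holomorphic_on S" if x: "x \<in> {0..1}" for x
  proof (rule holomorphic_uniform_sequence[OF S ap[OF x]])
    fix s assume "s \<in> S"
    then obtain d where d: "0 < d" "cball s d \<subseteq> S" using S open_contains_cball by blast
    have "uniform_limit (cball s d) (\<lambda>n s. perturbed.approx p (r s) n x) (\<lambda>s. perturbed.eigfun p (r s) x) sequentially"
    proof (rule uniform_limitI)
      fix e :: real assume "0 < e"
      have "eventually (\<lambda>n. perturbed.rate n < e) sequentially"
        using order_tendstoD(2)[OF perturbed.rate_tendsto_0[OF P[OF \<open>s \<in> S\<close>]] \<open>0 < e\<close>] .
      then show "\<forall>\<^sub>F n in sequentially. \<forall>s\<in>cball s d. dist (perturbed.approx p (r s) n x) (perturbed.eigfun p (r s) x) < e"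
      proof eventually_elim
        case (elim n)
        show ?case
        proof
          fix u assume "u \<in> cball s d"
          then have u: "u \<in> S" using d by blast
          show "dist (perturbed.approx p (r u) n x) (perturbed.eigfun p (r u) x) < e"
            using perturbed.approx_tendsto(2)[OF P[OF u] x, of n] elim unfolding dist_norm by (rule le_less_trans)
        qed
      qed
    qed
    with d show "\<exists>d>0. cball s d \<subseteq> S \<and> uniform_limit (cball s d) (\<lambda>n s. perturbed.approx p (r s) n x) (\<lambda>s. perturbed.eigfun p (r s) x) sequentially"
      by blast
  qed
  have "(\<lambda>s. perturbed.pavg p (r s) (perturbed.eigfun p (r s)) 0) holomorphic_on S"
    by (rule step[OF _ _ ef]) (use perturbed.admissibleD(5)[OF P perturbed.admissible_eigfun[OF P]] in auto)
  then show "(\<lambda>s. perturbed.eigval p (r s)) holomorphic_on S"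
    by (rule holomorphic_transform) (simp add: perturbed.eigval_def[OF P])
qed

section \<open>Bounded separately holomorphic functions\<close>

text \<open>Cauchy's estimates on discs of radius \<open>R / 4\<close> around points of the half
  disc: \<open>4 * M / R\<close> bounds the first derivative and
  \<open>2 * M / (R / 4)\<^sup>2\<close> the second.\<close>

lemma holomorphic_bounds:
  assumes hol: "g holomorphic_on ball c R" and B: "\<And>z. z \<in> ball c R \<Longrightarrow> cmod (g z) \<le> M" and R: "0 < R"
  shows "u \<in> ball c (R / 2) \<Longrightarrow> cmod ((deriv ^^ n) g u) \<le> fact n * M / (R / 4) ^ n"
    and "u \<in> ball c (R / 2) \<Longrightarrow> v \<in> ball c (R / 2) \<Longrightarrow> cmod (g v - g u) \<le> 4 * M / R * cmod (v - u)"
    and "u \<in> ball c (R / 2) \<Longrightarrow> v \<in> ball c (R / 2) \<Longrightarrow>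
      cmod (g v - g u - deriv g u * (v - u)) \<le> 32 * M / R\<^sup>2 * (cmod (v - u))\<^sup>2"
proof -
  show 1: "cmod ((deriv ^^ n) g u) \<le> fact n * M / (R / 4) ^ n" if u: "u \<in> ball c (R / 2)" for u n
  proof -
    have sub: "cball u (R / 4) \<subseteq> ball c R"
    proof
      fix z assume "z \<in> cball u (R / 4)"
      then have "dist c z \<le> dist c u + R / 4" using dist_triangle[of c z u] by (simp add: dist_commute)
      also have "\<dots> < R" using u R by simp
      finally show "z \<in> ball c R" by simp
    qed
    show ?thesis
    proof (rule Cauchy_inequality)
      show "g holomorphic_on ball u (R / 4)"
        by (rule holomorphic_on_subset[OF hol]) (use sub ball_subset_cball in blast)
      show "continuous_on (cball u (R / 4)) g"
        by (rule holomorphic_on_imp_continuous_on[OF holomorphic_on_subset[OF hol sub]])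
      fix x assume "norm (u - x) = R / 4"
      then have "x \<in> cball u (R / 4)" by (simp add: dist_norm)
      then show "norm (g x) \<le> M" using sub B by blast
    qed (use R in auto)
  qed
  have hd: "((deriv ^^ i) g has_field_derivative (deriv ^^ Suc i) g x) (at x within ball c (R / 2))"
    if "x \<in> ball c (R / 2)" for i x
  proof -
    have "(deriv ^^ i) g holomorphic_on ball c R" by (rule holomorphic_higher_deriv[OF hol]) simp
    then have "((deriv ^^ i) g has_field_derivative deriv ((deriv ^^ i) g) x) (at x)"
      using that R by (intro holomorphic_derivI[of _ "ball c R"]) auto
    then show ?thesis by (simp add: has_field_derivative_at_within)
  qed
  show "cmod (g v - g u) \<le> 4 * M / R * cmod (v - u)" if "u \<in> ball c (R / 2)" "v \<in> ball c (R / 2)" for u v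
  proof (rule field_differentiable_bound[OF _ _ _ that(2,1)])
    show "(g has_field_derivative deriv g z) (at z within ball c (R / 2))" if "z \<in> ball c (R / 2)" for z
      using hd[OF that, of 0] by simp
    show "cmod (deriv g z) \<le> 4 * M / R" if "z \<in> ball c (R / 2)" for z
      using 1[OF that, of 1] by (simp add: mult_ac)
  qed simp
  show "cmod (g v - g u - deriv g u * (v - u)) \<le> 32 * M / R\<^sup>2 * (cmod (v - u))\<^sup>2"
    if u: "u \<in> ball c (R / 2)" and v: "v \<in> ball c (R / 2)" for u v
  proof -
    have "cmod ((deriv ^^ 0) g v - (\<Sum>i\<le>1. (deriv ^^ i) g u * (v - u) ^ i / fact i))
      \<le> (32 * M / R\<^sup>2) * cmod (v - u) ^ Suc 1 / fact 1"
    proof (rule complex_Taylor[of "ball c (R / 2)"])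
      fix x assume "x \<in> ball c (R / 2)"
      from 1[OF this, of 2] show "cmod ((deriv ^^ Suc 1) g x) \<le> 32 * M / R\<^sup>2"
        by (simp add: numeral_2_eq_2 power2_eq_square mult_ac)
    qed (use hd u v in auto)
    then show ?thesis by (simp add: power2_eq_square algebra_simps)
  qed
qed

text \<open>The bound \<open>M\<close> does the work of Hartogs' theorem: with it Cauchy's estimates
  hold uniformly in the other variable, and joint differentiability follows from separate
  holomorphy.\<close>

definition sephol :: "(complex \<Rightarrow> complex \<Rightarrow> complex) \<Rightarrow> real \<Rightarrow> complex \<Rightarrow> complex \<Rightarrow> real \<Rightarrow> bool" where
  "sephol f M a b R \<longleftrightarrow> 0 < R \<and> (\<forall>z\<in>ball a R. \<forall>w\<in>ball b R. cmod (f z w) \<le> M) \<and>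
     (\<forall>w\<in>ball b R. (\<lambda>z. f z w) holomorphic_on ball a R) \<and>
     (\<forall>z\<in>ball a R. (\<lambda>w. f z w) holomorphic_on ball b R)"

lemma sephol_swap: "sephol f M a b R \<Longrightarrow> sephol (\<lambda>w z. f z w) M b a R"
  by (auto simp: sephol_def)

text \<open>In \<open>w\<close> this is the holomorphy of a derivative. In \<open>z\<close> the
  derivative is a uniform limit of difference quotients, by the second-order bound, whose constant
  is the same for all \<open>z\<close>.\<close>

lemma sephol_deriv:
  assumes "sephol f M a b R"
  shows "sephol (\<lambda>z w. deriv (f z) w) (4 * M / R) a b (R / 2)"
proof -
  have R: "0 < R" and B: "\<And>z w. z \<in> ball a R \<Longrightarrow> w \<in> ball b R \<Longrightarrow> cmod (f z w) \<le> M"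
    and h1: "\<And>w. w \<in> ball b R \<Longrightarrow> (\<lambda>z. f z w) holomorphic_on ball a R"
    and h2: "\<And>z. z \<in> ball a R \<Longrightarrow> f z holomorphic_on ball b R"
    using assms by (auto simp: sephol_def)
  have sub: "ball c (R / 2) \<subseteq> ball c R" for c :: complex using R by (intro subset_ball) simp
  have M: "0 \<le> M" using B[of a b] R norm_ge_zero[of "f a b"] by (simp del: norm_ge_zero)
  show ?thesis unfolding sephol_def
  proof (intro conjI ballI)
    show "0 < R / 2" using R by simp
  next
    fix z w assume z: "z \<in> ball a (R / 2)" and w: "w \<in> ball b (R / 2)"
    have z': "z \<in> ball a R" using z sub by blast
    show "cmod (deriv (f z) w) \<le> 4 * M / R"
      using holomorphic_bounds(1)[OF h2[OF z'] B[OF z'] R w, of 1] by (simp add: mult_ac)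
  next
    fix z assume "z \<in> ball a (R / 2)"
    then have "f z holomorphic_on ball b R" using sub by (intro h2) blast
    then have "deriv (f z) holomorphic_on ball b R" by (rule holomorphic_deriv) simp
    then show "deriv (f z) holomorphic_on ball b (R / 2)" using sub by (rule holomorphic_on_subset)
  next
    fix w assume w: "w \<in> ball b (R / 2)"
    define d where "d = R / 2 - dist b w"
    have d: "0 < d" using w by (simp add: d_def)
    define s where "s n = d / (real n + 2)" for n
    have s: "0 < s n" "s n < d" for n using d by (auto simp: s_def field_simps intro!: add_pos_nonneg)
    have ws: "w + of_real (s n) \<in> ball b (R / 2)" for n
    proof -
      have "dist b (w + of_real (s n)) \<le> dist b w + dist w (w + of_real (s n))" by (rule dist_triangle)
      also have "dist w (w + of_real (s n)) = s n" using s(1)[of n] by (simp add: dist_norm)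
      finally show ?thesis using s(2)[of n] by (simp add: d_def)
    qed
    define D where "D n z = (f z (w + of_real (s n)) - f z w) / of_real (s n)" for n z
    have est: "cmod (D n z - deriv (f z) w) \<le> 32 * M / R\<^sup>2 * s n" if z: "z \<in> ball a R" for n z
    proof -
      have N: "cmod (f z (w + of_real (s n)) - f z w - deriv (f z) w * of_real (s n)) \<le> 32 * M / R\<^sup>2 * (s n)\<^sup>2"
        using holomorphic_bounds(3)[OF h2[OF z] B[OF z] R w ws[of n]] s(1)[of n] by simp
      define N where "N = f z (w + of_real (s n)) - f z w - deriv (f z) w * of_real (s n)"
      have "D n z - deriv (f z) w = N / of_real (s n)"
        using s(1)[of n] by (simp add: D_def N_def field_simps)
      then have "cmod (D n z - deriv (f z) w) = cmod N / s n"
        using s(1)[of n] by (simp add: norm_divide)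
      also have "\<dots> \<le> 32 * M / R\<^sup>2 * (s n)\<^sup>2 / s n"
        using N s(1)[of n] unfolding N_def by (intro divide_right_mono) auto
      finally show ?thesis using s(1)[of n] by (simp add: power2_eq_square)
    qed
    have s0: "(\<lambda>n. 32 * M / R\<^sup>2 * s n) \<longlonglongrightarrow> 0"
      unfolding s_def by real_asymp
    show "(\<lambda>z. deriv (f z) w) holomorphic_on ball a (R / 2)"
    proof (rule holomorphic_on_subset[OF _ sub], rule holomorphic_uniform_sequence)
      show "D n holomorphic_on ball a R" for n
      proof -
        have "w \<in> ball b R" "w + of_real (s n) \<in> ball b R" using w ws[of n] sub by blast+
        then show ?thesis unfolding D_def[abs_def] using s(1)[of n]
          by (intro holomorphic_intros h1) auto
      qed
      fix x assume "x \<in> ball a R"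
      then obtain e where e: "0 < e" "cball x e \<subseteq> ball a R" using open_contains_cball open_ball by metis
      have "uniform_limit (cball x e) D (\<lambda>z. deriv (f z) w) sequentially"
      proof (rule uniform_limitI)
        fix \<epsilon> :: real assume "0 < \<epsilon>"
        from order_tendstoD(2)[OF s0 this]
        show "\<forall>\<^sub>F n in sequentially. \<forall>z\<in>cball x e. dist (D n z) (deriv (f z) w) < \<epsilon>"
        proof eventually_elim
          case (elim n)
          show ?case
          proof
            fix z assume "z \<in> cball x e"
            then have "z \<in> ball a R" using e by blast
            from est[OF this, of n] show "dist (D n z) (deriv (f z) w) < \<epsilon>"
              using elim unfolding dist_norm by (rule le_less_trans)
          qed
        qed
      qed
      with e show "\<exists>d>0. cball x d \<subseteq> ball a R \<and> uniform_limit (cball x d) D (\<lambda>z. deriv (f z) w) sequentially"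
        by blast
    qed simp
  qed
qed

lemma sephol_deriv':
  assumes "sephol f M a b R"
  shows "sephol (\<lambda>z w. deriv (\<lambda>z. f z w) z) (4 * M / R) a b (R / 2)"
  using sephol_swap[OF sephol_deriv[OF sephol_swap[OF assms]]] by simp

text \<open>Expand in \<open>z\<close> at fixed \<open>w\<close>, then in \<open>w\<close> at
  \<open>a\<close>. The cross term is the change of the \<open>z\<close>-derivative between
  \<open>b\<close> and \<open>w\<close>, which is Lipschitz because that derivative is again a
  bounded separately holomorphic function.\<close>

lemma sephol_quadratic:
  assumes f: "sephol f M a b R" and z: "z \<in> ball a (R / 4)" and w: "w \<in> ball b (R / 4)"
  shows "cmod (f z w - f a b - deriv (\<lambda>z. f z b) a * (z - a) - deriv (f a) b * (w - b))
    \<le> 32 * M / R\<^sup>2 * (cmod (z - a) + cmod (w - b))\<^sup>2"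
proof -
  have R: "0 < R" and B: "\<And>z w. z \<in> ball a R \<Longrightarrow> w \<in> ball b R \<Longrightarrow> cmod (f z w) \<le> M"
    and h1: "\<And>w. w \<in> ball b R \<Longrightarrow> (\<lambda>z. f z w) holomorphic_on ball a R"
    and h2: "\<And>z. z \<in> ball a R \<Longrightarrow> f z holomorphic_on ball b R"
    using f by (auto simp: sephol_def)
  have M: "0 \<le> M" using B[of a b] R norm_ge_zero[of "f a b"] by (simp del: norm_ge_zero)
  have R4: "0 < R / 2 / 2" "0 < R / 2" using R by auto
  have wR: "w \<in> ball b R" "w \<in> ball b (R / 2)" using w R by auto
  have zR: "z \<in> ball a (R / 2)" using z R by auto
  define C where "C = 32 * M / R\<^sup>2"
  define g where "g z w = deriv (\<lambda>z. f z w) z" for z w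
  have g: "sephol g (4 * M / R) a b (R / 2)" unfolding g_def by (rule sephol_deriv'[OF f])
  have 1: "cmod (f z w - f a w - g a w * (z - a)) \<le> C * (cmod (z - a))\<^sup>2"
    unfolding g_def C_def
    by (rule holomorphic_bounds(3)[OF h1[OF wR(1)] B[OF _ wR(1)] R]) (use zR R in auto)
  have gb: "cmod (g a w') \<le> 4 * M / R" if "w' \<in> ball b (R / 2)" for w'
    using g that R4(2) unfolding sephol_def by auto
  have gh: "g a holomorphic_on ball b (R / 2)" using g R4(2) unfolding sephol_def by auto
  have 2: "cmod (g a w - g a b) \<le> C * cmod (w - b)"
  proof -
    have "cmod (g a w - g a b) \<le> 4 * (4 * M / R) / (R / 2) * cmod (w - b)"
      by (rule holomorphic_bounds(2)[OF gh gb R4(2)]) (use w R in auto)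
    then show ?thesis by (simp add: C_def power2_eq_square mult_ac)
  qed
  have 3: "cmod (f a w - f a b - deriv (f a) b * (w - b)) \<le> C * (cmod (w - b))\<^sup>2"
    unfolding C_def by (rule holomorphic_bounds(3)[OF h2 B R]) (use wR R in auto)
  have "f z w - f a b - g a b * (z - a) - deriv (f a) b * (w - b) =
     (f z w - f a w - g a w * (z - a)) + (g a w - g a b) * (z - a) + (f a w - f a b - deriv (f a) b * (w - b))"
    by (simp add: algebra_simps)
  also have "cmod \<dots> \<le> C * (cmod (z - a))\<^sup>2 + C * cmod (w - b) * cmod (z - a) + C * (cmod (w - b))\<^sup>2"
    using 1 3 mult_right_mono[OF 2, of "cmod (z - a)"]
    by (intro norm_triangle_le add_mono) (auto simp: norm_mult)
  also have "\<dots> \<le> C * (cmod (z - a) + cmod (w - b))\<^sup>2"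
  proof -
    have "0 \<le> C * (cmod (w - b) * cmod (z - a))" using M by (simp add: C_def)
    then show ?thesis by (simp add: power2_eq_square algebra_simps)
  qed
  finally show ?thesis by (simp add: g_def C_def)
qed

text \<open>The notion is closed under partial derivatives, so all orders of differentiability of
  the pressure come from one holomorphic extension.\<close>

definition ranalytic :: "(real \<Rightarrow> real \<Rightarrow> real) \<Rightarrow> real \<Rightarrow> real \<Rightarrow> bool" where
  "ranalytic u t q \<longleftrightarrow> (\<exists>f M R. sephol f M (of_real t) (of_real q) R \<and>
     (\<forall>s r. \<bar>s - t\<bar> < R \<and> \<bar>r - q\<bar> < R \<longrightarrow> u s r = Re (f (of_real s) (of_real r))))"

definition pd1 :: "(real \<Rightarrow> real \<Rightarrow> real) \<Rightarrow> real \<Rightarrow> real \<Rightarrow> real" where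
  "pd1 u s r = deriv (\<lambda>x. u x r) s"

definition pd2 :: "(real \<Rightarrow> real \<Rightarrow> real) \<Rightarrow> real \<Rightarrow> real \<Rightarrow> real" where
  "pd2 u s r = deriv (u s) r"

lemma has_real_derivative_Re:
  assumes "(g has_field_derivative D) (at (of_real s))"
  shows "((\<lambda>x. Re (g (of_real x))) has_real_derivative Re D) (at s)"
proof -
  have "((\<lambda>x. g (of_real x)) has_vector_derivative D) (at s)"
  proof -
    have "(complex_of_real has_vector_derivative 1) (at s)"
      using has_vector_derivative_of_real[OF DERIV_ident, of "at s"] by simp
    from field_vector_diff_chain_at[OF this assms] show ?thesis by (simp add: o_def)
  qed
  then have "((\<lambda>x. Re (g (of_real x))) has_vector_derivative Re D) (at s)"
    by (rule bounded_linear.has_vector_derivative[OF bounded_linear_Re])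
  then show ?thesis by (simp add: has_real_derivative_iff_has_vector_derivative)
qed

lemma ranalytic_derivatives:
  assumes "ranalytic u t q"
  shows "ranalytic (pd1 u) t q" "ranalytic (pd2 u) t q"
    "((\<lambda>(s, r). u s r) has_derivative (\<lambda>(a, b). pd1 u t q * a + pd2 u t q * b)) (at (t, q))"
    "((\<lambda>s. u s q) has_real_derivative pd1 u t q) (at t)"
    "(u t has_real_derivative pd2 u t q) (at q)"
proof -
  obtain f M R where f: "sephol f M (of_real t) (of_real q) R"
    and u: "\<And>s r. \<bar>s - t\<bar> < R \<Longrightarrow> \<bar>r - q\<bar> < R \<Longrightarrow> u s r = Re (f (of_real s) (of_real r))"
    using assms by (auto simp: ranalytic_def)
  have R: "0 < R" using f by (simp add: sephol_def)
  have bl: "complex_of_real s \<in> ball (of_real t) R \<longleftrightarrow> \<bar>s - t\<bar> < R" for s t R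
    by (auto simp: dist_norm abs_minus_commute simp flip: of_real_diff)
  have d1: "((\<lambda>x. u x r) has_real_derivative Re (deriv (\<lambda>z. f z (of_real r)) (of_real s))) (at s)"
    if s: "\<bar>s - t\<bar> < R" and r: "\<bar>r - q\<bar> < R" for s r
  proof -
    have "(\<lambda>z. f z (of_real r)) holomorphic_on ball (of_real t) R" using f r bl by (simp add: sephol_def)
    then have "((\<lambda>z. f z (of_real r)) has_field_derivative deriv (\<lambda>z. f z (of_real r)) (of_real s)) (at (of_real s))"
      by (rule holomorphic_derivI) (use s bl in auto)
    from has_real_derivative_Re[OF this]
    show ?thesis
    proof (rule has_field_derivative_transform_within_open[of _ _ _ "{t - R<..<t + R}"])
      show "Re (f (of_real x) (of_real r)) = u x r" if "x \<in> {t - R<..<t + R}" for x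
        using u[of x r] r that by auto
    qed (use s in auto)
  qed
  have d2: "(u s has_real_derivative Re (deriv (f (of_real s)) (of_real r))) (at r)"
    if s: "\<bar>s - t\<bar> < R" and r: "\<bar>r - q\<bar> < R" for s r
  proof -
    have "f (of_real s) holomorphic_on ball (of_real q) R" using f s bl by (simp add: sephol_def)
    then have "(f (of_real s) has_field_derivative deriv (f (of_real s)) (of_real r)) (at (of_real r))"
      by (rule holomorphic_derivI) (use r bl in auto)
    from has_real_derivative_Re[OF this]
    show ?thesis
    proof (rule has_field_derivative_transform_within_open[of _ _ _ "{q - R<..<q + R}"])
      show "Re (f (of_real s) (of_real x)) = u s x" if "x \<in> {q - R<..<q + R}" for x
        using u[of s x] s that by auto
    qed (use r in auto)
  qed
  have p1: "pd1 u s r = Re (deriv (\<lambda>z. f z (of_real r)) (of_real s))"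
    and p2: "pd2 u s r = Re (deriv (f (of_real s)) (of_real r))"
    if "\<bar>s - t\<bar> < R" "\<bar>r - q\<bar> < R" for s r
    using d1[OF that] d2[OF that] by (auto simp: pd1_def pd2_def DERIV_imp_deriv)
  show "ranalytic (pd1 u) t q" unfolding ranalytic_def
    by (intro exI conjI, rule sephol_deriv'[OF f]) (use p1 R in auto)
  show "ranalytic (pd2 u) t q" unfolding ranalytic_def
    by (intro exI conjI, rule sephol_deriv[OF f]) (use p2 R in auto)
  show "((\<lambda>s. u s q) has_real_derivative pd1 u t q) (at t)" "(u t has_real_derivative pd2 u t q) (at q)"
    using d1[of t q] d2[of t q] p1[of t q] p2[of t q] R by auto
  define C where "C = 32 * M / R\<^sup>2"
  define L where "L = (\<lambda>(a, b). pd1 u t q * a + pd2 u t q * b)"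
  have bL: "bounded_linear L"
    unfolding L_def case_prod_beta by (intro bounded_linear_add bounded_linear_const_mult bounded_linear_fst bounded_linear_snd)
  have C0: "0 \<le> C"
  proof -
    have "cmod (f (of_real t) (of_real q)) \<le> M" using f R by (auto simp: sephol_def)
    then have "0 \<le> M" using norm_ge_zero order_trans by blast
    then show ?thesis by (simp add: C_def)
  qed
  have est: "norm ((\<lambda>(s, r). u s r) y - (\<lambda>(s, r). u s r) (t, q) - L (y - (t, q))) / norm (y - (t, q)) \<le> 4 * C * norm (y - (t, q))"
    if y: "norm (y - (t, q)) < R / 4" for y
  proof -
    obtain s r where sr: "y = (s, r)" by (cases y)
    have n: "\<bar>s - t\<bar> \<le> norm (y - (t, q))" "\<bar>r - q\<bar> \<le> norm (y - (t, q))"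
      using norm_fst_le[of "s - t" "r - q"] norm_snd_le[of "r - q" "s - t"] by (auto simp: sr)
    have near: "\<bar>s - t\<bar> < R / 4" "\<bar>r - q\<bar> < R / 4" "\<bar>s - t\<bar> < R" "\<bar>r - q\<bar> < R" using n y R by auto
    define Z where "Z = f (of_real s) (of_real r) - f (of_real t) (of_real q)
      - deriv (\<lambda>z. f z (of_real q)) (of_real t) * (of_real s - of_real t)
      - deriv (f (of_real t)) (of_real q) * (of_real r - of_real q)"
    have "u s r - u t q - (pd1 u t q * (s - t) + pd2 u t q * (r - q)) = Re Z"
      using u[of s r] u[of t q] p1[of t q] p2[of t q] near R
      by (simp add: Z_def flip: of_real_diff)
    then have "\<bar>u s r - u t q - (pd1 u t q * (s - t) + pd2 u t q * (r - q))\<bar> \<le> cmod Z"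
      using abs_Re_le_cmod[of Z] by simp
    also have "\<dots> \<le> C * (cmod (of_real s - of_real t) + cmod (of_real r - of_real q))\<^sup>2"
      unfolding Z_def C_def by (rule sephol_quadratic[OF f]) (simp_all only: bl near)
    also have "\<dots> = C * (\<bar>s - t\<bar> + \<bar>r - q\<bar>)\<^sup>2" by (simp flip: of_real_diff)
    also have "\<dots> \<le> C * (2 * norm (y - (t, q)))\<^sup>2"
      using n C0 by (intro mult_left_mono power_mono) auto
    finally have "\<bar>u s r - u t q - (pd1 u t q * (s - t) + pd2 u t q * (r - q))\<bar> \<le> 4 * C * norm (y - (t, q)) * norm (y - (t, q))"
      by (simp add: power2_eq_square mult_ac)
    moreover have "norm ((\<lambda>(s, r). u s r) y - (\<lambda>(s, r). u s r) (t, q) - L (y - (t, q))) = 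
       \<bar>u s r - u t q - (pd1 u t q * (s - t) + pd2 u t q * (r - q))\<bar>"
      by (simp add: sr L_def)
    ultimately show ?thesis
      by (cases "norm (y - (t, q)) = 0") (auto simp: field_simps)
  qed
  show "((\<lambda>(s, r). u s r) has_derivative (\<lambda>(a, b). pd1 u t q * a + pd2 u t q * b)) (at (t, q))"
    unfolding L_def[symmetric] has_derivative_iff_norm
  proof (intro conjI bL)
    have "((\<lambda>y. 4 * C * norm (y - (t, q))) \<longlongrightarrow> 4 * C * norm ((t, q) - (t, q))) (at (t, q))"
      by (intro tendsto_intros)
    then have l: "((\<lambda>y. 4 * C * norm (y - (t, q))) \<longlongrightarrow> 0) (at (t, q))" by simp
    have "eventually (\<lambda>y. dist y (t, q) < R / 4) (at (t, q))"
      using R by (auto simp: eventually_at intro!: exI[of _ "R / 4"])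
    then have "eventually (\<lambda>y. norm (norm ((\<lambda>(s, r). u s r) y - (\<lambda>(s, r). u s r) (t, q) - L (y - (t, q))) / norm (y - (t, q)))
        \<le> 4 * C * norm (y - (t, q))) (at (t, q))"
    proof (rule eventually_mono)
      fix y assume "dist y (t, q) < R / 4"
      then have "norm (y - (t, q)) < R / 4" by (simp add: dist_norm)
      from est[OF this] show "norm (norm ((\<lambda>(s, r). u s r) y - (\<lambda>(s, r). u s r) (t, q) - L (y - (t, q))) / norm (y - (t, q)))
        \<le> 4 * C * norm (y - (t, q))"
        by (subst real_norm_def, subst abs_of_nonneg, intro divide_nonneg_nonneg norm_ge_zero)
    qed
    then show "((\<lambda>y. norm ((\<lambda>(s, r). u s r) y - (\<lambda>(s, r). u s r) (t, q) - L (y - (t, q))) / norm (y - (t, q))) \<longlongrightarrow> 0) (at (t, q))"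
      by (rule Lim_null_comparison[OF _ l])
  qed
qed

section \<open>Real analyticity and strict convexity of the pressure\<close>

lemma cmod_exp_minus_1: "cmod (exp z - 1) \<le> cmod z * exp (cmod z)"
  using Taylor_exp_field[of z 0] by (simp add: mult.commute)

context gibbs
begin

text \<open>A quarter of the distance to the edge of convergence: one quarter absorbs the perturbed
  exponents, another the logarithm, and the series still converges.\<close>

definition gap :: real where "gap = (2 * t - q - 1) / 4"

text \<open>The middle factor bounds the kernel; the last one comes from
  \<open>cmod (exp z - 1) \<le> cmod z * exp (cmod z)\<close> with \<open>cmod z\<close> of order
  \<open>ln (k + 2)\<close>.\<close>

definition majorant :: "nat \<Rightarrow> real" where
  "majorant k = 40 * (2 ^ 20 * real (Suc k) powr (q - 2 * t)) * (ln (real (k + 2)) * real (k + 2) powr gap)"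

lemma gap_pos: "0 < gap"
  using conv by (simp add: gap_def)

lemma ln_k2: "1 / 2 \<le> ln (real (k + 2))"
proof -
  have "1 / 2 \<le> ln (2::real)" by (rule ln2_ge_two_thirds[THEN order_trans[rotated]]) simp
  also have "\<dots> \<le> ln (real (k + 2))" by simp
  finally show ?thesis .
qed

lemma majorant_summable: "summable majorant"
proof (rule summable_comparison_test')
  have "summable (\<lambda>k. real (Suc k) powr (q - 2 * t + 2 * gap))"
    using conv by (subst summable_Suc_iff) (simp add: summable_real_powr_iff gap_def field_simps)
  then show "summable (\<lambda>k. 40 * 2 ^ 20 * (2 powr (2 * gap) / gap) * real (Suc k) powr (q - 2 * t + 2 * gap))"
    by (rule summable_mult)
  fix k
  have 1: "ln (real (k + 2)) * real (k + 2) powr gap \<le> (2 powr (2 * gap) / gap) * real (Suc k) powr (2 * gap)"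
  proof -
    have "ln (real (k + 2)) \<le> real (k + 2) powr gap / gap"
      by (rule ln_powr_bound) (use gap_pos in auto)
    then have "ln (real (k + 2)) * real (k + 2) powr gap \<le> real (k + 2) powr gap / gap * real (k + 2) powr gap"
      by (intro mult_right_mono) auto
    also have "\<dots> = real (k + 2) powr (2 * gap) / gap" by (simp flip: powr_add)
    also have "\<dots> \<le> (2 * real (Suc k)) powr (2 * gap) / gap"
      using gap_pos by (intro divide_right_mono powr_mono2) auto
    also have "(2 * real (Suc k)) powr (2 * gap) = 2 powr (2 * gap) * real (Suc k) powr (2 * gap)"
      by (rule powr_mult)
    finally show ?thesis by simp
  qed
  have "0 \<le> majorant k" using ln_k2[of k] by (simp add: majorant_def)
  then show "norm (majorant k) \<le> 40 * 2 ^ 20 * (2 powr (2 * gap) / gap) * real (Suc k) powr (q - 2 * t + 2 * gap)"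
    using mult_left_mono[OF 1, of "40 * (2 ^ 20 * real (Suc k) powr (q - 2 * t))"]
    by (simp add: majorant_def powr_add mult_ac)
qed

end

text \<open>The factor 3 in the condition on \<open>gap\<close> counts one \<open>\<eta>\<close>
  from \<open>q\<close> and two from the exponent \<open>2 * t\<close>. The bounds by
  \<open>t\<close> and \<open>2 - t\<close> keep nearby real parameters in the range of
  \<open>gibbs\<close>.\<close>

locale gibbs_perturbed = gibbs +
  fixes h :: "real \<Rightarrow> real" and \<eta> :: real
  assumes h: "dcone h" "h 0 = 1"
    and eig: "\<And>x. x \<in> {0..1} \<Longrightarrow> transfer t q h x = exp (pressure t q) * h x"
    and eta: "0 < \<eta>" "3 * \<eta> \<le> gap" "\<eta> \<le> 1" "\<eta> \<le> t" "\<eta> \<le> 2 - t"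
    and eta_small: "\<eta> * suminf majorant \<le> kappa * kappa / 2"

lemma (in gibbs) perturbed_exists:
  assumes "0 < t" "t < 2"
  obtains h \<eta> where "gibbs_perturbed t q h \<eta>"
proof -
  obtain h where h: "dcone h" "h 0 = 1" "\<And>x. x \<in> {0..1} \<Longrightarrow> transfer t q h x = exp (pressure t q) * h x"
    by (rule eigenfunction_pressure) blast
  define S where "S = suminf majorant"
  have S: "0 \<le> S" unfolding S_def
    using ln_k2 by (intro suminf_nonneg majorant_summable) (auto simp: majorant_def intro: order_trans[of 0 "1/2"])
  define \<eta> where "\<eta> = Min {gap / 3, 1, t, 2 - t, kappa * kappa / 2 / (S + 1)}"
  have "0 < \<eta>" using gap_pos assms kappa S by (simp add: \<eta>_def)
  moreover have le: "\<eta> \<le> gap / 3" "\<eta> \<le> 1" "\<eta> \<le> t" "\<eta> \<le> 2 - t" "\<eta> \<le> kappa * kappa / 2 / (S + 1)"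
    unfolding \<eta>_def by (rule Min_le; simp)+
  moreover have "\<eta> * S \<le> kappa * kappa / 2"
  proof -
    have "\<eta> * S \<le> \<eta> * (S + 1)" using \<open>0 < \<eta>\<close> by (intro mult_left_mono) auto
    also have "\<dots> \<le> kappa * kappa / 2" using le(5) S by (simp add: field_simps)
    finally show ?thesis .
  qed
  ultimately have "gibbs_perturbed t q h \<eta>"
    using h gibbs_axioms by (auto simp: gibbs_perturbed_def gibbs_perturbed_axioms_def S_def)
  then show ?thesis by (rule that)
qed

context gibbs_perturbed
begin

abbreviation pk :: "nat \<Rightarrow> real \<Rightarrow> real" where "pk \<equiv> kernel h"

lemma pk_markov: "markov_kernel pk"
  by (rule markov_kernel[OF h(1)])

lemma pk_eq: "x \<in> {0..1} \<Longrightarrow> wt t q k x * h (branch k x) = exp (pressure t q) * h x * pk k x"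
  using eig[of x] coneD(1)[OF h(1), of x x] by (simp add: kernel_def)

text \<open>Here \<open>2 ^ 20 = 256 * 4096\<close>: the variation of \<open>h\<close> and the lower
  bound for \<open>transfer t q h\<close>.\<close>

lemma pk_le:
  assumes x: "x \<in> {0..1}"
  shows "pk k x \<le> 2 ^ 20 * real (Suc k) powr (q - 2 * t)"
proof -
  have hx: "0 < h x" and T: "h x / 4096 \<le> transfer t q h x"
    using coneD(1)[OF h(1) x x] transfer_ge_first[OF h(1) x] by auto
  have T0: "0 < transfer t q h x" using T hx by (meson divide_pos_pos less_le_trans zero_less_numeral)
  have "wt t q k x * h (branch k x) \<le> real (Suc k) powr (q - 2 * t) * (256 * h x)"
    using wt_le[OF x, of k] coneD(3)[OF h(1) branch_in[OF x] x, of k] wt_pos[OF x, of k]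
      coneD(1)[OF h(1) branch_in[OF x] x, of k]
    by (intro mult_mono) auto
  also have "\<dots> \<le> real (Suc k) powr (q - 2 * t) * (2 ^ 20 * transfer t q h x)"
    using T by (intro mult_left_mono) auto
  finally show ?thesis using T0 by (simp add: kernel_def field_simps)
qed

text \<open>The weight of a branch at \<open>(z, w)\<close> divided by that at
  \<open>(t, q)\<close>, written with \<open>exp\<close> so that the parameters may be
  complex.\<close>

definition mult :: "complex \<Rightarrow> complex \<Rightarrow> nat \<Rightarrow> real \<Rightarrow> complex" where
  "mult z w k x = exp ((w - of_real q) * of_real (ln (real (Suc k))) -
     2 * (z - of_real t) * of_real (ln (real (Suc k) + x)))"

text \<open>Then \<open>pk k x + defect z w k x\<close> is the kernel at \<open>(z, w)\<close>
  conjugated by the eigenfunction at \<open>(t, q)\<close>, in the form required by the locale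
  \<open>perturbed\<close>.\<close>

definition defect :: "complex \<Rightarrow> complex \<Rightarrow> nat \<Rightarrow> real \<Rightarrow> complex" where
  "defect z w k x = of_real (pk k x) * (mult z w k x - 1)"

lemma perturbed:
  assumes z: "cmod (z - of_real t) \<le> \<eta>" and w: "cmod (w - of_real q) \<le> \<eta>"
  shows "perturbed pk (defect z w) (\<lambda>k. \<eta> * majorant k) (\<eta> * suminf majorant)"
proof
  show "markov_kernel pk" by (rule pk_markov)
  show "(\<lambda>k. \<eta> * majorant k) sums (\<eta> * suminf majorant)"
    by (intro sums_mult summable_sums majorant_summable)
  show "\<eta> * suminf majorant \<le> kappa * kappa / 2" by (rule eta_small)
  define c where "c k = ln (real (k + 2))" for k
  define E where "E k = real (k + 2) powr gap" for k
  define bd where "bd k = 2 ^ 20 * real (Suc k) powr (q - 2 * t)" for k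
  have c: "1 / 2 \<le> c k" for k unfolding c_def by (rule ln_k2)
  have E0: "0 \<le> E k" for k by (simp add: E_def)
  have bd0: "0 \<le> bd k" for k by (simp add: bd_def)
  have maj: "majorant k = 40 * bd k * (c k * E k)" for k by (simp add: majorant_def bd_def c_def E_def)
  have pkb: "0 \<le> pk k x" "pk k x \<le> bd k" if "x \<in> {0..1}" for k x
    using markov_kernelD(1)[OF pk_markov that] pk_le[OF that] by (auto simp: bd_def)
  define ex where "ex k x = (w - of_real q) * of_real (ln (real (Suc k))) -
     2 * (z - of_real t) * of_real (ln (real (Suc k) + x))" for k x
  have m: "mult z w k x = exp (ex k x)" for k x by (simp add: mult_def ex_def)
  have exb: "cmod (ex k x) \<le> 3 * \<eta> * c k" "exp (cmod (ex k x)) \<le> E k" if x: "x \<in> {0..1}" for k x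
  proof -
    have l1: "\<bar>ln (real (Suc k))\<bar> \<le> c k" by (auto simp: c_def)
    have l2: "\<bar>ln (real (Suc k) + x)\<bar> \<le> c k" using x by (auto simp: c_def)
    have "cmod (ex k x) \<le> cmod (w - of_real q) * \<bar>ln (real (Suc k))\<bar> + 2 * cmod (z - of_real t) * \<bar>ln (real (Suc k) + x)\<bar>"
      unfolding ex_def by (rule norm_triangle_le_diff) (simp only: norm_mult norm_of_real norm_numeral order_refl)
    also have "\<dots> \<le> \<eta> * c k + 2 * \<eta> * c k"
      using z w l1 l2 eta by (intro add_mono mult_mono) auto
    finally show *: "cmod (ex k x) \<le> 3 * \<eta> * c k" by simp
    also have "\<dots> \<le> gap * c k" using eta(2) c[of k] by (intro mult_right_mono) auto
    finally have "exp (cmod (ex k x)) \<le> exp (gap * c k)" by simp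
    also have "\<dots> = E k" by (simp add: E_def powr_def c_def)
    finally show "exp (cmod (ex k x)) \<le> E k" .
  qed
  have mb: "cmod (mult z w k x) \<le> E k" "cmod (mult z w k x - 1) \<le> \<eta> * (3 * (c k * E k))" if x: "x \<in> {0..1}" for k x
  proof -
    show "cmod (mult z w k x) \<le> E k" unfolding m using norm_exp[of "ex k x"] exb(2)[OF x] by (rule order_trans)
    have "cmod (mult z w k x - 1) \<le> cmod (ex k x) * exp (cmod (ex k x))"
      unfolding m by (rule cmod_exp_minus_1)
    also have "\<dots> \<le> (3 * \<eta> * c k) * E k"
      using exb[OF x] eta(1) c[of k] by (intro mult_mono) auto
    finally show "cmod (mult z w k x - 1) \<le> \<eta> * (3 * (c k * E k))" by (simp add: mult_ac)
  qed
  \<comment> \<open>Only the term with \<open>ln (real (Suc k) + x)\<close> depends on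
    \<open>x\<close>, and its variation is at most \<open>ldist x y\<close>, so no logarithm of
    \<open>k\<close> enters here.\<close>
  have ml: "cmod (mult z w k x - mult z w k y) \<le> \<eta> * (16 * E k) * rho x y" if x: "x \<in> {0..1}" and y: "y \<in> {0..1}" for k x y
  proof -
    define d where "d = ex k x - ex k y"
    have "d = - 2 * (z - of_real t) * of_real (ln (real (Suc k) + x) - ln (real (Suc k) + y))"
      by (simp add: d_def ex_def algebra_simps)
    then have "cmod d = 2 * cmod (z - of_real t) * \<bar>ln (real (Suc k) + x) - ln (real (Suc k) + y)\<bar>"
      by (simp only: norm_mult norm_of_real norm_minus_cancel norm_numeral norm_neg_numeral)
    also have "\<dots> \<le> 2 * \<eta> * rho x y"
      using z eta ln_diff_le_ldist[of x y "real (Suc k)"] ldist_le_rho[OF x y] x y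
      by (intro mult_mono) auto
    finally have d: "cmod d \<le> 2 * \<eta> * rho x y" .
    also have "\<dots> \<le> 2 * 1 * 1" using eta rho_le_1 by (intro mult_mono) auto
    finally have "exp (cmod d) \<le> exp 2" by simp
    also have "exp (2::real) \<le> 8"
    proof -
      have "exp (2::real) = exp 1 * exp 1" by (simp flip: exp_add)
      also have "\<dots> \<le> 2.8 * 2.8" using e_less_272 by (intro mult_mono) auto
      finally show ?thesis by simp
    qed
    finally have ed: "exp (cmod d) \<le> 8" .
    have "mult z w k x - mult z w k y = mult z w k y * (exp d - 1)"
      by (simp add: m d_def exp_diff right_diff_distrib)
    then have "cmod (mult z w k x - mult z w k y) = cmod (mult z w k y) * cmod (exp d - 1)"
      by (simp add: norm_mult)
    also have "\<dots> \<le> E k * (2 * \<eta> * rho x y * 8)"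
      using mb(1)[OF y] order_trans[OF cmod_exp_minus_1 mult_mono[OF d ed]] eta E0
      by (intro mult_mono) auto
    finally show ?thesis by (simp add: mult_ac)
  qed
  fix k and x :: real assume x: "x \<in> {0..1}"
  have "cmod (defect z w k x) = pk k x * cmod (mult z w k x - 1)"
    using pkb[OF x] by (simp add: defect_def norm_mult)
  also have "\<dots> \<le> bd k * (\<eta> * (3 * (c k * E k)))" using pkb[OF x, of k] mb(2)[OF x] bd0[of k] by (intro mult_mono) auto
  also have "\<dots> \<le> \<eta> * majorant k"
    using mult_nonneg_nonneg[OF mult_nonneg_nonneg[OF bd0 E0], of \<eta> k k] c[of k] eta bd0[of k] E0[of k]
    by (simp add: maj mult_ac)
  finally show "cmod (defect z w k x) \<le> \<eta> * majorant k" .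
  fix y :: real assume y: "y \<in> {0..1}"
  have pd: "\<bar>pk k x - pk k y\<bar> \<le> bd k * rho x y"
  proof -
    have *: "pk k x - pk k y \<le> bd k * rho x y" if x: "x \<in> {0..1}" and y: "y \<in> {0..1}" for x y
    proof -
      have "pk k x - pk k y \<le> pk k x * (1 - exp (- 16 * ldist x y))"
        using markov_kernelD(5)[OF pk_markov y x, of k] by (simp add: algebra_simps ldist_commute)
      also have "\<dots> \<le> bd k * rho x y"
        using pkb[OF x] bd0[of k] by (intro mult_mono) (auto simp: rho_def)
      finally show ?thesis .
    qed
    show ?thesis using *[OF x y] *[OF y x] by (auto simp: rho_commute abs_le_iff)
  qed
  have "defect z w k x - defect z w k y = of_real (pk k x - pk k y) * (mult z w k x - 1) + of_real (pk k y) * (mult z w k x - mult z w k y)"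
    by (simp add: defect_def algebra_simps)
  also have "cmod \<dots> \<le> \<bar>pk k x - pk k y\<bar> * cmod (mult z w k x - 1) + pk k y * cmod (mult z w k x - mult z w k y)"
    using pkb[OF y] by (intro norm_triangle_le) (simp only: norm_mult norm_of_real abs_of_nonneg order_refl)
  also have "\<dots> \<le> (bd k * rho x y) * (\<eta> * (3 * (c k * E k))) + bd k * (\<eta> * (16 * E k) * rho x y)"
    using pd mb(2)[OF x] ml[OF x y] pkb[OF y] bd0
    by (intro add_mono mult_mono) auto
  also have "\<dots> = \<eta> * rho x y * (bd k * E k) * (3 * c k + 16)" by (simp add: algebra_simps)
  \<comment> \<open>By \<open>c k \<ge> 1 / 2\<close> one has
    \<open>3 * c k + 16 \<le> 40 * c k\<close>; this is the constant in
    \<open>majorant\<close>.\<close>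
  also have "\<dots> \<le> \<eta> * rho x y * (bd k * E k) * (40 * c k)"
    using c[of k] eta bd0[of k] E0[of k] by (intro mult_left_mono mult_nonneg_nonneg) auto
  finally show "cmod (defect z w k x - defect z w k y) \<le> \<eta> * majorant k * rho x y"
    by (simp add: maj mult_ac)
qed

definition mr :: "real \<Rightarrow> real \<Rightarrow> nat \<Rightarrow> real \<Rightarrow> real" where
  "mr s r k x = exp ((r - q) * ln (real (Suc k)) - 2 * (s - t) * ln (real (Suc k) + x))"

definition G :: "real \<Rightarrow> real \<Rightarrow> real \<Rightarrow> real" where
  "G s r x = Re (perturbed.eigfun pk (defect (of_real s) (of_real r)) x)"

definition mu :: "real \<Rightarrow> real \<Rightarrow> real" where
  "mu s r = Re (perturbed.eigval pk (defect (of_real s) (of_real r)))"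

lemma mult_real: "mult (of_real s) (of_real r) k x = of_real (mr s r k x)"
  by (simp add: mult_def mr_def exp_of_real[symmetric])

lemma perturbed_real:
  assumes "\<bar>s - t\<bar> \<le> \<eta>" "\<bar>r - q\<bar> \<le> \<eta>"
  shows "perturbed pk (defect (of_real s) (of_real r)) (\<lambda>k. \<eta> * majorant k) (\<eta> * suminf majorant)"
  by (rule perturbed) (use assms in \<open>simp_all flip: of_real_diff\<close>)

lemma gibbs_near:
  assumes "\<bar>s - t\<bar> \<le> \<eta>" "\<bar>r - q\<bar> \<le> \<eta>" shows "gibbs s r"
  using assms eta gap_pos by (simp add: gibbs_def gap_def abs_le_iff)

lemma wt_near: "x \<in> {0..1} \<Longrightarrow> wt s r k x = wt t q k x * mr s r k x"
proof -
  assume x: "x \<in> {0..1}"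
  have p: "real (Suc k) powr a = exp (a * ln (real (Suc k)))" for a by (simp add: powr_def)
  have b: "branch k x powr a = exp (- a * ln (real (Suc k) + x))" for a
    using branch_powr x by auto
  show ?thesis unfolding wt_def mr_def p b by (simp add: algebra_simps flip: exp_add del: of_nat_Suc)
qed

text \<open>The product of \<open>h\<close> and \<open>G s r\<close> is an eigenfunction at
  \<open>(s, r)\<close> for which membership in the cone is not established. Being both a sub- and a
  supereigenfunction, it still determines the pressure.\<close>

lemma real_eigen:
  assumes sr: "\<bar>s - t\<bar> \<le> \<eta>" "\<bar>r - q\<bar> \<le> \<eta>"
  shows "perturbed.eigval pk (defect (of_real s) (of_real r)) = of_real (mu s r)"
    "7 / 8 \<le> mu s r" "mu s r \<le> 9 / 8"
    "x \<in> {0..1} \<Longrightarrow> perturbed.eigfun pk (defect (of_real s) (of_real r)) x = of_real (G s r x)"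
    "x \<in> {0..1} \<Longrightarrow> 15 / 16 \<le> G s r x" "x \<in> {0..1} \<Longrightarrow> G s r x \<le> 17 / 16"
    "x \<in> {0..1} \<Longrightarrow> (\<lambda>k. pk k x * mr s r k x * G s r (branch k x)) sums (mu s r * G s r x)"
    "pressure s r = pressure t q + ln (mu s r)"
proof -
  interpret P: perturbed pk "defect (of_real s) (of_real r)" "\<lambda>k. \<eta> * majorant k" "\<eta> * suminf majorant"
    by (rule perturbed_real[OF sr])
  have im: "Im (defect (of_real s) (of_real r) k x) = 0" for k x
    by (simp add: defect_def mult_real)
  show ev: "P.eigval = of_real (mu s r)"
    using P.real_eigen(2)[OF im] by (simp add: mu_def complex_eq_iff)
  show ef: "P.eigfun x = of_real (G s r x)" if "x \<in> {0..1}" for x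
    using P.real_eigen(1)[OF im that] by (simp add: G_def complex_eq_iff)
  have "\<bar>mu s r - 1\<bar> \<le> 1 / 8" using P.eigval_near_1 abs_Re_le_cmod[of "P.eigval - 1"] by (simp add: ev)
  then show mb: "7 / 8 \<le> mu s r" "mu s r \<le> 9 / 8" by linarith+
  have "\<bar>G s r x - 1\<bar> \<le> 1 / 16" if "x \<in> {0..1}" for x
    using P.admissibleD(3)[OF P.admissible_eigfun that] kappa(2) abs_Re_le_cmod[of "P.eigfun x - 1"]
    by (simp add: ef[OF that])
  from this[unfolded abs_le_iff]
  show Gb: "15 / 16 \<le> G s r x" "G s r x \<le> 17 / 16" if "x \<in> {0..1}" for x
    using that by force+
  show su: "(\<lambda>k. pk k x * mr s r k x * G s r (branch k x)) sums (mu s r * G s r x)" if x: "x \<in> {0..1}" for x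
  proof -
    have "(\<lambda>k. (of_real (pk k x) + defect (of_real s) (of_real r) k x) * P.eigfun (branch k x)) sums P.pavg P.eigfun x"
      by (rule P.pavg_sums(1)[OF x P.admissibleD(5)[OF P.admissible_eigfun]])
    then have "(\<lambda>k. complex_of_real (pk k x * mr s r k x * G s r (branch k x))) sums of_real (mu s r * G s r x)"
      unfolding P.eigen_equation[OF x] ev ef[OF x] ef[OF branch_in[OF x]]
      by (simp add: defect_def mult_real algebra_simps)
    then show ?thesis by (subst (asm) sums_of_real_iff)
  qed
  have tr: "transfer s r (\<lambda>y. h y * G s r y) x = exp (pressure t q) * mu s r * (h x * G s r x)" if x: "x \<in> {0..1}" for x
  proof -
    have "(\<lambda>k. (exp (pressure t q) * h x) * (pk k x * mr s r k x * G s r (branch k x))) sums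
        ((exp (pressure t q) * h x) * (mu s r * G s r x))"
      by (rule sums_mult[OF su[OF x]])
    moreover have "(exp (pressure t q) * h x) * (pk k x * mr s r k x * G s r (branch k x)) =
        wt s r k x * (h (branch k x) * G s r (branch k x))" for k
      using pk_eq[OF x, of k] wt_near[OF x, of s r k] by (simp add: mult_ac)
    ultimately have "(\<lambda>k. wt s r k x * (h (branch k x) * G s r (branch k x))) sums
        ((exp (pressure t q) * h x) * (mu s r * G s r x))" by (simp only:)
    from sums_unique[OF this] show ?thesis unfolding transfer_def by (simp only: mult_ac)
  qed
  have hb: "1 / 256 \<le> h x" "h x \<le> 256" if "x \<in> {0..1}" for x
    using coneD(3)[OF h(1) that, of 0] coneD(3)[OF h(1) _ that, of 0] h(2) by auto
  have \<phi>: "1 / 256 * (15 / 16) \<le> h x * G s r x" "h x * G s r x \<le> 256 * (17 / 16)" if "x \<in> {0..1}" for x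
    using hb[OF that] Gb[OF that] by (intro mult_mono; simp)+
  have e0: "0 < exp (pressure t q) * mu s r" using mb by simp
  note g = gibbs_near[OF sr]
  have "ln (exp (pressure t q) * mu s r) \<le> pressure s r"
    by (rule gibbs.pressure_ge_subeigen[OF g \<phi> _ e0]) (use tr in auto)
  moreover have "pressure s r \<le> ln (exp (pressure t q) * mu s r)"
    by (rule gibbs.pressure_le_supereigen[OF g \<phi> _ e0]) (use tr in auto)
  ultimately show "pressure s r = pressure t q + ln (mu s r)"
    using mb by (simp add: ln_mult_pos)
qed

lemma in_ball_eta: "z \<in> ball (of_real a) \<eta> \<Longrightarrow> cmod (z - of_real a) \<le> \<eta>"
  by (simp add: dist_norm norm_minus_commute)

lemma defect_holomorphic:
  "(\<lambda>z. defect z w k x) holomorphic_on S" "(\<lambda>w. defect z w k x) holomorphic_on S"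
  unfolding defect_def mult_def by (intro holomorphic_intros)+

text \<open>The eigenvalue of the conjugated operator stays within \<open>1 / 8\<close> of 1, so its
  principal logarithm is holomorphic and bounded; the logarithm of the eigenvalue at
  \<open>(t, q)\<close> is added back.\<close>

lemma pressure_ranalytic: "ranalytic pressure t q"
proof -
  define ev where "ev z w = perturbed.eigval pk (defect z w)" for z w
  define f where "f z w = Ln (ev z w) + of_real (pressure t q)" for z w
  have near: "cmod (ev z w - 1) \<le> 1 / 8" if "z \<in> ball (of_real t) \<eta>" "w \<in> ball (of_real q) \<eta>" for z w
    unfolding ev_def by (rule perturbed.eigval_near_1[OF perturbed[OF in_ball_eta[OF that(1)] in_ball_eta[OF that(2)]]])
  have pos: "7 / 8 \<le> Re (ev z w)" if "z \<in> ball (of_real t) \<eta>" "w \<in> ball (of_real q) \<eta>" for z w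
    using near[OF that] abs_Re_le_cmod[of "ev z w - 1"] by simp
  have nr: "ev z w \<notin> \<real>\<^sub>\<le>\<^sub>0" if "z \<in> ball (of_real t) \<eta>" "w \<in> ball (of_real q) \<eta>" for z w
    using pos[OF that] by (auto simp: complex_nonpos_Reals_iff)
  have "sephol f (1 + pi + \<bar>pressure t q\<bar>) (of_real t) (of_real q) \<eta>"
    unfolding sephol_def
  proof (intro conjI ballI)
    show "0 < \<eta>" by (rule eta)
    fix z w assume zw: "z \<in> ball (complex_of_real t) \<eta>" "w \<in> ball (complex_of_real q) \<eta>"
    have n: "7 / 8 \<le> cmod (ev z w)" using pos[OF zw] complex_Re_le_cmod[of "ev z w"] by linarith
    have n2: "cmod (ev z w) \<le> 9 / 8"
      using near[OF zw] norm_triangle_ineq[of "ev z w - 1" 1] by simp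
    have ne: "ev z w \<noteq> 0" using n by auto
    have "ln (cmod (ev z w)) \<le> cmod (ev z w) - 1" using n by (intro ln_le_minus_one) auto
    then have "ln (cmod (ev z w)) \<le> 1" using n2 by linarith
    moreover have "- 1 \<le> ln (cmod (ev z w))"
    proof -
      have "ln (1 / cmod (ev z w)) \<le> 1 / cmod (ev z w) - 1" using n by (intro ln_le_minus_one) auto
      also have "\<dots> \<le> 1 / (7 / 8) - 1" using n by (intro diff_right_mono frac_le) auto
      also have "\<dots> \<le> (1::real)" by simp
      finally show ?thesis using ne by (simp add: ln_div)
    qed
    ultimately have "cmod (Ln (ev z w)) \<le> 1 + pi"
      using cmod_le[of "Ln (ev z w)"] mpi_less_Im_Ln[OF ne] Im_Ln_le_pi[OF ne] Re_Ln[OF ne] by auto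
    then show "cmod (f z w) \<le> 1 + pi + \<bar>pressure t q\<bar>"
      unfolding f_def by (intro norm_triangle_le) auto
  next
    fix w assume w: "w \<in> ball (complex_of_real q) \<eta>"
    have "(\<lambda>z. ev z w) holomorphic_on ball (of_real t) \<eta>" unfolding ev_def
      by (rule perturbed_holomorphic(2)[OF open_ball perturbed[OF in_ball_eta in_ball_eta[OF w]] defect_holomorphic(1)])
    then show "(\<lambda>z. f z w) holomorphic_on ball (of_real t) \<eta>"
      unfolding f_def using nr w by (intro holomorphic_intros) auto
  next
    fix z assume z: "z \<in> ball (complex_of_real t) \<eta>"
    have "(\<lambda>w. ev z w) holomorphic_on ball (of_real q) \<eta>" unfolding ev_def
      by (rule perturbed_holomorphic(2)[OF open_ball perturbed[OF in_ball_eta[OF z] in_ball_eta] defect_holomorphic(2)])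
    then show "(\<lambda>w. f z w) holomorphic_on ball (of_real q) \<eta>"
      unfolding f_def using nr z by (intro holomorphic_intros) auto
  qed
  moreover have "pressure s r = Re (f (of_real s) (of_real r))" if "\<bar>s - t\<bar> < \<eta>" "\<bar>r - q\<bar> < \<eta>" for s r
  proof -
    have sr: "\<bar>s - t\<bar> \<le> \<eta>" "\<bar>r - q\<bar> \<le> \<eta>" using that by auto
    have "0 < mu s r" using real_eigen(2)[OF sr] by simp
    then show ?thesis unfolding f_def ev_def real_eigen(1)[OF sr] real_eigen(8)[OF sr]
      by (simp add: Ln_of_real)
  qed
  ultimately show ?thesis unfolding ranalytic_def by blast
qed

text \<open>A Cauchy estimate in the complexified \<open>r\<close>, with a constant that is uniform
  in \<open>x\<close>.\<close>

lemma G_lipschitz: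
  assumes x: "x \<in> {0..1}" and r: "\<bar>r - q\<bar> < \<eta> / 2" "\<bar>r' - q\<bar> < \<eta> / 2"
  shows "\<bar>G t r x - G t r' x\<bar> \<le> 8 / \<eta> * \<bar>r - r'\<bar>"
proof -
  define g where "g w = perturbed.eigfun pk (defect (of_real t) w) x" for w
  have tt: "cmod (complex_of_real t - of_real t) \<le> \<eta>" using eta by simp
  have P: "perturbed pk (defect (of_real t) w) (\<lambda>k. \<eta> * majorant k) (\<eta> * suminf majorant)"
    if "w \<in> ball (of_real q) \<eta>" for w by (rule perturbed[OF tt in_ball_eta[OF that]])
  have hol: "g holomorphic_on ball (of_real q) \<eta>"
    unfolding g_def[abs_def] by (rule perturbed_holomorphic(1)[OF open_ball P defect_holomorphic(2) x])
  have b: "cmod (g w) \<le> 2" if "w \<in> ball (of_real q) \<eta>" for w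
    unfolding g_def by (rule perturbed.admissibleD(5)[OF P[OF that] perturbed.admissible_eigfun[OF P[OF that]] x])
  have "cmod (g (of_real r) - g (of_real r')) \<le> 4 * 2 / \<eta> * cmod (of_real r - of_real r')"
    by (rule holomorphic_bounds(2)[OF hol b eta(1)])
       (use r in \<open>auto simp: dist_norm abs_minus_commute simp flip: of_real_diff\<close>)
  moreover have "g (of_real r) = of_real (G t r x)" if "\<bar>r - q\<bar> < \<eta> / 2" for r
    unfolding g_def by (rule real_eigen(4)[OF _ _ x]) (use that eta in auto)
  ultimately show ?thesis using r by (simp flip: of_real_diff)
qed

lemma exp_away_from_1:
  fixes \<rho> \<delta> :: real
  assumes "0 < \<delta>" "\<delta> \<le> 1" "\<delta> / 2 \<le> \<rho> \<or> \<rho> \<le> - \<delta> / 2"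
  shows "(\<delta> / 4)\<^sup>2 \<le> (exp \<rho> - 1)\<^sup>2"
proof -
  have "\<delta> / 4 \<le> \<bar>exp \<rho> - 1\<bar>"
    using assms(3)
  proof
    assume "\<delta> / 2 \<le> \<rho>"
    then show ?thesis using exp_ge_add_one_self[of \<rho>] assms(1) by linarith
  next
    assume \<rho>: "\<rho> \<le> - \<delta> / 2"
    have "exp \<rho> \<le> exp (- (\<delta> / 2))" using \<rho> by simp
    also have "\<dots> = 1 / exp (\<delta> / 2)" by (simp add: exp_minus field_simps)
    also have "\<dots> \<le> 1 / (1 + \<delta> / 2)"
      using exp_ge_add_one_self[of "\<delta> / 2"] assms(1) by (intro divide_left_mono) auto
    also have "\<dots> \<le> 1 - \<delta> / 4"
      using assms(1,2) mult_left_mono[OF assms(2), of \<delta>] by (simp add: field_simps)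
    finally show ?thesis by linarith
  qed
  then show ?thesis using assms(1) by (metis abs_le_square_iff abs_of_nonneg divide_nonneg_pos less_eq_real_def zero_less_numeral)
qed

text \<open>Cauchy--Schwarz, applied branchwise to the eigenfunctions at \<open>q + \<delta>\<close> and \<open>q - \<delta>\<close>, loses at
  least \<open>c \<delta>\<^sup>2\<close>: their quotient varies by \<open>O(\<delta>)\<close>, whereas the weights \<open>\<omega>\<^sup>\<delta>\<close> of the digits
  \<open>1\<close> and \<open>K + 1\<close> differ by a factor \<open>(K + 1)\<^sup>\<delta>\<close> with \<open>K\<close> as large as we please.\<close>
lemma pressure_strictly_convex:
  obtains c d where "0 < c" "0 < d"
    "\<And>\<delta>. 0 < \<delta> \<Longrightarrow> \<delta> < d \<Longrightarrow> 2 * pressure t q + c * \<delta>\<^sup>2 \<le> pressure t (q + \<delta>) + pressure t (q - \<delta>)"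
proof -
  define C where "C = 16 / \<eta>"
  have C: "0 < C" using eta by (simp add: C_def)
  \<comment> \<open>\<open>K\<close> is chosen so that \<open>\<delta> * ln (K + 1)\<close> exceeds
    by \<open>\<delta>\<close> the possible variation \<open>2 * C * \<delta>\<close> of the
    eigenfunction terms.\<close>
  obtain K :: nat where K: "exp (2 * C + 1) \<le> real K" using real_arch_simple by blast
  have lK: "2 * C + 1 \<le> ln (real (Suc K))"
  proof -
    have "exp (2 * C + 1) \<le> real (Suc K)" using K by simp
    then show ?thesis by (subst ln_ge_iff) auto
  qed
  define p0 where "p0 = Min {1, pk 0 0 * exp (- 16 * ln 2), pk K 0 * exp (- 16 * ln 2)}"
  have pkpos: "0 < pk k 0" for k
    using wt_pos[of 0 k] coneD(1)[OF h(1), of "branch k 0" "branch k 0"] branch_in[of 0 k]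
      coneD(1)[OF cone_transfer[OF h(1)], of 0 0]
    by (simp add: kernel_def)
  have p0: "0 < p0" using pkpos by (simp add: p0_def)
  have p01: "p0 \<le> 1" "p0 \<le> pk 0 0 * exp (- 16 * ln 2)" "p0 \<le> pk K 0 * exp (- 16 * ln 2)"
    unfolding p0_def by (rule Min_le; simp)+
  have pk_ge: "p0 \<le> pk k x" if "k \<in> {0, K}" "x \<in> {0..1}" for k x
  proof -
    have "p0 \<le> pk k 0 * exp (- 16 * ln 2)" using that(1) p01 by auto
    also have "\<dots> \<le> pk k 0 * exp (- 16 * ldist x 0)"
      using ldist_le_ln2[OF that(2), of 0] pkpos[of k] by (intro mult_left_mono) auto
    also have "\<dots> \<le> pk k x"
      using markov_kernelD(5)[OF pk_markov that(2), of 0 k] by (simp add: mult.commute)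
    finally show ?thesis .
  qed
  define c0 where "c0 = p0 / (64 * real (Suc K))"
  have c0: "0 < c0" "c0 \<le> 1 / 64"
    using p0 p01(1) by (auto simp: c0_def field_simps)
  have main: "2 * pressure t q + 2 * c0 * \<delta>\<^sup>2 \<le> pressure t (q + \<delta>) + pressure t (q - \<delta>)"
    if \<delta>: "0 < \<delta>" "\<delta> < \<eta> / 2" for \<delta>
  proof -
    have \<delta>1: "\<delta> \<le> 1" using \<delta> eta by simp
    have tt: "\<bar>t - t\<bar> \<le> \<eta>" and qp: "\<bar>(q + \<delta>) - q\<bar> \<le> \<eta>" and qm: "\<bar>(q - \<delta>) - q\<bar> \<le> \<eta>"
      using \<delta> eta by auto
    define U where "U = G t (q + \<delta>)"
    define W where "W = G t (q - \<delta>)"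
    define m where "m = mu t (q + \<delta>)"
    define n where "n = mu t (q - \<delta>)"
    note ep = real_eigen[OF tt qp] and em = real_eigen[OF tt qm]
    have U: "15 / 16 \<le> U x" "U x \<le> 17 / 16" and W: "15 / 16 \<le> W x" "W x \<le> 17 / 16" if "x \<in> {0..1}" for x
      using ep(5,6) em(5,6) that by (auto simp: U_def W_def)
    have m: "7 / 8 \<le> m" "m \<le> 9 / 8" and n: "7 / 8 \<le> n" "n \<le> 9 / 8"
      using ep(2,3) em(2,3) by (auto simp: m_def n_def)
    have UW: "\<bar>ln (U x) - ln (W x)\<bar> \<le> 2 * C * \<delta>" if x: "x \<in> {0..1}" for x
    proof -
      have "\<bar>U x - W x\<bar> \<le> 8 / \<eta> * \<bar>(q + \<delta>) - (q - \<delta>)\<bar>"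
        unfolding U_def W_def by (rule G_lipschitz[OF x]) (use \<delta> in auto)
      also have "\<dots> = C * \<delta>" using \<delta> by (simp add: C_def)
      finally have d: "\<bar>U x - W x\<bar> \<le> C * \<delta>" .
      have l: "ln a - ln b \<le> 2 * \<bar>a - b\<bar>" if "15 / 16 \<le> a" "15 / 16 \<le> b" for a b :: real
      proof -
        have "ln a - ln b = ln (a / b)" using that by (simp add: ln_div)
        also have "\<dots> \<le> a / b - 1" using that by (intro ln_le_minus_one) auto
        also have "\<dots> = (a - b) / b" using that by (simp add: field_simps)
        also have "\<dots> \<le> \<bar>a - b\<bar> / (15 / 16)" using that by (intro frac_le) auto
        also have "\<dots> \<le> 2 * \<bar>a - b\<bar>" by simp
        finally show ?thesis .
      qed
      have "ln (U x) - ln (W x) \<le> 2 * (C * \<delta>)"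
        using l[OF U(1)[OF x] W(1)[OF x]] mult_left_mono[OF d, of 2] by simp
      moreover have "ln (W x) - ln (U x) \<le> 2 * (C * \<delta>)"
        using l[OF W(1)[OF x] U(1)[OF x]] mult_left_mono[OF d, of 2]
        by (simp add: abs_minus_commute)
      ultimately show ?thesis by (simp add: abs_le_iff)
    qed
    \<comment> \<open>The geometric mean of the two eigenfunctions serves as test function at
      \<open>q\<close>, since the weights at \<open>q + \<delta>\<close> and
      \<open>q - \<delta>\<close> have those at \<open>q\<close> as geometric mean.\<close>
    define g where "g x = sqrt (U x * W x)" for x
    have key: "(\<Sum>k. pk k x * g (branch k x)) \<le> (1 - c0 * \<delta>\<^sup>2) * sqrt (m * n) * g x"
      and sg: "summable (\<lambda>k. pk k x * g (branch k x))" if x: "x \<in> {0..1}" for x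
    proof -
      note p0' = markov_kernelD(1)[OF pk_markov x]
      note Ub = U[OF branch_in[OF x]] and Wb = W[OF branch_in[OF x]]
      define l where "l k = ln (real (Suc k))" for k
      define A where "A = m * U x"
      define B where "B = n * W x"
      have AB: "0 < A" "0 < B" using m n U[OF x] W[OF x] by (auto simp: A_def B_def)
      \<comment> \<open>By the two eigenvalue equations \<open>a\<close> and \<open>b\<close> are
        probability distributions over the branches; the sum of
        \<open>sqrt (a k) * sqrt (b k)\<close> falls short of 1 by \<open>suminf f\<close>.\<close>
      define a where "a k = pk k x * exp (\<delta> * l k) * U (branch k x) / A" for k
      define b where "b k = pk k x * exp (- \<delta> * l k) * W (branch k x) / B" for k
      have a0: "0 \<le> a k" and b0: "0 \<le> b k" for k
        using AB p0' Ub[of k] Wb[of k] by (auto simp: a_def b_def intro!: divide_nonneg_pos mult_nonneg_nonneg)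
      have sa: "a sums 1"
      proof -
        have "(\<lambda>k. pk k x * mr t (q + \<delta>) k x * U (branch k x)) sums A"
          using ep(7)[OF x] by (simp add: A_def U_def m_def)
        from sums_divide[OF this, of A] show ?thesis
          using AB by (simp add: a_def[abs_def] mr_def l_def)
      qed
      have sb: "b sums 1"
      proof -
        have "(\<lambda>k. pk k x * mr t (q - \<delta>) k x * W (branch k x)) sums B"
          using em(7)[OF x] by (simp add: B_def W_def n_def)
        from sums_divide[OF this, of B] show ?thesis
          using AB by (simp add: b_def[abs_def] mr_def l_def)
      qed
      have prod: "sqrt (a k) * sqrt (b k) = pk k x * g (branch k x) / sqrt (A * B)" for k
      proof -
        have "a k * b k = (pk k x)\<^sup>2 * (U (branch k x) * W (branch k x)) / (A * B)"
          by (simp add: a_def b_def power2_eq_square exp_minus field_simps)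
        then show ?thesis
          unfolding real_sqrt_mult[symmetric] g_def using p0'[of k]
          by (simp add: real_sqrt_divide real_sqrt_mult)
      qed
      define f where "f k = (a k + b k) / 2 - sqrt (a k) * sqrt (b k)" for k
      have fsq: "f k = (sqrt (a k) - sqrt (b k))\<^sup>2 / 2" for k
        using a0[of k] b0[of k] by (simp add: f_def power2_diff field_simps)
      have f0: "0 \<le> f k" for k by (simp add: fsq)
      have sum_ab: "summable (\<lambda>k. (a k + b k) / 2)" "(\<Sum>k. (a k + b k) / 2) = 1"
        using sums_divide[OF sums_add[OF sa sb], of 2] by (auto simp: sums_iff)
      have sprod: "summable (\<lambda>k. sqrt (a k) * sqrt (b k))"
      proof (rule summable_comparison_test'[OF sum_ab(1)])
        show "norm (sqrt (a k) * sqrt (b k)) \<le> (a k + b k) / 2" for k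
          using f0[of k] a0[of k] b0[of k] by (simp add: f_def abs_mult)
      qed
      have sf: "summable f" unfolding f_def[abs_def] by (rule summable_diff[OF sum_ab(1) sprod])
      have sumf: "suminf f = 1 - (\<Sum>k. sqrt (a k) * sqrt (b k))"
        unfolding f_def[abs_def] using suminf_diff[OF sum_ab(1) sprod] sum_ab(2) by simp
      \<comment> \<open>Half of \<open>ln (a k / b k)\<close>; the last term is the same for all
        \<open>k\<close> and cancels in \<open>\<rho> K - \<rho> 0\<close>.\<close>
      define \<rho> where "\<rho> k = \<delta> * l k + (ln (U (branch k x)) - ln (W (branch k x))) / 2 - (ln A - ln B) / 2" for k
      have ratio: "sqrt (a k) = sqrt (b k) * exp (\<rho> k)" for k
      proof -
        have "exp (2 * \<rho> k) = exp (\<delta> * l k + \<delta> * l k + (ln (U (branch k x)) - ln (W (branch k x))) - (ln A - ln B))"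
          by (simp add: \<rho>_def field_simps)
        also have "\<dots> = exp (\<delta> * l k) * exp (\<delta> * l k) * (U (branch k x) / W (branch k x)) / (A / B)"
          unfolding exp_add exp_diff using AB Ub[of k] Wb[of k] by simp
        finally have "a k = b k * exp (2 * \<rho> k)"
          using AB Wb[of k] by (simp add: a_def b_def exp_minus field_simps)
        then have "sqrt (a k) = sqrt (b k) * sqrt ((exp (\<rho> k))\<^sup>2)"
          by (simp add: real_sqrt_mult exp_double)
        then show ?thesis by simp
      qed
      have "\<delta> \<le> \<rho> K - \<rho> 0"
      proof -
        define e where "e = C * \<delta>"
        have "\<delta> * (2 * C + 1) \<le> \<delta> * l K" using lK \<delta> by (simp add: l_def)
        moreover define v where "v = \<delta> * l K"
        ultimately have "2 * e + \<delta> \<le> v" by (simp add: e_def algebra_simps)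
        moreover have "l 0 = 0" by (simp add: l_def)
        ultimately show ?thesis
          using UW[OF branch_in[OF x, of K], unfolded mult.assoc e_def[symmetric]]
            UW[OF branch_in[OF x, of 0], unfolded mult.assoc e_def[symmetric]]
          unfolding \<rho>_def v_def[symmetric] abs_le_iff by (simp, elim conjE, argo)
      qed
      then have "\<delta> / 2 \<le> \<rho> K \<or> \<rho> 0 \<le> - \<delta> / 2" by linarith
      then obtain k where k: "k \<in> {0, K}" "\<delta> / 2 \<le> \<rho> k \<or> \<rho> k \<le> - \<delta> / 2" by blast
      have bk: "p0 / (2 * real (Suc K)) \<le> b k"
      proof -
        have "l k \<le> ln (real (Suc K))" using k(1) by (auto simp: l_def)
        then have "\<delta> * l k \<le> 1 * ln (real (Suc K))" using \<delta> \<delta>1 by (intro mult_mono) (auto simp: l_def)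
        then have "exp (- ln (real (Suc K))) \<le> exp (- \<delta> * l k)" by simp
        then have e: "1 / real (Suc K) \<le> exp (- \<delta> * l k)" by (simp add: exp_minus inverse_eq_divide del: of_nat_Suc)
        have B: "B \<le> 9 / 8 * (17 / 16)" unfolding B_def using n W[OF x] by (intro mult_mono) auto
        have "p0 / (2 * real (Suc K)) = p0 * (1 / real (Suc K)) * (1 / 2)" by simp
        also have "\<dots> \<le> pk k x * exp (- \<delta> * l k) * (W (branch k x) / B)"
        proof (intro mult_mono)
          have "1 / 2 \<le> (15 / 16) / (9 / 8 * (17 / 16) :: real)" by simp
          also have "\<dots> \<le> W (branch k x) / B" using B AB Wb[of k] by (intro frac_le) auto
          finally show "1 / 2 \<le> W (branch k x) / B" .
        qed (use pk_ge[OF k(1) x] p0 e in auto)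
        finally show ?thesis by (simp add: b_def)
      qed
      have "c0 * \<delta>\<^sup>2 \<le> f k"
      proof -
        have "f k = b k * (exp (\<rho> k) - 1)\<^sup>2 / 2"
        proof -
          have "(y * e - y)\<^sup>2 = y\<^sup>2 * (e - 1)\<^sup>2" for y e :: real
            by (simp add: power2_eq_square algebra_simps)
          then show ?thesis unfolding fsq ratio using b0[of k] by simp
        qed
        also have "\<dots> \<ge> p0 / (2 * real (Suc K)) * (\<delta> / 4)\<^sup>2 / 2"
          using bk exp_away_from_1[OF \<delta>(1) \<delta>1 k(2)] b0[of k]
          by (intro divide_right_mono mult_mono) auto
        also have "p0 / (2 * real (Suc K)) * (\<delta> / 4)\<^sup>2 / 2 = c0 * \<delta>\<^sup>2"
          by (simp add: c0_def power2_eq_square)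
        finally show ?thesis .
      qed
      also have "f k = sum f {k}" by simp
      also have "\<dots> \<le> suminf f" by (rule sum_le_suminf[OF sf]) (auto simp: f0)
      finally have T: "(\<Sum>k. sqrt (a k) * sqrt (b k)) \<le> 1 - c0 * \<delta>\<^sup>2" using sumf by simp
      have sAB: "sqrt (A * B) = sqrt (m * n) * g x"
        by (simp add: A_def B_def g_def real_sqrt_mult)
      have sAB0: "0 < sqrt (A * B)" using AB by simp
      have su0: "(\<lambda>k. sqrt (A * B) * (sqrt (a k) * sqrt (b k))) sums (sqrt (A * B) * (\<Sum>k. sqrt (a k) * sqrt (b k)))"
        by (intro sums_mult summable_sums sprod)
      have su: "(\<lambda>k. pk k x * g (branch k x)) sums (sqrt (A * B) * (\<Sum>k. sqrt (a k) * sqrt (b k)))"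
      proof -
        have "sqrt (A * B) * (sqrt (a k) * sqrt (b k)) = pk k x * g (branch k x)" for k
          unfolding prod using AB by simp
        then show ?thesis using su0 by (simp only:)
      qed
      then show "summable (\<lambda>k. pk k x * g (branch k x))" by (simp add: sums_iff)
      have "(\<Sum>k. pk k x * g (branch k x)) \<le> sqrt (A * B) * (1 - c0 * \<delta>\<^sup>2)"
        using su T sAB0 by (simp add: sums_iff)
      then show "(\<Sum>k. pk k x * g (branch k x)) \<le> (1 - c0 * \<delta>\<^sup>2) * sqrt (m * n) * g x"
        unfolding sAB by (simp add: mult_ac)
    qed
    have g: "15 / 16 \<le> g x" "g x \<le> 17 / 16" if x: "x \<in> {0..1}" for x
    proof -
      have uw: "(15 / 16)\<^sup>2 \<le> U x * W x" "U x * W x \<le> (17 / 16)\<^sup>2"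
        unfolding power2_eq_square using U[OF x] W[OF x] by (intro mult_mono; simp)+
      show "15 / 16 \<le> g x" unfolding g_def by (rule real_le_rsqrt[OF uw(1)])
      show "g x \<le> 17 / 16" unfolding g_def by (rule real_le_lsqrt) (use uw in auto)
    qed
    \<comment> \<open>With this factor the product of \<open>h\<close> and \<open>g\<close> is a
      supereigenfunction at \<open>q\<close>; taking logarithms turns the defect into strict
      convexity.\<close>
    define b where "b = exp (pressure t q) * ((1 - c0 * \<delta>\<^sup>2) * sqrt (m * n))"
    have y: "c0 * \<delta>\<^sup>2 \<le> 1 / 64"
    proof -
      have "c0 * \<delta>\<^sup>2 \<le> 1 / 64 * 1\<^sup>2" using c0 \<delta> \<delta>1 by (intro mult_mono power_mono) auto
      then show ?thesis by simp
    qed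
    have mn: "0 < m * n" using m n by simp
    have b0: "0 < b" using y mn by (simp add: b_def)
    have hb: "1 / 256 \<le> h x" "h x \<le> 256" if "x \<in> {0..1}" for x
      using coneD(3)[OF h(1) that, of 0] coneD(3)[OF h(1) _ that, of 0] h(2) by auto
    have hg: "1 / 256 * (15 / 16) \<le> h x * g x" "h x * g x \<le> 256 * (17 / 16)" if "x \<in> {0..1}" for x
      using hb[OF that] g[OF that] by (intro mult_mono; simp)+
    have "pressure t q \<le> ln b"
    proof (rule pressure_le_supereigen[OF hg _ b0])
      fix x :: real assume x: "x \<in> {0..1}"
      have "transfer t q (\<lambda>y. h y * g y) x = (\<Sum>k. (exp (pressure t q) * h x) * (pk k x * g (branch k x)))"
        unfolding transfer_def using pk_eq[OF x] by (simp add: mult.assoc[symmetric])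
      also have "\<dots> = (exp (pressure t q) * h x) * (\<Sum>k. pk k x * g (branch k x))"
        by (rule suminf_mult[OF sg[OF x]])
      also have "\<dots> \<le> (exp (pressure t q) * h x) * ((1 - c0 * \<delta>\<^sup>2) * sqrt (m * n) * g x)"
        using key[OF x] hb(1)[OF x] by (intro mult_left_mono) auto
      finally show "transfer t q (\<lambda>y. h y * g y) x \<le> b * (h x * g x)" by (simp add: b_def mult_ac)
    qed auto
    also have "ln b = pressure t q + (ln (1 - c0 * \<delta>\<^sup>2) + (ln m + ln n) / 2)"
      using y m n mn by (simp add: b_def ln_mult_pos ln_sqrt)
    also have "ln (1 - c0 * \<delta>\<^sup>2) \<le> - (c0 * \<delta>\<^sup>2)"
      using ln_le_minus_one[of "1 - c0 * \<delta>\<^sup>2"] y by simp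
    finally have "2 * (c0 * \<delta>\<^sup>2) \<le> ln m + ln n" by simp
    then show ?thesis using ep(8) em(8) by (simp add: m_def n_def)
  qed
  show ?thesis by (rule that[of "2 * c0" "\<eta> / 2"]) (use c0 eta main in auto)
qed

end

section \<open>The Gauss measure and the pressure at \<open>t = 1\<close>\<close>

lemma gibbs_1: "q < 1 \<Longrightarrow> gibbs 1 q"
  by (simp add: gibbs_def)

text \<open>Up to the factor \<open>1 / ln 2\<close> the density of the Gauss measure; it is the
  eigenfunction at \<open>(1, 0)\<close>.\<close>

definition gauss_density :: "real \<Rightarrow> real" where
  "gauss_density x = 1 / (1 + x)"

lemma dcone_gauss_density: "dcone gauss_density"
  unfolding dcone_def
proof (intro ballI conjI)
  fix x y :: real assume x: "x \<in> {0..1}" and y: "y \<in> {0..1}"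
  show "0 < gauss_density x" using x by (simp add: gauss_density_def)
  have "(1 + y) / (1 + x) = exp (ln (1 + y) - ln (1 + x))" using x y by (simp add: exp_diff)
  also have "\<dots> \<le> exp (8 * ldist x y)" 
  proof -
    have "a - b \<le> 8 * \<bar>b - a\<bar>" for a b :: real by (simp add: abs_if)
    then show ?thesis by (simp add: ldist_def)
  qed
  finally have "(1 + y) / (1 + x) \<le> exp (8 * ldist x y)" .
  then show "gauss_density x \<le> exp (8 * ldist x y) * gauss_density y"
    using x y by (simp add: gauss_density_def field_simps)
qed

lemma wt_1: "0 \<le> x \<Longrightarrow> wt 1 q k x = real (Suc k) powr q * (branch k x)\<^sup>2"
  using branch_pos[of x k] by (simp add: wt_def)

definition gauss_weight :: "nat \<Rightarrow> real \<Rightarrow> real" where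
  "gauss_weight k x = 1 / ((real k + 1 + x) * (real k + 2 + x))"

lemma gauss_weight_eq:
  "0 \<le> x \<Longrightarrow> gauss_weight k x = (branch k x)\<^sup>2 * gauss_density (branch k x)"
proof -
  assume x: "0 \<le> x"
  define c where "c = real (Suc k) + x"
  have c: "0 < c" using x by (simp add: c_def add_pos_nonneg)
  have "gauss_weight k x = 1 / (c * (1 + c))" by (simp add: gauss_weight_def c_def add_ac)
  moreover have "(branch k x)\<^sup>2 * gauss_density (branch k x) = (1 / c)\<^sup>2 * (1 / (1 + 1 / c))"
    by (simp only: branch_def c_def gauss_density_def)
  moreover have "(1 / c)\<^sup>2 * (1 / (1 + 1 / c)) = 1 / (c * (1 + c))"
    using c by (simp add: divide_simps power2_eq_square)
  ultimately show ?thesis by simp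
qed

text \<open>The weight is the telescoping difference
  \<open>1 / (k + 1 + x) - 1 / (k + 2 + x)\<close>. This identity is the invariance of the Gauss
  measure.\<close>

lemma gauss_weight_sums: "0 \<le> x \<Longrightarrow> (\<lambda>k. gauss_weight k x) sums gauss_density x"
proof -
  assume x: "0 \<le> x"
  have "(\<lambda>k. 1 / (real k + 1 + x) - 1 / (real (Suc k) + 1 + x)) sums (1 / (real 0 + 1 + x) - 0)"
    by (rule telescope_sums') real_asymp
  moreover have "1 / (real k + 1 + x) - 1 / (real (Suc k) + 1 + x) = gauss_weight k x" for k
    using x by (simp add: gauss_weight_def field_simps)
  ultimately show ?thesis by (simp add: gauss_density_def)
qed

lemma pressure_1_0: "pressure 1 0 = 0"
proof -
  have "transfer 1 0 gauss_density x = 1 * gauss_density x" if "x \<in> {0..1}" for x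
    using gauss_weight_sums[of x] that
    by (simp add: transfer_def wt_1 gauss_weight_eq sums_iff)
  from gibbs.pressure_eq_ln[OF gibbs_1 dcone_gauss_density _ this] show ?thesis by simp
qed

lemma gauss_weight_nonneg: "0 \<le> x \<Longrightarrow> 0 \<le> gauss_weight k x"
  by (simp add: gauss_weight_def)

lemma gauss_weight_le: "0 \<le> x \<Longrightarrow> gauss_weight k x \<le> 1 / (real (Suc k))\<^sup>2"
  unfolding gauss_weight_def power2_eq_square by (intro divide_left_mono mult_mono) auto

lemma summable_ln_square: "summable (\<lambda>k. (a * ln (real (Suc k)) + b) / (real (Suc k))\<^sup>2)"
proof -
  have s1: "summable (\<lambda>k. ln (real (Suc k)) / (real (Suc k))\<^sup>2)"
  proof (rule summable_comparison_test')
    show "summable (\<lambda>k. 2 * real (Suc k) powr (- (3 / 2)))"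
      by (intro summable_mult, subst summable_Suc_iff) (simp add: summable_real_powr_iff)
    fix k
    have "ln (real (Suc k)) \<le> real (Suc k) powr (1 / 2) / (1 / 2)" by (rule ln_powr_bound) auto
    then have "ln (real (Suc k)) / (real (Suc k))\<^sup>2 \<le> 2 * real (Suc k) powr (1 / 2) / real (Suc k) powr 2"
      by (simp add: divide_right_mono powr_numeral del: of_nat_Suc)
    also have "\<dots> = 2 * real (Suc k) powr (- (3 / 2))"
      by (simp only: powr_diff[symmetric] times_divide_eq_right[symmetric]) simp
    finally show "norm (ln (real (Suc k)) / (real (Suc k))\<^sup>2) \<le> 2 * real (Suc k) powr (- (3 / 2))"
      by (simp del: of_nat_Suc)
  qed
  have s2: "summable (\<lambda>k. 1 / (real (Suc k))\<^sup>2)"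
    using inverse_squares_sums by (simp add: sums_iff add.commute)
  show ?thesis
    using summable_add[OF summable_mult[OF s1, of a] summable_mult[OF s2, of b]]
    by (simp add: add_divide_distrib)
qed

text \<open>This is \<open>ln 2\<close> times the Gauss measure of the set where the first digit is
  \<open>k + 1\<close>.\<close>

definition gauss_mass :: "nat \<Rightarrow> real" where
  "gauss_mass k = ln (1 + 1 / (real k + 1)) - ln (1 + 1 / (real k + 2))"

text \<open>Substitution of the branch: the factor \<open>(branch k x)\<^sup>2\<close> in
  \<open>gauss_weight\<close> is the modulus of its derivative, and \<open>- H (branch k x)\<close>
  is a primitive. Summed over \<open>k\<close> the right sides telescope.\<close>

lemma branch_weight_integral:
  assumes g: "continuous_on {0..1} g"
    and H: "\<And>y. H y = integral {0..y} (\<lambda>s. g s / (1 + s))"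
  shows "((\<lambda>x. gauss_weight k x * g (branch k x)) has_integral (H (1 / (real k + 1)) - H (1 / (real k + 2)))) {0..1}"
proof -
  define f where "f s = g s / (1 + s)" for s
  have fc: "continuous_on {0..1} f"
    unfolding f_def by (intro continuous_intros g) auto
  have dH: "(H has_real_derivative f y) (at y within {0..1})" if "y \<in> {0..1}" for y
  proof -
    have "((\<lambda>y. integral {0..y} f) has_real_derivative f y) (at y within {0..1})"
      by (rule integral_has_real_derivative[OF fc that])
    then show ?thesis by (simp add: H[abs_def] f_def[abs_def])
  qed
  have "((\<lambda>x. gauss_weight k x * g (branch k x)) has_integral (- H (branch k 1) - (- H (branch k 0)))) {0..1}"
  proof (rule fundamental_theorem_of_calculus)
    fix x :: real assume x: "x \<in> {0..1}"
    have b: "(branch k has_real_derivative - (1 / (real (Suc k) + x)\<^sup>2)) (at x within {0..1})"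
      unfolding branch_def[abs_def] using x
      by (auto intro!: derivative_eq_intros simp: power2_eq_square field_simps)
    have "(H has_real_derivative f (branch k x)) (at (branch k x) within branch k ` {0..1})"
      by (rule DERIV_subset[OF dH[OF branch_in[OF x]]]) (use branch_in in auto)
    from DERIV_image_chain[OF this b]
    have "((\<lambda>x. - H (branch k x)) has_real_derivative - (f (branch k x) * - (1 / (real (Suc k) + x)\<^sup>2))) (at x within {0..1})"
      unfolding o_def by (rule DERIV_minus)
    moreover have "- (f (branch k x) * - (1 / (real (Suc k) + x)\<^sup>2)) = gauss_weight k x * g (branch k x)"
      using x by (simp add: gauss_weight_eq f_def gauss_density_def branch_def power_one_over)
    ultimately show "((\<lambda>x. - H (branch k x)) has_vector_derivative gauss_weight k x * g (branch k x)) (at x within {0..1})"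
      by (simp add: has_real_derivative_iff_has_vector_derivative)
  qed simp
  then show ?thesis by (simp add: branch_def add_ac)
qed

lemma inverse_shift_integral:
  fixes a b :: real
  assumes "0 \<le> a" "a \<le> b" shows "((\<lambda>s. 1 / (1 + s)) has_integral (ln (1 + b) - ln (1 + a))) {a..b}"
proof (rule fundamental_theorem_of_calculus[OF assms(2)])
  fix x assume "x \<in> {a..b}"
  then have "0 < 1 + x" using assms by simp
  then have "((\<lambda>s. ln (1 + s)) has_real_derivative 1 / (1 + x)) (at x within {a..b})"
    by (auto intro!: derivative_eq_intros)
  then show "((\<lambda>s. ln (1 + s)) has_vector_derivative 1 / (1 + x)) (at x within {a..b})"
    by (simp add: has_real_derivative_iff_has_vector_derivative)
qed

lemma gauss_mass_integral: "((\<lambda>x. gauss_weight k x) has_integral gauss_mass k) {0..1}"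
proof -
  have H: "ln (1 + 1 / (real k + j)) = integral {0..1 / (real k + j)} (\<lambda>s. 1 / (1 + s))" if "0 < j" for j
    using integral_unique[OF inverse_shift_integral[of 0 "1 / (real k + j)"]] that by simp
  show ?thesis
    using branch_weight_integral[of "\<lambda>_. 1" "\<lambda>y. integral {0..y} (\<lambda>s. 1 / (1 + s))" k]
    by (simp add: gauss_mass_def H)
qed

lemma gauss_mass_bounds: "0 \<le> gauss_mass k" "gauss_mass k \<le> 1 / (real (Suc k))\<^sup>2"
proof -
  show "0 \<le> gauss_mass k"
    by (rule has_integral_nonneg[OF gauss_mass_integral]) (simp add: gauss_weight_nonneg)
  have "((\<lambda>x. 1 / (real (Suc k))\<^sup>2) has_integral (1 / (real (Suc k))\<^sup>2)) {0..1::real}"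
    using has_integral_const_real[of "1 / (real (Suc k))\<^sup>2" 0 1] by simp
  then show "gauss_mass k \<le> 1 / (real (Suc k))\<^sup>2"
    by (rule has_integral_le[OF gauss_mass_integral]) (use gauss_weight_le in auto)
qed

lemma gauss_mass_ln_summable: "summable (\<lambda>k. ln (real (Suc k)) * gauss_mass k)"
proof (rule summable_comparison_test')
  show "summable (\<lambda>k. (1 * ln (real (Suc k)) + 0) / (real (Suc k))\<^sup>2)" by (rule summable_ln_square)
  show "norm (ln (real (Suc k)) * gauss_mass k) \<le> (1 * ln (real (Suc k)) + 0) / (real (Suc k))\<^sup>2" for k
    using mult_left_mono[OF gauss_mass_bounds(2)[of k], of "ln (real (Suc k))"] gauss_mass_bounds(1)[of k]
    by (simp add: abs_mult del: of_nat_Suc)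
qed

lemma partial_quotient_1_eq:
  assumes "0 < x" "x < 1"
  shows "partial_quotient 1 x = int (Suc k) \<longleftrightarrow> x \<in> {1 / (real k + 2)<..1 / (real k + 1)}"
proof -
  have "\<lfloor>1 / x\<rfloor> = int (Suc k) \<longleftrightarrow> real k + 1 \<le> 1 / x \<and> 1 / x < real k + 2"
    by (simp add: floor_eq_iff add_ac)
  also have "\<dots> \<longleftrightarrow> x \<in> {1 / (real k + 2)<..1 / (real k + 1)}"
    using assms by (auto simp: field_simps)
  finally show ?thesis by (simp add: partial_quotient_def)
qed

text \<open>Decompose the interval by the first digit. The integrand is nonnegative, so sum and
  integral may be exchanged in \<open>ennreal\<close>.\<close>

lemma xi0_eq: "xi0 = (\<Sum>k. ln (real (Suc k)) * gauss_mass k) / ln 2"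
proof -
  define I where "I k = {1 / (real k + 2)<..1 / (real k + 1)}" for k :: nat
  have Im: "I k \<in> sets lborel" for k by (simp add: I_def)
  define f where "f x = ln (real_of_int (partial_quotient 1 x)) * (1 / (1 + x)) * indicator {0..<1} x" for x :: real
  have pq: "partial_quotient 1 = (\<lambda>x. \<lfloor>1 / x\<rfloor>)" by (simp add: partial_quotient_def fun_eq_iff)
  have m1: "(\<lambda>x. ln (real_of_int (partial_quotient 1 x))) \<in> borel_measurable borel"
    unfolding pq by measurable
  have fm: "f \<in> borel_measurable borel" unfolding f_def using m1 by measurable
  have gm: "(\<lambda>x. 1 / ((1 + x) * ln 2)) \<in> borel_measurable (restrict_space lborel {0..<1::real})"
    by (intro measurable_restrict_space1) measurable
  have "xi0 = integral\<^sup>L (restrict_space lborel {0..<1}) (\<lambda>x. (1 / ((1 + x) * ln 2)) *\<^sub>R ln (real_of_int (partial_quotient 1 x)))"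
    unfolding xi0_def gauss_measure_def
    by (rule integral_density) (auto intro!: measurable_restrict_space1 m1 gm AE_I2 simp: space_restrict_space simp del: One_nat_def)
  also have "\<dots> = integral\<^sup>L lborel (\<lambda>x. indicator {0..<1} x *\<^sub>R ((1 / ((1 + x) * ln 2)) *\<^sub>R ln (real_of_int (partial_quotient 1 x))))"
    by (rule integral_restrict_space) auto
  also have "\<dots> = integral\<^sup>L lborel (\<lambda>x. f x / ln 2)"
    by (intro Bochner_Integration.integral_cong) (auto simp: f_def mult_ac)
  also have "\<dots> = integral\<^sup>L lborel f / ln 2" by simp
  finally have 1: "xi0 = integral\<^sup>L lborel f / ln 2" .
  have pnn: "0 \<le> ln (real_of_int (partial_quotient 1 x))" if "0 \<le> x" "x < 1" for x
  proof (cases "x = 0")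
    case True then show ?thesis by (simp add: partial_quotient_def)
  next
    case False
    then have "1 \<le> 1 / x" using that by (simp add: field_simps)
    then have "1 \<le> \<lfloor>1 / x\<rfloor>" by (simp add: le_floor_iff)
    then show ?thesis by (simp add: partial_quotient_def)
  qed
  have f0: "0 \<le> f x" for x
    using pnn[of x] by (auto simp: f_def indicator_def)
  have fe: "ennreal (f x) = (\<Sum>k. ennreal (ln (real (Suc k))) * (ennreal (1 / (1 + x)) * indicator (I k) x))" if "x \<noteq> 1" for x
  proof (cases "0 < x \<and> x < 1")
    case True
    define j where "j = nat (partial_quotient 1 x) - 1"
    have "1 \<le> 1 / x" using True by (simp add: field_simps)
    then have "1 \<le> partial_quotient 1 x" by (simp add: partial_quotient_def le_floor_iff)
    then have j: "partial_quotient 1 x = int (Suc j)" by (simp add: j_def)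
    have xj: "x \<in> I k \<longleftrightarrow> k = j" for k
      using partial_quotient_1_eq[of x k] True j by (auto simp: I_def)
    have "(\<lambda>k. ennreal (ln (real (Suc k))) * (ennreal (1 / (1 + x)) * indicator (I k) x)) =
       (\<lambda>k. if k = j then ennreal (ln (real (Suc j))) * ennreal (1 / (1 + x)) else 0)"
      by (auto simp: fun_eq_iff xj indicator_def)
    moreover have "(\<lambda>k. if k = j then ennreal (ln (real (Suc j))) * ennreal (1 / (1 + x)) else 0) sums (ennreal (ln (real (Suc j))) * ennreal (1 / (1 + x)))"
      by (rule sums_single)
    ultimately have "(\<Sum>k. ennreal (ln (real (Suc k))) * (ennreal (1 / (1 + x)) * indicator (I k) x)) = ennreal (ln (real (Suc j))) * ennreal (1 / (1 + x))"
      by (simp add: sums_iff)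
    also have "\<dots> = ennreal (ln (real (Suc j)) * (1 / (1 + x)))"
      using True by (intro ennreal_mult[symmetric]) auto
    also have "ln (real (Suc j)) * (1 / (1 + x)) = f x" using True j by (simp add: f_def)
    finally show ?thesis by simp
  next
    case False
    have "x \<notin> I k" for k
    proof
      assume "x \<in> I k"
      then have "1 / (real k + 2) < x" "x \<le> 1 / (real k + 1)" by (auto simp: I_def)
      moreover have "0 < 1 / (real k + 2)" "1 / (real k + 1) \<le> 1" by auto
      ultimately have "0 < x" "x \<le> 1" by linarith+
      then show False using False that by auto
    qed
    moreover have "f x = 0" using False that
      by (cases "x = 0") (auto simp: f_def indicator_def partial_quotient_def)
    ultimately show ?thesis by simp
  qed
  have each: "(\<integral>\<^sup>+x. ennreal (1 / (1 + x)) * indicator (I k) x \<partial>lborel) = ennreal (gauss_mass k)" for k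
  proof -
    define a b where "a = 1 / (real k + 2)" and "b = 1 / (real k + 1)"
    have ab: "0 \<le> a" "a \<le> b" by (auto simp: a_def b_def field_simps)
    have Iab: "I k = {a<..b}" by (simp add: I_def a_def b_def)
    have "(\<integral>\<^sup>+x. ennreal (1 / (1 + x)) * indicator (I k) x \<partial>lborel) = (\<integral>\<^sup>+x. ennreal (1 / (1 + x)) * indicator {a..b} x \<partial>lborel)"
    proof (rule nn_integral_cong_AE)
      show "AE x in lborel. ennreal (1 / (1 + x)) * indicator (I k) x = ennreal (1 / (1 + x)) * indicator {a..b} x"
        using AE_lborel_singleton[of a]
      proof eventually_elim
        case (elim x)
        then have "x \<in> I k \<longleftrightarrow> x \<in> {a..b}" unfolding Iab by auto
        then show ?case unfolding indicator_def by simp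
      qed
    qed
    also have "\<dots> = ennreal (ln (1 + b) - ln (1 + a))"
    proof (rule nn_integral_FTC_Icc)
      fix x assume "x \<in> {a..b}"
      then have "0 < 1 + x" using ab by simp
      then show "((\<lambda>s. ln (1 + s)) has_real_derivative 1 / (1 + x)) (at x)" "0 \<le> 1 / (1 + x)"
        by (auto intro!: derivative_eq_intros)
    qed (use ab in auto)
    finally show ?thesis by (simp add: gauss_mass_def a_def b_def)
  qed
  have "(\<integral>\<^sup>+x. ennreal (f x) \<partial>lborel) = (\<integral>\<^sup>+x. (\<Sum>k. ennreal (ln (real (Suc k))) * (ennreal (1 / (1 + x)) * indicator (I k) x)) \<partial>lborel)"
  proof (rule nn_integral_cong_AE)
    show "AE x in lborel. ennreal (f x) = (\<Sum>k. ennreal (ln (real (Suc k))) * (ennreal (1 / (1 + x)) * indicator (I k) x))"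
      using AE_lborel_singleton[of 1] by eventually_elim (rule fe)
  qed
  also have "\<dots> = (\<Sum>k. \<integral>\<^sup>+x. ennreal (ln (real (Suc k))) * (ennreal (1 / (1 + x)) * indicator (I k) x) \<partial>lborel)"
    by (rule nn_integral_suminf) (use Im in measurable)
  also have "\<dots> = (\<Sum>k. ennreal (ln (real (Suc k)) * gauss_mass k))"
  proof (intro suminf_cong)
    fix k
    have "(\<integral>\<^sup>+x. ennreal (ln (real (Suc k))) * (ennreal (1 / (1 + x)) * indicator (I k) x) \<partial>lborel) =
        ennreal (ln (real (Suc k))) * ennreal (gauss_mass k)"
      unfolding each[symmetric] by (rule nn_integral_cmult) (use Im in measurable)
    then show "(\<integral>\<^sup>+x. ennreal (ln (real (Suc k))) * (ennreal (1 / (1 + x)) * indicator (I k) x) \<partial>lborel) =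
        ennreal (ln (real (Suc k)) * gauss_mass k)"
      using gauss_mass_bounds(1)[of k] by (simp add: ennreal_mult)
  qed
  also have "\<dots> = ennreal (\<Sum>k. ln (real (Suc k)) * gauss_mass k)"
    by (rule suminf_ennreal2[OF _ gauss_mass_ln_summable]) (use gauss_mass_bounds in auto)
  finally have "(\<integral>\<^sup>+x. ennreal (f x) \<partial>lborel) = ennreal (\<Sum>k. ln (real (Suc k)) * gauss_mass k)" .
  moreover have "0 \<le> (\<Sum>k. ln (real (Suc k)) * gauss_mass k)"
    by (rule suminf_nonneg[OF gauss_mass_ln_summable]) (use gauss_mass_bounds in auto)
  ultimately have "integral\<^sup>L lborel f = (\<Sum>k. ln (real (Suc k)) * gauss_mass k)"
    using fm f0 by (intro integral_eq_nn_integral[THEN trans]) auto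
  with 1 show ?thesis by simp
qed

lemma xi0_pos: "0 < xi0"
proof -
  have "0 < ln (real (Suc 1)) * gauss_mass 1"
    by (simp add: gauss_mass_def)
  also have "\<dots> = (\<Sum>k\<in>{1}. ln (real (Suc k)) * gauss_mass k)" by simp
  also have "\<dots> \<le> (\<Sum>k. ln (real (Suc k)) * gauss_mass k)"
    by (rule sum_le_suminf[OF gauss_mass_ln_summable]) (use gauss_mass_bounds in auto)
  finally show ?thesis unfolding xi0_eq by simp
qed

lemma dcone_continuous:
  assumes "dcone h" shows "continuous_on {0..1} (\<lambda>x. ln (h x))"
proof -
  have b: "\<bar>ln (h x) - ln (h y)\<bar> \<le> 8 * \<bar>ln (1 + x) - ln (1 + y)\<bar>" if x: "x \<in> {0..1}" and y: "y \<in> {0..1}" for x y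
  proof -
    have *: "ln (h x) - ln (h y) \<le> 8 * ldist x y" if x: "x \<in> {0..1}" and y: "y \<in> {0..1}" for x y
    proof -
      have "ln (h x) \<le> ln (exp (8 * ldist x y) * h y)"
        using coneD(2)[OF assms x y] coneD(1)[OF assms x x] by (intro ln_mono) auto
      then show ?thesis using coneD(1)[OF assms y y] by (simp add: ln_mult_pos)
    qed
    show ?thesis using *[OF x y] *[OF y x] by (simp add: ldist_def abs_le_iff abs_minus_commute)
  qed
  have c: "continuous_on {0..1::real} (\<lambda>x. ln (1 + x))" by (intro continuous_intros) auto
  show ?thesis unfolding continuous_on_iff
  proof (intro ballI allI impI)
    fix x e :: real assume x: "x \<in> {0..1}" and e: "0 < e"
    obtain d where d: "0 < d" "\<And>y. y \<in> {0..1} \<Longrightarrow> dist y x < d \<Longrightarrow> dist (ln (1 + y)) (ln (1 + x)) < e / 8"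
      using c[unfolded continuous_on_iff, rule_format, OF x, of "e / 8"] e by auto
    show "\<exists>d>0. \<forall>y\<in>{0..1}. dist y x < d \<longrightarrow> dist (ln (h y)) (ln (h x)) < e"
    proof (intro exI[of _ d] conjI ballI impI d(1))
      fix y assume y: "y \<in> {0..1}" "dist y x < d"
      show "dist (ln (h y)) (ln (h x)) < e"
        using b[OF y(1) x] d(2)[OF y] by (simp add: dist_real_def)
    qed
  qed
qed

text \<open>Jensen's inequality for the eigenvalue equation, integrated against the Gauss measure; the terms
  involving the eigenfunction cancel by invariance.\<close>
theorem pressure_1_ge:
  assumes q: "q < 1" shows "q * xi0 \<le> pressure 1 q"
proof -
  interpret gibbs 1 q by (rule gibbs_1[OF q])
  obtain h where h: "dcone h" "h 0 = 1" "\<And>x. x \<in> {0..1} \<Longrightarrow> transfer 1 q h x = exp (pressure 1 q) * h x"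
    by (rule eigenfunction_pressure) blast
  \<comment> \<open>The logarithm of the eigenfunction relative to the Gauss density. Its integral
    is preserved by averaging over branches, so it will drop out.\<close>
  define \<psi> where "\<psi> x = ln (h x) + ln (1 + x)" for x
  have hp: "0 < h x" if "x \<in> {0..1}" for x using coneD(1)[OF h(1) that that] .
  have \<psi>c: "continuous_on {0..1} \<psi>" unfolding \<psi>_def
    by (intro continuous_on_add dcone_continuous[OF h(1)] continuous_intros) auto
  obtain b where b: "\<And>x. x \<in> {0..1} \<Longrightarrow> \<bar>\<psi> x\<bar> \<le> b"
  proof -
    have "bounded (\<psi> ` {0..1})" by (intro compact_imp_bounded compact_continuous_image \<psi>c) simp
    then obtain a where "\<forall>x\<in>{0..1}. \<bar>\<psi> x\<bar> \<le> a" by (auto simp: bounded_iff)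
    then show ?thesis using that by blast
  qed
  define y where "y k x = q * ln (real (Suc k)) + \<psi> (branch k x)" for k x
  define w where "w k = (\<bar>q\<bar> * ln (real (Suc k)) + b) / (real (Suc k))\<^sup>2" for k
  have ws: "summable w" unfolding w_def by (rule summable_ln_square)
  have vy: "\<bar>gauss_weight k x * y k x\<bar> \<le> w k" if x: "x \<in> {0..1}" for k x
  proof -
    have "\<bar>y k x\<bar> \<le> \<bar>q\<bar> * ln (real (Suc k)) + b"
      using b[OF branch_in[OF x, of k]] abs_triangle_ineq[of "q * ln (real (Suc k))" "\<psi> (branch k x)"]
      by (simp add: y_def abs_mult)
    then have "gauss_weight k x * \<bar>y k x\<bar> \<le> 1 / (real (Suc k))\<^sup>2 * (\<bar>q\<bar> * ln (real (Suc k)) + b)"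
      using gauss_weight_le[of x k] gauss_weight_nonneg[of x k] x by (intro mult_mono) auto
    then show ?thesis using gauss_weight_nonneg[of x k] x by (simp add: w_def abs_mult)
  qed
  have jensen: "(\<Sum>k. gauss_weight k x * y k x) \<le> gauss_density x * (pressure 1 q + \<psi> x)"
    if x: "x \<in> {0..1}" for x
  proof -
    \<comment> \<open>\<open>exp m\<close> is the average of \<open>exp (y k x)\<close> with weights
      \<open>gauss_weight k x / gauss_density x\<close>; the inequality used is the tangent of
      \<open>exp\<close> at \<open>m\<close>.\<close>
    define m where "m = pressure 1 q + \<psi> x"
    have em: "exp m = exp (pressure 1 q) * h x * (1 + x)"
      using hp[OF x] x by (simp add: m_def \<psi>_def exp_add)
    have "(\<lambda>k. wt 1 q k x * h (branch k x)) sums (exp (pressure 1 q) * h x)"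
      using transfer_sums[OF h(1) x] h(3)[OF x] by simp
    moreover have "wt 1 q k x * h (branch k x) = gauss_weight k x * exp (y k x)" for k
      using x hp[OF branch_in[OF x, of k]] branch_pos[of x k]
      by (simp add: wt_1 gauss_weight_eq gauss_density_def y_def \<psi>_def exp_add powr_def add_pos_nonneg)
    ultimately have s1: "(\<lambda>k. gauss_weight k x * exp (y k x)) sums (exp (pressure 1 q) * h x)" by simp
    have vs: "summable (\<lambda>k. gauss_weight k x * y k x)"
      by (rule summable_comparison_test'[OF ws]) (use vy[OF x] in auto)
    have s2: "(\<lambda>k. exp m * (gauss_weight k x * (1 - m) + gauss_weight k x * y k x)) sums
       (exp m * (gauss_density x * (1 - m) + (\<Sum>k. gauss_weight k x * y k x)))"
      by (intro sums_mult sums_add sums_mult2 gauss_weight_sums summable_sums vs) (use x in auto)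
    have "exp m * (gauss_density x * (1 - m) + (\<Sum>k. gauss_weight k x * y k x)) \<le> exp (pressure 1 q) * h x"
    proof (rule sums_le[OF _ s2 s1])
      fix k
      have "exp m * (1 + (y k x - m)) \<le> exp m * exp (y k x - m)"
        by (intro mult_left_mono exp_ge_add_one_self) auto
      also have "\<dots> = exp (y k x)" by (simp flip: exp_add)
      finally have "gauss_weight k x * (exp m * (1 + (y k x - m))) \<le> gauss_weight k x * exp (y k x)"
        using x by (intro mult_left_mono gauss_weight_nonneg) auto
      then show "exp m * (gauss_weight k x * (1 - m) + gauss_weight k x * y k x) \<le> gauss_weight k x * exp (y k x)"
        by (simp add: algebra_simps)
    qed
    also have "exp (pressure 1 q) * h x = exp m * gauss_density x"
      using x by (simp add: em gauss_density_def)
    finally have "gauss_density x * (1 - m) + (\<Sum>k. gauss_weight k x * y k x) \<le> gauss_density x"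
      by simp
    then show ?thesis by (simp add: m_def algebra_simps)
  qed
  define H where "H z = integral {0..z} (\<lambda>s. \<psi> s / (1 + s))" for z
  have dc: "continuous_on {0..1} (\<lambda>s. \<psi> s / (1 + s))" by (intro continuous_intros \<psi>c) auto
  \<comment> \<open>Only finitely many digits are integrated; the rest is bounded by a tail of the
    summable \<open>w\<close>, uniformly in \<open>x\<close>.\<close>
  have partial: "(\<Sum>k<N. q * ln (real (Suc k)) * gauss_mass k) + H 1 - H (1 / (real N + 1))
      \<le> ln 2 * (pressure 1 q) + H 1 + (\<Sum>k. w (k + N))" for N
  proof -
    have "((\<lambda>x. \<Sum>k<N. gauss_weight k x * (q * ln (real (Suc k))) + gauss_weight k x * \<psi> (branch k x)) has_integral
      (\<Sum>k<N. gauss_mass k * (q * ln (real (Suc k))) + (H (1 / (real k + 1)) - H (1 / (real k + 2))))) {0..1}"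
      by (intro has_integral_sum has_integral_add has_integral_mult_left gauss_mass_integral
           branch_weight_integral[OF \<psi>c]) (auto simp: H_def)
    moreover have "((\<lambda>x. pressure 1 q * (1 / (1 + x)) + \<psi> x / (1 + x) + (\<Sum>k. w (k + N))) has_integral
       (pressure 1 q * (ln (1 + 1) - ln (1 + 0)) + H 1 + (\<Sum>k. w (k + N)))) {0..1}"
    proof (intro has_integral_add has_integral_mult_right inverse_shift_integral)
      show "((\<lambda>x. \<psi> x / (1 + x)) has_integral H 1) {0..1}"
        unfolding H_def by (intro integrable_integral integrable_continuous_interval dc)
      show "((\<lambda>x. \<Sum>k. w (k + N)) has_integral (\<Sum>k. w (k + N))) {0..1::real}"
        using has_integral_const_real[of "\<Sum>k. w (k + N)" 0 1] by simp
    qed auto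
    moreover have "(\<Sum>k<N. gauss_weight k x * (q * ln (real (Suc k))) + gauss_weight k x * \<psi> (branch k x))
        \<le> pressure 1 q * (1 / (1 + x)) + \<psi> x / (1 + x) + (\<Sum>k. w (k + N))" if x: "x \<in> {0..1}" for x
    proof -
      have vs: "summable (\<lambda>k. gauss_weight k x * y k x)"
        by (rule summable_comparison_test'[OF ws]) (use vy[OF x] in auto)
      have "- (\<Sum>k. w (k + N)) = (\<Sum>k. - w (k + N))"
        by (rule suminf_minus[symmetric]) (use ws in \<open>simp add: summable_iff_shift\<close>)
      also have "\<dots> \<le> (\<Sum>k. gauss_weight (k + N) x * y (k + N) x)"
      proof (rule suminf_le)
        show "- w (k + N) \<le> gauss_weight (k + N) x * y (k + N) x" for k
          using vy[OF x, of "k + N"] by linarith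
        show "summable (\<lambda>k. - w (k + N))" using summable_minus[OF summable_ignore_initial_segment[OF ws]] .
        show "summable (\<lambda>k. gauss_weight (k + N) x * y (k + N) x)"
          using summable_ignore_initial_segment[OF vs, of N] .
      qed
      finally have "(\<Sum>k<N. gauss_weight k x * y k x) \<le> (\<Sum>k. gauss_weight k x * y k x) + (\<Sum>k. w (k + N))"
        using suminf_split_initial_segment[OF vs, of N] by simp
      also have "\<dots> \<le> gauss_density x * (pressure 1 q + \<psi> x) + (\<Sum>k. w (k + N))"
        using jensen[OF x] by simp
      finally show ?thesis by (simp add: y_def gauss_density_def algebra_simps add_divide_distrib)
    qed
    ultimately have "(\<Sum>k<N. gauss_mass k * (q * ln (real (Suc k))) + (H (1 / (real k + 1)) - H (1 / (real k + 2))))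
       \<le> pressure 1 q * (ln (1 + 1) - ln (1 + 0)) + H 1 + (\<Sum>k. w (k + N))"
      by (rule has_integral_le)
    \<comment> \<open>This is the cancellation: the terms with \<open>\<psi>\<close> telescope to
      \<open>H 1\<close>, up to \<open>H (1 / (real N + 1))\<close>, which tends to 0.\<close>
    moreover have "(\<Sum>k<N. H (1 / (real k + 1)) - H (1 / (real k + 2))) = H 1 - H (1 / (real N + 1))"
      using sum_lessThan_telescope'[of "\<lambda>k. H (1 / (real k + 1))" N] by (simp add: add_ac)
    ultimately show ?thesis by (simp add: sum.distrib mult_ac)
  qed
  have l1: "(\<lambda>N. (\<Sum>k<N. q * ln (real (Suc k)) * gauss_mass k) + H 1 - H (1 / (real N + 1))) \<longlonglongrightarrow>
     (\<Sum>k. q * ln (real (Suc k)) * gauss_mass k) + H 1 - H 0"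
  proof (intro tendsto_intros summable_LIMSEQ)
    show "summable (\<lambda>k. q * ln (real (Suc k)) * gauss_mass k)"
      using summable_mult[OF gauss_mass_ln_summable, of q] by (simp add: mult.assoc)
    have "continuous_on {0..1} H"
      unfolding H_def[abs_def] by (intro indefinite_integral_continuous_1 integrable_continuous_interval dc)
    then show "(\<lambda>N. H (1 / (real N + 1))) \<longlonglongrightarrow> H 0"
      by (rule continuous_on_tendsto_compose) (real_asymp, auto)
  qed
  have "(\<lambda>N. \<Sum>k. w (k + N)) \<longlonglongrightarrow> 0"
    using suminf_exist_split2[OF ws] .
  then have l2: "(\<lambda>N. ln 2 * pressure 1 q + H 1 + (\<Sum>k. w (k + N))) \<longlonglongrightarrow> ln 2 * pressure 1 q + H 1 + 0"
    by (intro tendsto_intros)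
  have "(\<Sum>k. q * ln (real (Suc k)) * gauss_mass k) + H 1 - H 0 \<le> ln 2 * pressure 1 q + H 1 + 0"
    by (rule LIMSEQ_le[OF l1 l2]) (use partial in auto)
  moreover have "H 0 = 0" by (simp add: H_def)
  moreover have "(\<Sum>k. q * ln (real (Suc k)) * gauss_mass k) = q * (ln 2 * xi0)"
    unfolding xi0_eq using suminf_mult[OF gauss_mass_ln_summable, of q] by (simp add: mult.assoc)
  ultimately have "ln 2 * (q * xi0) \<le> ln 2 * pressure 1 q" by (simp add: mult_ac)
  then show ?thesis by simp
qed

section \<open>Derivatives of the pressure\<close>

abbreviation Pt :: "real \<Rightarrow> real \<Rightarrow> real" where "Pt \<equiv> pd1 pressure"
abbreviation Pq :: "real \<Rightarrow> real \<Rightarrow> real" where "Pq \<equiv> pd2 pressure"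

text \<open>An open region on which \<open>P\<close> is analytic; unlike \<open>D0\<close> it
  contains a neighbourhood of \<open>(1, 0)\<close>.\<close>

definition pdom :: "real \<Rightarrow> real \<Rightarrow> bool" where
  "pdom t q \<longleftrightarrow> 0 < t \<and> t < 2 \<and> 1 < 2 * t - q"

lemma pdom_gibbs: "pdom t q \<Longrightarrow> gibbs t q"
  by (simp add: pdom_def gibbs_def)

lemma pressure_ranalytic:
  assumes "pdom t q" shows "ranalytic pressure t q"
proof -
  obtain h \<eta> where "gibbs_perturbed t q h \<eta>"
    using gibbs.perturbed_exists[OF pdom_gibbs[OF assms]] assms by (auto simp: pdom_def)
  then show ?thesis by (rule gibbs_perturbed.pressure_ranalytic)
qed

lemma ranalytic_Pt: "pdom t q \<Longrightarrow> ranalytic Pt t q" and ranalytic_Pq: "pdom t q \<Longrightarrow> ranalytic Pq t q"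
  using ranalytic_derivatives(1,2)[OF pressure_ranalytic] by auto

lemma DERIV_Pt: "pdom t q \<Longrightarrow> ((\<lambda>s. pressure s q) has_real_derivative Pt t q) (at t)"
  and DERIV_Pq: "pdom t q \<Longrightarrow> (pressure t has_real_derivative Pq t q) (at q)"
  and DERIV_Pqq: "pdom t q \<Longrightarrow> (Pq t has_real_derivative pd2 Pq t q) (at q)"
  using ranalytic_derivatives(4,5)[OF pressure_ranalytic] ranalytic_derivatives(5)[OF ranalytic_Pq] by auto

lemma derivative_comparison:
  fixes f g :: "real \<Rightarrow> real"
  assumes "(f has_real_derivative D) (at x)" "(g has_real_derivative E) (at x)" "f x = g x" "0 < e"
    and "\<And>y. x < y \<Longrightarrow> y < x + e \<Longrightarrow> f y \<le> g y"
  shows "D \<le> E"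
proof (rule ccontr)
  assume "\<not> D \<le> E"
  then have "((\<lambda>y. g y - f y) has_real_derivative (E - D)) (at x)" "E - D < 0"
    using assms by (auto intro: DERIV_diff)
  from DERIV_neg_dec_right[OF this] obtain d where d: "0 < d"
    "\<And>h. 0 < h \<Longrightarrow> h < d \<Longrightarrow> g (x + h) - f (x + h) < g x - f x" by blast
  define h where "h = min d e / 2"
  have "0 < h" "h < d" "h < e" using d(1) assms(4) by (auto simp: h_def min_def)
  then show False using d(2)[of h] assms(3) assms(5)[of "x + h"] by simp
qed

lemma DERIV_affine:
  fixes u :: "real \<Rightarrow> real"
  assumes "(u has_real_derivative D) (at (a + b * x))"
  shows "((\<lambda>y. u (a + b * y)) has_real_derivative b * D) (at x)"
proof -
  have "((\<lambda>y. a + b * y) has_real_derivative b) (at x)" by (auto intro!: derivative_eq_intros)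
  from DERIV_chain'[OF this, of u D] assms show ?thesis by (simp add: mult.commute)
qed

text \<open>If the second derivative were not positive, \<open>g\<close> would be negative just to
  the right of 0, and its primitive \<open>f\<close> would fall below \<open>f 0\<close>, against
  the quantitative midpoint convexity.\<close>

lemma Pqq_pos:
  assumes D: "pdom t q" shows "0 < pd2 Pq t q"
proof (rule ccontr)
  assume neg: "\<not> ?thesis"
  obtain h \<eta> where "gibbs_perturbed t q h \<eta>"
    using gibbs.perturbed_exists[OF pdom_gibbs[OF D]] D by (auto simp: pdom_def)
  then interpret gibbs_perturbed t q h \<eta> .
  obtain c d where c: "0 < c" and d: "0 < d" and
    conv: "\<And>\<delta>. 0 < \<delta> \<Longrightarrow> \<delta> < d \<Longrightarrow> 2 * pressure t q + c * \<delta>\<^sup>2 \<le> pressure t (q + \<delta>) + pressure t (q - \<delta>)"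
    by (rule pressure_strictly_convex) blast
  define g where "g \<delta> = Pq t (q + \<delta>) - Pq t (q - \<delta>) - 2 * c * \<delta>" for \<delta>
  define f where "f \<delta> = pressure t (q + \<delta>) + pressure t (q - \<delta>) - c * \<delta>\<^sup>2" for \<delta>
  have ch: "((\<lambda>\<delta>. u (q + \<delta>)) has_real_derivative D1) (at \<delta>)" if "(u has_real_derivative D1) (at (q + \<delta>))" for u D1 \<delta>
    using DERIV_affine[of u D1 q 1 \<delta>] that by simp
  have ch': "((\<lambda>\<delta>. u (q - \<delta>)) has_real_derivative - D1) (at \<delta>)" if "(u has_real_derivative D1) (at (q - \<delta>))" for u D1 \<delta>
    using DERIV_affine[of u D1 q "-1" \<delta>] that by simp
  have "(g has_real_derivative (pd2 Pq t q - - pd2 Pq t q - 2 * c * 1)) (at 0)"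
    unfolding g_def by (intro DERIV_diff ch ch' DERIV_cmult DERIV_ident) (use DERIV_Pqq[OF D] in auto)
  moreover have "pd2 Pq t q - - pd2 Pq t q - 2 * c * 1 < 0" using neg c by simp
  ultimately obtain e where e: "0 < e" "\<And>h. 0 < h \<Longrightarrow> h < e \<Longrightarrow> g (0 + h) < g 0"
    using DERIV_neg_dec_right by blast
  define r where "r = Min {d, e, (2 * t - q - 1), 1} / 2"
  have r: "0 < r" "r < d" "r < e" "r < 2 * t - q - 1"
    using d e(1) D by (auto simp: r_def pdom_def min_def)
  have df: "(f has_real_derivative g \<delta>) (at \<delta>)" if "0 \<le> \<delta>" "\<delta> \<le> r" for \<delta>
  proof -
    have "pdom t (q + \<delta>)" "pdom t (q - \<delta>)" using D that r by (auto simp: pdom_def)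
    from ch[OF DERIV_Pq[OF this(1)]] ch'[OF DERIV_Pq[OF this(2)]]
    have "((\<lambda>\<delta>. pressure t (q + \<delta>) + pressure t (q - \<delta>)) has_real_derivative Pq t (q + \<delta>) + - Pq t (q - \<delta>)) (at \<delta>)"
      by (rule DERIV_add)
    moreover have "((\<lambda>\<delta>. c * \<delta>\<^sup>2) has_real_derivative 2 * c * \<delta>) (at \<delta>)"
      by (auto intro!: derivative_eq_intros)
    ultimately show ?thesis unfolding f_def g_def using DERIV_diff by fastforce
  qed
  obtain z where z: "0 < z" "z < r" "f r - f 0 = (r - 0) * g z"
    using MVT2[OF r(1), of f g] df by auto
  have "g z < 0" using e(2)[of z] z r by (simp add: g_def)
  then have "f r < f 0" using z(3) mult_pos_neg[OF r(1), of "g z"] by simp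
  moreover have "f 0 \<le> f r" using conv[OF r(1,2)] by (simp add: f_def)
  ultimately show False by simp
qed

lemma Pq_strict_mono:
  assumes "pdom t b" "a < b" shows "Pq t a < Pq t b"
proof (rule DERIV_pos_imp_increasing[OF assms(2)])
  fix x assume "a \<le> x" "x \<le> b"
  then have "pdom t x" using assms by (simp add: pdom_def)
  then show "\<exists>y. (Pq t has_real_derivative y) (at x) \<and> 0 < y" using DERIV_Pqq Pqq_pos by blast
qed

text \<open>One-sided derivatives of the three inequalities for \<open>P\<close>. The first bound
  makes the Jacobian of the system invertible, the second forces \<open>t'\<close> to vanish at
  infinity, the third forces it to blow up at 0.\<close>

lemma Pt_bounds:
  assumes D: "pdom t q"
  shows "Pt t q \<le> - ln 2" "Pt t q \<le> - 2 * Pq t q" "- Pt t q \<le> 2 * Pq t q + 2 * ln 2"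
proof -
  have t: "0 < t" "t < 2" "1 < 2 * t - q" using D by (auto simp: pdom_def)
  have dt: "((\<lambda>\<tau>. pressure (t + \<tau>) q) has_real_derivative Pt t q) (at 0)"
    using DERIV_affine[of "\<lambda>s. pressure s q" "Pt t q" t 1 0] DERIV_Pt[OF D] by simp
  have dt': "((\<lambda>\<tau>. pressure (t - \<tau>) q) has_real_derivative - Pt t q) (at 0)"
    using DERIV_affine[of "\<lambda>s. pressure s q" "Pt t q" t "-1" 0] DERIV_Pt[OF D] by simp
  have dq: "((\<lambda>\<tau>. pressure t (q + a * \<tau>)) has_real_derivative a * Pq t q) (at 0)" for a
    by (rule DERIV_affine) (use DERIV_Pq[OF D] in simp)
  show "Pt t q \<le> - ln 2"
  proof (rule derivative_comparison[OF dt])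
    show "((\<lambda>\<tau>. pressure t q - \<tau> * ln 2) has_real_derivative - ln 2) (at 0)"
      by (auto intro!: derivative_eq_intros)
    show "pressure (t + \<tau>) q \<le> pressure t q - \<tau> * ln 2" if "0 < \<tau>" "\<tau> < 0 + (2 - t)" for \<tau>
      using pressure_decreasing[OF pdom_gibbs[OF D], of \<tau>] that by simp
  qed (use t in auto)
  show "Pt t q \<le> - 2 * Pq t q"
  proof (rule derivative_comparison[OF dt dq])
    show "pressure (t + \<tau>) q \<le> pressure t (q + - 2 * \<tau>)" if "0 < \<tau>" "\<tau> < 0 + (2 - t)" for \<tau>
      using pressure_shift_up[of t \<tau> q] that t by (simp add: gibbs_def)
  qed (use t in auto)
  show "- Pt t q \<le> 2 * Pq t q + 2 * ln 2"
  proof (rule derivative_comparison[OF dt' DERIV_add[OF dq[of 2]]])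
    show "((\<lambda>\<tau>. 2 * \<tau> * ln 2) has_real_derivative 2 * ln 2) (at 0)"
      by (auto intro!: derivative_eq_intros)
    show "pressure (t - \<tau>) q \<le> pressure t (q + 2 * \<tau>) + 2 * \<tau> * ln 2"
      if "0 < \<tau>" "\<tau> < 0 + min t ((2 * t - q - 1) / 4)" for \<tau>
      using pressure_shift_down[of t q \<tau>] that t by (simp add: gibbs_def)
  qed (use t in auto)
qed

section \<open>The system defining \<open>t(\<xi>)\<close>\<close>

text \<open>The system on \<open>pdom\<close> instead of \<open>D0\<close>. Uniqueness with
  \<open>t\<close> ranging up to 2 is what later identifies the local inverse of the system with
  \<open>t_fun\<close>.\<close>

definition sol :: "real \<Rightarrow> real \<Rightarrow> real \<Rightarrow> bool" where
  "sol \<xi> t q \<longleftrightarrow> pdom t q \<and> pressure t q = q * \<xi> \<and> Pq t q = \<xi>"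

text \<open>The equation \<open>Pq t q = \<xi>\<close> makes \<open>q\<close> a critical point of
  the strictly convex function \<open>pressure t q - q * \<xi>\<close>, hence its only minimum; the
  other equation says that the minimum is 0.\<close>

lemma sol_minimal:
  assumes s: "sol \<xi> t q" and r: "1 < 2 * t - r" "r \<noteq> q"
  shows "r * \<xi> < pressure t r"
proof -
  have D: "pdom t q" and e: "pressure t q = q * \<xi>" "Pq t q = \<xi>" using s by (auto simp: sol_def)
  have dm: "pdom t x" if "x \<le> max q r" for x using D r(1) that by (auto simp: pdom_def max_def split: if_splits)
  define f where "f x = pressure t x - x * \<xi>" for x
  have df: "(f has_real_derivative Pq t x - \<xi>) (at x)" if "x \<le> max q r" for x
    unfolding f_def using DERIV_Pq[OF dm[OF that]] by (auto intro!: derivative_eq_intros)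
  have f0: "f q = 0" using e by (simp add: f_def)
  have "0 < f r"
  proof (cases "q < r")
    case True
    obtain z where z: "q < z" "z < r" "f r - f q = (r - q) * (Pq t z - \<xi>)"
      using MVT2[OF True, of f "\<lambda>x. Pq t x - \<xi>"] df by auto
    have "\<xi> < Pq t z" using Pq_strict_mono[of t z q] dm[of z] z e by simp
    then show ?thesis using z f0 True by simp
  next
    case False
    then have lt: "r < q" using r by simp
    obtain z where z: "r < z" "z < q" "f q - f r = (q - r) * (Pq t z - \<xi>)"
      using MVT2[OF lt, of f "\<lambda>x. Pq t x - \<xi>"] df by auto
    have "Pq t z < \<xi>" using Pq_strict_mono[OF D z(2)] e by simp
    then have "(q - r) * (Pq t z - \<xi>) < 0" using lt by (intro mult_pos_neg) auto
    then show ?thesis using z f0 by simp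
  qed
  then show ?thesis by (simp add: f_def)
qed

lemma sol_ge: "sol \<xi> t q \<Longrightarrow> 1 < 2 * t - r \<Longrightarrow> r * \<xi> \<le> pressure t r"
  using sol_minimal[of \<xi> t q r] by (cases "r = q") (auto simp: sol_def)

text \<open>If \<open>t < s\<close>, the minimum at \<open>s\<close> lies strictly below that at
  \<open>t\<close>, so both cannot be 0.\<close>

lemma sol_unique:
  assumes "sol \<xi> t q" "sol \<xi> s r" shows "t = s \<and> q = r"
proof -
  have *: False if "sol \<xi> t q" "sol \<xi> s r" "t < s" for t q s r
  proof -
    have D: "pdom t q" "pressure t q = q * \<xi>" "s < 2" using that by (auto simp: sol_def pdom_def)
    have "pressure s q \<le> pressure t q - (s - t) * ln 2"
      using pressure_decreasing[OF pdom_gibbs[OF D(1)], of "s - t"] that(3) D(3) by simp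
    also have "\<dots> < q * \<xi>" using that(3) D(2) by simp
    finally have "pressure s q < q * \<xi>" .
    moreover have "q * \<xi> \<le> pressure s q"
      using sol_ge[OF that(2), of q] D(1) that(3) by (simp add: pdom_def)
    ultimately show False by simp
  qed
  have ts: "t = s" using *[OF assms] *[OF assms(2,1)] by (cases t s rule: linorder_cases) auto
  moreover have "q = r"
  proof (rule ccontr)
    assume "q \<noteq> r"
    then have "r * \<xi> < pressure t r" using sol_minimal[OF assms(1), of r] assms(2) ts by (auto simp: sol_def pdom_def)
    then show False using assms(2) ts by (simp add: sol_def)
  qed
  ultimately show ?thesis by simp
qed

text \<open>The function to be minimised is large at both ends: \<open>P\<close> tends to infinity
  at \<open>q = 2 * t - 1\<close>, and \<open>- q * \<xi>\<close> does so as \<open>q\<close> tends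
  to minus infinity while \<open>P\<close> stays bounded below.\<close>

lemma minimizer_exists:
  assumes t: "0 < t" "t < 2" and \<xi>: "0 < \<xi>"
  obtains q where "pdom t q" "\<And>r. pdom t r \<Longrightarrow> pressure t q - q * \<xi> \<le> pressure t r - r * \<xi>"
proof -
  define f where "f q = pressure t q - q * \<xi>" for q
  define q1 where "q1 = 2 * t - 2"
  have "eventually (\<lambda>q. f q1 + 3 * \<xi> < pressure t q) (at_left (2 * t - 1))"
    by (rule pressure_at_edge) (use t in auto)
  then obtain b where b: "b < 2 * t - 1" "\<And>q. b < q \<Longrightarrow> q < 2 * t - 1 \<Longrightarrow> f q1 + 3 * \<xi> < pressure t q"
    by (auto simp: eventually_at_left_field)
  have big: "f q1 < f q" if "b < q" "q < 2 * t - 1" for q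
  proof -
    have "q * \<xi> \<le> 3 * \<xi>" using that t \<xi> by (intro mult_right_mono) auto
    then show ?thesis using b(2)[OF that] by (simp add: f_def)
  qed
  define a where "a = min (min (q1 - 1) b) (- (f q1 + 2 * t * ln 3) / \<xi>)"
  have low: "f q1 < f q" if "q < a" for q
  proof -
    have q: "q < q1" "q < - (f q1 + 2 * t * ln 3) / \<xi>" using that by (auto simp: a_def)
    have g: "gibbs t q" using t q(1) by (simp add: gibbs_def q1_def)
    have "f q1 + 2 * t * ln 3 < - q * \<xi>" using q(2) \<xi> by (simp add: field_simps)
    moreover have "0 \<le> ln (1 + 2 powr q)" by simp
    ultimately show ?thesis using gibbs.pressure_ge_two[OF g] unfolding f_def by linarith
  qed
  define b' where "b' = max b q1"
  have b': "b' < 2 * t - 1" using b(1) by (simp add: b'_def q1_def)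
  have ab: "q1 \<in> {a..b'}" by (auto simp: a_def b'_def)
  have "continuous_on {a..b'} f" unfolding f_def
  proof (intro continuous_intros continuous_at_imp_continuous_on ballI)
    fix x assume "x \<in> {a..b'}"
    then have "pdom t x" using b' t by (simp add: pdom_def)
    then show "isCont (pressure t) x" using DERIV_Pq DERIV_isCont by blast
  qed
  then obtain q where q: "q \<in> {a..b'}" "\<And>y. y \<in> {a..b'} \<Longrightarrow> f q \<le> f y"
    using continuous_attains_inf[of "{a..b'}" f] ab by auto
  have "f q \<le> f r" if "pdom t r" for r
  proof (cases "r \<in> {a..b'}")
    case True then show ?thesis by (rule q(2))
  next
    case False
    then have "f q1 < f r"
      using low[of r] big[of r] that by (auto simp: b'_def pdom_def)
    then show ?thesis using q(2)[OF ab] by simp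
  qed
  moreover have "pdom t q" using q(1) b' t by (simp add: pdom_def)
  ultimately show ?thesis using that by (auto simp: f_def)
qed

text \<open>The minimum \<open>F t\<close> is continuous, nonnegative for small \<open>t\<close>,
  and at \<open>t = 1\<close> at most its test value 0 at \<open>q = 0\<close>. At a zero of
  \<open>F\<close> the minimiser solves both equations.\<close>

lemma sol_exists:
  assumes \<xi>: "0 < \<xi>"
  obtains t q where "sol \<xi> t q" "t \<le> 1"
proof -
  have "\<forall>t\<in>{0<..<2}. \<exists>q. pdom t q \<and> (\<forall>r. pdom t r \<longrightarrow> pressure t q - q * \<xi> \<le> pressure t r - r * \<xi>)"
    using minimizer_exists[OF _ _ \<xi>] by (metis greaterThanLessThan_iff)
  then obtain m where m': "\<forall>t\<in>{0<..<2}. pdom t (m t) \<and> (\<forall>r. pdom t r \<longrightarrow> pressure t (m t) - m t * \<xi> \<le> pressure t r - r * \<xi>)"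
    unfolding bchoice_iff by blast
  have m: "0 < t \<Longrightarrow> t < 2 \<Longrightarrow> pdom t (m t)"
    "pdom t r \<Longrightarrow> pressure t (m t) - m t * \<xi> \<le> pressure t r - r * \<xi>" for t r
    using m'[rule_format, of t] by (auto simp: pdom_def)
  define F where "F t = pressure t (m t) - m t * \<xi>" for t
  \<comment> \<open>A Lipschitz constant of \<open>F\<close>: shifting \<open>q\<close> by
    \<open>2 * (t - s)\<close> along with \<open>t\<close> costs \<open>2 * \<xi>\<close> and, by
    \<open>pressure_shift_down\<close>, \<open>2 * ln 2\<close> per unit of
    \<open>t\<close>.\<close>
  define L where "L = 2 * (\<xi> + ln 2)"
  have L: "0 < L" using \<xi> by (simp add: L_def add_pos_pos)
  have step: "F t \<le> F s \<and> F s \<le> F t + L * (t - s)" if "0 < s" "s < t" "t < 2" for s t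
  proof
    have ds: "pdom s (m s)" and dt: "pdom t (m t)" using m(1) that by auto
    have ln2s: "0 \<le> (t - s) * ln 2" and ts: "s + (t - s) = t" "0 \<le> t - s" "t \<le> 2" using that by auto
    have "pdom t (m s)" using ds that by (simp add: pdom_def)
    from m(2)[OF this] show "F t \<le> F s"
      using pressure_decreasing[OF pdom_gibbs[OF ds], of "t - s", unfolded ts(1), OF ts(2,3)] ln2s
      unfolding F_def by linarith
    define r where "r = m t - 2 * (t - s)"
    have "pdom s r" using dt that by (simp add: pdom_def r_def)
    from m(2)[OF this] have "F s \<le> pressure s r - r * \<xi>" by (simp add: F_def)
    also have "pressure s r \<le> pressure t (m t) + 2 * (t - s) * ln 2"
      using pressure_shift_down[of t r "t - s"] pdom_gibbs[OF dt] that by (simp add: r_def)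
    finally show "F s \<le> F t + L * (t - s)" by (simp add: F_def L_def r_def algebra_simps)
  qed
  have cont: "isCont F x" if "0 < x" "x < 2" for x
  proof -
    have "eventually (\<lambda>y. y \<in> {0<..<2}) (at x)"
      using that by (intro eventually_at_in_open') auto
    then have ev: "eventually (\<lambda>y. norm (F y - F x) \<le> L * \<bar>y - x\<bar>) (at x)"
    proof eventually_elim
      case (elim y)
      then show ?case using step[of x y] step[of y x] that
        by (cases x y rule: linorder_cases) (auto simp: abs_le_iff algebra_simps)
    qed
    have "((\<lambda>y. L * \<bar>y - x\<bar>) \<longlongrightarrow> L * \<bar>x - x\<bar>) (at x)" by (intro tendsto_intros)
    then have "((\<lambda>y. F y - F x) \<longlongrightarrow> 0) (at x)" by (intro Lim_null_comparison[OF ev]) simp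
    then show ?thesis unfolding isCont_def by (rule LIM_zero_cancel)
  qed
  \<comment> \<open>With \<open>s \<le> 1 / 4\<close> every admissible \<open>q\<close> is at most
    \<open>- 1 / 2\<close>, so \<open>- q * \<xi> \<ge> \<xi> / 2\<close>; with
    \<open>s \<le> \<xi> / 8\<close> this outweighs the term \<open>2 * s * ln 3\<close>.\<close>
  define s where "s = min (1 / 4) (\<xi> / 8)"
  have s: "0 < s" "s \<le> 1 / 4" "s \<le> \<xi> / 8" using \<xi> by (auto simp: s_def)
  have Fs: "0 \<le> F s"
  proof -
    have d: "pdom s (m s)" using m(1) s by simp
    have "ln (3::real) \<le> 2" using ln_le_minus_one[of 3] by simp
    then have "2 * s * ln 3 \<le> 2 * (\<xi> / 8) * 2" using s by (intro mult_mono) auto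
    moreover have "m s \<le> - (1 / 2)" using d s by (simp add: pdom_def)
    then have "m s * \<xi> \<le> - (1 / 2) * \<xi>" using \<xi> by (intro mult_right_mono) auto
    moreover have "0 \<le> ln (1 + 2 powr m s)" by simp
    ultimately show ?thesis using gibbs.pressure_ge_two[OF pdom_gibbs[OF d]] unfolding F_def by linarith
  qed
  have F1: "F 1 \<le> 0" using m(2)[of 1 0] pressure_1_0 by (simp add: F_def pdom_def)
  obtain t where t: "s \<le> t" "t \<le> 1" "F t = 0"
    using IVT2[of F 1 0 s] F1 Fs s cont by (auto simp: less_le_trans[OF s(1)])
  have d: "pdom t (m t)" using m(1)[of t] t s by simp
  have "Pq t (m t) - \<xi> = 0"
  proof (rule DERIV_local_min)
    show "((\<lambda>q. pressure t q - q * \<xi>) has_real_derivative Pq t (m t) - \<xi>) (at (m t))"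
      using DERIV_Pq[OF d] by (auto intro!: derivative_eq_intros)
    show "0 < 2 * t - 1 - m t" using d by (simp add: pdom_def)
    show "\<forall>y. \<bar>m t - y\<bar> < 2 * t - 1 - m t \<longrightarrow> pressure t (m t) - m t * \<xi> \<le> pressure t y - y * \<xi>"
    proof (intro allI impI m(2))
      fix y assume "\<bar>m t - y\<bar> < 2 * t - 1 - m t"
      then show "pdom t y" using d by (auto simp: pdom_def)
    qed
  qed
  then have "sol \<xi> t (m t)" using d t(3) by (simp add: sol_def F_def)
  then show ?thesis using that t by blast
qed

definition q_fun :: "real \<Rightarrow> real" where
  "q_fun \<xi> = (THE q. \<exists>t. sol \<xi> t q)"

lemma t_fun_sol:
  assumes \<xi>: "0 < \<xi>"
  shows "sol \<xi> (t_fun \<xi>) (q_fun \<xi>)" "t_fun \<xi> \<le> 1"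
proof -
  obtain t q where s: "sol \<xi> t q" "t \<le> 1" using sol_exists[OF \<xi>] .
  have q: "q_fun \<xi> = q" unfolding q_fun_def using s sol_unique by (intro the_equality) blast+
  have "(THE p. p \<in> D0 \<and> pressure_system \<xi> (fst p) (snd p)) = (t, q)"
  proof (rule the_equality)
    show "(t, q) \<in> D0 \<and> pressure_system \<xi> (fst (t, q)) (snd (t, q))"
      using s DERIV_Pq[of t q] by (auto simp: D0_def pressure_system_def sol_def pdom_def)
    fix p assume p: "p \<in> D0 \<and> pressure_system \<xi> (fst p) (snd p)"
    obtain a b where ab: "p = (a, b)" by (cases p)
    have a: "0 \<le> a" "a \<le> 1" "1 < 2 * a - b" and P: "pressure a b = b * \<xi>"
      and Q: "(pressure a has_real_derivative \<xi>) (at b)"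
      using p by (auto simp: ab D0_def pressure_system_def)
    \<comment> \<open>\<open>D0\<close> includes \<open>t = 0\<close>, which \<open>pdom\<close>
      excludes. There \<open>P\<close> is positive while \<open>b * \<xi>\<close> is negative, since
      \<open>b < - 1\<close>.\<close>
    have "0 < a"
    proof (rule ccontr)
      assume "\<not> 0 < a"
      then have "a = 0" using a by simp
      have g: "gibbs 0 b" using a \<open>a = 0\<close> by (simp add: gibbs_def)
      have "0 < ln (1 + 2 powr b)" by (intro ln_gt_zero) simp
      then have "0 < pressure 0 b" using gibbs.pressure_ge_two[OF g] by simp
      moreover have "b * \<xi> < 0" using a \<open>a = 0\<close> \<xi> by (intro mult_neg_pos) auto
      ultimately show False using P \<open>a = 0\<close> by simp
    qed
    then have "pdom a b" using a by (simp add: pdom_def)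
    moreover from this have "Pq a b = \<xi>" using DERIV_Pq Q DERIV_unique by blast
    ultimately have "sol \<xi> a b" using P by (simp add: sol_def)
    then show "p = (t, q)" using sol_unique[OF _ s(1)] ab by auto
  qed
  then have "t_fun \<xi> = t" using \<xi> by (simp add: t_fun_def)
  with s q show "sol \<xi> (t_fun \<xi>) (q_fun \<xi>)" "t_fun \<xi> \<le> 1" by auto
qed

lemma t_fun_eqI: "0 < \<xi> \<Longrightarrow> sol \<xi> t q \<Longrightarrow> t = t_fun \<xi> \<and> q = q_fun \<xi>"
  using sol_unique t_fun_sol(1) by blast

text \<open>By \<open>pressure_1_ge\<close> the line \<open>q * xi0\<close> lies below
  \<open>P(1, q)\<close> and meets it at \<open>q = 0\<close>, hence is the tangent there.\<close>

lemma sol_xi0: "sol xi0 1 0"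
proof -
  have D: "pdom 1 0" by (simp add: pdom_def)
  have d: "((\<lambda>q. pressure 1 q - q * xi0) has_real_derivative Pq 1 0 - xi0) (at 0)"
    using DERIV_Pq[OF D] by (auto intro!: derivative_eq_intros)
  have "Pq 1 0 - xi0 = 0"
  proof (rule DERIV_local_min[OF d])
    show "\<forall>y. \<bar>0 - y\<bar> < 1 \<longrightarrow> pressure 1 0 - 0 * xi0 \<le> pressure 1 y - y * xi0"
      using pressure_1_ge pressure_1_0 by auto
  qed simp
  then show ?thesis using D pressure_1_0 by (simp add: sol_def)
qed

lemma t_fun_xi0: "t_fun xi0 = 1" "q_fun xi0 = 0"
  using t_fun_eqI[OF xi0_pos sol_xi0] by auto

text \<open>Comparing \<open>P(t, q)\<close> with \<open>P(1, q)\<close> and its tangent at 0 gives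
  \<open>(1 - t) * ln 2 \<le> q * (\<xi> - xi0)\<close>, which fixes the sign of
  \<open>q\<close>.\<close>

lemma q_fun_sign:
  assumes \<xi>: "0 < \<xi>"
  shows "xi0 < \<xi> \<Longrightarrow> 0 < q_fun \<xi>" "\<xi> < xi0 \<Longrightarrow> q_fun \<xi> < 0"
proof -
  define t q where "t = t_fun \<xi>" and "q = q_fun \<xi>"
  have s: "sol \<xi> t q" and t1: "t \<le> 1" using t_fun_sol[OF \<xi>] by (auto simp: t_def q_def)
  have D: "pdom t q" and P: "pressure t q = q * \<xi>" using s by (auto simp: sol_def)
  have "pressure 1 q \<le> pressure t q - (1 - t) * ln 2"
    using pressure_decreasing[OF pdom_gibbs[OF D], of "1 - t"] t1 by simp
  moreover have "q * xi0 \<le> pressure 1 q" using pressure_1_ge[of q] D t1 by (simp add: pdom_def)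
  ultimately have le: "(1 - t) * ln 2 \<le> q * (\<xi> - xi0)" using P by (simp add: algebra_simps)
  have q0: "q \<noteq> 0" if "\<xi> \<noteq> xi0"
  proof
    assume "q = 0"
    then have "(1 - t) * ln 2 \<le> 0" using le by simp
    moreover have "0 < ln (2::real)" by simp
    ultimately have "1 - t \<le> 0" by (smt (verit) mult_pos_pos)
    then have "t = 1" using t1 by simp
    then have "Pq 1 0 = \<xi>" using s \<open>q = 0\<close> by (simp add: sol_def)
    then show False using sol_xi0 that by (simp add: sol_def)
  qed
  have "0 \<le> (1 - t) * ln 2" using t1 by simp
  then have "0 \<le> q * (\<xi> - xi0)" using le by simp
  then show "xi0 < \<xi> \<Longrightarrow> 0 < q_fun \<xi>" "\<xi> < xi0 \<Longrightarrow> q_fun \<xi> < 0"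
    using q0 by (auto simp: q_def[symmetric] zero_le_mult_iff)
qed

lemma open_pdom: "open {p. pdom (fst p) (snd p)}"
  unfolding pdom_def by (intro open_Collect_conj open_Collect_less continuous_intros)

section \<open>Differentiability of \<open>t\<close> and \<open>q\<close>\<close>

text \<open>On solutions of the system, this map takes the value \<open>(0, \<xi>)\<close>.\<close>
definition system_map :: "real \<times> real \<Rightarrow> real \<times> real" where
  "system_map p = (pressure (fst p) (snd p) - snd p * Pq (fst p) (snd p), Pq (fst p) (snd p))"

definition system_deriv :: "real \<times> real \<Rightarrow> real \<times> real \<Rightarrow> real \<times> real" where
  "system_deriv p = (\<lambda>(a, b).
     ((Pt (fst p) (snd p) - snd p * pd1 Pq (fst p) (snd p)) * a - snd p * pd2 Pq (fst p) (snd p) * b,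
      pd1 Pq (fst p) (snd p) * a + pd2 Pq (fst p) (snd p) * b))"

lemma bounded_linear_matrix:
  "bounded_linear (\<lambda>(a, b). (m1 * a + m2 * b, m3 * a + m4 * b :: real) :: real \<times> real)"
  unfolding case_prod_beta
  by (intro bounded_linear_Pair bounded_linear_add bounded_linear_const_mult bounded_linear_fst bounded_linear_snd)

lemma bounded_linear_system_deriv: "bounded_linear (system_deriv p)"
  using bounded_linear_matrix[of "Pt (fst p) (snd p) - snd p * pd1 Pq (fst p) (snd p)" "- (snd p * pd2 Pq (fst p) (snd p))"
    "pd1 Pq (fst p) (snd p)" "pd2 Pq (fst p) (snd p)"] by (simp add: system_deriv_def)

lemma ranalytic_has_derivative:
  assumes "ranalytic u t q"
  shows "((\<lambda>p. u (fst p) (snd p)) has_derivative (\<lambda>(a, b). pd1 u t q * a + pd2 u t q * b)) (at (t, q))"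
  using ranalytic_derivatives(3)[OF assms] unfolding case_prod_unfold .

lemma system_map_derivative:
  assumes "pdom t q" shows "(system_map has_derivative system_deriv (t, q)) (at (t, q))"
proof -
  have d: "((\<lambda>p. (pressure (fst p) (snd p) - snd p * Pq (fst p) (snd p), Pq (fst p) (snd p))) has_derivative
     (\<lambda>h. ((\<lambda>(a, b). Pt t q * a + Pq t q * b) h - (snd (t, q) * (\<lambda>(a, b). pd1 Pq t q * a + pd2 Pq t q * b) h + snd h * Pq (fst (t, q)) (snd (t, q))),
       (\<lambda>(a, b). pd1 Pq t q * a + pd2 Pq t q * b) h))) (at (t, q))"
    by (intro has_derivative_Pair has_derivative_diff has_derivative_mult has_derivative_snd has_derivative_ident
        ranalytic_has_derivative pressure_ranalytic ranalytic_Pq assms)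
  show ?thesis unfolding system_map_def[abs_def] system_deriv_def
    by (rule has_derivative_eq_rhs[OF d]) (auto simp: fun_eq_iff algebra_simps)
qed

lemma ranalytic_continuous_on:
  assumes "\<And>p. p \<in> S \<Longrightarrow> ranalytic u (fst p) (snd p)"
  shows "continuous_on S (\<lambda>p. u (fst p) (snd p))"
proof (intro continuous_at_imp_continuous_on ballI)
  fix p assume "p \<in> S"
  from has_derivative_continuous[OF ranalytic_has_derivative[OF assms[OF this]]]
  show "isCont (\<lambda>p. u (fst p) (snd p)) p" by simp
qed

lemma DERIV_eventually_eq:
  fixes f g :: "real \<Rightarrow> real"
  assumes "(f has_real_derivative a) (at x)" "eventually (\<lambda>y. f y = g y) (nhds x)"
  shows "(g has_real_derivative a) (at x)"
  using assms DERIV_cong_ev[of x x f g a a] by simp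

text \<open>The Jacobian determinant of \<open>system_map\<close> is \<open>Pt * pd2 Pq\<close>,
  which is negative on \<open>pdom\<close>. The local inverse takes values in \<open>pdom\<close>,
  so by uniqueness of solutions it is \<open>(t_fun y, q_fun y)\<close> at
  \<open>(0, y)\<close>.\<close>

theorem t_fun_differentiable:
  assumes \<xi>: "0 < \<xi>"
  obtains a b where "(t_fun has_real_derivative a) (at \<xi>)" "(q_fun has_real_derivative b) (at \<xi>)"
proof -
  define U where "U = {p. pdom (fst p) (snd p)}"
  define f' where "f' p = Blinfun (system_deriv p)" for p
  have f': "blinfun_apply (f' p) = system_deriv p" for p
    unfolding f'_def by (rule bounded_linear_Blinfun_apply[OF bounded_linear_system_deriv])
  define x0 where "x0 = (t_fun \<xi>, q_fun \<xi>)"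
  have s: "sol \<xi> (t_fun \<xi>) (q_fun \<xi>)" using t_fun_sol[OF \<xi>] by simp
  have x0: "x0 \<in> U" using s by (simp add: U_def x0_def sol_def)
  have D: "pdom (t_fun \<xi>) (q_fun \<xi>)" using s by (simp add: sol_def)
  have r: "ranalytic Pt (fst p) (snd p)" "ranalytic Pq (fst p) (snd p)"
    "ranalytic (pd1 Pq) (fst p) (snd p)" "ranalytic (pd2 Pq) (fst p) (snd p)" if "p \<in> U" for p
    using that ranalytic_derivatives(1,2)[OF ranalytic_Pq] ranalytic_Pt ranalytic_Pq by (auto simp: U_def)
  have contf: "continuous_on U f'"
  proof (rule continuous_on_blinfun_componentwise)
    fix i :: "real \<times> real"
    obtain a b where i: "i = (a, b)" by (cases i)
    show "continuous_on U (\<lambda>x. blinfun_apply (f' x) i)"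
      unfolding f' system_deriv_def i prod.case
      by (intro continuous_intros ranalytic_continuous_on r)
  qed
  define m1 m2 m3 m4 where "m1 = Pt (t_fun \<xi>) (q_fun \<xi>) - q_fun \<xi> * pd1 Pq (t_fun \<xi>) (q_fun \<xi>)"
    and "m2 = - (q_fun \<xi> * pd2 Pq (t_fun \<xi>) (q_fun \<xi>))"
    and "m3 = pd1 Pq (t_fun \<xi>) (q_fun \<xi>)" and "m4 = pd2 Pq (t_fun \<xi>) (q_fun \<xi>)"
  define dt where "dt = m1 * m4 - m2 * m3"
  have "dt = Pt (t_fun \<xi>) (q_fun \<xi>) * pd2 Pq (t_fun \<xi>) (q_fun \<xi>)"
    by (simp add: dt_def m1_def m2_def m3_def m4_def algebra_simps)
  moreover have "Pt (t_fun \<xi>) (q_fun \<xi>) < 0"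
    using Pt_bounds(1)[OF D] ln_gt_zero[of "2::real"] by linarith
  ultimately have dt: "dt \<noteq> 0" using Pqq_pos[OF D] by simp
  define invf where "invf = Blinfun (\<lambda>(a, b). (m4 / dt * a + (- m2 / dt) * b, (- m3 / dt) * a + m1 / dt * b))"
  have invf: "blinfun_apply invf = (\<lambda>(a, b). (m4 / dt * a + (- m2 / dt) * b, (- m3 / dt) * a + m1 / dt * b))"
    unfolding invf_def by (rule bounded_linear_Blinfun_apply[OF bounded_linear_matrix])
  have inv: "invf o\<^sub>L f' x0 = id_blinfun"
  proof (rule blinfun_eqI)
    fix i :: "real \<times> real"
    obtain a b where i: "i = (a, b)" by (cases i)
    have "blinfun_apply (f' x0) i = (m1 * a + m2 * b, m3 * a + m4 * b)"
      unfolding f' i by (simp add: system_deriv_def x0_def m1_def m2_def m3_def m4_def)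
    then have "blinfun_apply (invf o\<^sub>L f' x0) i =
       (m4 / dt * (m1 * a + m2 * b) + (- m2 / dt) * (m3 * a + m4 * b), (- m3 / dt) * (m1 * a + m2 * b) + m1 / dt * (m3 * a + m4 * b))"
      by (simp add: invf)
    also have "m4 / dt * (m1 * a + m2 * b) + (- m2 / dt) * (m3 * a + m4 * b) = (m4 * (m1 * a + m2 * b) - m2 * (m3 * a + m4 * b)) / dt"
      by (simp add: diff_divide_distrib)
    also have "m4 * (m1 * a + m2 * b) - m2 * (m3 * a + m4 * b) = dt * a" by (simp add: dt_def algebra_simps)
    also have "(- m3 / dt) * (m1 * a + m2 * b) + m1 / dt * (m3 * a + m4 * b) = (m1 * (m3 * a + m4 * b) - m3 * (m1 * a + m2 * b)) / dt"
      by (simp add: diff_divide_distrib)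
    also have "m1 * (m3 * a + m4 * b) - m3 * (m1 * a + m2 * b) = dt * b" by (simp add: dt_def algebra_simps)
    finally show "blinfun_apply (invf o\<^sub>L f' x0) i = blinfun_apply id_blinfun i"
      using dt by (simp add: i)
  qed
  have derf: "(system_map has_derivative blinfun_apply (f' x)) (at x)" if "x \<in> U" for x
    using system_map_derivative[of "fst x" "snd x"] that by (simp add: U_def f')
  obtain U' V g g' where g: "U' \<subseteq> U" "open V" "system_map x0 \<in> V" "homeomorphism U' V system_map g"
    "\<And>y. y \<in> V \<Longrightarrow> (g has_derivative (g' y)) (at y)"
    using inverse_function_theorem[OF open_pdom[folded U_def] derf contf x0 inv] by metis
  have x0V: "system_map x0 = (0, \<xi>)" using s by (simp add: system_map_def x0_def sol_def)
  have gs: "g (0, y) = (t_fun y, q_fun y)" if y: "(0, y) \<in> V" "0 < y" for y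
  proof -
    have "g (0, y) \<in> U'" using homeomorphism_image2[OF g(4)] y(1) by blast
    moreover have "system_map (g (0, y)) = (0, y)" using homeomorphism_apply2[OF g(4) y(1)] .
    ultimately have "sol y (fst (g (0, y))) (snd (g (0, y)))"
      using g(1) by (auto simp: system_map_def sol_def U_def)
    from t_fun_eqI[OF y(2) this] show ?thesis by (metis prod.collapse)
  qed
  have near: "eventually (\<lambda>y. (0, y) \<in> V \<and> 0 < y) (nhds \<xi>)"
  proof -
    have "open ((\<lambda>y. (0::real, y)) -` V \<inter> {0<..})"
      by (intro open_Int open_vimage g continuous_intros)
    then have "eventually (\<lambda>y. y \<in> (\<lambda>y. (0::real, y)) -` V \<inter> {0<..}) (nhds \<xi>)"
      by (rule eventually_nhds_in_open) (use g(3) x0V \<xi> in auto)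
    then show ?thesis by eventually_elim auto
  qed
  have gd: "(g has_derivative g' (0, \<xi>)) (at (0, \<xi>))" using g(5) g(3) x0V by simp
  have "((\<lambda>y. g (0, y)) has_derivative (\<lambda>h. g' (0, \<xi>) (0, h))) (at \<xi>)"
    by (rule has_derivative_compose[of "\<lambda>y. (0, y)" "\<lambda>h. (0, h)" \<xi> UNIV g, OF _ gd])
       (auto intro!: derivative_eq_intros)
  from has_derivative_fst[OF this] has_derivative_snd[OF this]
  have 1: "(\<lambda>y. fst (g (0, y))) differentiable (at \<xi>)" "(\<lambda>y. snd (g (0, y))) differentiable (at \<xi>)"
    by (auto simp: differentiable_def)
  then obtain a b where ab: "((\<lambda>y. fst (g (0, y))) has_real_derivative a) (at \<xi>)"
    "((\<lambda>y. snd (g (0, y))) has_real_derivative b) (at \<xi>)"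
    by (auto simp: real_differentiable_def)
  have "(t_fun has_real_derivative a) (at \<xi>)"
    by (rule DERIV_eventually_eq[OF ab(1)], rule eventually_mono[OF near]) (use gs in auto)
  moreover have "(q_fun has_real_derivative b) (at \<xi>)"
    by (rule DERIV_eventually_eq[OF ab(2)], rule eventually_mono[OF near]) (use gs in auto)
  ultimately show ?thesis by (rule that)
qed

lemma chain_rule2:
  assumes "ranalytic u (f \<xi>) (g \<xi>)" "(f has_real_derivative a) (at \<xi>)" "(g has_real_derivative b) (at \<xi>)"
  shows "((\<lambda>\<eta>. u (f \<eta>) (g \<eta>)) has_real_derivative pd1 u (f \<xi>) (g \<xi>) * a + pd2 u (f \<xi>) (g \<xi>) * b) (at \<xi>)"
proof -
  have "((\<lambda>\<eta>. (f \<eta>, g \<eta>)) has_derivative (\<lambda>h. (a * h, b * h))) (at \<xi>)"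
    using assms(2,3) by (intro has_derivative_Pair) (auto simp: has_field_derivative_def)
  from has_derivative_compose[OF this ranalytic_has_derivative[OF assms(1)]]
  have "((\<lambda>\<eta>. u (f \<eta>) (g \<eta>)) has_derivative (\<lambda>h. pd1 u (f \<xi>) (g \<xi>) * (a * h) + pd2 u (f \<xi>) (g \<xi>) * (b * h))) (at \<xi>)"
    by simp
  then show ?thesis unfolding has_field_derivative_def
    by (rule has_derivative_eq_rhs) (simp add: fun_eq_iff algebra_simps)
qed

definition t_deriv :: "real \<Rightarrow> real" where
  "t_deriv \<xi> = q_fun \<xi> / Pt (t_fun \<xi>) (q_fun \<xi>)"

lemma Pt_neg: "pdom t q \<Longrightarrow> Pt t q < 0"
  using Pt_bounds(1)[of t q] ln_gt_zero[of "2::real"] by linarith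

lemma sol_pdom: "0 < \<xi> \<Longrightarrow> pdom (t_fun \<xi>) (q_fun \<xi>)"
  using t_fun_sol(1) by (auto simp: sol_def)

text \<open>Differentiate \<open>P(t, q) = q * \<xi>\<close>: the terms with the derivative of
  \<open>q\<close> cancel because \<open>Pq = \<xi>\<close>. Differentiating
  \<open>Pq = \<xi>\<close> then gives the derivative of \<open>q\<close>.\<close>

lemma t_fun_derivative:
  assumes \<xi>: "0 < \<xi>" shows "(t_fun has_real_derivative t_deriv \<xi>) (at \<xi>)"
    "(q_fun has_real_derivative (1 - pd1 Pq (t_fun \<xi>) (q_fun \<xi>) * t_deriv \<xi>) / pd2 Pq (t_fun \<xi>) (q_fun \<xi>)) (at \<xi>)"
proof -
  obtain a b where ab: "(t_fun has_real_derivative a) (at \<xi>)" "(q_fun has_real_derivative b) (at \<xi>)"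
    using t_fun_differentiable[OF \<xi>] .
  note D = sol_pdom[OF \<xi>]
  have s: "sol \<eta> (t_fun \<eta>) (q_fun \<eta>)" if "0 < \<eta>" for \<eta> using t_fun_sol[OF that] by simp
  have near: "eventually (\<lambda>\<eta>. 0 < \<eta>) (nhds \<xi>)"
    using eventually_nhds_in_open[of "{0<..}" \<xi>] \<xi> by simp
  have "((\<lambda>\<eta>. pressure (t_fun \<eta>) (q_fun \<eta>)) has_real_derivative Pt (t_fun \<xi>) (q_fun \<xi>) * a + Pq (t_fun \<xi>) (q_fun \<xi>) * b) (at \<xi>)"
    by (rule chain_rule2[OF pressure_ranalytic[OF D] ab])
  then have "((\<lambda>\<eta>. q_fun \<eta> * \<eta>) has_real_derivative Pt (t_fun \<xi>) (q_fun \<xi>) * a + Pq (t_fun \<xi>) (q_fun \<xi>) * b) (at \<xi>)"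
    by (rule DERIV_eventually_eq, intro eventually_mono[OF near]) (use s in \<open>simp add: sol_def\<close>)
  moreover have "((\<lambda>\<eta>. q_fun \<eta> * \<eta>) has_real_derivative b * \<xi> + q_fun \<xi>) (at \<xi>)"
    using ab(2) by (auto intro!: derivative_eq_intros)
  ultimately have "Pt (t_fun \<xi>) (q_fun \<xi>) * a + Pq (t_fun \<xi>) (q_fun \<xi>) * b = b * \<xi> + q_fun \<xi>"
    by (rule DERIV_unique)
  moreover have "Pq (t_fun \<xi>) (q_fun \<xi>) = \<xi>" using s[OF \<xi>] by (simp add: sol_def)
  ultimately have "a = t_deriv \<xi>" using Pt_neg[OF D] by (simp add: t_deriv_def field_simps)
  then show td: "(t_fun has_real_derivative t_deriv \<xi>) (at \<xi>)" using ab by simp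
  have "((\<lambda>\<eta>. Pq (t_fun \<eta>) (q_fun \<eta>)) has_real_derivative pd1 Pq (t_fun \<xi>) (q_fun \<xi>) * a + pd2 Pq (t_fun \<xi>) (q_fun \<xi>) * b) (at \<xi>)"
    by (rule chain_rule2[OF ranalytic_Pq[OF D] ab])
  then have "((\<lambda>\<eta>. \<eta>) has_real_derivative pd1 Pq (t_fun \<xi>) (q_fun \<xi>) * a + pd2 Pq (t_fun \<xi>) (q_fun \<xi>) * b) (at \<xi>)"
    by (rule DERIV_eventually_eq, intro eventually_mono[OF near]) (use s in \<open>simp add: sol_def\<close>)
  then have "pd1 Pq (t_fun \<xi>) (q_fun \<xi>) * a + pd2 Pq (t_fun \<xi>) (q_fun \<xi>) * b = 1"
    using DERIV_ident by (rule DERIV_unique)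
  then have "b = (1 - pd1 Pq (t_fun \<xi>) (q_fun \<xi>) * t_deriv \<xi>) / pd2 Pq (t_fun \<xi>) (q_fun \<xi>)"
    using Pqq_pos[OF D] \<open>a = t_deriv \<xi>\<close> by (simp add: field_simps)
  then show "(q_fun has_real_derivative (1 - pd1 Pq (t_fun \<xi>) (q_fun \<xi>) * t_deriv \<xi>) / pd2 Pq (t_fun \<xi>) (q_fun \<xi>)) (at \<xi>)"
    using ab by simp
qed

lemma deriv_t_fun: "0 < \<xi> \<Longrightarrow> deriv t_fun \<xi> = t_deriv \<xi>"
  using t_fun_derivative(1) by (rule DERIV_imp_deriv)

lemma deriv_t_fun_cong:
  assumes "0 < \<xi>"
  shows "(deriv t_fun has_real_derivative d) (at \<xi>) \<longleftrightarrow> (t_deriv has_real_derivative d) (at \<xi>)"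
proof (rule DERIV_cong_ev)
  have "eventually (\<lambda>\<eta>. 0 < \<eta>) (nhds \<xi>)"
    using eventually_nhds_in_open[of "{0<..}" \<xi>] assms by simp
  then show "eventually (\<lambda>\<eta>. deriv t_fun \<eta> = t_deriv \<eta>) (nhds \<xi>)"
    by eventually_elim (rule deriv_t_fun)
qed auto

text \<open>At \<open>xi0\<close> both \<open>q_fun\<close> and \<open>t_deriv\<close> vanish, so
  the quotient rule leaves the derivative of \<open>q_fun\<close>, which is
  \<open>1 / pd2 Pq 1 0\<close>, divided by \<open>Pt 1 0\<close>.\<close>

lemma t_deriv_differentiable:
  assumes \<xi>: "0 < \<xi>"
  obtains d where "(t_deriv has_real_derivative d) (at \<xi>)"
    "\<xi> = xi0 \<Longrightarrow> d = 1 / (pd2 Pq 1 0 * Pt 1 0)"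
proof -
  note D = sol_pdom[OF \<xi>]
  define b where "b = (1 - pd1 Pq (t_fun \<xi>) (q_fun \<xi>) * t_deriv \<xi>) / pd2 Pq (t_fun \<xi>) (q_fun \<xi>)"
  define N where "N = Pt (t_fun \<xi>) (q_fun \<xi>)"
  obtain c where c: "((\<lambda>\<eta>. Pt (t_fun \<eta>) (q_fun \<eta>)) has_real_derivative c) (at \<xi>)"
    using chain_rule2[OF ranalytic_Pt[OF D] t_fun_derivative[OF \<xi>]] by blast
  have N: "N \<noteq> 0" using Pt_neg[OF D] by (simp add: N_def)
  have d: "(t_deriv has_real_derivative (b * N - q_fun \<xi> * c) / (N * N)) (at \<xi>)"
  proof -
    have e: "t_deriv = (\<lambda>\<eta>. q_fun \<eta> / Pt (t_fun \<eta>) (q_fun \<eta>))" by (simp add: t_deriv_def fun_eq_iff)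
    have "((\<lambda>\<eta>. q_fun \<eta> / Pt (t_fun \<eta>) (q_fun \<eta>)) has_real_derivative (b * N - q_fun \<xi> * c) / (N * N)) (at \<xi>)"
      using DERIV_divide[OF t_fun_derivative(2)[OF \<xi>] c] N by (simp add: N_def b_def)
    then show ?thesis by (subst e)
  qed
  show ?thesis
  proof (rule that[OF d])
    assume x: "\<xi> = xi0"
    then have "q_fun \<xi> = 0" "t_deriv \<xi> = 0" "N = Pt 1 0" "b = 1 / pd2 Pq 1 0"
      using t_fun_xi0 by (simp_all add: t_deriv_def N_def b_def)
    then show "(b * N - q_fun \<xi> * c) / (N * N) = 1 / (pd2 Pq 1 0 * Pt 1 0)" using N by simp
  qed
qed

section \<open>Cylinders and continued fraction digits\<close>

abbreviation pos :: "nat list \<Rightarrow> bool" where "pos u \<equiv> \<forall>k\<in>set u. 1 \<le> k"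

definition lsum :: "nat list \<Rightarrow> real" where
  "lsum u = (\<Sum>k\<leftarrow>u. ln (real k))"

text \<open>At \<open>x = 0\<close> this is the reciprocal of the denominator of the convergent with
  digits \<open>u\<close>; in general its square is the modulus of the derivative of
  \<open>cfrac_tail u\<close> at \<open>x\<close>.\<close>

definition wprod :: "nat list \<Rightarrow> real \<Rightarrow> real" where
  "wprod u x = word_weight (1 / 2) 0 u x"

lemma lsum_append: "lsum (u @ v) = lsum u + lsum v"
  by (simp add: lsum_def)

lemma lsum_nonneg: "pos u \<Longrightarrow> 0 \<le> lsum u"
  unfolding lsum_def by (intro sum_list_nonneg) auto

lemma wprod_pos: "pos u \<Longrightarrow> x \<in> {0..1} \<Longrightarrow> 0 < wprod u x"
  unfolding wprod_def by (rule word_weight_pos)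

lemma wprod_Cons:
  assumes "pos (w # u)" "x \<in> {0..1}"
  shows "wprod (w # u) x = cfrac_tail (w # u) x * wprod u x"
proof -
  have "0 < real w" using assms by auto
  moreover have "0 \<le> cfrac_tail (w # u) x" using cfrac_tail_in[OF assms] by auto
  ultimately show ?thesis unfolding wprod_def word_weight_Cons by (simp del: cfrac_tail.simps)
qed

lemma wprod_append: "wprod (u @ v) x = wprod u (cfrac_tail v x) * wprod v x"
  unfolding wprod_def by (rule word_weight_append)

lemma word_weight_eq:
  assumes "pos u" "x \<in> {0..1}"
  shows "word_weight t q u x = exp (q * lsum u) * wprod u x powr (2 * t)"
  using assms(1)
proof (induction u)
  case Nil then show ?case by (simp add: lsum_def wprod_def)
next
  case (Cons w u)
  have u: "pos u" using Cons.prems by simp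
  have w: "0 < real w" using Cons.prems by auto
  have "0 \<le> cfrac_tail (w # u) x" using cfrac_tail_in[OF Cons.prems assms(2)] by auto
  then show ?case
    unfolding word_weight_Cons Cons.IH[OF u] wprod_Cons[OF Cons.prems assms(2)]
    using w wprod_pos[OF u assms(2)]
    by (simp add: powr_mult lsum_def distrib_left exp_add powr_def[of "real w"] del: cfrac_tail.simps)
qed

text \<open>The square of \<open>wprod\<close> is the word weight at \<open>(1, 0)\<close>, whose
  distortion is at most 256.\<close>

lemma wprod_distortion:
  assumes "pos u" "x \<in> {0..1}" "y \<in> {0..1}"
  shows "wprod u x \<le> 16 * wprod u y"
proof -
  have "word_weight 1 0 u x \<le> exp (8 * ldist x y) * word_weight 1 0 u y"
    by (rule gibbs.word_weight_distortion[OF gibbs_1 assms]) simp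
  also have "\<dots> \<le> 256 * word_weight 1 0 u y"
    using exp_ldist_le[OF assms(2,3)] word_weight_pos[OF assms(1,3), of 1 0] by (intro mult_right_mono) auto
  finally have "(wprod u x)\<^sup>2 \<le> (16 * wprod u y)\<^sup>2"
    using wprod_pos[OF assms(1,2)] wprod_pos[OF assms(1,3)]
    by (simp add: word_weight_eq[OF assms(1,2)] word_weight_eq[OF assms(1,3)] power_mult_distrib)
  then show ?thesis by (rule power2_le_imp_le) (use wprod_pos[OF assms(1,3)] in auto)
qed

text \<open>An exact identity for Moebius maps: the modulus of the difference quotient is the
  geometric mean of the moduli of the two derivatives.\<close>

lemma cfrac_tail_diff:
  assumes "pos u" "x \<in> {0..1}" "y \<in> {0..1}"
  shows "\<bar>cfrac_tail u x - cfrac_tail u y\<bar> = \<bar>x - y\<bar> * (wprod u x * wprod u y)"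
  using assms(1)
proof (induction u)
  case Nil then show ?case by (simp add: wprod_def)
next
  case (Cons w u)
  have u: "pos u" using Cons.prems by simp
  define a b where "a = real w + cfrac_tail u x" and "b = real w + cfrac_tail u y"
  have w: "1 \<le> real w" using Cons.prems by auto
  have ab: "0 < a" "0 < b"
    using w cfrac_tail_in[OF u assms(2)] cfrac_tail_in[OF u assms(3)] by (auto simp: a_def b_def)
  have "cfrac_tail (w # u) x - cfrac_tail (w # u) y = (cfrac_tail u y - cfrac_tail u x) * ((1 / a) * (1 / b))"
    using ab by (simp add: a_def[symmetric] b_def[symmetric] divide_simps) (simp add: a_def b_def)
  then have "\<bar>cfrac_tail (w # u) x - cfrac_tail (w # u) y\<bar> = \<bar>cfrac_tail u x - cfrac_tail u y\<bar> * ((1 / a) * (1 / b))"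
    using ab by (simp add: abs_mult abs_minus_commute)
  also have "\<dots> = \<bar>x - y\<bar> * ((1 / a * wprod u x) * (1 / b * wprod u y))"
    unfolding Cons.IH[OF u] by (simp add: mult_ac)
  also have "\<dots> = \<bar>x - y\<bar> * (wprod (w # u) x * wprod (w # u) y)"
    unfolding wprod_Cons[OF Cons.prems assms(2)] wprod_Cons[OF Cons.prems assms(3)] by (simp add: a_def b_def)
  finally show ?case .
qed

lemma wprod_square_le:
  assumes "pos u" "x \<in> {0..1}"
  shows "(wprod u x)\<^sup>2 \<le> 2 * (1 / 2) ^ length u"
proof -
  have "wprod u x \<le> 2 powr (1 / 2) * (2 powr - (1 / 2)) ^ length u"
    unfolding wprod_def by (rule word_weight_half[OF assms]) simp
  then have "(wprod u x)\<^sup>2 \<le> (2 powr (1 / 2) * (2 powr - (1 / 2)) ^ length u)\<^sup>2"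
    using wprod_pos[OF assms] by (intro power_mono) auto
  also have "\<dots> = (2 powr (1 / 2))\<^sup>2 * ((2 powr - (1 / 2))\<^sup>2) ^ length u"
    by (simp add: power_mult_distrib power_mult[symmetric] mult.commute)
  also have "(2 powr (1 / 2) :: real)\<^sup>2 = 2" by (simp add: power2_eq_square flip: powr_add)
  also have "(2 powr - (1 / 2) :: real)\<^sup>2 = 2 powr - 1" by (simp add: power2_eq_square flip: powr_add)
  also have "(2 powr - 1 :: real) = 1 / 2" by (simp add: powr_minus)
  finally show ?thesis .
qed

definition cyl :: "nat list \<Rightarrow> real set" where
  "cyl u = cfrac_tail u ` {0..1}"

lemma cyl_bounded: "pos u \<Longrightarrow> bounded (cyl u)"
  using cfrac_tail_in[of u] by (intro bounded_subset[OF bounded_closed_interval[of 0 1]]) (auto simp: cyl_def)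

lemma diameter_cyl:
  assumes "pos u" shows "diameter (cyl u) \<le> 256 * (wprod u 0)\<^sup>2"
proof (rule diameter_le)
  fix a b assume "a \<in> cyl u" "b \<in> cyl u"
  then obtain x y where xy: "x \<in> {0..1}" "y \<in> {0..1}" and ab: "a = cfrac_tail u x" "b = cfrac_tail u y"
    by (auto simp: cyl_def)
  have "norm (a - b) = \<bar>x - y\<bar> * (wprod u x * wprod u y)"
    by (simp add: ab cfrac_tail_diff[OF assms xy])
  also have "\<dots> \<le> 1 * ((16 * wprod u 0) * (16 * wprod u 0))"
    using xy wprod_distortion[OF assms xy(1), of 0] wprod_distortion[OF assms xy(2), of 0]
      wprod_pos[OF assms xy(1)] wprod_pos[OF assms xy(2)] wprod_pos[OF assms, of 0]
    by (intro mult_mono) auto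
  finally show "norm (a - b) \<le> 256 * (wprod u 0)\<^sup>2" by (simp add: power2_eq_square)
qed (auto simp: cyl_def)

section \<open>Digits of an irrational number\<close>

definition digits :: "nat \<Rightarrow> real \<Rightarrow> nat list" where
  "digits n x = map (\<lambda>j. nat (partial_quotient (Suc j) x)) [0..<n]"

lemma gauss_map_irrational:
  assumes "0 < x" "x < 1" "x \<notin> \<rat>"
  shows "0 < gauss_map x" "gauss_map x < 1" "gauss_map x \<notin> \<rat>" "1 \<le> \<lfloor>1 / x\<rfloor>"
    "x = 1 / (real (nat \<lfloor>1 / x\<rfloor>) + gauss_map x)"
proof -
  have g: "gauss_map x = 1 / x - of_int \<lfloor>1 / x\<rfloor>" using assms by (simp add: gauss_map_def frac_def)
  show irr: "gauss_map x \<notin> \<rat>"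
  proof
    assume "gauss_map x \<in> \<rat>"
    then have "gauss_map x + of_int \<lfloor>1 / x\<rfloor> \<in> \<rat>" by (intro Rats_add Rats_of_int)
    then have "1 / x \<in> \<rat>" by (simp add: g)
    from Rats_divide[OF Rats_1 this] show False using assms by simp
  qed
  have "0 \<le> gauss_map x" "gauss_map x < 1" using assms frac_ge_0[of "1 / x"] frac_lt_1[of "1 / x"]
    by (auto simp: gauss_map_def)
  moreover have "gauss_map x \<noteq> 0" using irr by auto
  ultimately show "0 < gauss_map x" "gauss_map x < 1" by auto
  have "1 \<le> 1 / x" using assms by simp
  then show f: "1 \<le> \<lfloor>1 / x\<rfloor>" by (simp add: le_floor_iff)
  then show "x = 1 / (real (nat \<lfloor>1 / x\<rfloor>) + gauss_map x)" using assms by (simp add: g)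
qed

lemma partial_quotient_Suc_Suc: "partial_quotient (Suc (Suc j)) x = partial_quotient (Suc j) (gauss_map x)"
  unfolding partial_quotient_def by (simp del: funpow.simps add: funpow_Suc_right)

lemma digits_Suc: "digits (Suc n) x = nat \<lfloor>1 / x\<rfloor> # digits n (gauss_map x)"
proof -
  have "[0..<Suc n] = 0 # map Suc [0..<n]" by (simp add: upt_conv_Cons map_Suc_upt del: upt_Suc)
  then show ?thesis
    by (simp add: digits_def partial_quotient_Suc_Suc partial_quotient_def[of "Suc 0"] del: upt_Suc)
qed

lemma digits_expansion:
  assumes "0 < x" "x < 1" "x \<notin> \<rat>"
  shows "digits n x \<in> pos_words n" "x = cfrac_tail (digits n x) ((gauss_map ^^ n) x)"
    "0 < (gauss_map ^^ n) x" "(gauss_map ^^ n) x < 1"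
proof -
  have "digits n x \<in> pos_words n \<and> x = cfrac_tail (digits n x) ((gauss_map ^^ n) x) \<and>
     0 < (gauss_map ^^ n) x \<and> (gauss_map ^^ n) x < 1"
    using assms
  proof (induction n arbitrary: x)
    case 0 then show ?case by (simp add: digits_def pos_words_def)
  next
    case (Suc n)
    note g = gauss_map_irrational[OF Suc.prems]
    have "1 \<le> nat \<lfloor>1 / x\<rfloor>" using nat_mono[OF g(4)] unfolding nat_1 One_nat_def .
    then show ?case using Suc.IH[OF g(1-3)] g(5)
      by (auto simp: digits_Suc pos_words_def funpow_Suc_right simp del: funpow.simps)
  qed
  then show "digits n x \<in> pos_words n" "x = cfrac_tail (digits n x) ((gauss_map ^^ n) x)"
    "0 < (gauss_map ^^ n) x" "(gauss_map ^^ n) x < 1" by auto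
qed

lemma sum_ln_partial_quotients:
  assumes "0 < x" "x < 1" "x \<notin> \<rat>"
  shows "(\<Sum>j=1..n. ln (real_of_int (partial_quotient j x))) = lsum (digits n x)"
proof -
  have "real_of_int (partial_quotient (Suc j) x) = real (nat (partial_quotient (Suc j) x))" if "j < n" for j
  proof -
    have "nat (partial_quotient (Suc j) x) \<in> set (digits n x)" using that by (auto simp: digits_def)
    then have "1 \<le> nat (partial_quotient (Suc j) x)" using digits_expansion(1)[OF assms, of n] by (auto simp: pos_words_def)
    then show ?thesis by simp
  qed
  then have "(\<Sum>j<n. ln (real_of_int (partial_quotient (Suc j) x))) = (\<Sum>j<n. ln (real (nat (partial_quotient (Suc j) x))))"
    by (intro sum.cong) auto
  also have "\<dots> = lsum (digits n x)"
    by (simp add: lsum_def digits_def o_def interv_sum_list_conv_sum_set_nat atLeast0LessThan)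
  finally show ?thesis by (simp add: sum.atLeast1_atMost_eq)
qed

section \<open>The upper bound for the dimension\<close>

lemma ennreal_suminf_le:
  fixes f :: "nat \<Rightarrow> ennreal"
  assumes "\<And>n. (\<Sum>i<n. f i) \<le> B" shows "suminf f \<le> B"
  unfolding suminf_eq_SUP by (rule SUP_least) (rule assms)

text \<open>Every point of the level set lies in cylinders of words in \<open>S n\<close> for all
  large \<open>n\<close>. On \<open>S n\<close> the tilt
  \<open>exp (q * (lsum u - n * \<xi>))\<close> is at least \<open>exp (- (n * c))\<close>, so
  inserting it bounds the sum of \<open>diameter powr s\<close> over \<open>S n\<close> by a
  geometric sequence.\<close>

lemma hausdorff_measure_eq_0:
  assumes g: "gibbs s q" and s: "0 < s" and less: "pressure s q < q * \<xi>"
  shows "hausdorff_measure s (khinchin_level_set \<xi>) = 0"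
proof -
  define c where "c = (q * \<xi> - pressure s q) / 2"
  have c: "0 < c" using less by (simp add: c_def)
  \<comment> \<open>Half of the margin \<open>q * \<xi> - pressure s q\<close> absorbs the deviation
    of \<open>lsum\<close>; the other half makes the sums decay like
    \<open>exp (- c) ^ n\<close>.\<close>
  define \<epsilon> where "\<epsilon> = c / (\<bar>q\<bar> + 1)"
  have e: "0 < \<epsilon>" "\<bar>q\<bar> * \<epsilon> \<le> c" using c by (auto simp: \<epsilon>_def field_simps)
  define S where "S n = {u \<in> pos_words n. \<bar>lsum u - real n * \<xi>\<bar> \<le> real n * \<epsilon>}" for n
  define w where "w u = (256 * (wprod u 0)\<^sup>2) powr s" for u
  define C where "C = 256 powr s * 256"
  have C: "0 < C" by (simp add: C_def)
  have w0: "0 \<le> w u" for u by (simp add: w_def)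
  have weight: "w u \<le> 256 powr s * exp (real n * (c - q * \<xi>)) * word_weight s q u 0" if u: "u \<in> S n" for u n
  proof -
    have p: "pos u" using u by (auto simp: S_def dest: pos_wordsD(1))
    have "- (q * lsum u) \<le> - (q * (real n * \<xi>)) + \<bar>q\<bar> * \<bar>lsum u - real n * \<xi>\<bar>"
    proof -
      have "- (q * (lsum u - real n * \<xi>)) \<le> \<bar>q * (lsum u - real n * \<xi>)\<bar>" by simp
      then have "- (q * (lsum u - real n * \<xi>)) \<le> \<bar>q\<bar> * \<bar>lsum u - real n * \<xi>\<bar>" by (simp only: abs_mult)
      then show ?thesis unfolding right_diff_distrib by linarith
    qed
    also have "\<bar>q\<bar> * \<bar>lsum u - real n * \<xi>\<bar> \<le> \<bar>q\<bar> * (real n * \<epsilon>)" using u by (intro mult_left_mono) (auto simp: S_def)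
    also have "\<dots> \<le> real n * c" using mult_left_mono[OF e(2), of "real n"] by (simp add: mult_ac)
    finally have q: "exp (- (q * lsum u)) \<le> exp (real n * (c - q * \<xi>))" by (simp add: algebra_simps)
    have "w u = 256 powr s * wprod u 0 powr (2 * s)"
      using wprod_pos[OF p, of 0] by (simp add: w_def powr_mult powr_powr flip: powr_numeral)
    also have "wprod u 0 powr (2 * s) = exp (- (q * lsum u)) * word_weight s q u 0"
      by (simp add: word_weight_eq[OF p] mult.assoc[symmetric] flip: exp_add)
    also have "\<dots> \<le> exp (real n * (c - q * \<xi>)) * word_weight s q u 0"
      using q word_weight_pos[OF p, of 0 s q] by (intro mult_right_mono) auto
    finally show ?thesis by (simp add: mult.assoc mult_left_mono)
  qed
  have level: "sum w F \<le> C * exp (- c) ^ n" if F: "finite F" "F \<subseteq> S n" for F n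
  proof -
    have sm: "(\<lambda>u. word_weight s q u 0) summable_on pos_words n" by (rule gibbs.summable_words[OF g]) simp
    have "sum w F \<le> (\<Sum>u\<in>F. 256 powr s * exp (real n * (c - q * \<xi>)) * word_weight s q u 0)"
      using F weight by (intro sum_mono) auto
    also have "\<dots> = 256 powr s * exp (real n * (c - q * \<xi>)) * (\<Sum>u\<in>F. word_weight s q u 0)"
      by (rule sum_distrib_left[symmetric])
    also have "(\<Sum>u\<in>F. word_weight s q u 0) \<le> gibbs.Zn s q n"
      unfolding gibbs.Zn_def[OF g]
    proof (rule finite_sum_le_infsum[OF sm F(1)])
      show "F \<subseteq> pos_words n" using F(2) by (auto simp: S_def)
      show "0 \<le> word_weight s q u 0" if "u \<in> pos_words n - F" for u
        using word_weight_pos[of u 0 s q] pos_wordsD(1)[of u n] that by auto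
    qed
    also have "\<dots> \<le> 256 * exp (real n * pressure s q)" by (rule gibbs.Zn_pressure(2)[OF g])
    also have "256 powr s * exp (real n * (c - q * \<xi>)) * (256 * exp (real n * pressure s q)) = C * exp (real n * (c - q * \<xi> + pressure s q))"
      by (simp add: C_def distrib_left exp_add)
    also have "c - q * \<xi> + pressure s q = - c" by (simp add: c_def field_simps)
    finally have "sum w F \<le> C * exp (real n * - c)" by (simp add: mult_left_mono)
    then show ?thesis unfolding exp_of_nat_mult .
  qed
  have c1: "0 \<le> exp (- c)" "exp (- c) < 1" using c by auto
  have tail: "sum w F \<le> C * exp (- c) ^ N / (1 - exp (- c))" if F: "finite F" "F \<subseteq> (\<Union>n\<in>{N..}. S n)" for F N
  proof -
    have len: "N \<le> length u" "u \<in> S (length u)" if "u \<in> F" for u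
      using F(2) that by (auto simp: S_def dest: pos_wordsD(2))
    have "sum w F = (\<Sum>n\<in>length ` F. sum w {u \<in> F. length u = n})"
      by (rule sum.image_gen[OF F(1)])
    also have "\<dots> \<le> (\<Sum>n\<in>length ` F. C * exp (- c) ^ n)"
    proof (intro sum_mono level)
      show "{u \<in> F. length u = n} \<subseteq> S n" for n using len(2) by auto
    qed (use F in auto)
    also have "\<dots> \<le> (\<Sum>n\<in>(\<lambda>i. i + N) ` {..Max (insert 0 (length ` F))}. C * exp (- c) ^ n)"
    proof (rule sum_mono2)
      show "length ` F \<subseteq> (\<lambda>i. i + N) ` {..Max (insert 0 (length ` F))}"
      proof
        fix n assume n: "n \<in> length ` F"
        then have "N \<le> n" using len by auto
        moreover have "n \<le> Max (insert 0 (length ` F))" using F(1) n by (intro Max_ge) auto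
        ultimately have "n = (n - N) + N" "n - N \<in> {..Max (insert 0 (length ` F))}" by auto
        then show "n \<in> (\<lambda>i. i + N) ` {..Max (insert 0 (length ` F))}" by (rule image_eqI)
      qed
    qed (use C in auto)
    also have "\<dots> = (\<Sum>i\<le>Max (insert 0 (length ` F)). C * exp (- c) ^ N * exp (- c) ^ i)"
      by (subst sum.reindex) (auto simp: power_add mult_ac)
    also have "\<dots> \<le> (\<Sum>i. C * exp (- c) ^ N * exp (- c) ^ i)"
      by (rule sum_le_suminf) (use c1 C in \<open>auto intro!: summable_mult summable_geometric\<close>)
    also have "\<dots> = C * exp (- c) ^ N * (1 / (1 - exp (- c)))"
      using c1 by (subst suminf_mult) (auto simp: suminf_geometric)
    finally show ?thesis by simp
  qed
  have in_levels: "\<exists>n\<ge>N. \<exists>u\<in>S n. x \<in> cyl u" if x: "x \<in> khinchin_level_set \<xi>" for x N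
  proof -
    have x0: "x \<noteq> 0" using x by (auto simp: khinchin_level_set_def)
    then have x1: "0 < x" "x < 1" "x \<notin> \<rat>" using x by (auto simp: khinchin_level_set_def)
    have "(\<lambda>n. (1 / real n) * lsum (digits n x)) \<longlonglongrightarrow> \<xi>"
      using x unfolding khinchin_level_set_def has_khinchin_exponent_def mem_Collect_eq
        sum_ln_partial_quotients[OF x1] by (elim conjE)
    from tendstoD[OF this e(1)] have "eventually (\<lambda>n. dist ((1 / real n) * lsum (digits n x)) \<xi> < \<epsilon> \<and> max 1 N \<le> n) sequentially"
      using eventually_ge_at_top[of "max 1 N"] by eventually_elim auto
    then obtain n where n: "dist ((1 / real n) * lsum (digits n x)) \<xi> < \<epsilon>" "1 \<le> n" "N \<le> n"
      by (metis (mono_tags, lifting) eventually_happens' max.bounded_iff sequentially_bot)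
    have "lsum (digits n x) - real n * \<xi> = real n * ((1 / real n) * lsum (digits n x) - \<xi>)"
      using n(2) by (simp add: field_simps)
    then have "\<bar>lsum (digits n x) - real n * \<xi>\<bar> = real n * \<bar>(1 / real n) * lsum (digits n x) - \<xi>\<bar>"
      by (simp only: abs_mult abs_of_nat)
    also have "\<dots> \<le> real n * \<epsilon>" using n(1) by (intro mult_left_mono) (auto simp: dist_real_def)
    finally have "digits n x \<in> S n" using digits_expansion(1)[OF x1] by (simp add: S_def)
    moreover have "x \<in> cyl (digits n x)"
      using digits_expansion(2-4)[OF x1, of n] unfolding cyl_def
      by (intro image_eqI[of x _ "(gauss_map ^^ n) x"]) auto
    ultimately show ?thesis using n(3) by blast
  qed
  have "hausdorff_content s \<delta> (khinchin_level_set \<xi>) \<le> ennreal \<rho>" if \<delta>: "0 < \<delta>" and \<rho>: "0 < \<rho>" for \<delta> \<rho>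
  proof -
    have "(\<lambda>n. C * exp (- c) ^ n / (1 - exp (- c))) \<longlonglongrightarrow> C * 0 / (1 - exp (- c))"
      using c1 by (intro tendsto_intros LIMSEQ_realpow_zero) auto
    then have "eventually (\<lambda>n. C * exp (- c) ^ n / (1 - exp (- c)) < \<rho>) sequentially"
      using \<rho> by (intro order_tendstoD(2)) auto
    moreover have "(\<lambda>n. 512 * (1 / 2) ^ n :: real) \<longlonglongrightarrow> 512 * 0"
      by (intro tendsto_intros LIMSEQ_realpow_zero) auto
    then have "eventually (\<lambda>n. 512 * (1 / 2) ^ n < \<delta>) sequentially"
      using \<delta> by (intro order_tendstoD(2)) auto
    ultimately have "eventually (\<lambda>n. C * exp (- c) ^ n / (1 - exp (- c)) < \<rho> \<and> 512 * (1 / 2) ^ n < \<delta>) sequentially"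
      by eventually_elim auto
    then obtain N where N: "C * exp (- c) ^ N / (1 - exp (- c)) < \<rho>" "512 * (1 / 2) ^ N < \<delta>"
      by (auto simp: eventually_sequentially)
    define W where "W = (\<Union>n\<in>{N..}. S n)"
    have Wp: "pos u" "N \<le> length u" if "u \<in> W" for u
      using that by (auto simp: W_def S_def dest: pos_wordsD)
    \<comment> \<open>The words in \<open>W\<close> are enumerated by their codes. The test
      \<open>to_nat u = i\<close> ensures that each word is used once; all other indices carry the
      empty set, whose gauge is 0.\<close>
    define U where "U i = (let u = from_nat i in if u \<in> W \<and> to_nat u = i then cyl u else {})" for i
    have diam: "diameter (cyl u) \<le> \<delta>" if u: "u \<in> W" for u
    proof -
      have "diameter (cyl u) \<le> 256 * (wprod u 0)\<^sup>2" by (rule diameter_cyl[OF Wp(1)[OF u]])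
      also have "\<dots> \<le> 256 * (2 * (1 / 2) ^ length u)"
        using wprod_square_le[OF Wp(1)[OF u], of 0] by (intro mult_left_mono) auto
      also have "\<dots> \<le> 256 * (2 * (1 / 2) ^ N)"
        using Wp(2)[OF u] by (intro mult_left_mono power_decreasing) auto
      finally show ?thesis using N(2) by simp
    qed
    have cov: "U \<in> delta_covers \<delta> (khinchin_level_set \<xi>)"
      unfolding delta_covers_def
    proof (intro CollectI conjI allI subsetI)
      fix x assume "x \<in> khinchin_level_set \<xi>"
      from in_levels[OF this, of N] obtain u where u: "u \<in> W" "x \<in> cyl u" by (auto simp: W_def)
      then have "x \<in> U (to_nat u)" by (simp add: U_def)
      then show "x \<in> (\<Union>i. U i)" by blast
    next
      fix i
      show "bounded (U i)" using cyl_bounded Wp by (auto simp: U_def Let_def)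
      show "diameter (U i) \<le> \<delta>" using diam \<delta> by (auto simp: U_def Let_def)
    qed
    have "(\<Sum>i. diam_gauge s (U i)) \<le> ennreal \<rho>"
    proof (rule ennreal_suminf_le)
      fix n
      define J where "J = {i \<in> {..<n}. (from_nat i :: nat list) \<in> W \<and> to_nat (from_nat i :: nat list) = i}"
      have inj: "inj_on (from_nat :: nat \<Rightarrow> nat list) J" by (rule inj_onI) (metis (mono_tags, lifting) J_def mem_Collect_eq)
      have "(\<Sum>i<n. diam_gauge s (U i)) = (\<Sum>i\<in>J. diam_gauge s (U i))"
        by (rule sum.mono_neutral_right) (auto simp: J_def U_def diam_gauge_def Let_def)
      also have "\<dots> \<le> (\<Sum>i\<in>J. ennreal (w (from_nat i)))"
      proof (rule sum_mono)
        fix i assume "i \<in> J"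
        then have i: "from_nat i \<in> W" "U i = cyl (from_nat i)" by (auto simp: J_def U_def)
        have "cyl (from_nat i) \<noteq> {}" by (simp add: cyl_def)
        then have "diam_gauge s (U i) = ennreal (diameter (cyl (from_nat i)) powr s)"
          using s by (simp add: i(2) diam_gauge_def)
        also have "\<dots> \<le> ennreal (w (from_nat i))"
          unfolding w_def using s diameter_cyl[OF Wp(1)[OF i(1)]] diameter_ge_0[OF cyl_bounded[OF Wp(1)[OF i(1)]]]
          by (intro ennreal_leI powr_mono2) auto
        finally show "diam_gauge s (U i) \<le> ennreal (w (from_nat i))" .
      qed
      also have "\<dots> = ennreal (\<Sum>i\<in>J. w (from_nat i))" by (rule sum_ennreal) (rule w0)
      also have "(\<Sum>i\<in>J. w (from_nat i)) = sum w (from_nat ` J)" by (simp add: sum.reindex[OF inj])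
      also have "ennreal \<dots> \<le> ennreal \<rho>"
      proof (rule ennreal_leI)
        have "sum w (from_nat ` J) \<le> C * exp (- c) ^ N / (1 - exp (- c))"
          by (rule tail) (auto simp: J_def W_def)
        then show "sum w (from_nat ` J) \<le> \<rho>" using N(1) by simp
      qed
      finally show "(\<Sum>i<n. diam_gauge s (U i)) \<le> ennreal \<rho>" .
    qed
    then show ?thesis unfolding hausdorff_content_def by (rule INF_lower2[OF cov])
  qed
  then have "hausdorff_content s \<delta> (khinchin_level_set \<xi>) = 0" if "0 < \<delta>" for \<delta>
    using that by (metis ennreal_0 ennreal_le_epsilon le_zero_eq add_0)
  then show ?thesis unfolding hausdorff_measure_def by (simp add: SUP_eq_const)
qed

lemma hausdorff_dim_le:
  assumes "0 \<le> t" "t < 2" "\<And>s. t < s \<Longrightarrow> s < 2 \<Longrightarrow> hausdorff_measure s A = 0"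
  shows "hausdorff_dim A \<le> ereal t"
proof (rule ereal_le_epsilon2)
  fix e :: real assume e: "0 < e"
  define s where "s = t + min e ((2 - t) / 2)"
  have s: "t < s" "s < 2" "s \<le> t + e" using assms e by (auto simp: s_def min_def field_simps)
  have "hausdorff_dim A \<le> ereal s"
    unfolding hausdorff_dim_def by (rule INF_lower) (use assms s in auto)
  also have "\<dots> \<le> ereal t + ereal e" using s by simp
  finally show "hausdorff_dim A \<le> ereal t + ereal e" .
qed

theorem hausdorff_dim_upper:
  assumes "0 \<le> \<xi>" shows "hausdorff_dim (khinchin_level_set \<xi>) \<le> ereal (t_fun \<xi>)"
proof (cases "\<xi> = 0")
  case True
  have "hausdorff_dim (khinchin_level_set 0) \<le> ereal 0"
  proof (rule hausdorff_dim_le)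
    fix s :: real assume s: "0 < s" "s < 2"
    obtain q where "q < - 2" "pressure s q < 0" using pressure_negative[of s] s by auto
    then show "hausdorff_measure s (khinchin_level_set 0) = 0"
      using s by (intro hausdorff_measure_eq_0[of s q]) (auto simp: gibbs_def)
  qed auto
  then show ?thesis using True by (simp add: t_fun_def)
next
  case False
  then have \<xi>: "0 < \<xi>" using assms by simp
  define t q where "t = t_fun \<xi>" and "q = q_fun \<xi>"
  have D: "pdom t q" and P: "pressure t q = q * \<xi>" using t_fun_sol(1)[OF \<xi>] by (auto simp: sol_def t_def q_def)
  have "hausdorff_dim (khinchin_level_set \<xi>) \<le> ereal t"
  proof (rule hausdorff_dim_le)
    fix s assume s: "t < s" "s < 2"
    have "pressure s q \<le> pressure t q - (s - t) * ln 2"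
      using pressure_decreasing[OF pdom_gibbs[OF D], of "s - t"] s by simp
    moreover have "0 < (s - t) * ln 2" using s by simp
    ultimately have "pressure s q < q * \<xi>" using P by linarith
    then show "hausdorff_measure s (khinchin_level_set \<xi>) = 0"
      using D s by (intro hausdorff_measure_eq_0[of s q]) (auto simp: gibbs_def pdom_def)
  qed (use D in \<open>auto simp: pdom_def\<close>)
  then show ?thesis by (simp add: t_def)
qed

section \<open>Numbers with prescribed partial quotients\<close>

text \<open>The cylinders are closed, so existence of a point is compactness; that endpoints do not
  occur is derived from the infinitude of the digits.\<close>

definition in_cyls :: "(nat \<Rightarrow> nat) \<Rightarrow> real \<Rightarrow> bool" where
  "in_cyls d x \<longleftrightarrow> (\<forall>n. x \<in> cyl (map d [0..<n]))"

lemma compact_cyl: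
  assumes "pos u" shows "compact (cyl u)"
  unfolding cyl_def
proof (rule compact_continuous_image)
  show "continuous_on {0..1} (cfrac_tail u)"
    using assms
  proof (induction u)
    case (Cons w u)
    have "real w + cfrac_tail u x \<noteq> 0" if "x \<in> {0..1}" for x
      using cfrac_tail_in[of u x] Cons.prems that by auto
    then show ?case using Cons by (auto intro!: continuous_intros)
  qed (simp add: continuous_on_id)
qed simp

lemma in_cyls_exists:
  assumes d: "\<And>j. 1 \<le> d j"
  obtains x where "in_cyls d x"
proof -
  define K where "K n = cyl (map d [0..<n])" for n
  have p: "pos (map d [0..<n])" for n using d by auto
  have dec: "K (Suc n) \<subseteq> K n" for n
  proof
    fix x assume "x \<in> K (Suc n)"
    then obtain y where y: "y \<in> {0..1}" "x = cfrac_tail (map d [0..<n] @ [d n]) y"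
      by (auto simp: K_def cyl_def)
    have "cfrac_tail [d n] y \<in> {0..1}" by (rule cfrac_tail_in) (use d y in auto)
    then show "x \<in> K n" unfolding K_def cyl_def y(2) cfrac_tail_append by (rule imageI)
  qed
  have "\<Inter>(range K) \<noteq> {}"
  proof (rule compact_nest)
    show "compact (K n)" for n unfolding K_def by (rule compact_cyl[OF p])
    show "K n \<noteq> {}" for n by (simp add: K_def cyl_def)
    show "K n \<subseteq> K m" if "m \<le> n" for m n using that by (rule lift_Suc_antimono_le[of K, OF dec])
  qed
  then show ?thesis using that by (auto simp: in_cyls_def K_def)
qed

lemma in_cyls_step:
  assumes d: "\<And>j. 1 \<le> d j" and x: "in_cyls d x"
  shows "0 < x" "in_cyls (\<lambda>j. d (Suc j)) (1 / x - real (d 0))"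
proof -
  have e: "\<exists>c. c \<in> cyl (map (\<lambda>j. d (Suc j)) [0..<n]) \<and> x = 1 / (real (d 0) + c)" for n
  proof -
    have "[0..<Suc n] = 0 # map Suc [0..<n]" by (simp add: upt_conv_Cons map_Suc_upt del: upt_Suc)
    then have m: "map d [0..<Suc n] = d 0 # map (\<lambda>j. d (Suc j)) [0..<n]" by (simp del: upt_Suc)
    have "x \<in> cyl (map d [0..<Suc n])" using x unfolding in_cyls_def by blast
    then show ?thesis unfolding m cyl_def by auto
  qed
  have d0: "1 \<le> real (d 0)" using d[of 0] by simp
  have c0: "0 \<le> c" if "c \<in> cyl (map (\<lambda>j. d (Suc j)) [0..<n])" for c n
    using that d cfrac_tail_in[of "map (\<lambda>j. d (Suc j)) [0..<n]"] by (auto simp: cyl_def)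
  show "0 < x"
  proof -
    obtain c where c: "c \<in> cyl (map (\<lambda>j. d (Suc j)) [0..<0])" "x = 1 / (real (d 0) + c)" using e by blast
    then show ?thesis using c0[OF c(1)] d0 by simp
  qed
  show "in_cyls (\<lambda>j. d (Suc j)) (1 / x - real (d 0))"
    unfolding in_cyls_def
  proof
    fix n
    obtain c where c: "c \<in> cyl (map (\<lambda>j. d (Suc j)) [0..<n])" "x = 1 / (real (d 0) + c)" using e by blast
    then show "1 / x - real (d 0) \<in> cyl (map (\<lambda>j. d (Suc j)) [0..<n])" by simp
  qed
qed

text \<open>The shifted point has prescribed digits again and is therefore positive. Used twice,
  this puts it strictly between 0 and 1, so the floor of \<open>1 / x\<close> is the digit.\<close>

lemma in_cyls_gauss:
  assumes d: "\<And>j. 1 \<le> d j" and x: "in_cyls d x"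
  shows "0 < x" "x < 1" "gauss_map x = 1 / x - real (d 0)" "\<lfloor>1 / x\<rfloor> = int (d 0)"
proof -
  have lt: "x < 1" "0 < 1 / x - real (d 0)" if d: "\<And>j. 1 \<le> d j" and x: "in_cyls d x" for d x
  proof -
    note s = in_cyls_step[OF d x]
    show *: "0 < 1 / x - real (d 0)" using in_cyls_step(1)[OF _ s(2)] d by simp
    have "1 \<le> real (d 0)" using d[of 0] by simp
    then have "1 < 1 / x" using * by linarith
    then show "x < 1" using s(1) by (simp add: field_simps)
  qed
  note s = in_cyls_step[OF d x]
  show "0 < x" "x < 1" using s(1) lt(1)[OF d x] by auto
  have b: "0 < 1 / x - real (d 0)" "1 / x - real (d 0) < 1" using lt(2)[OF d x] lt(1)[OF _ s(2)] d by auto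
  then show f: "\<lfloor>1 / x\<rfloor> = int (d 0)" by (simp add: floor_eq_iff)
  show "gauss_map x = 1 / x - real (d 0)" using s(1) f by (simp add: gauss_map_def frac_def)
qed

lemma in_cyls_iterate:
  assumes "\<And>j. 1 \<le> d j" "in_cyls d x"
  shows "in_cyls (\<lambda>j. d (n + j)) ((gauss_map ^^ n) x)"
proof (induction n)
  case 0 then show ?case using assms by simp
next
  case (Suc n)
  have d: "\<And>j. 1 \<le> d (n + j)" using assms by simp
  show ?case using in_cyls_step(2)[OF d Suc] in_cyls_gauss(3)[OF d Suc] by simp
qed

text \<open>On \<open>p / r\<close> the Gauss map performs one step of Euclid's algorithm, replacing
  \<open>(p, r)\<close> by \<open>(r mod p, p)\<close>.\<close>

lemma rational_orbit_terminates:
  assumes "p < r" shows "\<exists>n. (gauss_map ^^ n) (real p / real r) = 0"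
  using assms
proof (induction p arbitrary: r rule: less_induct)
  case (less p)
  show ?case
  proof (cases "p = 0")
    case True then show ?thesis by (intro exI[of _ 0]) simp
  next
    case False
    have "gauss_map (real p / real r) = frac (real r / real p)"
      using False less.prems by (simp add: gauss_map_def)
    also have "\<dots> = real (r mod p) / real p"
    proof -
      have "real r = real (r div p) * real p + real (r mod p)"
        by (metis div_mult_mod_eq of_nat_add of_nat_mult)
      then have e: "real r / real p = real_of_int (int (r div p)) + real (r mod p) / real p"
        using False by (simp add: field_simps)
      have "real (r mod p) < real p" using False by simp
      then have "real (r mod p) / real p < 1" using False by simp
      then show ?thesis unfolding e frac_unique_iff by simp
    qed
    finally have g: "gauss_map (real p / real r) = real (r mod p) / real p" .
    have "r mod p < p" using False by simp
    from less.IH[OF this this] obtain n where "(gauss_map ^^ n) (real (r mod p) / real p) = 0" by blast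
    then have "(gauss_map ^^ Suc n) (real p / real r) = 0" using g by (simp add: funpow_Suc_right del: funpow.simps)
    then show ?thesis by blast
  qed
qed

lemma in_cyls_irrational:
  assumes d: "\<And>j. 1 \<le> d j" and x: "in_cyls d x"
  shows "x \<notin> \<rat>"
proof
  assume "x \<in> \<rat>"
  moreover have "0 < x" "x < 1" using in_cyls_gauss[OF d x] by auto
  ultimately obtain p r :: nat where pr: "r \<noteq> 0" "\<bar>x\<bar> = real p / real r" using Rats_abs_nat_div_natE by metis
  then have xe: "x = real p / real r" using \<open>0 < x\<close> by simp
  then have "p < r" using \<open>x < 1\<close> pr(1) by simp
  from rational_orbit_terminates[OF this] obtain n where "(gauss_map ^^ n) x = 0" using xe by auto
  moreover have "0 < (gauss_map ^^ n) x"
    by (rule in_cyls_gauss(1)[OF _ in_cyls_iterate[OF d x]]) (rule d)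
  ultimately show False by simp
qed

lemma in_cyls_digits:
  assumes d: "\<And>j. 1 \<le> d j" and x: "in_cyls d x"
  shows "digits n x = map d [0..<n]"
proof -
  have "\<lfloor>1 / (gauss_map ^^ j) x\<rfloor> = int (d j)" for j
    using in_cyls_gauss(4)[OF _ in_cyls_iterate[OF d x], of j] d by simp
  then show ?thesis by (simp add: digits_def partial_quotient_def)
qed

lemma in_cyls_expansion:
  assumes d: "\<And>j. 1 \<le> d j" and x: "in_cyls d x"
  shows "x = cfrac_tail (map d [0..<n]) ((gauss_map ^^ n) x)"
  using digits_expansion(2)[OF in_cyls_gauss(1,2)[OF d x] in_cyls_irrational[OF d x], of n]
    in_cyls_digits[OF d x, of n] by simp

text \<open>The lower bound holds because the first digit is at most \<open>N\<close>; the same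
  bound for the image under the Gauss map keeps \<open>x\<close> away from 1.\<close>

lemma in_cyls_bounds:
  assumes d: "\<And>j. 1 \<le> d j" "\<And>j. d j \<le> N" and x: "in_cyls d x"
  shows "1 / (real N + 1) \<le> x" "x \<le> (real N + 1) / (real N + 2)"
proof -
  have low: "1 / (real N + 1) \<le> x" if d: "\<And>j. 1 \<le> d j" "\<And>j. d j \<le> N" and x: "in_cyls d x" for d x
  proof -
    note g = in_cyls_gauss[OF d(1) x]
    have "gauss_map x < 1" using in_cyls_gauss(2)[OF _ in_cyls_iterate[OF d(1) x, of 1]] d by simp
    then have "1 / x < real (d 0) + 1" using g(3) by simp
    also have "\<dots> \<le> real N + 1" using d(2)[of 0] by simp
    finally show ?thesis using g(1) by (simp add: field_simps)
  qed
  show "1 / (real N + 1) \<le> x" by (rule low[OF d x])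
  note g = in_cyls_gauss[OF d(1) x]
  have "1 / (real N + 1) \<le> gauss_map x"
    using low[OF _ _ in_cyls_iterate[OF d(1) x, of 1]] d by simp
  then have "real (d 0) + 1 / (real N + 1) \<le> 1 / x" using g(3) by simp
  moreover have "1 \<le> real (d 0)" using d(1)[of 0] by simp
  ultimately have "1 + 1 / (real N + 1) \<le> 1 / x" by linarith
  then have "x * (real N + 2) \<le> real N + 1" using g(1) by (simp add: field_simps)
  then show "x \<le> (real N + 1) / (real N + 2)" by (simp add: field_simps)
qed

text \<open>After the \<open>n\<close> common digits the shifted points differ by at least
  \<open>1 / (N + 2) ^ 3\<close>: their reciprocals differ by at least \<open>1 / (N + 2)\<close>,
  and so much each point exceeds 0. The common branch scales this by \<open>wprod\<close> at both
  points, each within a factor 16 of its value at 0.\<close>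

lemma in_cyls_separated:
  assumes d: "\<And>j. 1 \<le> d j" "\<And>j. d j \<le> N" and x: "in_cyls d x"
    and e: "\<And>j. 1 \<le> e j" "\<And>j. e j \<le> N" and y: "in_cyls e y"
    and eq: "\<And>j. j < n \<Longrightarrow> d j = e j" and ne: "d n \<noteq> e n"
  shows "(wprod (map d [0..<n]) 0)\<^sup>2 / (256 * (real N + 2) ^ 3) \<le> \<bar>x - y\<bar>"
proof -
  define x' y' where "x' = (gauss_map ^^ n) x" and "y' = (gauss_map ^^ n) y"
  have x': "in_cyls (\<lambda>j. d (n + j)) x'" and y': "in_cyls (\<lambda>j. e (n + j)) y'"
    unfolding x'_def y'_def by (rule in_cyls_iterate; fact)+
  have xb: "0 < x'" "x' < 1" "1 / (real N + 1) \<le> x'" and yb: "0 < y'" "y' < 1" "1 / (real N + 1) \<le> y'"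
    using in_cyls_gauss(1,2)[OF _ x'] in_cyls_gauss(1,2)[OF _ y'] in_cyls_bounds(1)[OF _ _ x'] in_cyls_bounds(1)[OF _ _ y'] d e
    by auto
  have gap: "1 / (real N + 2) ^ 3 \<le> x' - y'"
    if d: "\<And>j. 1 \<le> d j" "\<And>j. d j \<le> N" and x': "in_cyls d x'"
    and e: "\<And>j. 1 \<le> e j" "\<And>j. e j \<le> N" and y': "in_cyls e y'" and lt: "d 0 < e 0" for d e x' y'
  proof -
    have x0: "0 < x'" and y0: "0 < y'" using in_cyls_gauss(1)[OF _ x'] in_cyls_gauss(1)[OF _ y'] d e by auto
    have lx: "1 / (real N + 1) \<le> x'" and ly: "1 / (real N + 1) \<le> y'"
      using in_cyls_bounds(1)[OF _ _ x'] in_cyls_bounds(1)[OF _ _ y'] d e by auto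
    have gx: "gauss_map x' \<le> (real N + 1) / (real N + 2)"
      using in_cyls_bounds(2)[OF _ _ in_cyls_iterate[OF d(1) x', of 1]] d by simp
    have gy: "0 < gauss_map y'" using in_cyls_gauss(1)[OF _ in_cyls_iterate[OF e(1) y', of 1]] e by simp
    have "real (d 0) + 1 \<le> real (e 0)" using lt by simp
    then have "1 - (real N + 1) / (real N + 2) \<le> 1 / y' - 1 / x'"
      using in_cyls_gauss(3)[OF d(1) x'] in_cyls_gauss(3)[OF e(1) y'] gx gy by linarith
    moreover have "1 - (real N + 1) / (real N + 2) = 1 / (real N + 2)" by (simp add: field_simps)
    ultimately have h: "1 / (real N + 2) \<le> 1 / y' - 1 / x'" by simp
    have h0: "0 \<le> 1 / y' - 1 / x'" by (rule order_trans[OF _ h]) simp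
    have "1 / (real N + 2) ^ 3 = 1 / (real N + 2) * (1 / (real N + 2) * (1 / (real N + 2)))"
      by (simp add: power3_eq_cube)
    also have "\<dots> \<le> (1 / y' - 1 / x') * (x' * y')"
    proof (intro mult_mono h)
      have "1 / (real N + 2) \<le> 1 / (real N + 1)" by (simp add: field_simps)
      then show "1 / (real N + 2) \<le> x'" "1 / (real N + 2) \<le> y'" using lx ly by linarith+
    qed (use h0 x0 y0 in auto)
    also have "\<dots> = x' - y'" using x0 y0 by (simp add: field_simps)
    finally show ?thesis .
  qed
  have g: "1 / (real N + 2) ^ 3 \<le> \<bar>x' - y'\<bar>"
  proof (cases "d n < e n")
    case True
    have "1 / (real N + 2) ^ 3 \<le> x' - y'" by (rule gap[OF _ _ x' _ _ y']) (use d e True in auto)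
    then show ?thesis by simp
  next
    case False
    have "1 / (real N + 2) ^ 3 \<le> y' - x'" by (rule gap[OF _ _ y' _ _ x']) (use d e False ne in auto)
    then show ?thesis by simp
  qed
  define u where "u = map d [0..<n]"
  have u: "pos u" using d by (auto simp: u_def)
  have ue: "u = map e [0..<n]" using eq by (simp add: u_def)
  have xx: "x = cfrac_tail u x'" unfolding u_def x'_def by (rule in_cyls_expansion[OF d(1) x])
  have yy: "y = cfrac_tail u y'" unfolding ue y'_def by (rule in_cyls_expansion[OF e(1) y])
  have "\<bar>x - y\<bar> = \<bar>cfrac_tail u x' - cfrac_tail u y'\<bar>"
    by (simp only: xx[symmetric] yy[symmetric])
  also have "\<dots> = \<bar>x' - y'\<bar> * (wprod u x' * wprod u y')"
    by (rule cfrac_tail_diff[OF u]) (use xb yb in auto)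
  also have "\<dots> \<ge> 1 / (real N + 2) ^ 3 * ((wprod u 0 / 16) * (wprod u 0 / 16))"
    using g wprod_distortion[OF u, of 0 x'] wprod_distortion[OF u, of 0 y'] wprod_pos[OF u, of 0] xb yb
    by (intro mult_mono) auto
  finally show ?thesis by (simp add: u_def power2_eq_square)
qed

section \<open>Choice of the block distribution\<close>

definition blocks :: "nat \<Rightarrow> nat \<Rightarrow> nat list set" where
  "blocks m N = {u. length u = m \<and> set u \<subseteq> {1..N}}"

lemma finite_blocks: "finite (blocks m N)"
  using finite_lists_length_eq[of "{1..N}" m] by (simp add: blocks_def conj_commute)

lemma blocks_pos: "u \<in> blocks m N \<Longrightarrow> pos u"
  by (auto simp: blocks_def)

text \<open>Minimise \<open>R N\<close> over \<open>q\<close>: the vanishing derivative is the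
  centering condition. For some \<open>N\<close> all values of \<open>R N\<close> exceed
  \<open>Y\<close>. Otherwise the sublevel sets, compact and decreasing in \<open>N\<close>, share
  some \<open>q\<close>, for which the sums over all words of length \<open>m\<close> stay bounded.
  Below the edge this contradicts the margin, since \<open>exp (m * c) > 256 * Y\<close>; at or
  beyond it, the divergence of \<open>P\<close>.\<close>

lemma block_parameters:
  assumes s: "0 < s" "s < 2" and \<xi>: "0 < \<xi>" and c: "0 < c" and Y: "0 < Y"
    and margin: "\<And>q. gibbs s q \<Longrightarrow> q * \<xi> + c \<le> pressure s q"
  obtains m N q where "1 \<le> m" "1 \<le> N"
    "(\<Sum>u\<in>blocks m N. (lsum u - real m * \<xi>) * (exp (q * (lsum u - real m * \<xi>)) * wprod u 0 powr (2 * s))) = 0"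
    "Y \<le> (\<Sum>u\<in>blocks m N. exp (q * (lsum u - real m * \<xi>)) * wprod u 0 powr (2 * s))"
proof -
  obtain m :: nat where m: "256 * Y / c < real m" using reals_Archimedean2 by blast
  have "0 < 256 * Y / c" using c Y by simp
  then have m1: "1 \<le> m" and mpos: "0 < real m" using m by linarith+
  have mc: "256 * Y < exp (real m * c)"
  proof -
    have "256 * Y < real m * c" using m c by (simp add: field_simps)
    also have "\<dots> \<le> exp (real m * c)" using exp_ge_add_one_self[of "real m * c"] by linarith
    finally show ?thesis .
  qed
  define v where "v u = wprod u 0 powr (2 * s)" for u
  define X where "X u = lsum u - real m * \<xi>" for u
  define R where "R N q = (\<Sum>u\<in>blocks m N. exp (q * X u) * v u)" for N q
  have v: "0 < v u" if "pos u" for u unfolding v_def using wprod_pos[OF that, of 0] by simp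
  have v0: "0 \<le> v u" for u by (simp add: v_def)
  have term_le: "exp (q * X u) * v u \<le> R N q" if "u \<in> blocks m N" for u N q
    unfolding R_def by (rule member_le_sum[OF that _ finite_blocks]) (auto simp: v0)
  have mono: "R N q \<le> R N' q" if "N \<le> N'" for N N' q
    unfolding R_def by (rule sum_mono2[OF finite_blocks]) (use that in \<open>auto simp: blocks_def v0\<close>)
  \<comment> \<open>The words \<open>1 ... 1\<close> and \<open>N0 ... N0\<close> have mean
    logarithms below and above \<open>\<xi>\<close>, so \<open>R N q\<close> grows in both
    directions of \<open>q\<close>.\<close>
  obtain N0 :: nat where N0: "exp (\<xi> + 1) \<le> real N0" using real_arch_simple by blast
  have N01: "1 \<le> N0" using N0 exp_gt_zero[of "\<xi> + 1"] by linarith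
  have lN0: "\<xi> + 1 \<le> ln (real N0)" using N0 N01 by (subst ln_ge_iff) auto
  define u1 uN where "u1 = replicate m (1::nat)" and "uN = replicate m N0"
  have u1: "u1 \<in> blocks m N" if "1 \<le> N" for N using that by (auto simp: blocks_def u1_def)
  have uN: "uN \<in> blocks m N0" using N01 by (auto simp: blocks_def uN_def)
  have X1: "X u1 = - (real m * \<xi>)" by (simp add: X_def lsum_def u1_def sum_list_replicate)
  have XN: "real m \<le> X uN"
  proof -
    have "X uN = real m * (ln (real N0) - \<xi>)" by (simp add: X_def lsum_def uN_def sum_list_replicate right_diff_distrib)
    moreover have "real m * 1 \<le> real m * (ln (real N0) - \<xi>)" using lN0 by (intro mult_left_mono) auto
    ultimately show ?thesis by simp
  qed
  have v1: "0 < v u1" and vN: "0 < v uN" using v blocks_pos u1[of 1] uN by auto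
  have bounded: "\<exists>a b. \<forall>N\<ge>N0. {q. R N q \<le> B} \<subseteq> {a..b}" if B: "0 < B" for B
  proof (intro exI allI impI subsetI)
    fix N q assume N: "N0 \<le> N" and "q \<in> {q. R N q \<le> B}"
    then have q: "R N q \<le> B" by simp
    have "exp (q * X u1) * v u1 \<le> B" using term_le[OF u1, of N q] q N N01 by simp
    then have "exp (q * X u1) \<le> B / v u1" using v1 by (simp add: field_simps)
    then have "q * X u1 \<le> ln (B / v u1)" using B v1 by (simp add: ln_ge_iff)
    then have "- ln (B / v u1) / (real m * \<xi>) \<le> q" using mpos \<xi> by (simp add: X1 field_simps)
    moreover have "q \<le> max 0 (ln (B / v uN))"
    proof (cases "q \<le> 0")
      case False
      have "exp (q * X uN) * v uN \<le> B" using term_le[OF uN, of q] mono[OF N, of q] q by simp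
      then have "exp (q * X uN) \<le> B / v uN" using vN by (simp add: field_simps)
      then have "q * X uN \<le> ln (B / v uN)" using B vN by (simp add: ln_ge_iff)
      moreover have "q * 1 \<le> q * X uN" using False XN m1 by (intro mult_left_mono) auto
      ultimately show ?thesis by simp
    qed simp
    ultimately show "q \<in> {- ln (B / v u1) / (real m * \<xi>)..max 0 (ln (B / v uN))}" by simp
  qed
  have contR: "continuous_on S (R N)" for S N
    unfolding R_def[abs_def] by (intro continuous_intros)
  have clos: "closed {q. R N q \<le> B}" for N B
    by (rule closed_Collect_le) (auto intro: contR continuous_on_const)
  have "\<exists>N\<ge>N0. \<forall>q. Y < R N q"
  proof (rule ccontr)
    assume "\<not> ?thesis"
    then have ex: "\<exists>q. R N q \<le> Y" if "N0 \<le> N" for N using that by (auto simp: not_less)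
    obtain a b where ab: "\<And>N. N0 \<le> N \<Longrightarrow> {q. R N q \<le> Y} \<subseteq> {a..b}" using bounded[OF Y] by blast
    define F where "F j = {q. R (N0 + j) q \<le> Y}" for j
    have "\<Inter>(range F) \<noteq> {}"
    proof (rule compact_nest)
      show "compact (F j)" for j
        using ab[of "N0 + j"] clos unfolding F_def compact_eq_bounded_closed
        by (auto intro: bounded_subset[OF bounded_closed_interval])
      show "F j \<noteq> {}" for j using ex[of "N0 + j"] by (auto simp: F_def)
      show "F j \<subseteq> F i" if "i \<le> j" for i j using mono[of "N0 + i" "N0 + j"] that by (auto simp: F_def intro: order_trans)
    qed
    then obtain q where q0: "\<And>j. R (N0 + j) q \<le> Y" by (auto simp: F_def)
    have q: "R N q \<le> Y" for N
      using mono[of N "N0 + N" q] q0[of N] by simp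
    define B0 where "B0 = Y * exp (q * (real m * \<xi>))"
    have B0: "0 < B0" using Y by (simp add: B0_def)
    have fin: "(\<Sum>u\<in>F. exp (q * lsum u) * v u) \<le> B0" if F: "finite F" "F \<subseteq> pos_words m" for F
    proof -
      define N where "N = Max (insert 1 (\<Union>u\<in>F. set u))"
      have fs: "finite (insert 1 (\<Union>u\<in>F. set u))" using F(1) by auto
      have "F \<subseteq> blocks m N"
      proof
        fix u assume u: "u \<in> F"
        have "\<forall>k\<in>set u. k \<le> N"
        proof
          fix k assume "k \<in> set u"
          then have "k \<in> insert 1 (\<Union>u\<in>F. set u)" using u by blast
          from Max_ge[OF fs this] show "k \<le> N" by (simp only: N_def)
        qed
        moreover have "u \<in> pos_words m" using F(2) u by blast
        ultimately show "u \<in> blocks m N" by (auto simp: blocks_def pos_words_def)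
      qed
      then have "(\<Sum>u\<in>F. exp (q * X u) * v u) \<le> R N q"
        unfolding R_def by (intro sum_mono2 finite_blocks) (auto simp: v0)
      also have "\<dots> \<le> Y" by (rule q)
      finally have "exp (q * (real m * \<xi>)) * (\<Sum>u\<in>F. exp (q * X u) * v u) \<le> B0"
        by (simp add: B0_def mult.commute)
      then show ?thesis
        by (simp add: sum_distrib_left X_def right_diff_distrib exp_diff)
    qed
    \<comment> \<open>As \<open>lsum\<close> is nonnegative, lowering the exponent to
      \<open>r \<le> q\<close> only decreases the sums; a bound at \<open>q\<close> thus passes into
      the region of convergence.\<close>
    have Zb: "exp (real m * pressure s r) \<le> 256 * B0" if r: "r \<le> q" and g: "gibbs s r" for r
    proof -
      have sm: "(\<lambda>u. word_weight s r u 0) summable_on pos_words m" by (rule gibbs.summable_words[OF g]) simp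
      have "gibbs.Zn s r m \<le> B0" unfolding gibbs.Zn_def[OF g]
      proof (rule infsum_le_finite_sums[OF sm])
        fix F assume F: "finite F" "F \<subseteq> pos_words m"
        have "(\<Sum>u\<in>F. word_weight s r u 0) \<le> (\<Sum>u\<in>F. exp (q * lsum u) * v u)"
        proof (rule sum_mono)
          fix u assume "u \<in> F"
          then have u: "pos u" using F(2) pos_wordsD(1) by blast
          have "r * lsum u \<le> q * lsum u" using r lsum_nonneg[OF u] by (rule mult_right_mono)
          then show "word_weight s r u 0 \<le> exp (q * lsum u) * v u"
            unfolding word_weight_eq[OF u, of 0, simplified] v_def by (intro mult_right_mono) auto
        qed
        also have "\<dots> \<le> B0" by (rule fin[OF F])
        finally show "(\<Sum>u\<in>F. word_weight s r u 0) \<le> B0" .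
      qed
      then show ?thesis using gibbs.Zn_pressure(1)[OF g, of m] by simp
    qed
    show False
    proof (cases "1 < 2 * s - q")
      case True
      then have g: "gibbs s q" using s by (simp add: gibbs_def)
      have "real m * (q * \<xi> + c) \<le> real m * pressure s q" using margin[OF g] by (intro mult_left_mono) auto
      then have "exp (real m * (q * \<xi> + c)) \<le> 256 * B0" using Zb[OF order_refl g] by (meson exp_le_cancel_iff order_trans)
      then have "exp (q * (real m * \<xi>)) * exp (real m * c) \<le> exp (q * (real m * \<xi>)) * (256 * Y)"
      proof -
        have "exp (real m * (q * \<xi> + c)) = exp (q * (real m * \<xi>)) * exp (real m * c)"
          by (simp add: algebra_simps flip: exp_add)
        moreover have "256 * B0 = exp (q * (real m * \<xi>)) * (256 * Y)" by (simp add: B0_def)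
        ultimately show ?thesis using \<open>exp (real m * (q * \<xi> + c)) \<le> 256 * B0\<close> by simp
      qed
      then show False using mc by simp
    next
      case False
      have "eventually (\<lambda>r. \<bar>ln (256 * B0)\<bar> < pressure s r) (at_left (2 * s - 1))"
        by (rule pressure_at_edge) (use s in auto)
      then obtain b where b: "b < 2 * s - 1" "\<And>r. b < r \<Longrightarrow> r < 2 * s - 1 \<Longrightarrow> \<bar>ln (256 * B0)\<bar> < pressure s r"
        by (auto simp: eventually_at_left_field)
      define r where "r = (b + (2 * s - 1)) / 2"
      have r: "b < r" "r < 2 * s - 1" using b(1) by (auto simp: r_def)
      have g: "gibbs s r" using r s by (simp add: gibbs_def)
      have "\<bar>ln (256 * B0)\<bar> < pressure s r" by (rule b(2)[OF r])
      moreover from this have "1 * pressure s r \<le> real m * pressure s r" using m1 by (intro mult_right_mono) auto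
      ultimately have "ln (256 * B0) < real m * pressure s r" by linarith
      then have "exp (ln (256 * B0)) < exp (real m * pressure s r)" by (simp only: exp_less_cancel_iff)
      then show False using Zb[OF _ g] r False B0 by simp
    qed
  qed
  then obtain N where N: "N0 \<le> N" "\<And>q. Y < R N q" by blast
  have R0: "0 < R N 0" using N(2)[of 0] Y by simp
  obtain a b where ab: "{q. R N q \<le> R N 0} \<subseteq> {a..b}" using bounded[OF R0] N(1) by blast
  have "0 \<in> {a..b}" using ab by auto
  then obtain q where q: "q \<in> {a..b}" "\<And>r. r \<in> {a..b} \<Longrightarrow> R N q \<le> R N r"
    using continuous_attains_inf[of "{a..b}" "R N"] contR by auto
  have glob: "R N q \<le> R N r" for r
  proof (cases "r \<in> {a..b}")
    case False
    then have "r \<notin> {q. R N q \<le> R N 0}" using ab by blast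
    then have "R N 0 \<le> R N r" by simp
    then show ?thesis using q(2)[OF \<open>0 \<in> {a..b}\<close>] by simp
  qed (rule q(2))
  have "(R N has_real_derivative (\<Sum>u\<in>blocks m N. exp (q * X u) * X u * v u)) (at q)"
    unfolding R_def[abs_def] by (auto intro!: derivative_eq_intros sum.cong)
  then have "(\<Sum>u\<in>blocks m N. exp (q * X u) * X u * v u) = 0"
    by (rule DERIV_local_min[of _ _ _ 1]) (use glob in auto)
  then show ?thesis
    using that[of m N q] m1 N N01 less_imp_le[OF N(2)[of q]]
    by (simp add: R_def X_def v_def mult_ac)
qed

section \<open>Mass distribution\<close>

lemma wprod_ge:
  assumes "pos u" "\<forall>k\<in>set u. k \<le> N" "x \<in> {0..1}"
  shows "(1 / (real N + 1)) ^ length u \<le> wprod u x"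
  using assms(1,2)
proof (induction u)
  case Nil then show ?case by (simp add: wprod_def)
next
  case (Cons w u)
  have u: "pos u" "\<forall>k\<in>set u. k \<le> N" and w: "1 \<le> real w" "real w \<le> real N" using Cons.prems by auto
  have "1 / (real N + 1) \<le> cfrac_tail (w # u) x"
    using cfrac_tail_in[OF u(1) assms(3)] w by (auto intro!: divide_left_mono)
  then have "1 / (real N + 1) * (1 / (real N + 1)) ^ length u \<le> cfrac_tail (w # u) x * wprod u x"
    using Cons.IH[OF u] wprod_pos[OF u(1) assms(3)] by (intro mult_mono) (auto simp del: cfrac_tail.simps intro: order_trans[rotated])
  then show ?case unfolding wprod_Cons[OF Cons.prems(1) assms(3)] by simp
qed

text \<open>The factor \<open>256 powr s\<close> in \<open>large\<close> pays for the distortion between consecutive blocks; the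
  factor \<open>2\<close> leaves an exponential margin that absorbs the fluctuations of the tilt.\<close>
locale block_process =
  fixes m N :: nat and q s \<xi> :: real
  assumes m: "1 \<le> m" and N: "1 \<le> N" and s: "0 < s" and \<xi>: "0 < \<xi>"
    and centered: "(\<Sum>u\<in>blocks m N. (lsum u - real m * \<xi>) * (exp (q * (lsum u - real m * \<xi>)) * wprod u 0 powr (2 * s))) = 0"
    and large: "2 * 256 powr s \<le> (\<Sum>u\<in>blocks m N. exp (q * (lsum u - real m * \<xi>)) * wprod u 0 powr (2 * s))"
begin

definition X :: "nat list \<Rightarrow> real" where "X u = lsum u - real m * \<xi>"
definition v :: "nat list \<Rightarrow> real" where "v u = wprod u 0 powr (2 * s)"
definition R :: real where "R = (\<Sum>u\<in>blocks m N. exp (q * X u) * v u)"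

lemma R: "2 * 256 powr s \<le> R" "0 < R"
proof -
  show "2 * 256 powr s \<le> R" using large by (simp add: R_def X_def v_def)
  moreover have "0 < 2 * (256::real) powr s" by simp
  ultimately show "0 < R" by linarith
qed

lemma v_nonneg: "0 \<le> v u" by (simp add: v_def)

definition P :: "nat list pmf" where
  "P = embed_pmf (\<lambda>u. if u \<in> blocks m N then exp (q * X u) * v u / R else 0)"

lemma pmf_P: "pmf P u = (if u \<in> blocks m N then exp (q * X u) * v u / R else 0)"
  unfolding P_def
proof (rule pmf_embed_pmf)
  show "0 \<le> (if u \<in> blocks m N then exp (q * X u) * v u / R else 0)" for u
    using R v_nonneg by simp
  have "(\<integral>\<^sup>+u. ennreal (if u \<in> blocks m N then exp (q * X u) * v u / R else 0) \<partial>count_space UNIV) =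
      (\<Sum>u\<in>blocks m N. ennreal (if u \<in> blocks m N then exp (q * X u) * v u / R else 0))"
    by (rule nn_integral_count_space'[OF finite_blocks]) auto
  also have "\<dots> = (\<Sum>u\<in>blocks m N. ennreal (exp (q * X u) * v u / R))" by simp
  also have "\<dots> = ennreal (\<Sum>u\<in>blocks m N. exp (q * X u) * v u / R)"
    by (rule sum_ennreal) (use R v_nonneg in auto)
  also have "(\<Sum>u\<in>blocks m N. exp (q * X u) * v u / R) = 1"
    using R by (simp add: R_def sum_divide_distrib[symmetric])
  finally show "(\<integral>\<^sup>+u. ennreal (if u \<in> blocks m N then exp (q * X u) * v u / R else 0) \<partial>count_space UNIV) = 1"
    by simp
qed

lemma set_pmf_P: "set_pmf P \<subseteq> blocks m N"
  by (auto simp: set_pmf_iff pmf_P split: if_splits)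

lemma expectation_X: "measure_pmf.expectation P X = 0"
proof -
  have "measure_pmf.expectation P X = (\<Sum>u\<in>blocks m N. X u * pmf P u)"
    by (rule integral_measure_pmf_real[OF finite_blocks]) (use set_pmf_P in auto)
  also have "\<dots> = (\<Sum>u\<in>blocks m N. X u * (exp (q * X u) * v u) / R)" by (simp add: pmf_P)
  also have "\<dots> = 0" using centered by (simp add: sum_divide_distrib[symmetric] X_def v_def)
  finally show ?thesis .
qed

section \<open>Product measure and the law of large numbers\<close>

definition M :: "(nat \<Rightarrow> nat list) measure" where
  "M = PiM UNIV (\<lambda>_. measure_pmf P)"

lemma prob_space_M: "prob_space M"
  unfolding M_def by (rule prob_space_PiM) (rule measure_pmf.prob_space_axioms)

lemma space_M: "space M = UNIV"
  by (simp add: M_def space_PiM)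

lemma measurable_coord: "(\<lambda>b. f (b i)) \<in> measurable M borel" for f :: "nat list \<Rightarrow> real"
proof -
  have "(\<lambda>b. b i) \<in> measurable M (measure_pmf P)" unfolding M_def by measurable
  moreover have "f \<in> measurable (measure_pmf P) borel" by simp
  ultimately show ?thesis by (rule measurable_compose)
qed

definition cylb :: "(nat \<Rightarrow> nat list) \<Rightarrow> nat \<Rightarrow> (nat \<Rightarrow> nat list) set" where
  "cylb b k = {b'. \<forall>i<k. b' i = b i}"

lemma cylb: "cylb b k \<in> sets M" "emeasure M (cylb b k) = ennreal (\<Prod>i<k. pmf P (b i))"
proof -
  have e: "cylb b k = prod_emb UNIV (\<lambda>_. measure_pmf P) {..<k} (PiE {..<k} (\<lambda>i. {b i}))"
  proof (rule set_eqI)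
    fix b' :: "nat \<Rightarrow> nat list"
    show "b' \<in> cylb b k \<longleftrightarrow> b' \<in> prod_emb UNIV (\<lambda>_. measure_pmf P) {..<k} (PiE {..<k} (\<lambda>i. {b i}))"
      by (simp add: cylb_def prod_emb_def PiE_iff Ball_def)
  qed
  show "cylb b k \<in> sets M" unfolding e M_def by (rule sets_PiM_I) auto
  have "emeasure M (cylb b k) = (\<Prod>i<k. emeasure (measure_pmf P) {b i})"
    unfolding e M_def by (rule emeasure_PiM_emb) (auto intro: measure_pmf.prob_space_axioms)
  also have "\<dots> = ennreal (\<Prod>i<k. pmf P (b i))"
    by (simp add: emeasure_pmf_single prod_ennreal)
  finally show "emeasure M (cylb b k) = ennreal (\<Prod>i<k. pmf P (b i))" .
qed

definition S :: "(nat \<Rightarrow> nat list) \<Rightarrow> nat \<Rightarrow> real" where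
  "S b k = (\<Sum>i<k. X (b i))"

lemma measurable_S: "(\<lambda>b. S b k) \<in> borel_measurable M"
  unfolding S_def by (intro borel_measurable_sum measurable_coord)

lemma AE_blocks: "AE b in M. \<forall>i. b i \<in> blocks m N"
  unfolding AE_all_countable M_def
proof
  fix i :: nat
  show "AE b in PiM UNIV (\<lambda>_. measure_pmf P). b i \<in> blocks m N"
    by (rule AE_PiM_component[of UNIV "\<lambda>_. measure_pmf P" i "\<lambda>u. u \<in> blocks m N"])
       (use set_pmf_P in \<open>auto simp: AE_measure_pmf_iff intro: measure_pmf.prob_space_axioms\<close>)
qed

definition B :: real where "B = real m * ln (real N) + real m * \<xi>"

lemma B_pos: "0 < B"
  using m N \<xi> by (auto simp: B_def intro!: add_nonneg_pos)

lemma lsum_le: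
  assumes "pos u" "\<forall>k\<in>set u. k \<le> N"
  shows "lsum u \<le> real (length u) * ln (real N)"
  using assms by (induction u) (auto simp: lsum_def distrib_right intro!: add_mono)

lemma X_bound: "u \<in> blocks m N \<Longrightarrow> \<bar>X u\<bar> \<le> B"
proof -
  assume u: "u \<in> blocks m N"
  then have "\<forall>k\<in>set u. k \<le> N" "length u = m" by (auto simp: blocks_def)
  then have l: "lsum u \<le> real m * ln (real N)" using lsum_le[OF blocks_pos[OF u]] by simp
  have "0 \<le> lsum u" using lsum_nonneg[OF blocks_pos[OF u]] .
  moreover have "0 \<le> real m * ln (real N)" "0 \<le> real m * \<xi>" using N \<xi> by auto
  ultimately show ?thesis using l unfolding X_def B_def abs_le_iff by (intro conjI) linarith+
qed

lemma indep_coords: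
  assumes "1 \<le> k" shows "prob_space.indep_vars M (\<lambda>_. borel) (\<lambda>i b. X (b i)) {..<k}"
proof -
  interpret M: prob_space M by (rule prob_space_M)
  have rv: "(\<lambda>b. b i) \<in> measurable M (measure_pmf P)" for i unfolding M_def by measurable
  have "0 \<in> {..<k}" using assms by simp
  then have ne: "{..<k} \<noteq> {}" by blast
  have "M.indep_vars (\<lambda>_. measure_pmf P) (\<lambda>i b. b i) {..<k}"
  proof (subst M.indep_vars_iff_distr_eq_PiM'[OF ne])
    have "distr M (PiM {..<k} (\<lambda>_. measure_pmf P)) (\<lambda>x. \<lambda>i\<in>{..<k}. x i) = PiM {..<k} (\<lambda>_. measure_pmf P)"
      unfolding M_def using distr_PiM_reindex[of UNIV "\<lambda>_. measure_pmf P" "\<lambda>i. i" "{..<k}"]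
      by (auto intro: measure_pmf.prob_space_axioms)
    also have "\<dots> = PiM {..<k} (\<lambda>i. distr M (measure_pmf P) (\<lambda>b. b i))"
      unfolding M_def by (subst distr_PiM_component) (auto intro: measure_pmf.prob_space_axioms)
    finally show "distr M (PiM {..<k} (\<lambda>_. measure_pmf P)) (\<lambda>x. \<lambda>i\<in>{..<k}. x i) =
      PiM {..<k} (\<lambda>i. distr M (measure_pmf P) (\<lambda>b. b i))" .
  qed (rule rv)
  then show ?thesis by (rule M.indep_vars_compose2) simp
qed

text \<open>Hoeffding's inequality for independent centred variables in an interval of length
  \<open>2 * B\<close>. The rate is exponential in \<open>k\<close>, so the bounds are summable for
  the Borel--Cantelli lemma.\<close>

lemma deviation:
  assumes k: "1 \<le> k" and e: "0 < e"
  shows "measure M {b \<in> space M. e * real k \<le> \<bar>S b k\<bar>} \<le> 2 * exp (- (e\<^sup>2 / (2 * B\<^sup>2))) ^ k"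
proof -
  interpret M: prob_space M by (rule prob_space_M)
  interpret H: indep_interval_bounded_random_variables M "{..<k}" "\<lambda>i b. X (b i)" "\<lambda>_. - B" "\<lambda>_. B"
  proof
    show "M.indep_vars (\<lambda>_. borel) (\<lambda>i b. X (b i)) {..<k}" by (rule indep_coords[OF k])
    show "AE b in M. X (b i) \<in> {- B..B}" for i
      using AE_blocks by eventually_elim (use X_bound in \<open>auto simp: abs_le_iff minus_le_iff\<close>)
  qed simp
  have ex: "M.expectation (\<lambda>b. X (b i)) = 0" for i
  proof -
    have "M.expectation (\<lambda>b. X (b i)) = integral\<^sup>L (distr M (measure_pmf P) (\<lambda>b. b i)) X"
      by (rule integral_distr[symmetric]) (auto simp: M_def)
    also have "distr M (measure_pmf P) (\<lambda>b. b i) = measure_pmf P"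
      unfolding M_def by (rule distr_PiM_component) (auto intro: measure_pmf.prob_space_axioms)
    finally show ?thesis using expectation_X by simp
  qed
  interpret H: Hoeffding_ineq M "{..<k}" "\<lambda>i b. X (b i)" "\<lambda>_. - B" "\<lambda>_. B" "\<Sum>i<k. M.expectation (\<lambda>b. X (b i))"
    by unfold_locales
  have "(\<Sum>i<k. (B - - B)\<^sup>2) = real k * (4 * B\<^sup>2)" by (simp add: power2_eq_square)
  then have "measure M {b \<in> space M. e * real k \<le> \<bar>S b k\<bar>} \<le> 2 * exp (- 2 * (e * real k)\<^sup>2 / (real k * (4 * B\<^sup>2)))"
    using H.Hoeffding_ineq_abs_ge[of "e * real k"] e k B_pos by (simp add: ex S_def)
  also have "- 2 * (e * real k)\<^sup>2 / (real k * (4 * B\<^sup>2)) = real k * - (e\<^sup>2 / (2 * B\<^sup>2))"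
    using k B_pos by (simp add: power2_eq_square field_simps)
  finally show ?thesis unfolding exp_of_nat_mult .
qed

lemma AE_average: "AE b in M. (\<lambda>k. S b k / real k) \<longlonglongrightarrow> 0"
proof -
  interpret M: prob_space M by (rule prob_space_M)
  have "AE b in M. \<forall>j::nat. eventually (\<lambda>k. \<bar>S b (Suc k)\<bar> < 1 / real (Suc j) * real (Suc k)) sequentially"
    unfolding AE_all_countable
  proof
    fix j :: nat
    define e where "e = 1 / real (Suc j)"
    have e: "0 < e" by (simp add: e_def)
    define Ev where "Ev k = {b \<in> space M. e * real (Suc k) \<le> \<bar>S b (Suc k)\<bar>}" for k
    have "AE b in M. eventually (\<lambda>k. b \<in> space M - Ev k) sequentially"
    proof (rule borel_cantelli_AE1)
      show "Ev k \<in> sets M" for k unfolding Ev_def using measurable_S by measurable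
      show "emeasure M (Ev k) < \<infinity>" for k by (simp add: less_top[symmetric])
      show "summable (\<lambda>k. measure M (Ev k))"
      proof (rule summable_comparison_test')
        have "0 < e\<^sup>2 / (2 * B\<^sup>2)" using e B_pos by simp
        then have "summable (\<lambda>k. exp (- (e\<^sup>2 / (2 * B\<^sup>2))) ^ k)" by (intro summable_geometric) simp
        then show "summable (\<lambda>k. 2 * exp (- (e\<^sup>2 / (2 * B\<^sup>2))) ^ Suc k)"
          by (intro summable_mult) (subst summable_Suc_iff)
        show "norm (measure M (Ev k)) \<le> 2 * exp (- (e\<^sup>2 / (2 * B\<^sup>2))) ^ Suc k" for k
          using deviation[of "Suc k" e] e unfolding Ev_def by simp
      qed
    qed
    then show "AE b in M. eventually (\<lambda>k. \<bar>S b (Suc k)\<bar> < 1 / real (Suc j) * real (Suc k)) sequentially"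
    proof eventually_elim
      case (elim b)
      then show ?case by (rule eventually_mono) (auto simp: Ev_def space_M e_def not_le)
    qed
  qed
  then show ?thesis
  proof eventually_elim
    case (elim b)
    have "(\<lambda>k. S b (Suc k) / real (Suc k)) \<longlonglongrightarrow> 0"
    proof (rule tendstoI)
      fix r :: real assume "0 < r"
      then obtain j where j: "1 / real (Suc j) < r" using nat_approx_posE by blast
      from elim[rule_format, of j]
      show "eventually (\<lambda>k. dist (S b (Suc k) / real (Suc k)) 0 < r) sequentially"
      proof (rule eventually_mono)
        fix k assume "\<bar>S b (Suc k)\<bar> < 1 / real (Suc j) * real (Suc k)"
        then have "\<bar>S b (Suc k)\<bar> / real (Suc k) < 1 / real (Suc j)"
          by (subst pos_divide_less_eq) auto
        then show "dist (S b (Suc k) / real (Suc k)) 0 < r" using j by simp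
      qed
    qed
    then show ?case by (subst (asm) filterlim_sequentially_Suc)
  qed
qed

section \<open>Points coded by sequences of blocks\<close>

definition W :: "(nat \<Rightarrow> nat list) \<Rightarrow> nat \<Rightarrow> nat list" where
  "W b k = concat (map b [0..<k])"

definition dig :: "(nat \<Rightarrow> nat list) \<Rightarrow> nat \<Rightarrow> nat" where
  "dig b j = b (j div m) ! (j mod m)"

definition xpt :: "(nat \<Rightarrow> nat list) \<Rightarrow> real" where
  "xpt b = (SOME x. in_cyls (dig b) x)"

lemma W_Suc: "W b (Suc k) = W b k @ b k"
  by (simp add: W_def)

lemma W_blocks:
  assumes "\<forall>i. b i \<in> blocks m N"
  shows "pos (W b k)" "\<forall>j\<in>set (W b k). j \<le> N" "length (W b k) = k * m"
proof -
  show "pos (W b k)" "\<forall>j\<in>set (W b k). j \<le> N" using assms by (force simp: W_def blocks_def)+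
  show "length (W b k) = k * m"
    using assms by (induction k) (auto simp: W_Suc blocks_def, simp add: W_def)
qed

lemma lsum_W: "lsum (W b k) = S b k + real k * (real m * \<xi>)"
  by (induction k) (simp_all add: W_Suc lsum_append S_def X_def W_def lsum_def distrib_right)

text \<open>A block has probability \<open>exp (q * X u) * v u / R\<close>. Joining it to the
  previous word costs at most \<open>16 powr (2 * s) = 256 powr s\<close>, half of the lower bound
  for \<open>R\<close>; the remaining factor 2 yields \<open>(1 / 2) ^ k\<close>.\<close>

lemma pmf_product_le:
  assumes b: "\<forall>i. b i \<in> blocks m N"
  shows "(\<Prod>i<k. pmf P (b i)) \<le> (1 / 2) ^ k * exp (q * S b k) * wprod (W b k) 0 powr (2 * s)"
proof (induction k)
  case 0 then show ?case by (simp add: S_def W_def wprod_def)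
next
  case (Suc k)
  note p = W_blocks(1)[OF b, of k]
  have bk: "pos (b k)" using b blocks_pos by blast
  define y where "y = cfrac_tail (b k) 0"
  have y: "y \<in> {0..1}" unfolding y_def by (rule cfrac_tail_in[OF bk]) simp
  have w: "wprod (W b (Suc k)) 0 = wprod (W b k) y * wprod (b k) 0"
    by (simp add: W_Suc wprod_append y_def)
  have pw: "0 < wprod (W b k) y" "0 < wprod (W b k) 0" "0 < wprod (b k) 0"
    using wprod_pos[OF p y] wprod_pos[OF p, of 0] wprod_pos[OF bk, of 0] by auto
  have "wprod (W b k) 0 powr (2 * s) \<le> (16 * wprod (W b k) y) powr (2 * s)"
    using wprod_distortion[OF p _ y, of 0] pw s by (intro powr_mono2) auto
  also have "\<dots> = 256 powr s * wprod (W b k) y powr (2 * s)"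
  proof -
    have "(16::real) powr (2 * s) = (16 powr 2) powr s" by (simp only: powr_powr)
    then show ?thesis using pw by (simp add: powr_mult powr_numeral)
  qed
  finally have d: "wprod (W b k) 0 powr (2 * s) * v (b k) \<le> 256 powr s * wprod (W b (Suc k)) 0 powr (2 * s)"
    using mult_right_mono[OF _ v_nonneg[of "b k"]] pw unfolding w v_def by (simp add: powr_mult mult.assoc)
  have "pmf P (b k) \<le> exp (q * X (b k)) * v (b k) / (2 * 256 powr s)"
    using b R v_nonneg[of "b k"] by (auto simp: pmf_P intro!: divide_left_mono)
  then have "(\<Prod>i<Suc k. pmf P (b i)) \<le> ((1 / 2) ^ k * exp (q * S b k) * wprod (W b k) 0 powr (2 * s)) * (exp (q * X (b k)) * v (b k) / (2 * 256 powr s))"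
    unfolding prod.lessThan_Suc using v_nonneg[of "b k"] wprod_pos[OF p, of 0]
    by (intro mult_mono[OF Suc.IH]) auto
  also have "\<dots> = (1 / 2) ^ Suc k * exp (q * S b (Suc k)) * (wprod (W b k) 0 powr (2 * s) * v (b k) / 256 powr s)"
    by (simp add: S_def distrib_left exp_add)
  also have "\<dots> \<le> (1 / 2) ^ Suc k * exp (q * S b (Suc k)) * wprod (W b (Suc k)) 0 powr (2 * s)"
    using d by (intro mult_left_mono) (auto simp: field_simps)
  finally show ?case .
qed

lemma dig_bounds:
  assumes "\<forall>i. b i \<in> blocks m N" shows "1 \<le> dig b j" "dig b j \<le> N"
proof -
  have u: "b (j div m) \<in> blocks m N" using assms by blast
  have "j mod m < length (b (j div m))" using u m by (simp add: blocks_def)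
  then have "dig b j \<in> set (b (j div m))" unfolding dig_def by (rule nth_mem)
  then show "1 \<le> dig b j" "dig b j \<le> N" using u by (auto simp: blocks_def)
qed

lemma map_dig:
  assumes b: "\<forall>i. b i \<in> blocks m N" shows "map (dig b) [0..<k * m] = W b k"
proof (induction k)
  case 0 then show ?case by (simp add: W_def)
next
  case (Suc k)
  have l: "length (b k) = m" using b by (auto simp: blocks_def)
  have "map (dig b) [k * m..<k * m + m] = b k"
  proof (rule nth_equalityI)
    fix i assume "i < length (map (dig b) [k * m..<k * m + m])"
    then have i: "i < m" by simp
    then have "(k * m + i) div m = k" "(k * m + i) mod m = i" by auto
    then show "map (dig b) [k * m..<k * m + m] ! i = b k ! i" using i by (simp add: dig_def)
  qed (simp add: l)
  moreover have "[0..<Suc k * m] = [0..<k * m] @ [k * m..<k * m + m]"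
    using upt_add_eq_append[of 0 "k * m" m] by (simp add: add.commute)
  ultimately show ?case using Suc by (simp add: W_Suc)
qed

lemma xpt: "\<forall>i. b i \<in> blocks m N \<Longrightarrow> in_cyls (dig b) (xpt b)"
  unfolding xpt_def using in_cyls_exists[of "dig b"] dig_bounds(1)[of b] by (metis someI_ex)

text \<open>The factor \<open>1 / 16\<close> is the distortion at a block boundary, the power bounds
  a partial block from below, and the denominator is that of
  \<open>in_cyls_separated\<close>.\<close>

definition c1 :: real where
  "c1 = (1 / 16 * (1 / (real N + 1)) ^ m)\<^sup>2 / (256 * (real N + 2) ^ 3)"

lemma c1_pos: "0 < c1"
  by (simp add: c1_def)

text \<open>The first differing digit lies in block \<open>k\<close>. The digits of that block
  before it form a word \<open>\<tau>\<close> of length at most \<open>m\<close>, whose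
  \<open>wprod\<close> is bounded below since digits are at most \<open>N\<close>.\<close>

lemma xpt_separated:
  assumes b: "\<forall>i. b i \<in> blocks m N" and b': "\<forall>i. b' i \<in> blocks m N"
    and eq: "\<And>i. i < k \<Longrightarrow> b i = b' i" and ne: "b k \<noteq> b' k"
  shows "c1 * (wprod (W b k) 0)\<^sup>2 \<le> \<bar>xpt b - xpt b'\<bar>"
proof -
  have l: "length (b k) = m" "length (b' k) = m" using b b' by (auto simp: blocks_def)
  then obtain r where r: "r < m" "b k ! r \<noteq> b' k ! r" using ne by (metis nth_equalityI)
  have "dig b (k * m + r) \<noteq> dig b' (k * m + r)" using r by (simp add: dig_def)
  define n where "n = (LEAST n. dig b n \<noteq> dig b' n)"
  have n: "dig b n \<noteq> dig b' n" "n \<le> k * m + r"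
    unfolding n_def by (rule LeastI, fact, rule Least_le, fact)
  have before: "dig b j = dig b' j" if "j < n" for j
    using not_less_Least[of j "\<lambda>n. dig b n \<noteq> dig b' n"] that by (auto simp: n_def)
  have km: "k * m \<le> n"
  proof (rule ccontr)
    assume "\<not> k * m \<le> n"
    then have "n div m < k" by (simp add: less_mult_imp_div_less)
    then show False using n(1) eq by (simp add: dig_def)
  qed
  define \<tau> where "\<tau> = map (dig b) [k * m..<n]"
  have \<tau>: "pos \<tau>" "\<forall>j\<in>set \<tau>. j \<le> N" "length \<tau> \<le> m"
    using dig_bounds[OF b] n(2) r(1) by (auto simp: \<tau>_def)
  have split: "map (dig b) [0..<n] = W b k @ \<tau>"
    using upt_add_eq_append[of 0 "k * m" "n - k * m"] km map_dig[OF b, of k] by (simp add: \<tau>_def)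
  define y where "y = cfrac_tail \<tau> 0"
  have y: "y \<in> {0..1}" unfolding y_def by (rule cfrac_tail_in[OF \<tau>(1)]) simp
  note p = W_blocks(1)[OF b, of k]
  have pw: "0 < wprod (W b k) 0" using wprod_pos[OF p] by simp
  have "(1 / (real N + 1)) ^ m \<le> (1 / (real N + 1)) ^ length \<tau>"
    using \<tau>(3) by (intro power_decreasing) auto
  also have "\<dots> \<le> wprod \<tau> 0" by (rule wprod_ge[OF \<tau>(1,2)]) simp
  finally have t: "(1 / (real N + 1)) ^ m \<le> wprod \<tau> 0" .
  have "wprod (W b k) 0 / 16 * (1 / (real N + 1)) ^ m \<le> wprod (W b k) y * wprod \<tau> 0"
    using wprod_distortion[OF p _ y, of 0] t pw wprod_pos[OF p y] by (intro mult_mono) auto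
  then have "(wprod (W b k) 0 * (1 / 16 * (1 / (real N + 1)) ^ m))\<^sup>2 \<le> (wprod (map (dig b) [0..<n]) 0)\<^sup>2"
    using pw by (intro power_mono) (auto simp: split wprod_append y_def)
  then have "c1 * (wprod (W b k) 0)\<^sup>2 \<le> (wprod (map (dig b) [0..<n]) 0)\<^sup>2 / (256 * (real N + 2) ^ 3)"
    unfolding c1_def times_divide_eq_left power_mult_distrib
    by (intro divide_right_mono) (auto simp: mult.commute)
  also have "\<dots> \<le> \<bar>xpt b - xpt b'\<bar>"
    by (rule in_cyls_separated[OF dig_bounds[OF b] xpt[OF b] dig_bounds[OF b'] xpt[OF b'] before n(1)])
  finally show ?thesis .
qed

definition good :: "(nat \<Rightarrow> nat list) \<Rightarrow> bool" where
  "good b \<longleftrightarrow> (\<forall>i. b i \<in> blocks m N) \<and> (\<lambda>k. S b k / real k) \<longlonglongrightarrow> 0"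

text \<open>The incomplete last block changes the centred sum by at most \<open>B\<close>, which
  division by \<open>n\<close> removes.\<close>

lemma xpt_level_set:
  assumes "good b" shows "xpt b \<in> khinchin_level_set \<xi>"
proof -
  have b: "\<forall>i. b i \<in> blocks m N" and lim: "(\<lambda>k. S b k / real k) \<longlonglongrightarrow> 0" using assms by (auto simp: good_def)
  note d = dig_bounds(1)[OF b]
  note x = in_cyls_gauss(1,2)[OF d xpt[OF b]] in_cyls_irrational[OF d xpt[OF b]]
  define L where "L n = lsum (map (dig b) [0..<n])" for n
  have est: "\<bar>L n / real n - \<xi>\<bar> \<le> \<bar>S b (n div m) / real (n div m)\<bar> + B / real n" if n: "0 < n" for n
  proof -
    define k where "k = n div m"
    define \<tau> where "\<tau> = map (dig b) [k * m..<n]"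
    have km: "k * m \<le> n" "n = k * m + n mod m" by (auto simp: k_def)
    have len: "length \<tau> \<le> m" 
    proof -
      have "length \<tau> = n mod m" unfolding \<tau>_def k_def by (simp add: minus_div_mult_eq_mod)
      also have "\<dots> \<le> m" using m by (intro less_imp_le mod_less_divisor) linarith
      finally show ?thesis .
    qed
    have "map (dig b) [0..<n] = W b k @ \<tau>"
      using upt_add_eq_append[of 0 "k * m" "n - k * m"] km map_dig[OF b, of k] by (simp add: \<tau>_def)
    then have "L n = S b k + real k * (real m * \<xi>) + lsum \<tau>" by (simp add: L_def lsum_append lsum_W)
    moreover have "real n = real k * real m + real (n mod m)" using km(2) by (metis of_nat_add of_nat_mult)
    ultimately have e: "L n - real n * \<xi> = S b k + (lsum \<tau> - real (n mod m) * \<xi>)" by (simp add: algebra_simps)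
    have \<tau>: "pos \<tau>" "\<forall>j\<in>set \<tau>. j \<le> N" using dig_bounds[OF b] by (auto simp: \<tau>_def)
    have "lsum \<tau> \<le> real (length \<tau>) * ln (real N)" by (rule lsum_le[OF \<tau>])
    also have "\<dots> \<le> real m * ln (real N)" using len N by (intro mult_right_mono) auto
    finally have l1: "lsum \<tau> \<le> real m * ln (real N)" .
    have l2: "real (n mod m) * \<xi> \<le> real m * \<xi>" using m \<xi> by (intro mult_right_mono) (auto simp: less_imp_le)
    have l3: "0 \<le> lsum \<tau>" by (rule lsum_nonneg[OF \<tau>(1)])
    have l4: "0 \<le> real m * ln (real N)" "0 \<le> real (n mod m) * \<xi>" using N \<xi> by auto
    have "\<bar>L n - real n * \<xi>\<bar> \<le> \<bar>S b k\<bar> + B"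
      unfolding e B_def using l1 l2 l3 l4 by linarith
    then have "\<bar>L n - real n * \<xi>\<bar> / real n \<le> \<bar>S b k\<bar> / real n + B / real n"
      using n by (simp add: add_divide_distrib[symmetric] divide_right_mono)
    also have "\<bar>S b k\<bar> / real n \<le> \<bar>S b k / real k\<bar>"
    proof (cases "k = 0")
      case True then show ?thesis by (simp add: S_def)
    next
      case False
      have "k * 1 \<le> k * m" using m by (intro mult_le_mono) auto
      then have "k \<le> n" using km(1) by linarith
      then show ?thesis using False by (simp add: divide_left_mono)
    qed
    also have "\<bar>L n - real n * \<xi>\<bar> / real n = \<bar>L n / real n - \<xi>\<bar>"
    proof -
      have "L n / real n - \<xi> = (L n - real n * \<xi>) / real n" using n by (simp add: field_simps)
      then show ?thesis by (simp add: abs_divide)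
    qed
    finally show ?thesis by (simp add: k_def)
  qed
  have fl: "filterlim (\<lambda>n. n div m) sequentially sequentially"
    unfolding filterlim_at_top
  proof
    fix Z
    show "eventually (\<lambda>n. Z \<le> n div m) sequentially"
      using eventually_ge_at_top[of "Z * m"]
      by eventually_elim (use m in \<open>simp add: less_eq_div_iff_mult_less_eq\<close>)
  qed
  have "(\<lambda>n. \<bar>S b (n div m) / real (n div m)\<bar> + B / real n) \<longlonglongrightarrow> \<bar>0\<bar> + 0"
    by (intro tendsto_add tendsto_rabs filterlim_compose[OF lim fl] lim_const_over_n)
  then have "(\<lambda>n. L n / real n - \<xi>) \<longlonglongrightarrow> 0"
    by (intro Lim_null_comparison[of "\<lambda>n. L n / real n - \<xi>" "\<lambda>n. \<bar>S b (n div m) / real (n div m)\<bar> + B / real n"])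
       (use est in \<open>auto intro!: eventually_sequentiallyI[of 1]\<close>)
  then have "(\<lambda>n. L n / real n) \<longlonglongrightarrow> \<xi>" by (rule LIM_zero_cancel)
  then have "(\<lambda>n. (1 / real n) * lsum (digits n (xpt b))) \<longlonglongrightarrow> \<xi>"
    unfolding in_cyls_digits[OF d xpt[OF b]] L_def by simp
  then have "has_khinchin_exponent (xpt b) \<xi>"
    unfolding has_khinchin_exponent_def sum_ln_partial_quotients[OF x] .
  then show ?thesis using x by (simp add: khinchin_level_set_def)
qed

text \<open>On a set of positive measure the mass of a cylinder is at most a constant times its
  length scale to the power \<open>s\<close>. Hence a covering set captures at most a multiple of
  its gauge, and the gauges of a cover cannot have a small sum.\<close>

lemma hausdorff_measure_pos:
  assumes s': "0 \<le> s'" "s' \<le> s"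
  shows "hausdorff_measure s' (khinchin_level_set \<xi>) \<noteq> 0"
proof -
  interpret M: prob_space M by (rule prob_space_M)
  \<comment> \<open>On \<open>H K\<close> the tilt \<open>exp (q * S b k)\<close> is at most
    \<open>2 ^ k\<close> for \<open>k \<ge> K\<close>, and the factor \<open>(1 / 2) ^ k\<close> of
    \<open>pmf_product_le\<close> cancels it.\<close>
  define H where "H K = {b \<in> space M. \<forall>k\<ge>K. q * S b k \<le> real k * ln 2}" for K
  have Hm: "H K \<in> sets M" for K
  proof -
    have "{b \<in> space M. q * S b k \<le> real k * ln 2} \<in> sets M" for k
      using measurable_S[of k] by measurable
    then show ?thesis unfolding H_def by (intro sets.sets_Collect_countable_All' sets.sets_Collect) auto
  qed
  have AE_good: "AE b in M. good b"
    using AE_blocks AE_average by eventually_elim (simp add: good_def)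
  have good_H: "\<exists>K. b \<in> H K" if "good b" for b
  proof -
    have "(\<lambda>k. q * (S b k / real k)) \<longlonglongrightarrow> q * 0" using that unfolding good_def by (intro tendsto_intros) auto
    then have "eventually (\<lambda>k. q * (S b k / real k) < ln 2) sequentially" by (rule order_tendstoD(2)) simp
    then obtain K where K: "\<And>k. K \<le> k \<Longrightarrow> q * (S b k / real k) < ln 2" by (auto simp: eventually_sequentially)
    have "q * S b k \<le> real k * ln 2" if "max 1 K \<le> k" for k
      using K[of k] that by (simp add: field_simps)
    then show ?thesis by (intro exI[of _ "max 1 K"]) (auto simp: H_def space_M)
  qed
  have "\<exists>K. emeasure M (H K) \<noteq> 0"
  proof (rule ccontr)
    assume "\<not> ?thesis"
    then have "(\<Union>K. H K) \<in> null_sets M" using Hm by (intro null_sets_UN) auto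
    then have "AE b in M. b \<notin> (\<Union>K. H K)" by (rule AE_not_in)
    then have "AE b in M. False" using AE_good by eventually_elim (use good_H in blast)
    then show False by simp
  qed
  then obtain K where K: "emeasure M (H K) \<noteq> 0" by blast
  define e where "e = measure M (H K)"
  have e: "0 < e" "emeasure M (H K) = ennreal e"
    using K by (auto simp: e_def M.emeasure_eq_measure zero_less_measure_iff)
  \<comment> \<open>This covers the levels \<open>k < K\<close>, where the mass is bounded by 1 and
    \<open>wprod\<close> from below by \<open>(1 / (N + 1)) ^ (K * m)\<close>.\<close>
  define C2 where "C2 = ((real N + 1) ^ (K * m)) powr (2 * s)"
  have C2: "1 \<le> C2" unfolding C2_def using s by (intro ge_one_powr_ge_zero one_le_power) auto
  have mass: "(\<Prod>i<k. pmf P (b i)) \<le> C2 * wprod (W b k) 0 powr (2 * s)" if b: "good b" "b \<in> H K" for b k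
  proof -
    have bb: "\<forall>i. b i \<in> blocks m N" using b by (simp add: good_def)
    have pw: "0 < wprod (W b k) 0" using wprod_pos[OF W_blocks(1)[OF bb], of 0] by simp
    show ?thesis
    proof (cases "K \<le> k")
      case True
      have "q * S b k \<le> real k * ln 2" using b(2) True by (simp add: H_def)
      then have "exp (q * S b k) \<le> exp (real k * ln 2)" by simp
      also have "\<dots> = 2 ^ k" by (subst exp_of_nat_mult) simp
      finally have "(1 / 2) ^ k * exp (q * S b k) \<le> (1 / 2) ^ k * 2 ^ k" by (intro mult_left_mono) auto
      also have "\<dots> = (1::real)" by (simp flip: power_mult_distrib)
      also have "\<dots> \<le> C2" by (rule C2)
      finally have "(1 / 2) ^ k * exp (q * S b k) * wprod (W b k) 0 powr (2 * s) \<le> C2 * wprod (W b k) 0 powr (2 * s)"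
        by (intro mult_right_mono) auto
      then show ?thesis using pmf_product_le[OF bb, of k] by linarith
    next
      case False
      have "(\<Prod>i<k. pmf P (b i)) \<le> (\<Prod>i<k. 1)" by (intro prod_mono) (auto simp: pmf_le_1)
      then have "(\<Prod>i<k. pmf P (b i)) \<le> 1" by simp
      also have "1 \<le> C2 * wprod (W b k) 0 powr (2 * s)"
      proof -
        have "(1 / (real N + 1)) ^ (K * m) \<le> (1 / (real N + 1)) ^ (k * m)"
          using False by (intro power_decreasing mult_le_mono) auto
        also have "\<dots> \<le> wprod (W b k) 0" using wprod_ge[OF W_blocks(1,2)[OF bb], of 0 k] W_blocks(3)[OF bb, of k] by simp
        finally have "1 \<le> (real N + 1) ^ (K * m) * wprod (W b k) 0" by (simp add: power_one_over field_simps)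
        then have "1 \<le> ((real N + 1) ^ (K * m) * wprod (W b k) 0) powr (2 * s)" using s by (intro ge_one_powr_ge_zero) auto
        then show ?thesis using pw by (simp add: C2_def powr_mult)
      qed
      finally show ?thesis .
    qed
  qed
  define C3 where "C3 = C2 / c1 powr s"
  have C3: "0 < C3" using C2 c1_pos by (simp add: C3_def)
  have lower: "ennreal (e / C3) \<le> (\<Sum>i. diam_gauge s (U i))" if U: "U \<in> delta_covers 1 (khinchin_level_set \<xi>)" for U
  proof -
    have Ub: "bounded (U i)" for i using U by (simp add: delta_covers_def)
    \<comment> \<open>The mass is not transported to the line: the sequences coding points of
      \<open>U i\<close> are enclosed in a measurable set \<open>Z\<close> built from cylinders,
      whatever \<open>U i\<close> is.\<close>
    define E where "E i = {b. good b \<and> b \<in> H K \<and> xpt b \<in> U i}" for i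
    have "\<exists>Z. Z \<in> sets M \<and> E i \<subseteq> Z \<and> emeasure M Z \<le> ennreal C3 * diam_gauge s (U i)" for i
    proof (cases "E i = {}")
      case True then show ?thesis by (intro exI[of _ "{}"]) auto
    next
      case False
      then obtain b0 where b0: "b0 \<in> E i" by blast
      then have g0: "good b0" "b0 \<in> H K" and bb0: "\<forall>i. b0 i \<in> blocks m N" by (auto simp: E_def good_def)
      have Une: "U i \<noteq> {}" using b0 by (auto simp: E_def)
      show ?thesis
      \<comment> \<open>A single sequence has mass 0, lying in cylinders of arbitrarily small mass.
        Otherwise let \<open>k\<close> be the first block at which a sequence of \<open>E i\<close>
        departs from \<open>b0\<close>: all of \<open>E i\<close> lies in \<open>cylb b0 k\<close>,
        and separation bounds the diameter of \<open>U i\<close> from below.\<close>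
      proof (cases "E i \<subseteq> {b0}")
        case True
        define Z where "Z = (\<Inter>k. cylb b0 k)"
        have Zm: "Z \<in> sets M" unfolding Z_def by (intro sets.countable_INT) (auto simp: cylb)
        have "emeasure M Z \<le> ennreal r" if r: "0 < r" for r
        proof -
          have "(\<lambda>k. C2 * (2 * (1 / 2) ^ k) powr s) \<longlonglongrightarrow> C2 * (2 * 0) powr s"
            using s by (intro tendsto_intros LIMSEQ_realpow_zero tendsto_powr') auto
          then have "eventually (\<lambda>k. C2 * (2 * (1 / 2) ^ k) powr s < r) sequentially"
            using r s by (intro order_tendstoD(2)) auto
          then obtain k where k: "C2 * (2 * (1 / 2) ^ k) powr s < r" by (auto simp: eventually_sequentially)
          have pw: "0 < wprod (W b0 k) 0" using wprod_pos[OF W_blocks(1)[OF bb0], of 0] by simp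
          have "(wprod (W b0 k) 0)\<^sup>2 \<le> 2 * (1 / 2) ^ (k * m)"
            using wprod_square_le[OF W_blocks(1)[OF bb0], of 0 k] W_blocks(3)[OF bb0, of k] by simp
          also have "\<dots> \<le> 2 * (1 / 2) ^ k" using m by (intro mult_left_mono power_decreasing) auto
          finally have "((wprod (W b0 k) 0)\<^sup>2) powr s \<le> (2 * (1 / 2) ^ k) powr s" using s by (intro powr_mono2) auto
          moreover have "((wprod (W b0 k) 0)\<^sup>2) powr s = wprod (W b0 k) 0 powr (2 * s)"
            using pw by (simp add: powr_powr flip: powr_numeral)
          ultimately have "C2 * wprod (W b0 k) 0 powr (2 * s) \<le> C2 * (2 * (1 / 2) ^ k) powr s"
            using C2 by (intro mult_left_mono) auto
          then have "(\<Prod>i<k. pmf P (b0 i)) \<le> r" using mass[OF g0, of k] k by linarith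
          then have "emeasure M (cylb b0 k) \<le> ennreal r" unfolding cylb(2) by (rule ennreal_leI)
          moreover have "emeasure M Z \<le> emeasure M (cylb b0 k)" by (rule emeasure_mono) (auto simp: Z_def cylb)
          ultimately show ?thesis by simp
        qed
        then have "emeasure M Z = 0" by (metis add_0 ennreal_le_epsilon le_zero_eq)
        moreover have "E i \<subseteq> Z" using True by (auto simp: Z_def cylb_def)
        ultimately show ?thesis using Zm by (intro exI[of _ Z]) auto
      next
        case False
        then obtain b1 where b1: "b1 \<in> E i" "b1 \<noteq> b0" by blast
        define k where "k = (LEAST k. \<exists>b\<in>E i. b k \<noteq> b0 k)"
        have "\<exists>k. \<exists>b\<in>E i. b k \<noteq> b0 k" using b1 by (auto simp: fun_eq_iff)
        from LeastI_ex[OF this] obtain b where b: "b \<in> E i" "b k \<noteq> b0 k" by (auto simp: k_def)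
        have before: "b' j = b0 j" if "j < k" "b' \<in> E i" for b' j
          using not_less_Least[of j "\<lambda>k. \<exists>b\<in>E i. b k \<noteq> b0 k"] that by (auto simp: k_def)
        have bb: "\<forall>i. b i \<in> blocks m N" using b by (auto simp: E_def good_def)
        have pw: "0 < wprod (W b0 k) 0" using wprod_pos[OF W_blocks(1)[OF bb0], of 0] by simp
        have "c1 * (wprod (W b0 k) 0)\<^sup>2 \<le> \<bar>xpt b0 - xpt b\<bar>"
          by (rule xpt_separated[OF bb0 bb]) (use before b in auto)
        also have "\<dots> = dist (xpt b0) (xpt b)" by (simp add: dist_real_def)
        also have "\<dots> \<le> diameter (U i)"
          by (rule diameter_bounded_bound[OF Ub]) (use b0 b in \<open>auto simp: E_def\<close>)
        finally have "(wprod (W b0 k) 0)\<^sup>2 \<le> diameter (U i) / c1" using c1_pos by (simp add: field_simps)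
        then have "((wprod (W b0 k) 0)\<^sup>2) powr s \<le> (diameter (U i) / c1) powr s" using s by (intro powr_mono2) auto
        moreover have "((wprod (W b0 k) 0)\<^sup>2) powr s = wprod (W b0 k) 0 powr (2 * s)"
          using pw by (simp add: powr_powr flip: powr_numeral)
        moreover have "(diameter (U i) / c1) powr s = diameter (U i) powr s / c1 powr s"
          using diameter_ge_0[OF Ub] c1_pos by (simp add: powr_divide)
        ultimately have "C2 * wprod (W b0 k) 0 powr (2 * s) \<le> C3 * diameter (U i) powr s"
          using C2 mult_left_mono[of "wprod (W b0 k) 0 powr (2 * s)" "diameter (U i) powr s / c1 powr s" C2]
          by (simp add: C3_def)
        then have "(\<Prod>i<k. pmf P (b0 i)) \<le> C3 * diameter (U i) powr s" using mass[OF g0, of k] by linarith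
        then have "emeasure M (cylb b0 k) \<le> ennreal (C3 * diameter (U i) powr s)" unfolding cylb(2) by (rule ennreal_leI)
        also have "\<dots> = ennreal C3 * diam_gauge s (U i)"
          using C3 s Une by (simp add: diam_gauge_def ennreal_mult)
        finally have "emeasure M (cylb b0 k) \<le> ennreal C3 * diam_gauge s (U i)" .
        moreover have "E i \<subseteq> cylb b0 k" using before by (auto simp: cylb_def)
        ultimately show ?thesis using cylb(1)[of b0 k] by blast
      qed
    qed
    then obtain Z where Z: "\<And>i. Z i \<in> sets M" "\<And>i. E i \<subseteq> Z i" "\<And>i. emeasure M (Z i) \<le> ennreal C3 * diam_gauge s (U i)"
      by metis
    have "emeasure M (H K) \<le> emeasure M (\<Union>i. Z i)"
    proof (rule emeasure_mono_AE)
      show "AE b in M. b \<in> H K \<longrightarrow> b \<in> (\<Union>i. Z i)"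
        using AE_good
      proof eventually_elim
        case (elim b)
        show ?case
        proof
          assume bH: "b \<in> H K"
          have "xpt b \<in> (\<Union>i. U i)" using U xpt_level_set[OF elim] by (auto simp: delta_covers_def)
          then obtain i where "xpt b \<in> U i" by blast
          then have "b \<in> E i" using elim bH by (simp add: E_def)
          then show "b \<in> (\<Union>i. Z i)" using Z(2) by blast
        qed
      qed
    qed (use Z in auto)
    also have "\<dots> \<le> (\<Sum>i. emeasure M (Z i))" by (rule emeasure_subadditive_countably) (use Z in auto)
    also have "\<dots> \<le> (\<Sum>i. ennreal C3 * diam_gauge s (U i))" by (rule suminf_le[OF Z(3)]) auto
    also have "\<dots> = ennreal C3 * (\<Sum>i. diam_gauge s (U i))" by (rule ennreal_suminf_cmult)
    finally have "ennreal (1 / C3) * ennreal e \<le> ennreal (1 / C3) * (ennreal C3 * (\<Sum>i. diam_gauge s (U i)))"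
      unfolding e(2) by (intro mult_left_mono) auto
    also have "ennreal (1 / C3) * (ennreal C3 * (\<Sum>i. diam_gauge s (U i))) = (\<Sum>i. diam_gauge s (U i))"
      using C3 by (simp add: mult.assoc[symmetric] ennreal_mult[symmetric])
    also have "ennreal (1 / C3) * ennreal e = ennreal (e / C3)"
      using C3 e by (simp add: ennreal_mult[symmetric])
    finally show ?thesis .
  qed
  \<comment> \<open>On sets of diameter at most 1 smaller exponents give larger gauges; this
    includes \<open>s' = 0\<close>, where nonempty sets have gauge 1.\<close>
  have gauge_mono: "diam_gauge s V \<le> diam_gauge s' V" if "bounded V" "diameter V \<le> 1" for V :: "real set"
    using that s s' diameter_ge_0[OF that(1)]
    by (auto simp: diam_gauge_def powr_le1 powr_mono' intro!: ennreal_leI)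
  have "ennreal (e / C3) \<le> hausdorff_content s' 1 (khinchin_level_set \<xi>)"
    unfolding hausdorff_content_def
  proof (rule INF_greatest)
    fix U :: "nat \<Rightarrow> real set" assume U: "U \<in> delta_covers 1 (khinchin_level_set \<xi>)"
    have "(\<Sum>i. diam_gauge s (U i)) \<le> (\<Sum>i. diam_gauge s' (U i))"
      by (rule suminf_le) (use gauge_mono U in \<open>auto simp: delta_covers_def\<close>)
    with lower[OF U] show "ennreal (e / C3) \<le> (\<Sum>i. diam_gauge s' (U i))" by (rule order_trans)
  qed
  also have "\<dots> \<le> hausdorff_measure s' (khinchin_level_set \<xi>)"
    unfolding hausdorff_measure_def by (rule SUP_upper) simp
  finally have "ennreal (e / C3) \<le> hausdorff_measure s' (khinchin_level_set \<xi>)" .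
  moreover have "0 < ennreal (e / C3)" using e(1) C3 by simp
  ultimately show ?thesis by (metis leD)
qed

end

theorem hausdorff_dim_lower:
  assumes \<xi>: "0 \<le> \<xi>" shows "ereal (t_fun \<xi>) \<le> hausdorff_dim (khinchin_level_set \<xi>)"
  unfolding hausdorff_dim_def
proof (rule INF_greatest)
  fix s' assume "s' \<in> {s. 0 \<le> s \<and> hausdorff_measure s (khinchin_level_set \<xi>) = 0}"
  then have s': "0 \<le> s'" "hausdorff_measure s' (khinchin_level_set \<xi>) = 0" by auto
  show "ereal (t_fun \<xi>) \<le> ereal s'"
  proof (rule ccontr)
    assume "\<not> ereal (t_fun \<xi>) \<le> ereal s'"
    then have lt: "s' < t_fun \<xi>" by simp
    then have \<xi>p: "0 < \<xi>" using s' \<xi> by (cases "\<xi> = 0") (auto simp: t_fun_def)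
    define t q where "t = t_fun \<xi>" and "q = q_fun \<xi>"
    have sol: "sol \<xi> t q" "t \<le> 1" using t_fun_sol[OF \<xi>p] by (auto simp: t_def q_def)
    \<comment> \<open>Strictly between the two, so that \<open>s\<close> is positive even if
      \<open>s' = 0\<close> and a margin \<open>(t - s) * ln 2\<close> remains.\<close>
    define s where "s = (s' + t) / 2"
    have s: "0 < s" "s < t" "s' \<le> s" "s < 2" using lt s'(1) sol(2) by (auto simp: s_def t_def)
    have margin: "r * \<xi> + (t - s) * ln 2 \<le> pressure s r" if g: "gibbs s r" for r
    proof -
      have "pressure t r \<le> pressure s r - (t - s) * ln 2"
        using pressure_decreasing[OF g, of "t - s"] s sol(2) by simp
      moreover have "r * \<xi> \<le> pressure t r" using sol_ge[OF sol(1), of r] g s by (simp add: gibbs_def)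
      ultimately show ?thesis by linarith
    qed
    have c: "0 < (t - s) * ln 2" using s by simp
    have Y: "0 < 2 * (256::real) powr s" by simp
    obtain m N r where mN: "1 \<le> m" "1 \<le> N"
      "(\<Sum>u\<in>blocks m N. (lsum u - real m * \<xi>) * (exp (r * (lsum u - real m * \<xi>)) * wprod u 0 powr (2 * s))) = 0"
      "2 * 256 powr s \<le> (\<Sum>u\<in>blocks m N. exp (r * (lsum u - real m * \<xi>)) * wprod u 0 powr (2 * s))"
      by (rule block_parameters[OF s(1,4) \<xi>p c Y margin]) blast
    note s3 = s(3)
    interpret block_process m N r s \<xi>
      by unfold_locales (use mN s \<xi>p in auto)
    from hausdorff_measure_pos[OF s'(1) s3] s'(2) show False by simp
  qed
qed

theorem hausdorff_dim_eq:
  "0 \<le> \<xi> \<Longrightarrow> hausdorff_dim (khinchin_level_set \<xi>) = ereal (t_fun \<xi>)"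
  by (intro antisym hausdorff_dim_upper hausdorff_dim_lower)

section \<open>The shape of \<open>t\<close>\<close>

text \<open>The hypothesis makes the minimum over \<open>q\<close> negative at \<open>t\<close>, so
  its zero lies to the left of \<open>t\<close>.\<close>

lemma t_fun_less:
  assumes \<xi>: "0 < \<xi>" and t: "0 < t" "t < 2" "1 < 2 * t - q" and p: "pressure t q < q * \<xi>"
  shows "t_fun \<xi> < t"
proof (rule ccontr)
  assume "\<not> ?thesis"
  then have le: "t \<le> t_fun \<xi>" "1 < 2 * t_fun \<xi> - q" using t by auto
  have "pressure (t + (t_fun \<xi> - t)) q \<le> pressure t q - (t_fun \<xi> - t) * ln 2"
    by (rule pressure_decreasing) (use t le t_fun_sol(2)[OF \<xi>] in \<open>auto simp: gibbs_def\<close>)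
  moreover have "0 \<le> (t_fun \<xi> - t) * ln 2" using le by simp
  moreover have "q * \<xi> \<le> pressure (t_fun \<xi>) q" by (rule sol_ge[OF t_fun_sol(1)[OF \<xi>] le(2)])
  ultimately show False using p by simp
qed

text \<open>Here \<open>q\<close> is positive, and \<open>2 * t - q > 1\<close> then forces
  \<open>t > 1 / 2\<close>.\<close>

lemma t_fun_gt_half: "xi0 < \<xi> \<Longrightarrow> 1 / 2 < t_fun \<xi>"
  using q_fun_sign(1)[of \<xi>] sol_pdom[of \<xi>] xi0_pos by (simp add: pdom_def)

lemma q_fun_less_1: "0 < \<xi> \<Longrightarrow> q_fun \<xi> < 1"
  using sol_pdom[of \<xi>] t_fun_sol(2)[of \<xi>] by (simp add: pdom_def)

lemma t_fun_less_1:
  assumes "0 < \<xi>" "\<xi> \<noteq> xi0" shows "t_fun \<xi> < 1"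
proof (rule ccontr)
  assume "\<not> ?thesis"
  then have one: "t_fun \<xi> = 1" using t_fun_sol(2)[OF assms(1)] by simp
  have "q_fun \<xi> \<noteq> 0" using q_fun_sign[OF assms(1)] assms(2) by (cases "xi0 < \<xi>") auto
  then have "0 * \<xi> < pressure 1 0"
    using sol_minimal[OF t_fun_sol(1)[OF assms(1)], of 0] one by simp
  then show False by (simp add: pressure_1_0)
qed

lemma t_fun_at_top: "(t_fun \<longlongrightarrow> 1 / 2) at_top"
proof (rule order_tendstoI)
  fix a :: real assume "a < 1 / 2"
  show "eventually (\<lambda>\<xi>. a < t_fun \<xi>) at_top"
    using eventually_gt_at_top[of xi0] by eventually_elim (use t_fun_gt_half \<open>a < 1 / 2\<close> in force)
next
  fix b :: real assume b: "1 / 2 < b"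
  define t where "t = min b 1"
  \<comment> \<open>Then \<open>2 * t - q = t + 1 / 2 > 1\<close>, and \<open>q > 0\<close> makes
    \<open>q * \<xi>\<close> exceed the fixed pressure for large \<open>\<xi>\<close>.\<close>
  define q where "q = t - 1 / 2"
  have t: "0 < t" "t < 2" "1 < 2 * t - q" "0 < q" "t \<le> b" using b by (auto simp: t_def q_def)
  show "eventually (\<lambda>\<xi>. t_fun \<xi> < b) at_top"
    using eventually_gt_at_top[of "max 0 (pressure t q / q)"]
  proof eventually_elim
    case (elim \<xi>)
    then have "pressure t q < q * \<xi>" using t(4) by (simp add: field_simps)
    from t_fun_less[OF _ t(1-3) this] elim t(5) show ?case by simp
  qed
qed

lemma t_fun_small:
  assumes "0 < r" shows "eventually (\<lambda>\<xi>. t_fun \<xi> < r) (at_right 0)"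
proof -
  define t where "t = min r 1"
  have t: "0 < t" "t \<le> 2" "t < 2" "t \<le> r" using assms by (auto simp: t_def)
  obtain q where q: "q < - 2" "pressure t q < 0" by (rule pressure_negative[OF t(1,2)])
  have "0 < pressure t q / q" using q by (simp add: divide_neg_neg)
  then have "eventually (\<lambda>\<xi>. \<xi> \<in> {0<..<pressure t q / q}) (at_right 0)"
    by (rule eventually_at_right_real)
  then show ?thesis
  proof eventually_elim
    case (elim \<xi>)
    then have "pressure t q < q * \<xi>" using q(1) by (simp add: field_simps)
    from t_fun_less[OF _ t(1,3) _ this] elim q(1) t show ?case by simp
  qed
qed

text \<open>As \<open>\<xi>\<close> tends to 0, so does \<open>t\<close>, and
  \<open>ln (1 + 2 powr q) - 2 * t * ln 3 \<le> q * \<xi> < 0\<close> drives \<open>q\<close> to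
  minus infinity, whereas \<open>- Pt\<close> stays below \<open>2 * xi0 + 2 * ln 2\<close>.\<close>

lemma t_deriv_at_0: "filterlim t_deriv at_top (at_right 0)"
  unfolding filterlim_at_top
proof
  fix Z :: real
  define C where "C = 2 * xi0 + 2 * ln 2"
  define Q where "Q = max 0 Z * C"
  have C: "0 < C" using xi0_pos by (simp add: C_def add_pos_pos)
  have "(0::real) < 1 + 2 powr - Q" by (simp add: add_pos_pos)
  then have "0 < ln (1 + 2 powr - Q) / (2 * ln 3)" by (intro divide_pos_pos ln_gt_zero) auto
  note t_fun_small[OF this]
  moreover have "eventually (\<lambda>\<xi>. \<xi> \<in> {0<..<xi0}) (at_right 0)"
    by (rule eventually_at_right_real[OF xi0_pos])
  ultimately show "eventually (\<lambda>\<xi>. Z \<le> t_deriv \<xi>) (at_right 0)"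
  proof eventually_elim
    case (elim \<xi>)
    then have \<xi>: "0 < \<xi>" "\<xi> < xi0" by auto
    define t q where "t = t_fun \<xi>" and "q = q_fun \<xi>"
    have D: "pdom t q" and s: "sol \<xi> t q" using sol_pdom[OF \<xi>(1)] t_fun_sol[OF \<xi>(1)] by (auto simp: t_def q_def)
    have q0: "q < 0" using q_fun_sign(2)[OF \<xi>] by (simp add: q_def)
    have "q \<le> - Q"
    proof (rule ccontr)
      assume "\<not> ?thesis"
      then have "1 + 2 powr - Q \<le> 1 + 2 powr q" by simp
      then have "ln (1 + 2 powr - Q) \<le> ln (1 + 2 powr q)"
        using \<open>0 < 1 + 2 powr - Q\<close> by (intro ln_mono) auto
      moreover have "ln (1 + 2 powr q) - 2 * t * ln 3 \<le> q * \<xi>"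
        using gibbs.pressure_ge_two[OF pdom_gibbs[OF D]] s by (simp add: sol_def)
      moreover have "q * \<xi> < 0" using q0 \<xi> by (simp add: mult_neg_pos)
      moreover have "2 * t * ln 3 < ln (1 + 2 powr - Q)" using elim(1) by (simp add: t_def field_simps)
      ultimately show False by linarith
    qed
    moreover have "- Pt t q \<le> C" using Pt_bounds(3)[OF D] s \<xi> by (simp add: C_def sol_def)
    ultimately have "Q / C \<le> (- q) / (- Pt t q)"
      using Pt_neg[OF D] C q0 by (intro frac_le) (auto simp: Q_def)
    moreover have "Q / C = max 0 Z" using C by (simp add: Q_def)
    ultimately show ?case by (simp add: t_deriv_def t_def q_def)
  qed
qed

text \<open>For \<open>\<xi> > xi0\<close> one has \<open>0 < q < 1\<close>, while
  \<open>- Pt \<ge> 2 * Pq = 2 * \<xi>\<close>.\<close>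

lemma t_deriv_at_top: "(t_deriv \<longlongrightarrow> 0) at_top"
proof (rule Lim_null_comparison)
  show "eventually (\<lambda>\<xi>. norm (t_deriv \<xi>) \<le> 1 / (2 * \<xi>)) at_top"
    using eventually_gt_at_top[of xi0]
  proof eventually_elim
    case (elim \<xi>)
    then have \<xi>: "0 < \<xi>" using xi0_pos by simp
    have q: "0 < q_fun \<xi>" "q_fun \<xi> < 1" using q_fun_sign(1)[OF \<xi> elim] q_fun_less_1[OF \<xi>] by auto
    have "2 * \<xi> \<le> - Pt (t_fun \<xi>) (q_fun \<xi>)"
      using Pt_bounds(2)[OF sol_pdom[OF \<xi>]] t_fun_sol(1)[OF \<xi>] by (simp add: sol_def)
    then have "q_fun \<xi> / - Pt (t_fun \<xi>) (q_fun \<xi>) \<le> 1 / (2 * \<xi>)" using q \<xi> by (intro frac_le) auto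
    then show ?case using q Pt_neg[OF sol_pdom[OF \<xi>]] by (simp add: t_deriv_def abs_divide)
  qed
  show "((\<lambda>\<xi>. 1 / (2 * \<xi>)) \<longlongrightarrow> (0::real)) at_top" by real_asymp
qed

lemma t_deriv_sign:
  assumes "0 < \<xi>" shows "xi0 < \<xi> \<Longrightarrow> t_deriv \<xi> < 0" "\<xi> < xi0 \<Longrightarrow> 0 < t_deriv \<xi>"
  using q_fun_sign[OF assms] Pt_neg[OF sol_pdom[OF assms]]
  by (auto simp: t_deriv_def divide_pos_neg divide_neg_neg)

lemma t_fun_second_derivative_neg: "\<exists>d<0. (deriv t_fun has_real_derivative d) (at xi0)"
proof -
  have D: "pdom 1 0" by (simp add: pdom_def)
  obtain d where d: "(t_deriv has_real_derivative d) (at xi0)" "d = 1 / (pd2 Pq 1 0 * Pt 1 0)"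
    using t_deriv_differentiable[OF xi0_pos] by blast
  have "pd2 Pq 1 0 * Pt 1 0 < 0" using Pqq_pos[OF D] Pt_neg[OF D] by (rule mult_pos_neg)
  then have "d < 0" unfolding d(2) by simp
  then show ?thesis using d(1) deriv_t_fun_cong[OF xi0_pos] by blast
qed

text \<open>The derivative is negative at \<open>xi0 + 1\<close> yet tends to 0, so it increases
  somewhere; the mean value theorem for \<open>t_deriv\<close> gives the point.\<close>

lemma t_fun_second_derivative_pos: "\<exists>\<xi>>xi0. \<exists>d>0. (deriv t_fun has_real_derivative d) (at \<xi>)"
proof -
  have "t_deriv (xi0 + 1) < 0" using t_deriv_sign(1)[of "xi0 + 1"] xi0_pos by simp
  then have "eventually (\<lambda>\<xi>. t_deriv (xi0 + 1) < t_deriv \<xi>) at_top"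
    by (rule order_tendstoD(1)[OF t_deriv_at_top])
  then have "eventually (\<lambda>\<xi>. t_deriv (xi0 + 1) < t_deriv \<xi> \<and> xi0 + 1 < \<xi>) at_top"
    using eventually_gt_at_top by (rule eventually_conj)
  then obtain b where b: "t_deriv (xi0 + 1) < t_deriv b" "xi0 + 1 < b"
    by (auto simp: eventually_at_top_linorder)
  have der: "(t_deriv has_real_derivative deriv t_deriv \<xi>) (at \<xi>)" if "0 < \<xi>" for \<xi>
    using t_deriv_differentiable[OF that] DERIV_imp_deriv by metis
  obtain z where z: "xi0 + 1 < z" "z < b" "t_deriv b - t_deriv (xi0 + 1) = (b - (xi0 + 1)) * deriv t_deriv z"
    using MVT2[OF b(2), of t_deriv "deriv t_deriv"] der xi0_pos by force
  have "0 < (b - (xi0 + 1)) * deriv t_deriv z" using b(1) z(3) by linarith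
  then have "0 < deriv t_deriv z" using b(2) by (simp add: zero_less_mult_iff)
  moreover have "0 < z" "xi0 < z" using z xi0_pos by auto
  ultimately show ?thesis using der[of z] deriv_t_fun_cong[of z] by blast
qed

text \<open>At \<open>xi0\<close>, the midpoint of \<open>xi0 / 2\<close> and
  \<open>3 * xi0 / 2\<close>, the function exceeds both end values.\<close>

lemma t_fun_not_convex: "\<not> convex_on {0..} t_fun"
proof
  assume c: "convex_on {0..} t_fun"
  have "t_fun ((1 - 1 / 2) *\<^sub>R (xi0 / 2) + (1 / 2) *\<^sub>R (3 * xi0 / 2))
      \<le> (1 - 1 / 2) * t_fun (xi0 / 2) + 1 / 2 * t_fun (3 * xi0 / 2)"
    by (rule convex_onD[OF c]) (use xi0_pos in auto)
  moreover have "t_fun (xi0 / 2) < 1" "t_fun (3 * xi0 / 2) < 1"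
    using t_fun_less_1[of "xi0 / 2"] t_fun_less_1[of "3 * xi0 / 2"] xi0_pos by auto
  ultimately show False using t_fun_xi0(1) by simp
qed

text \<open>Concavity would continue the drop \<open>\<delta>\<close> between \<open>xi0\<close> and
  \<open>xi0 + 1\<close> at least linearly and bring \<open>t\<close> down to 0 at
  \<open>xi0 + 1 / \<delta>\<close>, but \<open>t > 1 / 2\<close> there.\<close>

lemma t_fun_not_concave: "\<not> concave_on {0..} t_fun"
proof
  assume c: "concave_on {0..} t_fun"
  define \<delta> where "\<delta> = 1 - t_fun (xi0 + 1)"
  have \<delta>: "0 < \<delta>" "\<delta> < 1"
    using t_fun_less_1[of "xi0 + 1"] t_fun_gt_half[of "xi0 + 1"] xi0_pos by (auto simp: \<delta>_def)
  have "(1 - \<delta>) * t_fun xi0 + \<delta> * t_fun (xi0 + 1 / \<delta>) \<le> t_fun ((1 - \<delta>) *\<^sub>R xi0 + \<delta> *\<^sub>R (xi0 + 1 / \<delta>))"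
    by (rule concave_onD[OF c]) (use xi0_pos \<delta> in auto)
  moreover have "(1 - \<delta>) *\<^sub>R xi0 + \<delta> *\<^sub>R (xi0 + 1 / \<delta>) = xi0 + 1" using \<delta> by (simp add: algebra_simps)
  ultimately have "1 - \<delta> + \<delta> * t_fun (xi0 + 1 / \<delta>) \<le> 1 - \<delta>" by (simp add: t_fun_xi0 \<delta>_def)
  then have "\<delta> * t_fun (xi0 + 1 / \<delta>) \<le> 0" by simp
  moreover have "0 < t_fun (xi0 + 1 / \<delta>)" using t_fun_gt_half[of "xi0 + 1 / \<delta>"] \<delta> by simp
  ultimately show False using \<delta> by (simp add: mult_le_0_iff)
qed

theorem theorem1p2:
  "(\<forall>\<xi>\<ge>0. hausdorff_dim (khinchin_level_set \<xi>) = ereal (t_fun \<xi>)) \<and>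
   (t_fun xi0 = 1 \<and> (t_fun \<longlongrightarrow> 1 / 2) at_top) \<and>
   ((\<forall>\<xi>>xi0. \<exists>d<0. (t_fun has_real_derivative d) (at \<xi>)) \<and>
    (t_fun has_real_derivative 0) (at xi0) \<and>
    (\<forall>\<xi>. 0 < \<xi> \<and> \<xi> < xi0 \<longrightarrow> (\<exists>d>0. (t_fun has_real_derivative d) (at \<xi>)))) \<and>
   (filterlim (deriv t_fun) at_top (at_right 0) \<and> (deriv t_fun \<longlongrightarrow> 0) at_top) \<and>
   ((\<exists>d<0. (deriv t_fun has_real_derivative d) (at xi0)) \<and>
    (\<exists>\<xi>1>xi0. \<exists>d>0. (deriv t_fun has_real_derivative d) (at \<xi>1)) \<and>
    \<not> convex_on {0..} t_fun \<and> \<not> concave_on {0..} t_fun)"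
proof (intro conjI)
  show "\<forall>\<xi>\<ge>0. hausdorff_dim (khinchin_level_set \<xi>) = ereal (t_fun \<xi>)" using hausdorff_dim_eq by blast
  show "\<forall>\<xi>>xi0. \<exists>d<0. (t_fun has_real_derivative d) (at \<xi>)"
  proof (intro allI impI)
    fix \<xi> assume "xi0 < \<xi>"
    moreover from this have "0 < \<xi>" using xi0_pos by simp
    ultimately show "\<exists>d<0. (t_fun has_real_derivative d) (at \<xi>)"
      using t_deriv_sign(1) t_fun_derivative(1) by blast
  qed
  show "(t_fun has_real_derivative 0) (at xi0)"
    using t_fun_derivative(1)[OF xi0_pos] by (simp add: t_deriv_def t_fun_xi0)
  show "\<forall>\<xi>. 0 < \<xi> \<and> \<xi> < xi0 \<longrightarrow> (\<exists>d>0. (t_fun has_real_derivative d) (at \<xi>))"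
    using t_deriv_sign(2) t_fun_derivative(1) by blast
  have "eventually (\<lambda>\<xi>. deriv t_fun \<xi> = t_deriv \<xi>) (at_right 0)"
    using eventually_at_right_less[of 0] by eventually_elim (rule deriv_t_fun)
  then show "filterlim (deriv t_fun) at_top (at_right 0)"
    using t_deriv_at_0 by (subst filterlim_cong[OF refl refl]) auto
  have "eventually (\<lambda>\<xi>. deriv t_fun \<xi> = t_deriv \<xi>) at_top"
    using eventually_gt_at_top[of 0] by eventually_elim (rule deriv_t_fun)
  then show "(deriv t_fun \<longlongrightarrow> 0) at_top"
    using t_deriv_at_top by (subst filterlim_cong[OF refl refl]) auto
qed (fact t_fun_xi0(1) t_fun_at_top t_fun_second_derivative_neg t_fun_second_derivative_pos
    t_fun_not_convex t_fun_not_concave)+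

end
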